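(* Let $n\ge1$ and let $z\in H^1_{loc}(\mathbb{R}^{n+1})$ be a $\frac32$-homogeneous global solution of the thin obstacle problem. Then there exist $C\ge0$ and $e\in\partial B_1'$ such that $z=C\,h_e$, where $$h_e(x',x_{n+1})=\mathrm{Re}\left((x'\cdot e+i|x_{n+1}|)^{\frac32}\right).$$
   Context: Notation: points of $\mathbb{R}^{n+1}$ are written $x=(x',x_{n+1})$ with $x'=(x_1,\dots,x_n)$; $B_R$ is the open ball of radius $R$ centred at $0$ in $\mathbb{R}^{n+1}$ and $B_R'=B_R\cap\{x_{n+1}=0\}$. The condition $e\in\partial B_1'$ means that $e$ is a unit vector of $\mathbb{R}^n\cong\{x_{n+1}=0\}$. The power $w^{3/2}$, for $w$ complex with $\mathrm{Im}\,w\ge0$, is taken with argument of $w$ in $[0,\pi]$. Thin obstacle problem (with zero obstacle): $u\in H^1(B_R)$ is a solution in $B_R$ if, with $g=u|_{\partial B_R}$ in the trace sense, $u$ belongs to $$\mathcal{K}_g=\{v\in H^1(B_R):\ v\ge 0 \text{ on } B_R',\ v=g \text{ on }\partial B_R,\ v(x',x_{n+1})=v(x',-x_{n+1})\}$$ and minimizes the Dirichlet energy $\int_{B_R}|\nabla v|^2\,dx$ over $\mathcal{K}_g$. A global solution is a function $z\in H^1_{loc}(\mathbb{R}^{n+1})$ whose restriction to $B_R$ is a solution in $B_R$ for every $R>0$. It is $\frac32$-homogeneous if $z(tx)=t^{3/2}z(x)$ for all $t>0$. *)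

theory Defs
  imports "HOL-Analysis.Analysis"
begin

section \<open>Smooth functions and test functions\<close>

primrec C_k :: "nat \<Rightarrow> ('a::euclidean_space \<Rightarrow> real) \<Rightarrow> bool" where
  "C_k 0 f \<longleftrightarrow> continuous_on UNIV f"
| "C_k (Suc k) f \<longleftrightarrow> (\<forall>x. f differentiable (at x)) \<and>
     (\<forall>b\<in>Basis. C_k k (\<lambda>x. frechet_derivative f (at x) b))"

definition smooth :: "('a::euclidean_space \<Rightarrow> real) \<Rightarrow> bool" where
  "smooth f \<longleftrightarrow> (\<forall>k. C_k k f)"

definition test_function :: "'a::euclidean_space set \<Rightarrow> ('a \<Rightarrow> real) \<Rightarrow> bool" where
  "test_function \<Omega> \<phi> \<longleftrightarrow> smooth \<phi> \<and>
     compact (closure {x. \<phi> x \<noteq> 0}) \<and> closure {x. \<phi> x \<noteq> 0} \<subseteq> \<Omega>"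

section \<open>The Sobolev space \<open>H\<^sup>1\<close>\<close>

text \<open>Elements of \<open>L\<^sup>2\<close> and \<open>H\<^sup>1\<close> are represented by functions; every notion below that concerns
  such an element depends only on its values almost everywhere in the domain.\<close>

definition L2 :: "'a measure \<Rightarrow> ('a \<Rightarrow> 'b::euclidean_space) \<Rightarrow> bool" where
  "L2 M f \<longleftrightarrow> f \<in> borel_measurable M \<and> integrable M (\<lambda>x. (norm (f x))\<^sup>2)"

definition locally_integrable :: "'a::euclidean_space set \<Rightarrow> ('a \<Rightarrow> 'b::euclidean_space) \<Rightarrow> bool"
  where "locally_integrable \<Omega> f \<longleftrightarrow>
     (\<forall>K. compact K \<and> K \<subseteq> \<Omega> \<longrightarrow> set_integrable lebesgue K f)"

definition has_weak_gradient ::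
    "'a::euclidean_space set \<Rightarrow> ('a \<Rightarrow> real) \<Rightarrow> ('a \<Rightarrow> 'a) \<Rightarrow> bool" where
  "has_weak_gradient \<Omega> u G \<longleftrightarrow>
     locally_integrable \<Omega> u \<and> locally_integrable \<Omega> G \<and>
     (\<forall>\<phi>. test_function \<Omega> \<phi> \<longrightarrow> (\<forall>b\<in>Basis.
        (LINT x|lebesgue_on \<Omega>. u x * frechet_derivative \<phi> (at x) b) =
        - (LINT x|lebesgue_on \<Omega>. (G x \<bullet> b) * \<phi> x)))"

definition weak_gradient :: "'a::euclidean_space set \<Rightarrow> ('a \<Rightarrow> real) \<Rightarrow> 'a \<Rightarrow> 'a" where
  "weak_gradient \<Omega> u = (SOME G. has_weak_gradient \<Omega> u G)"

definition H1 :: "'a::euclidean_space set \<Rightarrow> ('a \<Rightarrow> real) \<Rightarrow> bool" where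
  "H1 \<Omega> u \<longleftrightarrow> L2 (lebesgue_on \<Omega>) u \<and>
     (\<exists>G. has_weak_gradient \<Omega> u G \<and> L2 (lebesgue_on \<Omega>) G)"

definition H1_loc :: "('a::euclidean_space \<Rightarrow> real) \<Rightarrow> bool" where
  "H1_loc u \<longleftrightarrow> (\<forall>V. open V \<and> bounded V \<longrightarrow> H1 V u)"

definition dirichlet_energy :: "'a::euclidean_space set \<Rightarrow> ('a \<Rightarrow> real) \<Rightarrow> real" where
  "dirichlet_energy \<Omega> u = (LINT x|lebesgue_on \<Omega>. (norm (weak_gradient \<Omega> u x))\<^sup>2)"

definition H1_norm :: "'a::euclidean_space set \<Rightarrow> ('a \<Rightarrow> real) \<Rightarrow> real" where
  "H1_norm \<Omega> u = sqrt ((LINT x|lebesgue_on \<Omega>. (u x)\<^sup>2) + dirichlet_energy \<Omega> u)"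

section \<open>Traces\<close>

text \<open>The trace operator is the continuous extension of the restriction of smooth functions. Here
  \<open>\<mu>\<close> is the surface measure carried by the hypersurface on which the trace is taken, seen as a
  measure on the ambient space: \<open>g\<close> is the \<open>L\<^sup>2(\<mu>)\<close>-limit of the values of functions which are
  smooth up to the boundary and converge to \<open>u\<close> in \<open>H\<^sup>1(\<Omega>)\<close>.\<close>

definition has_trace ::
    "'a::euclidean_space set \<Rightarrow> 'a measure \<Rightarrow> ('a \<Rightarrow> real) \<Rightarrow> ('a \<Rightarrow> real) \<Rightarrow> bool" where
  "has_trace \<Omega> \<mu> u g \<longleftrightarrow> H1 \<Omega> u \<and> L2 \<mu> g \<and>
     (\<exists>\<phi> :: nat \<Rightarrow> 'a \<Rightarrow> real. (\<forall>k. smooth (\<phi> k)) \<and>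
        (\<lambda>k. H1_norm \<Omega> (\<lambda>x. \<phi> k x - u x)) \<longlonglongrightarrow> 0 \<and>
        (\<lambda>k. LINT x|\<mu>. (\<phi> k x - g x)\<^sup>2) \<longlonglongrightarrow> 0)"

text \<open>Surface measure of the sphere of radius \<open>R\<close> in polar-coordinate form: the measure of \<open>A\<close> is
  \<open>N/R\<close> times the volume of the cone \<open>{x. 0 < |x| < R, R x/|x| \<in> A}\<close>, with \<open>N\<close> the dimension.\<close>

definition sphere_measure :: "real \<Rightarrow> 'a::euclidean_space measure" where
  "sphere_measure R = scale_measure (ennreal (real DIM('a) / R))
     (distr (restrict_space lborel (ball 0 R - {0})) borel (\<lambda>x. (R / norm x) *\<^sub>R x))"

section \<open>The thin obstacle problem\<close>

text \<open>A point \<open>(x', x\<^sub>n\<^sub>+\<^sub>1)\<close> is a pair in \<open>(real ^ 'n) \<times> real\<close>, whose norm is the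
  Euclidean one. The following is \<open>n\<close>-dimensional Lebesgue measure on the thin ball.\<close>

definition thin_measure :: "real \<Rightarrow> ((real ^ 'n) \<times> real) measure" where
  "thin_measure R = distr (restrict_space lborel (ball 0 R)) borel (\<lambda>x'. (x', 0))"

definition admissible ::
    "real \<Rightarrow> ((real ^ 'n) \<times> real \<Rightarrow> real) \<Rightarrow> ((real ^ 'n) \<times> real \<Rightarrow> real) set" where
  "admissible R g = {v. H1 (ball 0 R) v \<and>
     (\<exists>T. has_trace (ball 0 R) (thin_measure R) v T \<and> (AE x in thin_measure R. T x \<ge> 0)) \<and>
     has_trace (ball 0 R) (sphere_measure R) v g \<and>
     (AE x in lebesgue_on (ball 0 R). v (fst x, snd x) = v (fst x, - snd x))}"

definition thin_obstacle_solution :: "real \<Rightarrow> ((real ^ 'n) \<times> real \<Rightarrow> real) \<Rightarrow> bool" where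
  "thin_obstacle_solution R u \<longleftrightarrow> H1 (ball 0 R) u \<and>
     (\<exists>g. has_trace (ball 0 R) (sphere_measure R) u g \<and>
        u \<in> admissible R g \<and>
        (\<forall>v\<in>admissible R g. dirichlet_energy (ball 0 R) u \<le> dirichlet_energy (ball 0 R) v))"

definition global_solution :: "((real ^ 'n) \<times> real \<Rightarrow> real) \<Rightarrow> bool" where
  "global_solution z \<longleftrightarrow> H1_loc z \<and> (\<forall>R>0. thin_obstacle_solution R z)"

definition homogeneous :: "real \<Rightarrow> ('a::euclidean_space \<Rightarrow> real) \<Rightarrow> bool" where
  "homogeneous \<alpha> z \<longleftrightarrow> (\<forall>t>0. AE x in lebesgue. z (t *\<^sub>R x) = t powr \<alpha> * z x)"

text \<open>The principal branch of \<open>powr\<close> uses arguments in \<open>(-\<pi>, \<pi>]\<close>, hence in \<open>[0, \<pi>]\<close> when the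
  imaginary part is nonnegative.\<close>

definition h :: "real ^ 'n \<Rightarrow> (real ^ 'n) \<times> real \<Rightarrow> real" where
  "h e x = Re (Complex (fst x \<bullet> e) \<bar>snd x\<bar> powr (3/2))"

end

theory Submission
  imports Defs "HOL-Real_Asymp.Real_Asymp"
begin

text \<open>Write \<open>E\<close> for integration against the Gaussian weight \<open>exp (-|x|\<^sup>2/2)\<close>, \<open>y\<close> for the last
  coordinate and \<open>G\<close> for the weak gradient of the solution \<open>u\<close>. Because \<open>G x \<bullet> x = 3/2 u\<close>, testing the
  variational inequality with \<open>(-u + \<psi>) exp (-|x|\<^sup>2/2)\<close>, where \<open>\<psi>\<close> is even in \<open>y\<close> and nonnegative on
  the thin space, yields \<open>E|G|\<^sup>2 \<le> 3/2 E u\<^sup>2\<close> and \<open>E G\<bullet>grad \<psi> \<ge> 3/2 E u \<psi>\<close>. The choices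
  \<open>\<psi> = \<plusminus> y\<^sup>2\<close>, which vanish on the thin space, give \<open>E u y\<^sup>2 = 4 E u\<close>, and \<open>\<psi> = h e\<close> controls the
  mixed term, so that \<open>w = u - C h e\<close> satisfies \<open>E|grad w|\<^sup>2 \<le> 3/2 E w\<^sup>2\<close> and \<open>E w y\<^sup>2 = 4 E w\<close> for
  all \<open>C \<ge> 0\<close> and unit vectors \<open>e\<close>. These are chosen such that \<open>w\<close> is orthogonal to the linear
  functions; the oscillator then has spectral gap \<open>2\<close> above the constants, whence
  \<open>2 E (w - a)\<^sup>2 \<le> 3/2 (E (w - a)\<^sup>2 + E a\<^sup>2)\<close> for the mean \<open>a\<close> of \<open>w\<close>, while pairing \<open>w - a\<close> with
  \<open>y\<^sup>2 - 1\<close> shows \<open>E (w - a)\<^sup>2 \<ge> 9/2 E a\<^sup>2\<close>. Together they force \<open>w = 0\<close>.\<close>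

section \<open>Smooth functions\<close>

text \<open>The gradient of the weight is a multiple of \<open>x\<close>, so differentiating it only
  ever produces \<open>G x \<bullet> x\<close>, and the degree 3/2 becomes a bound on the Rayleigh
  quotient of an operator with eigenvalues 0, 1, 2, .... As 3/2 lies between 1 and 2, a function
  with quotient at most 3/2 and no component of degree 1 must lean on the constants; the relation
  with y^2 then forces a share of y^2 - 1 that is too large (9/2 against the permitted 3). The
  parameters \<open>C\<close> and \<open>e\<close> are just enough to remove degree 1:
  \<open>u\<close> is even in y, and the first moments of \<open>h e\<close> in the thin directions
  form a positive multiple of \<open>e\<close>. No regularity of \<open>u\<close> beyond H^1 enters,
  and neither its contact set nor its normal derivative is discussed. Nor is \<open>h e\<close>
  shown to be a solution: a few Gaussian integrals of it are computed instead. The price is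
  technical. Only smooth compactly supported tests are available, so the weight needs cutoffs, and
  \<open>h e\<close>, whose gradient jumps across a slit, needs smooth approximations that are
  nonnegative on the thin space. The spectral gap rests on the density of polynomials.\<close>

lemma C_k_continuous: "C_k k f \<Longrightarrow> continuous_on UNIV f"
  by (cases k) (auto intro: differentiable_imp_continuous_on
      simp: differentiable_on_def differentiable_at_withinI)

lemma C_k_SucD: "C_k (Suc k) f \<Longrightarrow> C_k k f"
proof (induction k arbitrary: f)
  case 0
  then show ?case using C_k_continuous by (metis C_k.simps(1))
next
  case (Suc k)
  then show ?case by (simp only: C_k.simps(2)) auto
qed

lemma frechet_derivative_worksI:
  "f differentiable at x \<Longrightarrow> (f has_derivative frechet_derivative f (at x)) (at x)"
  using frechet_derivative_works by blast

lemma frechet_derivative_eqI: "(f has_derivative f') (at x) \<Longrightarrow> frechet_derivative f (at x) b = f' b"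
  by (metis frechet_derivative_at)

lemma C_k_const: "C_k k (\<lambda>_. c)"
  by (induction k arbitrary: c) auto

lemma C_k_add: "C_k k f \<Longrightarrow> C_k k g \<Longrightarrow> C_k k (\<lambda>x. f x + g x)"
proof (induction k arbitrary: f g)
  case 0
  then show ?case by (auto intro: continuous_intros)
next
  case (Suc k)
  have d: "f differentiable at x" "g differentiable at x" for x using Suc.prems by auto
  have "frechet_derivative (\<lambda>x. f x + g x) (at x) b
      = frechet_derivative f (at x) b + frechet_derivative g (at x) b" for x b
    using has_derivative_add[OF d[of x, THEN frechet_derivative_worksI]]
    by (rule frechet_derivative_eqI)
  then show ?case using Suc d by auto
qed

lemma C_k_mult: "C_k k f \<Longrightarrow> C_k k g \<Longrightarrow> C_k k (\<lambda>x. f x * g x)"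
proof (induction k arbitrary: f g)
  case 0
  then show ?case by (auto intro: continuous_intros)
next
  case (Suc k)
  have d: "f differentiable at x" "g differentiable at x" for x using Suc.prems by auto
  have "frechet_derivative (\<lambda>x. f x * g x) (at x) b
      = f x * frechet_derivative g (at x) b + frechet_derivative f (at x) b * g x" for x b
    using has_derivative_mult[OF d[of x, THEN frechet_derivative_worksI]]
    by (rule frechet_derivative_eqI)
  then show ?case using Suc d C_k_SucD[OF Suc.prems(1)] C_k_SucD[OF Suc.prems(2)]
    by (auto intro!: C_k_add)
qed

lemma C_k_inner: "C_k k (\<lambda>x. x \<bullet> v)"
proof (cases k)
  case 0
  then show ?thesis by (auto intro: continuous_intros)
next
  case (Suc m)
  have *: "((\<lambda>x. x \<bullet> v) has_derivative (\<lambda>x. x \<bullet> v)) (at x)" for x :: 'a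
    by (auto intro!: derivative_eq_intros)
  then show ?thesis
    using Suc by (auto simp: frechet_derivative_eqI[OF *] C_k_const differentiable_def)
qed

text \<open>The tower of derivatives only has to be valid on the range of \<open>f\<close>, so that this covers powers
  of positive functions.\<close>

lemma C_k_compose:
  assumes "\<And>n x. (\<beta> n has_real_derivative \<beta> (Suc n) (f x)) (at (f x))"
  shows "C_k k f \<Longrightarrow> C_k k (\<lambda>x. \<beta> n (f x))"
proof (induction k arbitrary: n)
  case 0
  have "isCont (\<beta> n) (f x)" for x using assms DERIV_isCont by blast
  moreover have "isCont f x" for x using 0 by (simp add: continuous_on_eq_continuous_at)
  ultimately have "isCont (\<lambda>x. \<beta> n (f x)) x" for x
    by (metis isCont_o2)
  then show ?case by (simp add: continuous_on_eq_continuous_at)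
next
  case (Suc k)
  have d: "f differentiable at x" for x using Suc.prems by auto
  have h: "((\<lambda>x. \<beta> n (f x)) has_derivative (\<lambda>b. frechet_derivative f (at x) b * \<beta> (Suc n) (f x))) (at x)"
    for x
    using DERIV_compose_FDERIV[OF assms d[of x, THEN frechet_derivative_worksI]] by simp
  have "C_k k (\<lambda>x. frechet_derivative f (at x) b * \<beta> (Suc n) (f x))" if "b \<in> Basis" for b
    using Suc.prems that Suc.IH[OF C_k_SucD[OF Suc.prems]] by (intro C_k_mult) auto
  moreover have "(\<lambda>x. \<beta> n (f x)) differentiable at x" for x using h by (auto simp: differentiable_def)
  ultimately show ?case by (simp add: frechet_derivative_eqI[OF h])
qed

lemma smooth_const: "smooth (\<lambda>_. c)"
  and smooth_inner: "smooth (\<lambda>x. x \<bullet> v)"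
  by (auto simp: smooth_def C_k_const C_k_inner)

lemma smooth_add: "smooth f \<Longrightarrow> smooth g \<Longrightarrow> smooth (\<lambda>x. f x + g x)"
  and smooth_mult: "smooth f \<Longrightarrow> smooth g \<Longrightarrow> smooth (\<lambda>x. f x * g x)"
  by (auto simp: smooth_def C_k_add C_k_mult)

lemma smooth_cmult: "smooth f \<Longrightarrow> smooth (\<lambda>x. c * f x)"
  by (intro smooth_mult smooth_const)

lemma smooth_minus: "smooth f \<Longrightarrow> smooth (\<lambda>x. - f x)"
  using smooth_cmult[of f "-1"] by simp

lemma smooth_diff: "smooth f \<Longrightarrow> smooth g \<Longrightarrow> smooth (\<lambda>x. f x - g x)"
  using smooth_add[of f, OF _ smooth_minus] by simp

lemma smooth_sum: "(\<And>i. i \<in> I \<Longrightarrow> smooth (f i)) \<Longrightarrow> smooth (\<lambda>x. \<Sum>i\<in>I. f i x)"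
  by (induction I rule: infinite_finite_induct) (auto intro: smooth_const smooth_add)

lemma smooth_prod: "(\<And>i. i \<in> I \<Longrightarrow> smooth (f i)) \<Longrightarrow> smooth (\<lambda>x. \<Prod>i\<in>I. f i x)"
  by (induction I rule: infinite_finite_induct) (auto intro: smooth_const smooth_mult)

lemma smooth_compose:
  assumes "\<And>n x. (\<beta> n has_real_derivative \<beta> (Suc n) (f x)) (at (f x))" "smooth f"
  shows "smooth (\<lambda>x. \<beta> n (f x))"
  using C_k_compose[of \<beta> f, OF assms(1)] assms(2) by (auto simp: smooth_def)

lemma smooth_norm_square: "smooth (\<lambda>x. (norm x)\<^sup>2)"
proof -
  have "(norm x)\<^sup>2 = (\<Sum>b\<in>Basis. (x \<bullet> b) * (x \<bullet> b))" for x :: 'a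
    by (simp add: power2_norm_eq_inner euclidean_inner[of x x])
  then show ?thesis by (simp add: smooth_sum smooth_mult smooth_inner)
qed

lemma smooth_exp: "smooth f \<Longrightarrow> smooth (\<lambda>x. exp (f x))"
  by (rule smooth_compose[where \<beta> = "\<lambda>_. exp"]) (auto intro: DERIV_exp)

lemma smooth_powr:
  fixes f :: "'a::euclidean_space \<Rightarrow> real"
  assumes "smooth f" "\<And>x. f x > 0"
  shows "smooth (\<lambda>x. f x powr a)"
proof -
  \<comment> \<open>The falling factorial times \<open>t powr (a - real n)\<close> is the n-th
    derivative of \<open>t powr a\<close> on the positive axis, which \<open>f\<close> never
    leaves.\<close>
  define \<beta> where "\<beta> n t = (\<Prod>i<n. a - real i) * t powr (a - real n)" for n and t :: real
  have "smooth (\<lambda>x. \<beta> 0 (f x))"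
  proof (rule smooth_compose[of \<beta>])
    show "(\<beta> n has_real_derivative \<beta> (Suc n) (f x)) (at (f x))" for n x
      unfolding \<beta>_def prod.lessThan_Suc mult.assoc
      using has_real_derivative_powr[OF assms(2), of "a - real n" x]
      by (intro DERIV_cmult) (simp add: algebra_simps)
  qed fact
  then show ?thesis by (simp add: \<beta>_def)
qed

lemma smooth_sqrt:
  fixes f :: "'a::euclidean_space \<Rightarrow> real"
  assumes "smooth f" "\<And>x. f x > 0"
  shows "smooth (\<lambda>x. sqrt (f x))"
  using smooth_powr[OF assms, of "1/2"] assms(2) by (simp add: powr_half_sqrt less_imp_le)

lemma smooth_differentiable: "smooth f \<Longrightarrow> f differentiable at x"
  unfolding smooth_def by (metis C_k.simps(2))

lemma smooth_continuous: "smooth f \<Longrightarrow> continuous_on A f"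
  unfolding smooth_def by (meson C_k_continuous continuous_on_subset subset_UNIV)

lemma smooth_frechet_Basis: "smooth f \<Longrightarrow> b \<in> Basis \<Longrightarrow> smooth (\<lambda>x. frechet_derivative f (at x) b)"
  unfolding smooth_def by (metis C_k.simps(2))

text \<open>The Riesz vector of the derivative, assembled from basis components because
  \<open>has_weak_gradient\<close> tests componentwise.\<close>

definition grad :: "('a::euclidean_space \<Rightarrow> real) \<Rightarrow> 'a \<Rightarrow> 'a" where
  "grad f x = (\<Sum>b\<in>Basis. frechet_derivative f (at x) b *\<^sub>R b)"

lemma grad_inner_Basis: "b \<in> Basis \<Longrightarrow> grad f x \<bullet> b = frechet_derivative f (at x) b"
  by (simp add: grad_def)

lemma has_derivative_grad:
  assumes "f differentiable at x"
  shows "(f has_derivative (\<lambda>v. grad f x \<bullet> v)) (at x)"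
proof -
  have l: "linear (frechet_derivative f (at x))"
    using assms by (rule linear_frechet_derivative)
  have "frechet_derivative f (at x) v = grad f x \<bullet> v" for v
  proof -
    have "frechet_derivative f (at x) (\<Sum>b\<in>Basis. (v \<bullet> b) *\<^sub>R b) = grad f x \<bullet> v"
      by (simp only: linear_sum[OF l] linear_cmul[OF l])
        (simp add: grad_def inner_sum_left inner_commute[of v] mult.commute)
    then show ?thesis by (simp add: euclidean_representation)
  qed
  then show ?thesis using frechet_derivative_worksI[OF assms] by presburger
qed

lemma grad_eqI: "(f has_derivative (\<lambda>v. g \<bullet> v)) (at x) \<Longrightarrow> grad f x = g"
  by (rule euclidean_eqI) (simp add: grad_inner_Basis frechet_derivative_eqI)

lemma grad_add: "smooth f \<Longrightarrow> smooth g \<Longrightarrow> grad (\<lambda>x. f x + g x) x = grad f x + grad g x"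
  by (rule grad_eqI) (auto intro!: derivative_eq_intros has_derivative_grad smooth_differentiable
      simp: inner_add_left)

lemma grad_mult: "smooth f \<Longrightarrow> smooth g \<Longrightarrow> grad (\<lambda>x. f x * g x) x = f x *\<^sub>R grad g x + g x *\<^sub>R grad f x"
  by (rule grad_eqI) (auto intro!: derivative_eq_intros has_derivative_grad smooth_differentiable
      simp: inner_add_left)

lemma grad_const [simp]: "grad (\<lambda>_. c) x = 0"
  by (rule grad_eqI) simp

lemma grad_cmult: "smooth f \<Longrightarrow> grad (\<lambda>x. c * f x) x = c *\<^sub>R grad f x"
  by (simp add: grad_mult smooth_const)

lemma grad_inner [simp]: "grad (\<lambda>x. x \<bullet> v) x = v"
  by (rule grad_eqI) (auto intro!: derivative_eq_intros simp: inner_commute)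

lemma continuous_grad: "smooth f \<Longrightarrow> continuous_on A (grad f)"
  unfolding grad_def by (intro continuous_intros smooth_continuous smooth_frechet_Basis)

lemma smooth_grad_inner: "smooth f \<Longrightarrow> smooth (\<lambda>x. grad f x \<bullet> v)"
  unfolding grad_def inner_sum_left inner_scaleR_left
  by (intro smooth_sum smooth_mult smooth_const smooth_frechet_Basis)

section \<open>Bump functions\<close>

definition bump :: "real \<Rightarrow> real" where
  "bump t = (if t > 0 then exp (- 1 / t) else 0)"

text \<open>With s = 1/t, differentiation in t is -s^2 d/ds and sends p(s) exp(-s) to s^2 (p(s) -
  p'(s)) exp(-s); this is the recursion for the derivatives of \<open>bump\<close>.\<close>

fun bump_poly :: "nat \<Rightarrow> real poly" where
  "bump_poly 0 = 1"
| "bump_poly (Suc n) = [:0, 0, 1:] * (bump_poly n - pderiv (bump_poly n))"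

definition bump_tower :: "nat \<Rightarrow> real \<Rightarrow> real" where
  "bump_tower n t = (if t > 0 then poly (bump_poly n) (1 / t) * exp (- 1 / t) else 0)"

lemma poly_exp_tendsto_0: "((\<lambda>t::real. poly p (1 / t) * exp (- 1 / t)) \<longlongrightarrow> 0) (at_right 0)"
proof -
  have 1: "((\<lambda>s::real. poly p s * exp (- s)) \<longlongrightarrow> 0) at_top"
  proof -
    have "((\<lambda>s::real. \<Sum>i\<le>degree p. coeff p i * (s ^ i / exp s)) \<longlongrightarrow> (\<Sum>i\<le>degree p. coeff p i * 0)) at_top"
      by (intro tendsto_intros tendsto_power_div_exp_0)
    moreover have "(\<Sum>i\<le>degree p. coeff p i * (s ^ i / exp s)) = poly p s * exp (- s)" for s :: real
      by (simp add: poly_altdef sum_distrib_right exp_minus divide_inverse mult.assoc)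
    ultimately show ?thesis by simp
  qed
  show ?thesis
    using filterlim_compose[OF 1 filterlim_inverse_at_top_right]
    by (simp add: inverse_eq_divide)
qed

lemma bump_tower_deriv: "(bump_tower n has_real_derivative bump_tower (Suc n) t) (at t)"
proof -
  consider "t > 0" | "t < 0" | "t = 0" by linarith
  then show ?thesis
  proof cases
    case 1
    have "((\<lambda>t. poly (bump_poly n) (1 / t) * exp (- 1 / t)) has_real_derivative
        poly (bump_poly (Suc n)) (1 / t) * exp (- 1 / t)) (at t)"
      using 1 by (auto intro!: derivative_eq_intros DERIV_chain2[OF poly_DERIV]
          simp: field_simps power2_eq_square)
    then have "(bump_tower n has_real_derivative
        poly (bump_poly (Suc n)) (1 / t) * exp (- 1 / t)) (at t)"
      by (rule has_field_derivative_transform_within_open[where S = "{0<..}"])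
        (use 1 in \<open>auto simp: bump_tower_def\<close>)
    then show ?thesis using 1 by (simp add: bump_tower_def[of "Suc n"])
  next
    case 2
    have "(bump_tower n has_real_derivative 0) (at t)"
      by (rule has_field_derivative_transform_within_open[where S = "{..<0}" and f = "\<lambda>_. 0"])
        (use 2 in \<open>auto simp: bump_tower_def\<close>)
    then show ?thesis using 2 by (simp add: bump_tower_def[of "Suc n"])
  next
    case 3
    \<comment> \<open>Dividing by \<open>y\<close> multiplies the polynomial in 1/y by its variable,
      so the difference quotient at 0 is again of the form treated in
      \<open>poly_exp_tendsto_0\<close>.\<close>
    have r: "((\<lambda>y. (bump_tower n y - bump_tower n 0) / (y - 0)) \<longlongrightarrow> 0) (at_right 0)"
    proof (rule Lim_transform_eventually[OF poly_exp_tendsto_0[of "[:0, 1:] * bump_poly n"]])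
      show "\<forall>\<^sub>F x in at_right 0. poly ([:0, 1:] * bump_poly n) (1 / x) * exp (- 1 / x) =
              (bump_tower n x - bump_tower n 0) / (x - 0)"
        unfolding eventually_at_right_field by (auto simp: bump_tower_def intro!: exI[of _ 1])
    qed
    have l: "((\<lambda>y. (bump_tower n y - bump_tower n 0) / (y - 0)) \<longlongrightarrow> 0) (at_left 0)"
      by (rule Lim_transform_eventually[OF tendsto_const])
        (auto simp: eventually_at_left_field bump_tower_def intro!: exI[of _ "-1"])
    have "(bump_tower n has_real_derivative 0) (at 0)"
      unfolding has_field_derivative_iff using filterlim_split_at[OF l r] by simp
    then show ?thesis using 3 by (simp add: bump_tower_def[of "Suc n"])
  qed
qed

lemma bump_tower_0: "bump_tower 0 = bump"
  by (auto simp: bump_tower_def bump_def)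

lemma bump_has_derivative: "(bump has_real_derivative bump_tower 1 t) (at t)"
  using bump_tower_deriv[of 0 t] by (simp add: bump_tower_0)

lemma smooth_bump: "smooth f \<Longrightarrow> smooth (\<lambda>x. bump (f x))"
  using smooth_compose[of bump_tower f 0, OF bump_tower_deriv] by (simp add: bump_tower_0)

lemma bump_ge_0: "bump t \<ge> 0" and bump_less_1: "bump t < 1" and bump_tower_1_ge_0: "bump_tower 1 t \<ge> 0"
  by (auto simp: bump_def bump_tower_def)

lemma bump_eq_0_iff: "bump t = 0 \<longleftrightarrow> t \<le> 0"
  by (auto simp: bump_def)

lemma continuous_bump: "continuous_on A bump" and continuous_bump_tower: "continuous_on A (bump_tower n)"
  using DERIV_isCont[OF bump_has_derivative] DERIV_isCont[OF bump_tower_deriv]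
  by (auto intro: continuous_at_imp_continuous_on)

section \<open>Test functions\<close>

lemma test_function_smooth: "test_function \<Omega> \<phi> \<Longrightarrow> smooth \<phi>"
  by (simp add: test_function_def)

lemma test_function_mono: "test_function \<Omega> \<phi> \<Longrightarrow> \<Omega> \<subseteq> \<Omega>' \<Longrightarrow> test_function \<Omega>' \<phi>"
  by (auto simp: test_function_def)

lemma test_functionI:
  assumes "smooth \<phi>" "compact K" "K \<subseteq> \<Omega>" "\<And>x. x \<notin> K \<Longrightarrow> \<phi> x = 0"
  shows "test_function \<Omega> \<phi>"
proof -
  have "closure {x. \<phi> x \<noteq> 0} \<subseteq> K"
    by (rule closure_minimal) (use assms compact_imp_closed in auto)
  then show ?thesis using assms compact_imp_closed[OF assms(2)]
    by (auto simp: test_function_def compact_closure intro: bounded_subset[OF compact_imp_bounded])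
qed

lemma test_function_supportE:
  assumes "test_function \<Omega> \<phi>"
  obtains K where "compact K" "K \<subseteq> \<Omega>" "\<And>x. x \<notin> K \<Longrightarrow> \<phi> x = 0"
  using assms closure_subset[of "{x. \<phi> x \<noteq> 0}"] that[of "closure {x. \<phi> x \<noteq> 0}"]
  unfolding test_function_def by blast

lemma test_function_mult:
  assumes "test_function \<Omega> \<phi>" "smooth f"
  shows "test_function \<Omega> (\<lambda>x. \<phi> x * f x)" "test_function \<Omega> (\<lambda>x. f x * \<phi> x)"
proof -
  obtain K where K: "compact K" "K \<subseteq> \<Omega>" "\<And>x. x \<notin> K \<Longrightarrow> \<phi> x = 0"
    using assms by (metis test_function_supportE)
  show "test_function \<Omega> (\<lambda>x. \<phi> x * f x)"
    by (rule test_functionI[OF smooth_mult[OF test_function_smooth[OF assms(1)] assms(2)] K(1,2)])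
      (simp add: K(3))
  show "test_function \<Omega> (\<lambda>x. f x * \<phi> x)"
    by (rule test_functionI[OF smooth_mult[OF assms(2) test_function_smooth[OF assms(1)]] K(1,2)])
      (simp add: K(3))
qed

lemma test_function_support:
  assumes "test_function \<Omega> \<phi>"
  obtains K where "compact K" "K \<subseteq> \<Omega>" "\<And>x. x \<notin> K \<Longrightarrow> \<phi> x = 0" "\<And>x. x \<notin> K \<Longrightarrow> grad \<phi> x = 0"
proof -
  obtain K where K: "compact K" "K \<subseteq> \<Omega>" and z: "\<And>x. x \<notin> K \<Longrightarrow> \<phi> x = 0"
    using assms by (metis test_function_supportE)
  have "grad \<phi> x = 0" if "x \<notin> K" for x
  proof (rule grad_eqI)
    show "(\<phi> has_derivative (\<lambda>v. 0 \<bullet> v)) (at x)"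
      by (rule has_derivative_transform_within_open[where s = "-K" and f = "\<lambda>_. 0"])
        (use that z K compact_imp_closed in auto)
  qed
  then show ?thesis using that[of K] K z by blast
qed

lemma frechet_derivative_grad: "smooth \<phi> \<Longrightarrow> frechet_derivative \<phi> (at x) v = grad \<phi> x \<bullet> v"
  by (metis has_derivative_grad frechet_derivative_eqI smooth_differentiable)

section \<open>Integration by parts\<close>

lemma integrable_translation:
  fixes f :: "'a::euclidean_space \<Rightarrow> real"
  assumes "integrable lborel f"
  shows "integrable lborel (\<lambda>x. f (x + v))" "(LINT x|lborel. f (x + v)) = (LINT x|lborel. f x)"
proof -
  have f: "integrable (distr lborel borel ((+) v)) f"
    using assms by (simp add: lborel_distr_plus)
  have [measurable]: "f \<in> borel_measurable borel" using assms by auto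
  show "integrable lborel (\<lambda>x. f (x + v))"
    using f by (subst (asm) integrable_distr_eq) (auto simp: add.commute)
  have "(LINT x|lborel. f x) = (LINT x|distr lborel borel ((+) v). f x)"
    by (simp add: lborel_distr_plus)
  also have "\<dots> = (LINT x|lborel. f (x + v))"
    by (subst integral_distr) (auto simp: add.commute)
  finally show "(LINT x|lborel. f (x + v)) = (LINT x|lborel. f x)" ..
qed

lemma test_function_bounded:
  assumes "test_function \<Omega> \<phi>"
  obtains B where "B \<ge> 0" "\<And>x. \<bar>\<phi> x\<bar> \<le> B" "\<And>x. norm (grad \<phi> x) \<le> B"
proof -
  obtain K where K: "compact K" "\<And>x. x \<notin> K \<Longrightarrow> \<phi> x = 0" "\<And>x. x \<notin> K \<Longrightarrow> grad \<phi> x = 0"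
    using assms by (metis test_function_support)
  have "bounded (\<phi> ` K)" "bounded (grad \<phi> ` K)"
    using compact_continuous_image[OF smooth_continuous K(1)] test_function_smooth[OF assms]
      compact_continuous_image[OF continuous_grad K(1)] by (auto intro: compact_imp_bounded)
  then obtain B1 B2 where B: "\<And>x. x \<in> K \<Longrightarrow> \<bar>\<phi> x\<bar> \<le> B1" "\<And>x. x \<in> K \<Longrightarrow> norm (grad \<phi> x) \<le> B2"
    by (auto simp: bounded_iff)
  show ?thesis
  proof (rule that[of "\<bar>B1\<bar> + \<bar>B2\<bar>"])
    fix x
    show "\<bar>\<phi> x\<bar> \<le> \<bar>B1\<bar> + \<bar>B2\<bar>" "norm (grad \<phi> x) \<le> \<bar>B1\<bar> + \<bar>B2\<bar>"
      using B[of x] K(2,3)[of x] by (cases "x \<in> K"; force)+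
  qed auto
qed

lemma lipschitz_of_grad:
  assumes "smooth \<phi>" "\<And>x. norm (grad \<phi> x) \<le> B"
  shows "\<bar>\<phi> x - \<phi> y\<bar> \<le> B * norm (x - y)"
proof -
  have "norm (\<phi> x - \<phi> y) \<le> B * norm (x - y)"
  proof (rule differentiable_bound[of UNIV \<phi> "\<lambda>x v. grad \<phi> x \<bullet> v"])
    show "onorm ((\<bullet>) (grad \<phi> x)) \<le> B" for x
    proof (rule order_trans[OF onorm_bound])
      fix v show "norm (grad \<phi> x \<bullet> v) \<le> norm (grad \<phi> x) * norm v"
        by (simp add: Cauchy_Schwarz_ineq2)
    qed (use assms in auto)
  qed (use assms in \<open>auto intro: has_derivative_grad smooth_differentiable\<close>)
  then show ?thesis by simp
qed

lemma integrable_continuous_compact_support: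
  fixes f :: "'a::euclidean_space \<Rightarrow> 'b::{banach, second_countable_topology}"
  assumes "continuous_on UNIV f" "compact K" "\<And>x. x \<notin> K \<Longrightarrow> f x = 0"
  shows "integrable lborel f"
proof -
  have "integrable lborel (\<lambda>x. indicator K x *\<^sub>R f x)"
    by (rule borel_integrable_compact[OF assms(2) continuous_on_subset[OF assms(1)], of]) simp
  then show ?thesis
    by (rule Bochner_Integration.integrable_cong[THEN iffD1, rotated 2]) (use assms in \<open>auto simp: indicator_def\<close>)
qed

lemma test_function_integrable:
  assumes "test_function \<Omega> \<phi>"
  shows "integrable lborel \<phi>" "integrable lborel (grad \<phi>)" "integrable lborel (\<lambda>x. grad \<phi> x \<bullet> v)"
proof -
  obtain K where K: "compact K" "\<And>x. x \<notin> K \<Longrightarrow> \<phi> x = 0" "\<And>x. x \<notin> K \<Longrightarrow> grad \<phi> x = 0"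
    using assms by (metis test_function_support)
  show "integrable lborel \<phi>" "integrable lborel (grad \<phi>)" "integrable lborel (\<lambda>x. grad \<phi> x \<bullet> v)"
    by (rule integrable_continuous_compact_support[OF _ K(1)];
        use K test_function_smooth[OF assms] in
          \<open>auto intro: smooth_continuous continuous_grad continuous_intros\<close>)+
qed

text \<open>Differentiate the translation invariance of the integral.\<close>

lemma integral_grad_test_function:
  assumes "test_function \<Omega> \<phi>"
  shows "(LINT x|lborel. grad \<phi> x \<bullet> v) = 0"
proof -
  note sm = test_function_smooth[OF assms]
  have [measurable]: "\<phi> \<in> borel_measurable borel"
    using smooth_continuous[OF sm, of UNIV] by (rule borel_measurable_continuous_onI)
  have [measurable]: "(\<lambda>x. grad \<phi> x \<bullet> v) \<in> borel_measurable borel"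
    using test_function_integrable(3)[OF assms] by auto
  obtain K where K: "compact K" "\<And>x. x \<notin> K \<Longrightarrow> \<phi> x = 0"
    using assms by (metis test_function_support)
  obtain B where B: "B \<ge> 0" "\<And>x. norm (grad \<phi> x) \<le> B" using test_function_bounded[OF assms] by metis
  obtain R where R: "\<And>x. x \<in> K \<Longrightarrow> norm x \<le> R"
    using compact_imp_bounded[OF K(1)] by (auto simp: bounded_iff)
  define t :: "nat \<Rightarrow> real" where "t n = 1 / real (Suc n)" for n
  have t: "t n > 0" "t n \<le> 1" for n by (auto simp: t_def)
  have t0: "t \<longlonglongrightarrow> 0" unfolding t_def by (rule LIMSEQ_Suc[OF lim_1_over_n])
  define q where "q n x = (\<phi> (x + t n *\<^sub>R v) - \<phi> x) / t n" for n x
  have "(\<lambda>n. LINT x|lborel. q n x) \<longlonglongrightarrow> (LINT x|lborel. grad \<phi> x \<bullet> v)"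
  proof (rule integral_dominated_convergence)
    \<comment> \<open>Since \<open>t n \<le> 1\<close>, a point farther out than
      \<open>R + norm v\<close> is not moved into \<open>K\<close>, so one ball contains the
      supports of all difference quotients.\<close>
    show "integrable lborel (\<lambda>x. (B * norm v) * indicator (cball 0 (R + norm v)) x :: real)"
      by (intro integrable_mult_right integrable_real_indicator emeasure_lborel_cball_finite) auto
    show "AE x in lborel. norm (q n x) \<le> (B * norm v) * indicator (cball 0 (R + norm v)) x" for n
    proof (rule AE_I2)
      fix x
      show "norm (q n x) \<le> (B * norm v) * indicator (cball 0 (R + norm v)) x"
      proof (cases "norm x \<le> R + norm v")
        case True
        have "\<bar>\<phi> (x + t n *\<^sub>R v) - \<phi> x\<bar> \<le> B * norm (t n *\<^sub>R v)"
          using lipschitz_of_grad[OF sm B(2), of "x + t n *\<^sub>R v" x] by simp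
        then show ?thesis using True t[of n] by (simp add: q_def field_simps)
      next
        case False
        have "norm (x + t n *\<^sub>R v) \<ge> norm x - norm (t n *\<^sub>R v)" by (rule norm_diff_ineq)
        moreover have "norm (t n *\<^sub>R v) \<le> norm v" using t[of n] by (simp add: mult_left_le_one_le)
        ultimately have "x + t n *\<^sub>R v \<notin> K" "x \<notin> K" using False R[of "x + t n *\<^sub>R v"] R[of x]
          by (auto simp: not_le) (use norm_ge_zero[of v] in linarith)
        then show ?thesis using False K by (simp add: q_def)
      qed
    qed
    show "AE x in lborel. (\<lambda>n. q n x) \<longlonglongrightarrow> grad \<phi> x \<bullet> v"
    proof (rule AE_I2)
      fix x
      have "((\<lambda>s. \<phi> (x + s *\<^sub>R v)) has_real_derivative grad \<phi> x \<bullet> v) (at 0)"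
        unfolding has_field_derivative_def
        by (rule has_derivative_eq_rhs[OF has_derivative_compose[where g = \<phi> and f = "\<lambda>s. x + s *\<^sub>R v"]])
          (auto intro!: derivative_eq_intros has_derivative_grad smooth_differentiable[OF sm] simp: fun_eq_iff)
      then have "((\<lambda>s. (\<phi> (x + s *\<^sub>R v) - \<phi> x) / s) \<longlongrightarrow> grad \<phi> x \<bullet> v) (at 0)"
        by (simp add: has_field_derivative_iff)
      from filterlim_compose[OF this, of t sequentially]
      show "(\<lambda>n. q n x) \<longlonglongrightarrow> grad \<phi> x \<bullet> v"
        unfolding q_def using t t0 by (simp add: filterlim_at less_imp_neq[symmetric])
    qed
  qed (auto simp: q_def)
  moreover have "(LINT x|lborel. q n x) = 0" for n
    using integrable_translation[OF test_function_integrable(1)[OF assms], of "t n *\<^sub>R v"]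
      test_function_integrable(1)[OF assms] by (simp add: q_def)
  ultimately show ?thesis by (simp add: LIMSEQ_const_iff)
qed

text \<open>The product \<open>f x * \<phi> x\<close> is itself a test function, so the integral of
  its derivative vanishes.\<close>

lemma smooth_integration_by_parts:
  assumes "smooth f" "test_function \<Omega> \<phi>"
  shows "(LINT x|lborel. f x * (grad \<phi> x \<bullet> v)) = - (LINT x|lborel. (grad f x \<bullet> v) * \<phi> x)"
proof -
  obtain K where K: "compact K" "\<And>x. x \<notin> K \<Longrightarrow> \<phi> x = 0" "\<And>x. x \<notin> K \<Longrightarrow> grad \<phi> x = 0"
    using assms by (metis test_function_support)
  note sm = test_function_smooth[OF assms(2)]
  have i: "integrable lborel (\<lambda>x. f x * (grad \<phi> x \<bullet> v))" "integrable lborel (\<lambda>x. (grad f x \<bullet> v) * \<phi> x)"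
    by (rule integrable_continuous_compact_support[OF _ K(1)],
        rule continuous_on_mult[OF smooth_continuous smooth_continuous, OF _ smooth_grad_inner]
          continuous_on_mult[OF smooth_continuous smooth_continuous, OF smooth_grad_inner],
        use K sm assms(1) in simp_all)+
  have "(LINT x|lborel. grad (\<lambda>x. f x * \<phi> x) x \<bullet> v) = 0"
    by (rule integral_grad_test_function[OF test_function_mult(2)[OF assms(2,1)]])
  then have "(LINT x|lborel. f x * (grad \<phi> x \<bullet> v) + (grad f x \<bullet> v) * \<phi> x) = 0"
    by (simp only: grad_mult[OF assms(1) sm] inner_add_left inner_scaleR_left mult.commute[of "\<phi> _"])
  then show ?thesis using i by simp
qed

section \<open>The fundamental lemma of the calculus of variations\<close>

text \<open>Each factor is flat at a face of the box, which makes the extension by zero smooth.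
  Inside the box its argument grows with \<open>j\<close>, and exp(-1/t) tends to 1 as t
  grows.\<close>

lemma box_test_functions:
  fixes a b :: "'a::euclidean_space"
  assumes "cbox a b \<subseteq> \<Omega>"
  obtains \<phi> :: "nat \<Rightarrow> 'a \<Rightarrow> real" where "\<And>j. test_function \<Omega> (\<phi> j)"
    "\<And>j x. 0 \<le> \<phi> j x \<and> \<phi> j x \<le> indicator (cbox a b) x" "\<And>x. (\<lambda>j. \<phi> j x) \<longlonglongrightarrow> indicator (box a b) x"
proof -
  define \<phi> where "\<phi> j x = (\<Prod>i\<in>Basis. bump (real (Suc j) * (x \<bullet> i - a \<bullet> i)) * bump (real (Suc j) * (b \<bullet> i - x \<bullet> i)))"
    for j :: nat and x :: 'a
  have z: "\<phi> j x = 0" if "x \<notin> box a b" for j x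
    using that unfolding \<phi>_def
    by (auto simp: bump_eq_0_iff mem_box not_less mult_le_0_iff intro!: prod_zero)
  have sm: "smooth (\<phi> j)" for j unfolding \<phi>_def
    by (intro smooth_prod smooth_mult smooth_bump smooth_cmult smooth_diff smooth_inner smooth_const)
  have t: "test_function \<Omega> (\<phi> j)" for j
    by (rule test_functionI[OF sm _ assms]) (auto intro: z simp: box_subset_cbox[THEN subsetD])
  have 01: "0 \<le> \<phi> j x \<and> \<phi> j x \<le> 1" for j x unfolding \<phi>_def
    by (auto intro!: prod_nonneg prod_le_1 mult_nonneg_nonneg mult_le_one bump_ge_0 less_imp_le[OF bump_less_1])
  have b1: "(\<lambda>j. bump (real (Suc j) * s)) \<longlonglongrightarrow> 1" if "s > 0" for s
    using that unfolding bump_def by simp real_asymp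
  show ?thesis
  proof (rule that[of \<phi>])
    show "(\<lambda>j. \<phi> j x) \<longlonglongrightarrow> indicator (box a b) x" for x
    proof (cases "x \<in> box a b")
      case True
      have "(\<lambda>j. \<phi> j x) \<longlonglongrightarrow> (\<Prod>i\<in>(Basis::'a set). 1 * 1)" unfolding \<phi>_def
        by (intro tendsto_prod tendsto_mult b1) (use True in \<open>auto simp: mem_box\<close>)
      then show ?thesis using True by simp
    qed (simp add: z)
    show "0 \<le> \<phi> j x \<and> \<phi> j x \<le> indicator (cbox a b) x" for j x
      using 01[of j x] z[of x j] box_subset_cbox[of a b] by (cases "x \<in> box a b") (auto simp: indicator_def)
  qed (rule t)
qed

text \<open>A Dynkin argument: open boxes are stable under intersection and generate the Borel sets,
  so the signed measure with density \<open>F\<close> vanishes on every Borel set.\<close>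

lemma integral_boxes_0_imp_AE_0:
  fixes F :: "'a::euclidean_space \<Rightarrow> real"
  assumes F: "integrable lborel F" and box: "\<And>a b. (LINT x:box a b|lborel. F x) = 0"
  shows "AE x in lborel. F x = 0"
proof (rule density_unique_real[OF F, of "\<lambda>_. 0"])
  have si: "set_integrable lborel A F" if "A \<in> sets borel" for A
    using F that unfolding set_integrable_def by (intro integrable_mult_indicator) auto
  \<comment> \<open>The whole space is not a box. Its integral, which the complement step of the
    induction uses, is reached by exhausting it with boxes.\<close>
  have U: "(LINT x|lborel. F x) = 0"
  proof -
    have "(\<lambda>n. LINT x|lborel. indicator (box (- real n *\<^sub>R One) (real n *\<^sub>R One)) x *\<^sub>R F x) \<longlonglongrightarrow> (LINT x|lborel. F x)"
    proof (rule integral_dominated_convergence[where w = "\<lambda>x. \<bar>F x\<bar>"])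
      show "AE x in lborel. (\<lambda>n. indicator (box (- real n *\<^sub>R One) (real n *\<^sub>R One)) x *\<^sub>R F x) \<longlonglongrightarrow> F x"
      proof (rule AE_I2, rule tendsto_eventually)
        fix x :: 'a
        obtain k :: nat where k: "norm x < real k" using reals_Archimedean2 by blast
        show "\<forall>\<^sub>F n in sequentially. indicator (box (- real n *\<^sub>R One) (real n *\<^sub>R One)) x *\<^sub>R F x = F x"
          using eventually_ge_at_top[of k]
        proof eventually_elim
          case (elim n)
          have "\<bar>x \<bullet> i\<bar> < real n" if "i \<in> Basis" for i
            using Basis_le_norm[OF that, of x] k elim by linarith
          then have "x \<in> box (- real n *\<^sub>R One) (real n *\<^sub>R One)"
            by (auto simp: mem_box abs_less_iff) (use abs_less_iff in fastforce)
          then show ?case by simp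
        qed
      qed
    qed (use F in \<open>auto simp: indicator_def\<close>)
    then show ?thesis using box by (simp add: set_lebesgue_integral_def LIMSEQ_const_iff)
  qed
  fix A :: "'a set" assume "A \<in> sets lborel"
  then have "Int_stable (range (\<lambda>(a, b). box a b :: 'a set))"
    "range (\<lambda>(a, b). box a b :: 'a set) \<subseteq> Pow UNIV"
    "A \<in> sigma_sets UNIV (range (\<lambda>(a, b). box a b))"
    by (auto simp: borel_eq_box Int_stable_def box_Int_box)
  then have "(LINT x:A|lborel. F x) = 0"
  proof (induction rule: sigma_sets_induct_disjoint)
    case (basic X)
    then show ?case using box by auto
  next
    case empty
    then show ?case by (simp add: set_lebesgue_integral_def)
  next
    case (compl B)
    then have B: "B \<in> sets borel" by (simp add: borel_eq_box)
    have "(LINT x:UNIV|lborel. F x) = (LINT x:(B \<union> (UNIV - B))|lborel. F x)" by simp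
    also have "\<dots> = (LINT x:B|lborel. F x) + (LINT x:(UNIV - B)|lborel. F x)"
      by (rule set_integral_Un) (use B si in auto)
    finally show ?case using compl U by (simp add: set_lebesgue_integral_def)
  next
    case (union B)
    then have B: "B i \<in> sets borel" for i by (auto simp: borel_eq_box)
    have "(LINT x:(\<Union>i. B i)|lborel. F x) = (\<Sum>i. LINT x:B i|lborel. F x)"
      by (rule lebesgue_integral_countable_add) (use B si union in \<open>auto simp: disjoint_family_on_def\<close>)
    then show ?case using union by simp
  qed
  then show "(LINT x:A|lborel. F x) = (LINT x:A|lborel. 0)" by simp
qed simp

text \<open>Inside a box whose closure lies in \<open>\<Omega>\<close> the function is integrable,
  and box indicators are bounded limits of test functions; so all its box integrals vanish.
  Countably many such boxes cover \<open>\<Omega>\<close>.\<close>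

lemma fundamental_lemma:
  fixes f :: "'a::euclidean_space \<Rightarrow> real"
  assumes "open \<Omega>" and li: "locally_integrable \<Omega> f"
    and zero: "\<And>\<phi>. test_function \<Omega> \<phi> \<Longrightarrow> (LINT x|lebesgue. f x * \<phi> x) = 0"
  shows "AE x in lebesgue. x \<in> \<Omega> \<longrightarrow> f x = 0"
proof -
  have box: "AE x in lebesgue. x \<in> box c d \<longrightarrow> f x = 0" if cd: "cbox c d \<subseteq> \<Omega>" for c d
  proof -
    have int: "integrable lebesgue (\<lambda>x. indicator (cbox c d) x *\<^sub>R f x)"
      using li cd compact_cbox unfolding locally_integrable_def set_integrable_def by blast
    define F where "F x = indicator (box c d) x *\<^sub>R f x" for x
    have F: "integrable lebesgue F"
      unfolding F_def
      by (rule Bochner_Integration.integrable_cong[THEN iffD1, OF refl _ integrable_mult_indicator[OF _ int, of "box c d"]])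
        (use box_subset_cbox[of c d] in \<open>auto simp: indicator_def\<close>)
    then have "F \<in> borel_measurable (completion lborel)" by auto
    \<comment> \<open>A Borel representative, since the criterion on box integrals is stated for
      \<open>lborel\<close>.\<close>
    then obtain F' where F': "F' \<in> borel_measurable lborel" "AE x in lborel. F x = F' x"
      using completion_ex_borel_measurable_real by blast
    have ae: "AE x in lebesgue. F x = F' x" using F'(2) by (rule AE_completion)
    have "integrable lebesgue F'"
      using F F' ae by (subst integrable_cong_AE[of _ _ F]) (auto intro: measurable_completion)
    then have intF': "integrable lborel F'" using F' by (simp add: integrable_completion)
    have "(LINT x:box a b|lborel. F' x) = 0" for a b
    proof -
      \<comment> \<open>The intersection of two boxes is a box, and its closure stays inside
        \<open>\<Omega>\<close>; arbitrary boxes can thus be tested although \<open>\<Omega>\<close>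
        need not contain them.\<close>
      obtain a' b' where ab: "box a b \<inter> box c d = box a' b'" by (auto simp: box_Int_box)
      have "(LINT x|lebesgue. indicator (box a' b') x * f x) = 0"
      proof (cases "box a' b' = {}")
        case False
        have sub: "cbox a' b' \<subseteq> cbox c d"
        proof -
          have "box c d \<noteq> {}" using ab False by auto
          then show ?thesis using closure_mono[of "box a' b'" "box c d"] ab False
            by (simp add: closure_box) blast
        qed
        from sub cd have "cbox a' b' \<subseteq> \<Omega>" by blast
        then obtain \<phi> :: "nat \<Rightarrow> 'a \<Rightarrow> real" where \<phi>: "\<And>j. test_function \<Omega> (\<phi> j)"
          "\<And>j x. 0 \<le> \<phi> j x \<and> \<phi> j x \<le> indicator (cbox a' b') x"
          "\<And>x. (\<lambda>j. \<phi> j x) \<longlonglongrightarrow> indicator (box a' b') x"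
          using box_test_functions by metis
        have \<phi>c: "\<phi> j x = \<phi> j x * indicator (cbox c d) x" for j x
          using \<phi>(2)[of j x] sub by (cases "x \<in> cbox a' b'") auto
        have \<phi>m: "\<phi> j \<in> borel_measurable lebesgue" for j
          by (intro measurable_completion) (auto intro!: borel_measurable_continuous_onI smooth_continuous
              test_function_smooth[OF \<phi>(1)])
        have fm: "(\<lambda>x. indicator (cbox c d) x * f x) \<in> borel_measurable lebesgue" using int by auto
        have "(\<lambda>j. LINT x|lebesgue. \<phi> j x * (indicator (cbox c d) x * f x)) \<longlonglongrightarrow>
            (LINT x|lebesgue. indicator (box a' b') x * (indicator (cbox c d) x * f x))"
        proof (rule integral_dominated_convergence[where w = "\<lambda>x. \<bar>indicator (cbox c d) x * f x\<bar>"])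
          show "AE x in lebesgue. (\<lambda>j. \<phi> j x * (indicator (cbox c d) x * f x)) \<longlonglongrightarrow>
              indicator (box a' b') x * (indicator (cbox c d) x * f x)"
            by (auto intro!: tendsto_intros \<phi>)
          show "AE x in lebesgue. norm (\<phi> j x * (indicator (cbox c d) x * f x)) \<le> \<bar>indicator (cbox c d) x * f x\<bar>" for j
          proof (rule AE_I2)
            fix x
            have "\<bar>\<phi> j x\<bar> \<le> 1" using \<phi>(2)[of j x] by (cases "x \<in> cbox a' b'") auto
            then show "norm (\<phi> j x * (indicator (cbox c d) x * f x)) \<le> \<bar>indicator (cbox c d) x * f x\<bar>"
              by (simp add: abs_mult mult_left_le_one_le)
          qed
          show "(\<lambda>x. indicator (box a' b') x * (indicator (cbox c d) x * f x)) \<in> borel_measurable lebesgue"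
            by (rule borel_measurable_times[OF borel_measurable_indicator fm]) simp
          show "integrable lebesgue (\<lambda>x. \<bar>indicator (cbox c d) x * f x\<bar>)" using int by simp
        qed (rule borel_measurable_times[OF \<phi>m fm])
        moreover have "(LINT x|lebesgue. \<phi> j x * (indicator (cbox c d) x * f x)) = 0" for j
        proof -
          have "\<phi> j x * (indicator (cbox c d) x * f x) = f x * \<phi> j x" for x
            using \<phi>c[of j x] by (metis mult.assoc mult.commute)
          then show ?thesis using zero[OF \<phi>(1)] by presburger
        qed
        moreover have "indicator (box a' b') x * (indicator (cbox c d) x * f x) = indicator (box a' b') x * f x" for x
          using ab box_subset_cbox[of c d] by (auto simp: indicator_def)
        ultimately show ?thesis by (simp add: LIMSEQ_const_iff)
      qed simp
      moreover have "indicator (box a b) x *\<^sub>R F x = indicator (box a' b') x * f x" for x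
        unfolding F_def ab[symmetric] by (simp add: indicator_inter_arith)
      ultimately have "(LINT x|lebesgue. indicator (box a b) x *\<^sub>R F x) = 0" by simp
      moreover have "(LINT x|lebesgue. indicator (box a b) x *\<^sub>R F x) = (LINT x|lebesgue. indicator (box a b) x *\<^sub>R F' x)"
      proof (rule integral_cong_AE)
        show "(\<lambda>x. indicator (box a b) x *\<^sub>R F x) \<in> borel_measurable lebesgue"
          "(\<lambda>x. indicator (box a b) x *\<^sub>R F' x) \<in> borel_measurable lebesgue"
          using F F'(1) by (intro borel_measurable_scaleR borel_measurable_indicator; simp add: measurable_completion)+
      qed (use ae in auto)
      moreover have "\<dots> = (LINT x|lborel. indicator (box a b) x *\<^sub>R F' x)"
        by (rule integral_completion) (use F' in auto)
      ultimately show ?thesis by (simp add: set_lebesgue_integral_def)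
    qed
    then have "AE x in lborel. F' x = 0" by (rule integral_boxes_0_imp_AE_0[OF intF'])
    then have "AE x in lebesgue. F' x = 0" by (rule AE_completion)
    then show ?thesis using ae by eventually_elim (auto simp: F_def indicator_def)
  qed
  define \<F> where "\<F> = {box c d | c d. cbox c d \<subseteq> \<Omega>}"
  \<comment> \<open>Exceptional null sets may only be united countably often, hence
    Lindelof.\<close>
  obtain \<F>' where \<F>': "\<F>' \<subseteq> \<F>" "countable \<F>'" "\<Union>\<F>' = \<Union>\<F>"
    using Lindelof[of \<F>] by (auto simp: \<F>_def open_box)
  have "\<Omega> \<subseteq> \<Union>\<F>"
  proof
    fix x assume "x \<in> \<Omega>"
    then obtain e where e: "e > 0" "cball x e \<subseteq> \<Omega>" using \<open>open \<Omega>\<close> open_contains_cball by blast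
    obtain c d where "x \<in> box c d" "box c d \<subseteq> ball x e" using rational_boxes[OF e(1), of x] by blast
    moreover from this have "cbox c d \<subseteq> cball x e"
      using closure_mono[of "box c d" "ball x e"] e closure_box[of c d]
      by (metis closure_ball empty_iff order_less_le)
    ultimately show "x \<in> \<Union>\<F>" using e unfolding \<F>_def by blast
  qed
  moreover have "AE x in lebesgue. \<forall>U\<in>\<F>'. x \<in> U \<longrightarrow> f x = 0"
    using \<F>' box by (subst AE_ball_countable) (auto simp: \<F>_def)
  ultimately show ?thesis using \<F>'(3) by (auto elim!: eventually_mono)
qed

section \<open>Weak gradients\<close>

lemma lebesgue_on_integrable_iff:
  fixes f :: "'a::euclidean_space \<Rightarrow> 'b::{banach, second_countable_topology}"
  assumes "\<Omega> \<in> sets lebesgue" "\<And>x. x \<notin> \<Omega> \<Longrightarrow> f x = 0"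
  shows "integrable (lebesgue_on \<Omega>) f \<longleftrightarrow> integrable lebesgue f"
    "(LINT x|lebesgue_on \<Omega>. f x) = (LINT x|lebesgue. f x)"
proof -
  have "indicator \<Omega> x *\<^sub>R f x = f x" for x using assms(2)[of x] by (auto simp: indicator_def)
  then show "integrable (lebesgue_on \<Omega>) f \<longleftrightarrow> integrable lebesgue f"
    "(LINT x|lebesgue_on \<Omega>. f x) = (LINT x|lebesgue. f x)"
    using assms(1) by (simp_all add: integrable_restrict_space integral_restrict_space)
qed

lemma integrable_bounded_mult:
  fixes f g :: "'a \<Rightarrow> real"
  assumes "integrable M f" "g \<in> borel_measurable M" "AE x in M. \<bar>g x\<bar> \<le> C"
  shows "integrable M (\<lambda>x. f x * g x)"
proof (rule Bochner_Integration.integrable_bound)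
  show "integrable M (\<lambda>x. C * f x)" using assms(1) by simp
  show "AE x in M. norm (f x * g x) \<le> norm (C * f x)"
    using assms(3)
  proof eventually_elim
    case (elim x)
    then have "\<bar>f x\<bar> * \<bar>g x\<bar> \<le> \<bar>f x\<bar> * \<bar>C\<bar>" by (intro mult_left_mono) auto
    then show ?case by (simp add: abs_mult mult.commute)
  qed
qed (use assms in auto)

lemma locally_integrable_mult:
  fixes f \<phi> :: "'a::euclidean_space \<Rightarrow> real"
  assumes "locally_integrable \<Omega> f" "continuous_on UNIV \<phi>" "compact K" "K \<subseteq> \<Omega>" "\<And>x. x \<notin> K \<Longrightarrow> \<phi> x = 0"
  shows "integrable lebesgue (\<lambda>x. f x * \<phi> x)"
proof -
  have f: "integrable lebesgue (\<lambda>x. indicator K x *\<^sub>R f x)"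
    using assms unfolding locally_integrable_def set_integrable_def by blast
  have "bounded (\<phi> ` K)"
    by (intro compact_imp_bounded compact_continuous_image continuous_on_subset[OF assms(2)] assms) auto
  then obtain C where C: "\<And>x. x \<in> K \<Longrightarrow> \<bar>\<phi> x\<bar> \<le> C" by (auto simp: bounded_iff)
  have "\<bar>\<phi> x\<bar> \<le> \<bar>C\<bar>" for x using C[of x] assms(5)[of x] by (cases "x \<in> K") auto
  then have "integrable lebesgue (\<lambda>x. (indicator K x *\<^sub>R f x) * \<phi> x)"
    by (intro integrable_bounded_mult[OF f, of _ "\<bar>C\<bar>"] measurable_completion borel_measurable_continuous_onI assms)
      (auto intro: borel_measurable_continuous_onI assms)
  moreover have "(\<lambda>x. (indicator K x *\<^sub>R f x) * \<phi> x) = (\<lambda>x. f x * \<phi> x)"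
    using assms(5) by (force simp: indicator_def)
  ultimately show ?thesis by metis
qed

lemma locally_integrable_inner:
  fixes G :: "'a::euclidean_space \<Rightarrow> 'b::euclidean_space"
  assumes "locally_integrable \<Omega> G"
  shows "locally_integrable \<Omega> (\<lambda>x. G x \<bullet> v)"
  unfolding locally_integrable_def set_integrable_def
proof (intro allI impI)
  fix K assume "compact K \<and> K \<subseteq> \<Omega>"
  then have "integrable lebesgue (\<lambda>x. indicator K x *\<^sub>R G x)"
    using assms unfolding locally_integrable_def set_integrable_def by blast
  then have "integrable lebesgue (\<lambda>x. (indicator K x *\<^sub>R G x) \<bullet> v)" by (rule integrable_inner_left)
  then show "integrable lebesgue (\<lambda>x. indicator K x *\<^sub>R (G x \<bullet> v))" by simp
qed

text \<open>Test functions and their gradients vanish outside \<open>\<Omega>\<close>, so the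
  restricted measure can be replaced by the full one.\<close>

lemma has_weak_gradient_iff:
  assumes "open \<Omega>"
  shows "has_weak_gradient \<Omega> u G \<longleftrightarrow> locally_integrable \<Omega> u \<and> locally_integrable \<Omega> G \<and>
    (\<forall>\<phi>. test_function \<Omega> \<phi> \<longrightarrow> (\<forall>b\<in>Basis. (LINT x|lebesgue. u x * (grad \<phi> x \<bullet> b)) =
      - (LINT x|lebesgue. (G x \<bullet> b) * \<phi> x)))"
proof -
  have "(LINT x|lebesgue_on \<Omega>. u x * frechet_derivative \<phi> (at x) b) = (LINT x|lebesgue. u x * (grad \<phi> x \<bullet> b))"
    "(LINT x|lebesgue_on \<Omega>. (G x \<bullet> b) * \<phi> x) = (LINT x|lebesgue. (G x \<bullet> b) * \<phi> x)"
    if \<phi>: "test_function \<Omega> \<phi>" and b: "b \<in> Basis" for \<phi> b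
  proof -
    obtain K where K: "K \<subseteq> \<Omega>" "\<And>x. x \<notin> K \<Longrightarrow> \<phi> x = 0" "\<And>x. x \<notin> K \<Longrightarrow> grad \<phi> x = 0"
      using \<phi> by (metis test_function_support)
    have z: "\<phi> x = 0" "grad \<phi> x = 0" if "x \<notin> \<Omega>" for x using K that by blast+
    show "(LINT x|lebesgue_on \<Omega>. u x * frechet_derivative \<phi> (at x) b) = (LINT x|lebesgue. u x * (grad \<phi> x \<bullet> b))"
      using assms by (subst lebesgue_on_integrable_iff(2)[symmetric, of \<Omega>])
        (auto simp: z frechet_derivative_grad[OF test_function_smooth[OF \<phi>]])
    show "(LINT x|lebesgue_on \<Omega>. (G x \<bullet> b) * \<phi> x) = (LINT x|lebesgue. (G x \<bullet> b) * \<phi> x)"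
      using assms by (subst lebesgue_on_integrable_iff(2)[symmetric, of \<Omega>]) (auto simp: z)
  qed
  then show ?thesis unfolding has_weak_gradient_def by auto
qed

lemma has_weak_gradientD:
  assumes "has_weak_gradient \<Omega> u G" "open \<Omega>" "test_function \<Omega> \<phi>" "b \<in> Basis"
  shows "(LINT x|lebesgue. u x * (grad \<phi> x \<bullet> b)) = - (LINT x|lebesgue. (G x \<bullet> b) * \<phi> x)"
    "integrable lebesgue (\<lambda>x. u x * (grad \<phi> x \<bullet> v))" "integrable lebesgue (\<lambda>x. u x * \<phi> x)"
    "integrable lebesgue (\<lambda>x. (G x \<bullet> v) * \<phi> x)"
proof -
  note w = assms(1)[unfolded has_weak_gradient_iff[OF assms(2)]]
  show "(LINT x|lebesgue. u x * (grad \<phi> x \<bullet> b)) = - (LINT x|lebesgue. (G x \<bullet> b) * \<phi> x)"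
    using w assms by blast
  obtain K where K: "compact K" "K \<subseteq> \<Omega>" "\<And>x. x \<notin> K \<Longrightarrow> \<phi> x = 0" "\<And>x. x \<notin> K \<Longrightarrow> grad \<phi> x = 0"
    using assms(3) by (metis test_function_support)
  note sm = test_function_smooth[OF assms(3)]
  show "integrable lebesgue (\<lambda>x. u x * (grad \<phi> x \<bullet> v))" "integrable lebesgue (\<lambda>x. u x * \<phi> x)"
    "integrable lebesgue (\<lambda>x. (G x \<bullet> v) * \<phi> x)"
    by (rule locally_integrable_mult[OF _ _ K(1,2)];
      use w K locally_integrable_inner in
        \<open>auto intro: smooth_continuous[OF sm] smooth_continuous[OF smooth_grad_inner[OF sm]]\<close>)+
qed

text \<open>Each component of \<open>G - H\<close> integrates to zero against every test function.
  This determines the gradient that \<open>weak_gradient\<close> picks by \<open>SOME\<close>, and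
  later lets gradients on different balls be glued.\<close>

lemma has_weak_gradient_unique:
  assumes \<Omega>: "open \<Omega>" and u: "has_weak_gradient \<Omega> u G" and v: "has_weak_gradient \<Omega> v H"
    and eq: "AE x in lebesgue. x \<in> \<Omega> \<longrightarrow> u x = v x"
  shows "AE x in lebesgue. x \<in> \<Omega> \<longrightarrow> G x = H x"
proof -
  have li: "locally_integrable \<Omega> G" "locally_integrable \<Omega> H"
    using u v by (auto simp: has_weak_gradient_def)
  have "AE x in lebesgue. x \<in> \<Omega> \<longrightarrow> (G x - H x) \<bullet> b = 0" if b: "b \<in> Basis" for b
  proof (rule fundamental_lemma[OF \<Omega>])
    show "locally_integrable \<Omega> (\<lambda>x. (G x - H x) \<bullet> b)"
    proof (rule locally_integrable_inner)
      show "locally_integrable \<Omega> (\<lambda>x. G x - H x)"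
        using li unfolding locally_integrable_def by (auto intro: set_integral_diff)
    qed
    fix \<phi> assume \<phi>: "test_function \<Omega> \<phi>"
    obtain K where K: "K \<subseteq> \<Omega>" "\<And>x. x \<notin> K \<Longrightarrow> grad \<phi> x = 0"
      using \<phi> by (metis test_function_support)
    have "(LINT x|lebesgue. u x * (grad \<phi> x \<bullet> b)) = (LINT x|lebesgue. v x * (grad \<phi> x \<bullet> b))"
    proof (rule integral_cong_AE)
      show "AE x in lebesgue. u x * (grad \<phi> x \<bullet> b) = v x * (grad \<phi> x \<bullet> b)"
        using eq
      proof eventually_elim
        case (elim x)
        then show ?case using K by (cases "x \<in> K") auto
      qed
    qed (use has_weak_gradientD(2)[OF u \<Omega> \<phi> b] has_weak_gradientD(2)[OF v \<Omega> \<phi> b] in auto)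
    then have "(LINT x|lebesgue. (G x \<bullet> b) * \<phi> x) = (LINT x|lebesgue. (H x \<bullet> b) * \<phi> x)"
      using has_weak_gradientD(1)[OF u \<Omega> \<phi> b] has_weak_gradientD(1)[OF v \<Omega> \<phi> b] by simp
    then show "(LINT x|lebesgue. (G x - H x) \<bullet> b * \<phi> x) = 0"
      using has_weak_gradientD(4)[OF u \<Omega> \<phi> b] has_weak_gradientD(4)[OF v \<Omega> \<phi> b]
      by (simp add: inner_diff_left left_diff_distrib)
  qed
  then have "AE x in lebesgue. \<forall>b\<in>Basis. x \<in> \<Omega> \<longrightarrow> (G x - H x) \<bullet> b = 0"
    by (subst AE_finite_all) auto
  then show ?thesis
    by eventually_elim (auto simp: inner_diff_left intro: euclidean_eqI)
qed

subsection \<open>Square integrable weak gradients\<close>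

lemma L2_add:
  assumes "L2 M f" "L2 M g"
  shows "L2 M (\<lambda>x. f x + g x)"
  unfolding L2_def
proof
  have [measurable]: "f \<in> borel_measurable M" "g \<in> borel_measurable M" using assms by (auto simp: L2_def)
  show "(\<lambda>x. f x + g x) \<in> borel_measurable M" by simp
  show "integrable M (\<lambda>x. (norm (f x + g x))\<^sup>2)"
  proof (rule Bochner_Integration.integrable_bound)
    show "integrable M (\<lambda>x. 2 * (norm (f x))\<^sup>2 + 2 * (norm (g x))\<^sup>2)"
      using assms by (auto simp: L2_def)
    have "(norm (f x + g x))\<^sup>2 \<le> 2 * (norm (f x))\<^sup>2 + 2 * (norm (g x))\<^sup>2" for x
    proof -
      have "(norm (f x + g x))\<^sup>2 \<le> (norm (f x) + norm (g x))\<^sup>2"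
        by (intro power_mono norm_triangle_ineq) auto
      also have "\<dots> \<le> 2 * (norm (f x))\<^sup>2 + 2 * (norm (g x))\<^sup>2"
        using sum_squares_bound[of "norm (f x)" "norm (g x)"] by (simp add: power2_sum)
      finally show ?thesis .
    qed
    then show "AE x in M. norm ((norm (f x + g x))\<^sup>2) \<le> norm (2 * (norm (f x))\<^sup>2 + 2 * (norm (g x))\<^sup>2)"
      by (auto intro: order_trans)
  qed simp
qed

lemma L2_bounded:
  assumes "L2 M f" "g \<in> borel_measurable M" "AE x in M. norm (g x) \<le> C * norm (f x)"
  shows "L2 M g"
  unfolding L2_def
proof
  show "integrable M (\<lambda>x. (norm (g x))\<^sup>2)"
  proof (rule Bochner_Integration.integrable_bound)
    show "integrable M (\<lambda>x. C\<^sup>2 * (norm (f x))\<^sup>2)" using assms by (auto simp: L2_def)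
    show "AE x in M. norm ((norm (g x))\<^sup>2) \<le> norm (C\<^sup>2 * (norm (f x))\<^sup>2)"
      using assms(3) by eventually_elim (auto simp flip: power_mult_distrib intro: power_mono)
  qed (use assms in simp)
qed (use assms in simp)

lemma L2_scaleR: "L2 M f \<Longrightarrow> L2 M (\<lambda>x. c *\<^sub>R f x)"
  by (rule L2_bounded[where f = f and C = "\<bar>c\<bar>"]) (auto simp: L2_def)

lemma L2_cmult: "L2 M f \<Longrightarrow> L2 M (\<lambda>x. c * f x)" for f :: "_ \<Rightarrow> real"
  using L2_scaleR[of M f c] by simp

lemma L2_const_bounded:
  assumes "finite_measure M" "g \<in> borel_measurable M" "AE x in M. norm (g x) \<le> C"
  shows "L2 M g"
proof (rule L2_bounded[where f = "\<lambda>_. 1::real" and C = C])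
  show "L2 M (\<lambda>_. 1::real)" using assms(1) by (simp add: L2_def finite_measure.integrable_const)
qed (use assms in auto)

lemma integrable_inner_L2:
  fixes f g :: "'a \<Rightarrow> 'b::euclidean_space"
  assumes "L2 M f" "L2 M g"
  shows "integrable M (\<lambda>x. f x \<bullet> g x)"
proof (rule Bochner_Integration.integrable_bound)
  show "integrable M (\<lambda>x. (norm (f x))\<^sup>2 + (norm (g x))\<^sup>2)"
    using assms by (auto simp: L2_def)
  have "\<bar>f x \<bullet> g x\<bar> \<le> (norm (f x))\<^sup>2 + (norm (g x))\<^sup>2" for x
  proof -
    have "\<bar>f x \<bullet> g x\<bar> \<le> norm (f x) * norm (g x)" by (rule Cauchy_Schwarz_ineq2)
    moreover have "0 \<le> norm (f x) * norm (g x)" by simp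
    ultimately show ?thesis using sum_squares_bound[of "norm (f x)" "norm (g x)"] by linarith
  qed
  then show "AE x in M. norm (f x \<bullet> g x) \<le> norm ((norm (f x))\<^sup>2 + (norm (g x))\<^sup>2)"
    by (auto intro: order_trans)
qed (use assms in \<open>auto simp: L2_def\<close>)

lemma integrable_mult_L2:
  fixes f g :: "'a \<Rightarrow> real"
  assumes "L2 M f" "L2 M g"
  shows "integrable M (\<lambda>x. f x * g x)"
  using integrable_inner_L2[OF assms] by simp

text \<open>On a compact set 1 is integrable, and |f| is at most 1 + |f|^2.\<close>

lemma L2_locally_integrable:
  assumes \<Omega>: "\<Omega> \<in> sets lebesgue" and f: "L2 (lebesgue_on \<Omega>) f"
  shows "locally_integrable \<Omega> f"
  unfolding locally_integrable_def set_integrable_def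
proof (intro allI impI)
  fix K assume K: "compact K \<and> K \<subseteq> \<Omega>"
  then have Kb: "K \<in> sets borel" by (auto intro: borel_compact)
  have m: "(\<lambda>x. indicator \<Omega> x *\<^sub>R f x) \<in> borel_measurable lebesgue"
    using f \<Omega> by (auto simp: L2_def borel_measurable_restrict_space_iff)
  have eq: "indicator K x *\<^sub>R f x = indicator K x *\<^sub>R (indicator \<Omega> x *\<^sub>R f x)" for x
    using K by (auto simp: indicator_def)
  show "integrable lebesgue (\<lambda>x. indicator K x *\<^sub>R f x)"
  proof (rule Bochner_Integration.integrable_bound)
    have "integrable lborel (indicator K :: _ \<Rightarrow> real)"
      using K Kb emeasure_compact_finite[of K] by (intro integrable_real_indicator) auto
    then have "integrable lebesgue (indicator K :: _ \<Rightarrow> real)"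
      using Kb by (subst integrable_completion) auto
    moreover have "integrable lebesgue (\<lambda>x. indicator \<Omega> x *\<^sub>R (norm (f x))\<^sup>2)"
      using f \<Omega> by (simp add: L2_def integrable_restrict_space)
    ultimately show "integrable lebesgue (\<lambda>x. indicator K x + indicator \<Omega> x *\<^sub>R (norm (f x))\<^sup>2)"
      by simp
    show "AE x in lebesgue. norm (indicator K x *\<^sub>R f x) \<le> norm (indicator K x + indicator \<Omega> x *\<^sub>R (norm (f x))\<^sup>2)"
    proof (rule AE_I2)
      fix x
      have "norm (f x) \<le> 1 + (norm (f x))\<^sup>2"
        using sum_squares_bound[of 1 "norm (f x)"] by simp (use norm_ge_zero[of "f x"] in linarith)
      then show "norm (indicator K x *\<^sub>R f x) \<le> norm (indicator K x + indicator \<Omega> x *\<^sub>R (norm (f x))\<^sup>2)"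
        using K by (auto simp: indicator_def)
    qed
    show "(\<lambda>x. indicator K x *\<^sub>R f x) \<in> borel_measurable lebesgue"
      unfolding eq using Kb by (intro borel_measurable_scaleR[OF borel_measurable_indicator m]) auto
  qed
qed

text \<open>Carries an explicit gradient, so that calculations need not go through the choice made
  by \<open>weak_gradient\<close>.\<close>

definition H1_grad :: "'a::euclidean_space set \<Rightarrow> ('a \<Rightarrow> real) \<Rightarrow> ('a \<Rightarrow> 'a) \<Rightarrow> bool" where
  "H1_grad \<Omega> u G \<longleftrightarrow> L2 (lebesgue_on \<Omega>) u \<and> L2 (lebesgue_on \<Omega>) G \<and> has_weak_gradient \<Omega> u G"

lemma H1_iff_H1_grad: "H1 \<Omega> u \<longleftrightarrow> (\<exists>G. H1_grad \<Omega> u G)"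
  by (auto simp: H1_def H1_grad_def)

lemma H1_gradI:
  assumes "open \<Omega>" "L2 (lebesgue_on \<Omega>) u" "L2 (lebesgue_on \<Omega>) G"
    and "\<And>\<phi> b. test_function \<Omega> \<phi> \<Longrightarrow> b \<in> Basis \<Longrightarrow> (LINT x|lebesgue. u x * (grad \<phi> x \<bullet> b)) =
      - (LINT x|lebesgue. (G x \<bullet> b) * \<phi> x)"
  shows "H1_grad \<Omega> u G"
  using assms by (auto simp: H1_grad_def has_weak_gradient_iff intro: L2_locally_integrable)

text \<open>By uniqueness the chosen gradient agrees almost everywhere with \<open>G\<close>; it
  inherits measurability because Lebesgue measure is complete.\<close>

lemma dirichlet_energy_eq:
  assumes \<Omega>: "open \<Omega>" and u: "H1_grad \<Omega> u G"
  shows "dirichlet_energy \<Omega> u = (LINT x|lebesgue_on \<Omega>. (norm (G x))\<^sup>2)"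
proof -
  have \<Omega>s[simp]: "\<Omega> \<in> sets lebesgue" using \<Omega> by auto
  have hw: "has_weak_gradient \<Omega> u G" using u by (simp add: H1_grad_def)
  then have "has_weak_gradient \<Omega> u (weak_gradient \<Omega> u)"
    unfolding weak_gradient_def by (rule someI[where P = "has_weak_gradient \<Omega> u"])
  from has_weak_gradient_unique[OF \<Omega> hw this]
  have ae: "AE x in lebesgue. x \<in> \<Omega> \<longrightarrow> G x = weak_gradient \<Omega> u x" by simp
  have m: "(\<lambda>x. indicator \<Omega> x *\<^sub>R G x) \<in> borel_measurable lebesgue"
    using u by (auto simp: H1_grad_def L2_def borel_measurable_restrict_space_iff)
  have "(\<lambda>x. indicator \<Omega> x *\<^sub>R weak_gradient \<Omega> u x) \<in> borel_measurable lebesgue"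
    by (rule borel_measurable_AE[OF m]) (use ae in eventually_elim, auto simp: indicator_def)
  then have "weak_gradient \<Omega> u \<in> borel_measurable (lebesgue_on \<Omega>)"
    by (simp add: borel_measurable_restrict_space_iff)
  then show ?thesis unfolding dirichlet_energy_def
    using u ae by (intro integral_cong_AE) (auto simp: H1_grad_def L2_def AE_restrict_space_iff)
qed

lemma H1_grad_add:
  fixes u :: "'a::euclidean_space \<Rightarrow> real"
  assumes \<Omega>: "open \<Omega>" and "H1_grad \<Omega> u G" "H1_grad \<Omega> v H"
  shows "H1_grad \<Omega> (\<lambda>x. u x + v x) (\<lambda>x. G x + H x)"
proof (rule H1_gradI[OF \<Omega>])
  fix \<phi> :: "'a \<Rightarrow> real" and b :: 'a assume \<phi>: "test_function \<Omega> \<phi>" "b \<in> Basis"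
  have hw: "has_weak_gradient \<Omega> u G" "has_weak_gradient \<Omega> v H" using assms by (auto simp: H1_grad_def)
  show "(LINT x|lebesgue. (u x + v x) * (grad \<phi> x \<bullet> b)) = - (LINT x|lebesgue. ((G x + H x) \<bullet> b) * \<phi> x)"
    using has_weak_gradientD[OF hw(1) \<Omega> \<phi>] has_weak_gradientD[OF hw(2) \<Omega> \<phi>]
    by (simp add: distrib_right inner_add_left)
qed (use assms in \<open>auto simp: H1_grad_def intro: L2_add\<close>)

lemma bounded_on_ball:
  fixes f :: "'a::euclidean_space \<Rightarrow> 'b::real_normed_vector"
  assumes "continuous_on UNIV f"
  obtains C :: real where "C \<ge> 0" "\<And>x. norm x \<le> R \<Longrightarrow> norm (f x) \<le> C"
proof -
  have "bounded (f ` cball 0 R)"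
    by (intro compact_imp_bounded compact_continuous_image continuous_on_subset[OF assms]) auto
  then obtain C where C: "\<forall>x\<in>cball 0 R. norm (f x) \<le> C" by (auto simp: bounded_iff)
  show ?thesis by (rule that[of "\<bar>C\<bar>"]) (use C in \<open>force simp: mem_cball_0\<close>)+
qed

lemma continuous_measurable_lebesgue_on:
  fixes f :: "'a::euclidean_space \<Rightarrow> 'b::euclidean_space"
  assumes "continuous_on UNIV f"
  shows "f \<in> borel_measurable (lebesgue_on \<Omega>)"
  by (intro measurable_restrict_space1 measurable_completion) (auto intro: borel_measurable_continuous_onI assms)

lemma AE_lebesgue_on_ball: "AE x in lebesgue_on (ball 0 R). norm x < R"
  by (subst AE_restrict_space_iff) auto

lemma finite_measure_lebesgue_on_ball: "finite_measure (lebesgue_on (ball (0::'a::euclidean_space) R))"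
  using emeasure_lborel_ball_finite[of "0::'a" R]
  by (intro finite_measureI) (simp add: emeasure_restrict_space space_restrict_space)

lemma L2_continuous_mult:
  fixes f :: "'a::euclidean_space \<Rightarrow> 'b::euclidean_space"
  assumes "L2 (lebesgue_on (ball 0 R)) f" "continuous_on UNIV a"
  shows "L2 (lebesgue_on (ball 0 R)) (\<lambda>x. a x *\<^sub>R f x)"
proof -
  obtain C where C: "C \<ge> 0" "\<And>x. norm x \<le> R \<Longrightarrow> norm (a x) \<le> C"
    using bounded_on_ball[OF assms(2)] by metis
  show ?thesis
  proof (rule L2_bounded[OF assms(1), where C = C])
    show "AE x in lebesgue_on (ball 0 R). norm (a x *\<^sub>R f x) \<le> C * norm (f x)"
      using AE_lebesgue_on_ball by eventually_elim (use C in \<open>auto intro: mult_right_mono\<close>)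
  qed (use assms continuous_measurable_lebesgue_on[OF assms(2)] in \<open>auto simp: L2_def\<close>)
qed

lemma L2_continuous:
  fixes f :: "'a::euclidean_space \<Rightarrow> 'b::euclidean_space"
  assumes "continuous_on UNIV f"
  shows "L2 (lebesgue_on (ball 0 R)) f"
proof -
  obtain C where C: "\<And>x. norm x \<le> R \<Longrightarrow> norm (f x) \<le> C"
    using bounded_on_ball[OF assms] by metis
  show ?thesis
  proof (rule L2_const_bounded[OF finite_measure_lebesgue_on_ball, where C = C])
    show "AE x in lebesgue_on (ball 0 R). norm (f x) \<le> C"
      using AE_lebesgue_on_ball by eventually_elim (use C in auto)
  qed (rule continuous_measurable_lebesgue_on[OF assms])
qed

lemma H1_grad_smooth:
  fixes f :: "'a::euclidean_space \<Rightarrow> real"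
  assumes "smooth f"
  shows "H1_grad (ball 0 R) f (grad f)"
proof (rule H1_gradI)
  fix \<phi> :: "'a \<Rightarrow> real" and b :: 'a assume \<phi>: "test_function (ball 0 R) \<phi>" "b \<in> Basis"
  have "(\<lambda>x. f x * (grad \<phi> x \<bullet> b)) \<in> borel_measurable lborel" "(\<lambda>x. (grad f x \<bullet> b) * \<phi> x) \<in> borel_measurable lborel"
    using assms test_function_smooth[OF \<phi>(1)]
    by (auto intro!: borel_measurable_continuous_onI smooth_continuous smooth_mult smooth_grad_inner)
  then show "(LINT x|lebesgue. f x * (grad \<phi> x \<bullet> b)) = - (LINT x|lebesgue. (grad f x \<bullet> b) * \<phi> x)"
    using smooth_integration_by_parts[OF assms \<phi>(1), of b] by (simp add: integral_completion)
qed (auto intro: L2_continuous smooth_continuous continuous_grad assms)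

text \<open>The product rule is moved to the test side: the weak identity is used with
  \<open>a x * \<phi> x\<close>, and the surplus term contains the test function
  \<open>(grad a x \<bullet> b) * \<phi> x\<close>.\<close>

lemma H1_grad_mult:
  fixes u :: "'a::euclidean_space \<Rightarrow> real"
  assumes u: "H1_grad (ball 0 R) u G" and a: "smooth a"
  shows "H1_grad (ball 0 R) (\<lambda>x. a x * u x) (\<lambda>x. a x *\<^sub>R G x + u x *\<^sub>R grad a x)"
proof (rule H1_gradI)
  have hw: "has_weak_gradient (ball 0 R) u G" and u2: "L2 (lebesgue_on (ball 0 R)) u"
    and G2: "L2 (lebesgue_on (ball 0 R)) G" using u by (auto simp: H1_grad_def)
  show "L2 (lebesgue_on (ball 0 R)) (\<lambda>x. a x * u x)"
    using L2_continuous_mult[OF u2 smooth_continuous[OF a]] by simp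
  show "L2 (lebesgue_on (ball 0 R)) (\<lambda>x. a x *\<^sub>R G x + u x *\<^sub>R grad a x)"
  proof (rule L2_add[OF L2_continuous_mult[OF G2 smooth_continuous[OF a]]])
    obtain C where C: "\<And>x. norm x \<le> R \<Longrightarrow> norm (grad a x) \<le> C"
      using bounded_on_ball[OF continuous_grad[OF a]] by metis
    show "L2 (lebesgue_on (ball 0 R)) (\<lambda>x. u x *\<^sub>R grad a x)"
    proof (rule L2_bounded[OF u2, where C = C])
      show "AE x in lebesgue_on (ball 0 R). norm (u x *\<^sub>R grad a x) \<le> C * norm (u x)"
        using AE_lebesgue_on_ball by eventually_elim (use C in \<open>auto simp: mult.commute[of _ "\<bar>u _\<bar>"] intro!: mult_left_mono\<close>)
    qed (use u2 continuous_measurable_lebesgue_on[OF continuous_grad[OF a]] in \<open>auto simp: L2_def\<close>)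
  qed
  fix \<phi> :: "'a \<Rightarrow> real" and b :: 'a assume \<phi>: "test_function (ball 0 R) \<phi>" and b: "b \<in> Basis"
  note sm = test_function_smooth[OF \<phi>]
  have a\<phi>: "test_function (ball 0 R) (\<lambda>x. a x * \<phi> x)" by (rule test_function_mult[OF \<phi> a])
  have \<phi>a: "test_function (ball 0 R) (\<lambda>x. (grad a x \<bullet> b) * \<phi> x)" by (rule test_function_mult[OF \<phi> smooth_grad_inner[OF a]])
  note D = has_weak_gradientD[OF hw open_ball a\<phi> b] has_weak_gradientD[OF hw open_ball \<phi>a b]
  have "u x * (grad (\<lambda>x. a x * \<phi> x) x \<bullet> b) = (a x * u x) * (grad \<phi> x \<bullet> b) + u x * ((grad a x \<bullet> b) * \<phi> x)" for x
    unfolding grad_mult[OF a sm] by (simp add: inner_add_left algebra_simps)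
  then have eq: "(a x * u x) * (grad \<phi> x \<bullet> b) = u x * (grad (\<lambda>x. a x * \<phi> x) x \<bullet> b) - u x * ((grad a x \<bullet> b) * \<phi> x)" for x
    by simp
  have "(LINT x|lebesgue. (a x * u x) * (grad \<phi> x \<bullet> b)) =
     - (LINT x|lebesgue. (G x \<bullet> b) * (a x * \<phi> x)) - (LINT x|lebesgue. u x * ((grad a x \<bullet> b) * \<phi> x))"
    unfolding eq using D by (subst Bochner_Integration.integral_diff) auto
  also have "\<dots> = - (LINT x|lebesgue. (G x \<bullet> b) * (a x * \<phi> x) + u x * ((grad a x \<bullet> b) * \<phi> x))"
    using D by (subst Bochner_Integration.integral_add) auto
  finally show "(LINT x|lebesgue. (a x * u x) * (grad \<phi> x \<bullet> b)) =
      - (LINT x|lebesgue. ((a x *\<^sub>R G x + u x *\<^sub>R grad a x) \<bullet> b) * \<phi> x)"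
    by (simp add: inner_add_left algebra_simps)
qed simp

lemma H1_norm_eq:
  fixes u :: "'a::euclidean_space \<Rightarrow> real"
  assumes "H1_grad (ball 0 R) u G"
  shows "H1_norm (ball 0 R) u = sqrt ((LINT x|lebesgue_on (ball 0 R). (u x)\<^sup>2) + (LINT x|lebesgue_on (ball 0 R). (norm (G x))\<^sup>2))"
  unfolding H1_norm_def dirichlet_energy_eq[OF open_ball assms] ..

text \<open>Multiplication by a smooth function is continuous on H^1 of a ball; this carries the
  approximating sequence in the definition of a trace over to a product.\<close>

lemma H1_norm_mult_le:
  fixes a :: "'a::euclidean_space \<Rightarrow> real"
  assumes "smooth a"
  obtains C where "\<And>u. H1 (ball 0 R) u \<Longrightarrow> H1_norm (ball 0 R) (\<lambda>x. a x * u x) \<le> C * H1_norm (ball 0 R) u"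
proof -
  obtain A where A: "A \<ge> 0" "\<And>x. norm x \<le> R \<Longrightarrow> norm (a x) \<le> A"
    using bounded_on_ball[OF smooth_continuous[OF assms]] by metis
  obtain A' where A': "A' \<ge> 0" "\<And>x. norm x \<le> R \<Longrightarrow> norm (grad a x) \<le> A'"
    using bounded_on_ball[OF continuous_grad[OF assms]] by metis
  \<comment> \<open>The squared function contributes A^2 and the squared gradient, split by (p +
    q)^2 \<le> 2 p^2 + 2 q^2, contributes 2 A^2 and 2 A'^2; this constant bounds the coefficients of
    both u^2 and |G|^2.\<close>
  define C2 where "C2 = 2 * A\<^sup>2 + 2 * A'\<^sup>2"
  show ?thesis
  proof (rule that[of "sqrt C2"])
    fix u :: "'a \<Rightarrow> real" assume "H1 (ball 0 R) u"
    then obtain G where G: "H1_grad (ball 0 R) u G" by (auto simp: H1_iff_H1_grad)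
    note aG = H1_grad_mult[OF G assms]
    let ?B = "lebesgue_on (ball (0::'a) R)"
    have i: "integrable ?B (\<lambda>x. (u x)\<^sup>2)" "integrable ?B (\<lambda>x. (norm (G x))\<^sup>2)"
      "integrable ?B (\<lambda>x. (a x * u x)\<^sup>2)" "integrable ?B (\<lambda>x. (norm (a x *\<^sub>R G x + u x *\<^sub>R grad a x))\<^sup>2)"
      using G aG by (auto simp: H1_grad_def L2_def)
    have "(LINT x|?B. (a x * u x)\<^sup>2) + (LINT x|?B. (norm (a x *\<^sub>R G x + u x *\<^sub>R grad a x))\<^sup>2)
        = (LINT x|?B. (a x * u x)\<^sup>2 + (norm (a x *\<^sub>R G x + u x *\<^sub>R grad a x))\<^sup>2)"
      using i by simp
    also have "\<dots> \<le> (LINT x|?B. C2 * ((u x)\<^sup>2 + (norm (G x))\<^sup>2))"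
    proof (rule integral_mono_AE)
      show "AE x in ?B. (a x * u x)\<^sup>2 + (norm (a x *\<^sub>R G x + u x *\<^sub>R grad a x))\<^sup>2 \<le> C2 * ((u x)\<^sup>2 + (norm (G x))\<^sup>2)"
        using AE_lebesgue_on_ball
      proof eventually_elim
        case (elim x)
        have a2: "(a x)\<^sup>2 \<le> A\<^sup>2" "(norm (grad a x))\<^sup>2 \<le> A'\<^sup>2"
          using A(2)[of x] A'(2)[of x] elim by (auto simp: abs_le_square_iff[symmetric] intro: power_mono)
        have "norm (a x *\<^sub>R G x + u x *\<^sub>R grad a x) \<le> \<bar>a x\<bar> * norm (G x) + \<bar>u x\<bar> * norm (grad a x)"
          by (rule norm_triangle_le) simp
        then have "(norm (a x *\<^sub>R G x + u x *\<^sub>R grad a x))\<^sup>2 \<le> (\<bar>a x\<bar> * norm (G x) + \<bar>u x\<bar> * norm (grad a x))\<^sup>2"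
          by (intro power_mono) auto
        also have "\<dots> \<le> 2 * (\<bar>a x\<bar> * norm (G x))\<^sup>2 + 2 * (\<bar>u x\<bar> * norm (grad a x))\<^sup>2"
          using sum_squares_bound[of "\<bar>a x\<bar> * norm (G x)" "\<bar>u x\<bar> * norm (grad a x)"] by (simp add: power2_sum)
        also have "\<dots> = 2 * ((a x)\<^sup>2 * (norm (G x))\<^sup>2) + 2 * ((norm (grad a x))\<^sup>2 * (u x)\<^sup>2)"
          by (simp add: power_mult_distrib)
        finally have "(a x * u x)\<^sup>2 + (norm (a x *\<^sub>R G x + u x *\<^sub>R grad a x))\<^sup>2
            \<le> (a x)\<^sup>2 * (u x)\<^sup>2 + (2 * ((a x)\<^sup>2 * (norm (G x))\<^sup>2) + 2 * ((norm (grad a x))\<^sup>2 * (u x)\<^sup>2))"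
          by (simp add: power_mult_distrib)
        also have "\<dots> \<le> A\<^sup>2 * (u x)\<^sup>2 + (2 * (A\<^sup>2 * (norm (G x))\<^sup>2) + 2 * (A'\<^sup>2 * (u x)\<^sup>2))"
          by (intro add_mono mult_left_mono mult_right_mono a2) auto
        also have "\<dots> \<le> C2 * ((u x)\<^sup>2 + (norm (G x))\<^sup>2)"
          by (simp add: C2_def algebra_simps)
        finally show ?case .
      qed
    qed (use i in auto)
    also have "\<dots> = C2 * ((LINT x|?B. (u x)\<^sup>2) + (LINT x|?B. (norm (G x))\<^sup>2))"
      using i by simp
    finally show "H1_norm (ball 0 R) (\<lambda>x. a x * u x) \<le> sqrt C2 * H1_norm (ball 0 R) u"
      unfolding H1_norm_eq[OF G] H1_norm_eq[OF aG] by (simp flip: real_sqrt_mult)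
  qed
qed

section \<open>The first variation of the thin obstacle problem\<close>

lemma H1_norm_nonneg: "H1_norm \<Omega> u \<ge> 0"
  unfolding H1_norm_def dirichlet_energy_def by (intro real_sqrt_ge_zero add_nonneg_nonneg integral_nonneg) auto

lemma borel_measurable_smooth: "smooth f \<Longrightarrow> sets M = sets borel \<Longrightarrow> f \<in> borel_measurable M"
  by (subst measurable_cong_sets[of _ borel _ borel]) (auto intro: borel_measurable_continuous_onI smooth_continuous)

text \<open>If the smooth \<open>\<psi> k\<close> approximate \<open>u\<close> and its trace, then
  \<open>a x * \<psi> k x + \<phi> x\<close> do so for the new function. The measure lives on the
  closed ball, where \<open>a\<close> and \<open>\<phi>\<close> are bounded.\<close>

lemma has_trace_perturb:
  fixes u :: "'a::euclidean_space \<Rightarrow> real"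
  assumes tr: "has_trace (ball 0 R) \<mu> u g"
    and \<mu>: "sets \<mu> = sets borel" "finite_measure \<mu>" "AE x in \<mu>. norm x \<le> R"
    and a: "smooth a" and \<phi>: "smooth \<phi>"
  shows "has_trace (ball 0 R) \<mu> (\<lambda>x. a x * u x + \<phi> x) (\<lambda>x. a x * g x + \<phi> x)"
proof -
  note [measurable] = borel_measurable_smooth[OF a \<mu>(1)] borel_measurable_smooth[OF \<phi> \<mu>(1)]
  obtain A where A: "\<And>x. norm x \<le> R \<Longrightarrow> norm (a x) \<le> A"
    using bounded_on_ball[OF smooth_continuous[OF a]] by metis
  have bdd: "L2 \<mu> f" if f: "smooth f" for f :: "'a \<Rightarrow> real"
  proof -
    obtain C where C: "\<And>x. norm x \<le> R \<Longrightarrow> norm (f x) \<le> C"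
      using bounded_on_ball[OF smooth_continuous[OF f]] by metis
    show ?thesis
    proof (rule L2_const_bounded[OF \<mu>(2) borel_measurable_smooth[OF f \<mu>(1)]])
      show "AE x in \<mu>. norm (f x) \<le> C" using \<mu>(3) by eventually_elim (rule C)
    qed
  qed
  have mult: "L2 \<mu> (\<lambda>x. a x * f x)" if f: "L2 \<mu> f" for f :: "'a \<Rightarrow> real"
  proof (rule L2_bounded[OF f])
    show "AE x in \<mu>. norm (a x * f x) \<le> A * norm (f x)"
      using \<mu>(3) by eventually_elim (use A in \<open>auto simp: abs_mult intro!: mult_right_mono\<close>)
  qed (use f in \<open>auto simp: L2_def\<close>)
  obtain \<psi> where \<psi>: "\<And>k. smooth (\<psi> k)" "(\<lambda>k. H1_norm (ball 0 R) (\<lambda>x. \<psi> k x - u x)) \<longlonglongrightarrow> 0"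
    "(\<lambda>k. LINT x|\<mu>. (\<psi> k x - g x)\<^sup>2) \<longlonglongrightarrow> 0" and g: "L2 \<mu> g" and u: "H1 (ball 0 R) u"
    using tr unfolding has_trace_def by blast
  obtain G where G: "H1_grad (ball 0 R) u G" using u by (auto simp: H1_iff_H1_grad)
  have H1d: "H1 (ball 0 R) (\<lambda>x. \<psi> k x - u x)" for k
    using H1_grad_add[OF open_ball H1_grad_smooth[OF \<psi>(1)[of k]] H1_grad_mult[OF G smooth_const[of "-1"]]]
    by (auto simp: H1_iff_H1_grad)
  have L2d: "L2 \<mu> (\<lambda>x. \<psi> k x - g x)" for k
    using L2_add[OF bdd[OF \<psi>(1)[of k]] L2_cmult[OF g, of "-1"]] by simp
  obtain C where C: "\<And>w. H1 (ball 0 R) w \<Longrightarrow> H1_norm (ball 0 R) (\<lambda>x. a x * w x) \<le> C * H1_norm (ball 0 R) w"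
    using H1_norm_mult_le[OF a] by metis
  show ?thesis unfolding has_trace_def
  proof (intro conjI exI[of _ "\<lambda>k x. a x * \<psi> k x + \<phi> x"] allI)
    show "H1 (ball 0 R) (\<lambda>x. a x * u x + \<phi> x)"
      using H1_grad_add[OF open_ball H1_grad_mult[OF G a] H1_grad_smooth[OF \<phi>]] by (auto simp: H1_iff_H1_grad)
    show "L2 \<mu> (\<lambda>x. a x * g x + \<phi> x)" by (intro L2_add mult g bdd \<phi>)
    show "smooth (\<lambda>x. a x * \<psi> k x + \<phi> x)" for k by (intro smooth_add smooth_mult a \<phi> \<psi>)
    have "(\<lambda>k. H1_norm (ball 0 R) (\<lambda>x. a x * (\<psi> k x - u x))) \<longlonglongrightarrow> 0"
    proof (rule tendsto_sandwich[OF _ _ tendsto_const])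
      show "\<forall>\<^sub>F k in sequentially. 0 \<le> H1_norm (ball 0 R) (\<lambda>x. a x * (\<psi> k x - u x))"
        by (simp add: H1_norm_nonneg)
      show "\<forall>\<^sub>F k in sequentially. H1_norm (ball 0 R) (\<lambda>x. a x * (\<psi> k x - u x)) \<le> C * H1_norm (ball 0 R) (\<lambda>x. \<psi> k x - u x)"
        by (simp add: C H1d)
      show "(\<lambda>k. C * H1_norm (ball 0 R) (\<lambda>x. \<psi> k x - u x)) \<longlonglongrightarrow> 0"
        using tendsto_mult_left[OF \<psi>(2), of C] by simp
    qed
    then show "(\<lambda>k. H1_norm (ball 0 R) (\<lambda>x. a x * \<psi> k x + \<phi> x - (a x * u x + \<phi> x))) \<longlonglongrightarrow> 0"
      by (simp add: algebra_simps)
    have "(\<lambda>k. LINT x|\<mu>. (a x * (\<psi> k x - g x))\<^sup>2) \<longlonglongrightarrow> 0"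
    proof (rule tendsto_sandwich[OF _ _ tendsto_const])
      show "\<forall>\<^sub>F k in sequentially. 0 \<le> (LINT x|\<mu>. (a x * (\<psi> k x - g x))\<^sup>2)" by simp
      have "(LINT x|\<mu>. (a x * (\<psi> k x - g x))\<^sup>2) \<le> (LINT x|\<mu>. A\<^sup>2 * (\<psi> k x - g x)\<^sup>2)" for k
      proof (rule integral_mono_AE)
        show "integrable \<mu> (\<lambda>x. (a x * (\<psi> k x - g x))\<^sup>2)" "integrable \<mu> (\<lambda>x. A\<^sup>2 * (\<psi> k x - g x)\<^sup>2)"
          using mult[OF L2d[of k]] L2d[of k] by (auto simp: L2_def)
        show "AE x in \<mu>. (a x * (\<psi> k x - g x))\<^sup>2 \<le> A\<^sup>2 * (\<psi> k x - g x)\<^sup>2"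
          using \<mu>(3)
        proof eventually_elim
          case (elim x)
          have "(a x)\<^sup>2 \<le> A\<^sup>2" using A[OF elim] by (auto simp: abs_le_square_iff[symmetric])
          then show ?case by (simp add: power_mult_distrib mult_right_mono)
        qed
      qed
      then show "\<forall>\<^sub>F k in sequentially. (LINT x|\<mu>. (a x * (\<psi> k x - g x))\<^sup>2) \<le> A\<^sup>2 * (LINT x|\<mu>. (\<psi> k x - g x)\<^sup>2)"
        by simp
      show "(\<lambda>k. A\<^sup>2 * (LINT x|\<mu>. (\<psi> k x - g x)\<^sup>2)) \<longlonglongrightarrow> 0"
        using tendsto_mult_left[OF \<psi>(3), of "A\<^sup>2"] by simp
    qed
    then show "(\<lambda>k. LINT x|\<mu>. (a x * \<psi> k x + \<phi> x - (a x * g x + \<phi> x))\<^sup>2) \<longlonglongrightarrow> 0"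
      by (simp add: algebra_simps)
  qed
qed

text \<open>Needed on the sphere: the perturbed trace is \<open>a x * g x + \<phi> x\<close>, which
  equals the prescribed \<open>g\<close> only almost everywhere for the surface measure.\<close>

lemma has_trace_cong_AE:
  fixes u :: "'a::euclidean_space \<Rightarrow> real"
  assumes tr: "has_trace \<Omega> \<mu> u g" and \<mu>: "sets \<mu> = sets borel" and eq: "AE x in \<mu>. g x = g' x"
    and g': "g' \<in> borel_measurable \<mu>"
  shows "has_trace \<Omega> \<mu> u g'"
proof -
  have g: "L2 \<mu> g" using tr by (simp add: has_trace_def)
  then have [measurable]: "g \<in> borel_measurable \<mu>" "g' \<in> borel_measurable \<mu>" using g' by (auto simp: L2_def)
  have "L2 \<mu> g'"
    by (rule L2_bounded[OF g g', of 1]) (use eq in \<open>auto elim!: eventually_mono\<close>)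
  moreover have *: "(LINT x|\<mu>. (\<phi> x - g x)\<^sup>2) = (LINT x|\<mu>. (\<phi> x - g' x)\<^sup>2)" if "smooth \<phi>" for \<phi>
  proof -
    note [measurable] = borel_measurable_smooth[OF that \<mu>]
    show ?thesis by (rule integral_cong_AE) (use eq in auto)
  qed
  moreover obtain \<psi> where \<psi>: "\<And>k. smooth (\<psi> k)" "(\<lambda>k. H1_norm \<Omega> (\<lambda>x. \<psi> k x - u x)) \<longlonglongrightarrow> 0"
    "(\<lambda>k. LINT x|\<mu>. (\<psi> k x - g x)\<^sup>2) \<longlonglongrightarrow> 0" and u: "H1 \<Omega> u"
    using tr unfolding has_trace_def by blast
  ultimately show ?thesis
    unfolding has_trace_def by (intro conjI exI[of _ \<psi>]) (auto simp: *[symmetric])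
qed

section \<open>Surface measures and competitors\<close>

lemma sets_thin_measure: "sets (thin_measure R) = sets borel"
  and sets_sphere_measure: "sets (sphere_measure R) = sets borel"
  by (simp_all add: thin_measure_def sphere_measure_def)

lemma measurable_thin_map: "(\<lambda>x'. (x', 0)) \<in> restrict_space lborel (ball 0 R) \<rightarrow>\<^sub>M (borel :: ((real ^ 'n) \<times> real) measure)"
  by (intro measurable_restrict_space1) (auto intro!: borel_measurable_continuous_onI continuous_intros)

lemma AE_thin_measure: "AE x in (thin_measure R :: ((real ^ 'n) \<times> real) measure). snd x = 0 \<and> norm x \<le> R"
  unfolding thin_measure_def
proof (subst AE_distr_iff[OF measurable_thin_map])
  have "{x \<in> space borel. snd x = 0 \<and> norm x \<le> R} = (UNIV \<times> {0}) \<inter> (cball 0 R :: ((real ^ 'n) \<times> real) set)"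
    by (auto simp: mem_cball_0)
  moreover have "closed ((UNIV \<times> {0}) \<inter> (cball 0 R :: ((real ^ 'n) \<times> real) set))"
    by (intro closed_Int closed_Times) auto
  ultimately show "{x :: (real ^ 'n) \<times> real \<in> space borel. snd x = 0 \<and> norm x \<le> R} \<in> sets borel" by simp
  show "AE x in restrict_space lborel (ball (0 :: real ^ 'n) R). snd (x, 0::real) = 0 \<and> norm (x, 0::real) \<le> R"
    by (subst AE_restrict_space_iff) (auto simp: norm_Pair)
qed

lemma finite_thin_measure: "finite_measure (thin_measure R :: ((real ^ 'n) \<times> real) measure)"
proof (rule finite_measureI)
  show "emeasure (thin_measure R) (space (thin_measure R :: ((real ^ 'n) \<times> real) measure)) \<noteq> \<infinity>"
    unfolding thin_measure_def
    using emeasure_lborel_ball_finite[of "0::real ^ 'n" R]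
    by (subst emeasure_distr[OF measurable_thin_map]) (auto simp: space_restrict_space emeasure_restrict_space)
qed

lemma measurable_sphere_map:
  "(\<lambda>x. (R / norm x) *\<^sub>R x) \<in> restrict_space lborel (ball 0 R - {0}) \<rightarrow>\<^sub>M (borel :: 'a::euclidean_space measure)"
  by (intro measurable_restrict_space1) simp

lemma AE_scale_measure: "AE x in M. P x \<Longrightarrow> AE x in scale_measure r M. P x"
  unfolding eventually_ae_filter by (auto simp: null_sets_def space_scale_measure)

lemma AE_sphere_measure:
  assumes "R > 0"
  shows "AE x in (sphere_measure R :: 'a::euclidean_space measure). norm x = R"
  unfolding sphere_measure_def
proof (rule AE_scale_measure, subst AE_distr_iff[OF measurable_sphere_map])
  have "{x \<in> space borel. norm x = R} = (sphere 0 R :: 'a set)" by auto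
  then show "{x :: 'a \<in> space borel. norm x = R} \<in> sets borel" by simp
  show "AE x in restrict_space lborel (ball (0 :: 'a) R - {0}). norm ((R / norm x) *\<^sub>R x) = R"
    using assms by (subst AE_restrict_space_iff) auto
qed

lemma finite_sphere_measure: "finite_measure (sphere_measure R :: 'a::euclidean_space measure)"
proof (rule finite_measureI)
  have "emeasure lborel (ball (0::'a) R - {0}) \<le> emeasure lborel (ball (0::'a) R)"
    by (intro emeasure_mono) auto
  also have "\<dots> < \<infinity>" by (rule emeasure_lborel_ball_finite)
  finally have "emeasure lborel (ball (0::'a) R - {0}) < \<infinity>" .
  then show "emeasure (sphere_measure R) (space (sphere_measure R :: 'a measure)) \<noteq> \<infinity>"
    unfolding sphere_measure_def space_scale_measure emeasure_scale_measure
    by (subst emeasure_distr[OF measurable_sphere_map])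
      (auto simp: space_restrict_space emeasure_restrict_space ennreal_mult_eq_top_iff)
qed

text \<open>Multiplying by a nonnegative factor preserves the sign of the thin trace without any
  knowledge of where it vanishes, so \<open>u\<close> can be varied in its own direction; additive
  changes must be nonnegative on the thin space.\<close>

lemma admissible_perturb:
  fixes u :: "(real ^ 'n) \<times> real \<Rightarrow> real"
  assumes "R > 0" and u: "u \<in> admissible R g"
    and a: "smooth a" "\<And>x. norm x = R \<Longrightarrow> a x = 1" "\<And>x. a x \<ge> 0" "\<And>x. a (fst x, - snd x) = a x"
    and \<phi>: "smooth \<phi>" "\<And>x. norm x = R \<Longrightarrow> \<phi> x = 0" "\<And>x'. \<phi> (x', 0) \<ge> 0" "\<And>x. \<phi> (fst x, - snd x) = \<phi> x"
  shows "(\<lambda>x. a x * u x + \<phi> x) \<in> admissible R g"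
proof -
  obtain T where T: "has_trace (ball 0 R) (thin_measure R) u T" "AE x in thin_measure R. T x \<ge> 0"
    and tr: "has_trace (ball 0 R) (sphere_measure R) u g"
    and even: "AE x in lebesgue_on (ball 0 R). u (fst x, snd x) = u (fst x, - snd x)"
    using u by (auto simp: admissible_def)
  have t1: "has_trace (ball 0 R) (thin_measure R) (\<lambda>x. a x * u x + \<phi> x) (\<lambda>x. a x * T x + \<phi> x)"
    by (rule has_trace_perturb[OF T(1) sets_thin_measure finite_thin_measure _ a(1) \<phi>(1)])
      (use AE_thin_measure in \<open>auto elim!: eventually_mono\<close>)
  have t2: "AE x in thin_measure R. a x * T x + \<phi> x \<ge> 0"
    using T(2) AE_thin_measure
  proof eventually_elim
    case (elim x)
    then have "\<phi> x \<ge> 0" using \<phi>(3)[of "fst x"] by (cases x) auto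
    then show ?case using elim a(3)[of x] by simp
  qed
  have "has_trace (ball 0 R) (sphere_measure R) (\<lambda>x. a x * u x + \<phi> x) (\<lambda>x. a x * g x + \<phi> x)"
    by (rule has_trace_perturb[OF tr sets_sphere_measure finite_sphere_measure _ a(1) \<phi>(1)])
      (use AE_sphere_measure[OF \<open>R > 0\<close>] in \<open>auto elim!: eventually_mono\<close>)
  then have t3: "has_trace (ball 0 R) (sphere_measure R) (\<lambda>x. a x * u x + \<phi> x) g"
    by (rule has_trace_cong_AE[OF _ sets_sphere_measure])
      (use AE_sphere_measure[OF \<open>R > 0\<close>] tr a(2) \<phi>(2) in
        \<open>auto elim!: eventually_mono simp: has_trace_def L2_def\<close>)
  have "AE x in lebesgue_on (ball 0 R). a (fst x, snd x) * u (fst x, snd x) + \<phi> (fst x, snd x)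
      = a (fst x, - snd x) * u (fst x, - snd x) + \<phi> (fst x, - snd x)"
    using even by eventually_elim (use a(4) \<phi>(4) in auto)
  with t1 t2 t3 show ?thesis by (auto simp: admissible_def has_trace_def)
qed

text \<open>The competitor \<open>(1 + \<epsilon> * \<eta> x) * u x + \<epsilon> * \<phi> x\<close>
  has gradient \<open>G x + \<epsilon> *\<^sub>R W x\<close>. Comparing energies, dividing by
  \<open>\<epsilon> > 0\<close> and letting it become small leaves the linear term. Only an
  inequality results, since \<open>\<phi>\<close> cannot be replaced by its negative.\<close>

lemma first_variation:
  fixes u :: "(real ^ 'n) \<times> real \<Rightarrow> real"
  assumes "R > 0" and sol: "thin_obstacle_solution R u" and G: "H1_grad (ball 0 R) u G"
    and \<eta>: "test_function (ball 0 R) \<eta>" "\<And>x. \<eta> (fst x, - snd x) = \<eta> x"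
    and \<phi>: "test_function (ball 0 R) \<phi>" "\<And>x. \<phi> (fst x, - snd x) = \<phi> x" "\<And>x'. \<phi> (x', 0) \<ge> 0"
  shows "0 \<le> (LINT x|lebesgue_on (ball 0 R). G x \<bullet> (\<eta> x *\<^sub>R G x + u x *\<^sub>R grad \<eta> x + grad \<phi> x))"
proof -
  let ?B = "lebesgue_on (ball (0 :: (real ^ 'n) \<times> real) R)"
  obtain g where g: "u \<in> admissible R g"
    and min: "\<And>v. v \<in> admissible R g \<Longrightarrow> dirichlet_energy (ball 0 R) u \<le> dirichlet_energy (ball 0 R) v"
    using sol unfolding thin_obstacle_solution_def by blast
  note sm = test_function_smooth[OF \<eta>(1)] test_function_smooth[OF \<phi>(1)]
  define W where "W x = \<eta> x *\<^sub>R G x + u x *\<^sub>R grad \<eta> x + grad \<phi> x" for x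
  have WH: "H1_grad (ball 0 R) (\<lambda>x. \<eta> x * u x + \<phi> x) W"
    unfolding W_def by (intro H1_grad_add H1_grad_mult H1_grad_smooth G sm open_ball)
  obtain C where C: "C \<ge> 0" "\<And>x. \<bar>\<eta> x\<bar> \<le> C" using test_function_bounded[OF \<eta>(1)] by metis
  define I1 I2 where "I1 = (LINT x|?B. G x \<bullet> W x)" and "I2 = (LINT x|?B. (norm (W x))\<^sup>2)"
  have L2: "L2 ?B G" "L2 ?B W" using G WH by (auto simp: H1_grad_def)
  have key: "0 \<le> 2 * I1 + \<epsilon> * I2" if \<epsilon>: "\<epsilon> > 0" "\<epsilon> * C \<le> 1" for \<epsilon>
  proof -
    have zero: "f x = 0" if f: "test_function (ball 0 R) f" and x: "norm x = R" for f :: "(real ^ 'n) \<times> real \<Rightarrow> real" and x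
    proof -
      obtain K where "K \<subseteq> ball 0 R" "\<And>x. x \<notin> K \<Longrightarrow> f x = 0" using test_function_supportE[OF f] by metis
      moreover have "x \<notin> ball 0 R" using x by simp
      ultimately show ?thesis by blast
    qed
    note zero = zero[OF \<eta>(1)] zero[OF \<phi>(1)]
    have "(\<lambda>x. (1 + \<epsilon> * \<eta> x) * u x + \<epsilon> * \<phi> x) \<in> admissible R g"
    proof (rule admissible_perturb[OF \<open>R > 0\<close> g])
      show "1 + \<epsilon> * \<eta> x \<ge> 0" for x
      proof -
        have "\<epsilon> * \<bar>\<eta> x\<bar> \<le> \<epsilon> * C" using C(2)[of x] \<epsilon> by (intro mult_left_mono) auto
        moreover have "- (\<epsilon> * \<bar>\<eta> x\<bar>) \<le> \<epsilon> * \<eta> x" using \<epsilon> mult_left_mono[of "- \<bar>\<eta> x\<bar>" "\<eta> x" \<epsilon>] by simp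
        ultimately show ?thesis using \<epsilon> by linarith
      qed
    qed (use sm zero \<epsilon> \<eta>(2) \<phi>(2,3) in \<open>auto intro: smooth_add smooth_cmult smooth_const\<close>)
    then have "dirichlet_energy (ball 0 R) u \<le> dirichlet_energy (ball 0 R) (\<lambda>x. (1 + \<epsilon> * \<eta> x) * u x + \<epsilon> * \<phi> x)"
      by (rule min)
    moreover have "H1_grad (ball 0 R) (\<lambda>x. (1 + \<epsilon> * \<eta> x) * u x + \<epsilon> * \<phi> x) (\<lambda>x. G x + \<epsilon> *\<^sub>R W x)"
    proof -
      have "H1_grad (ball 0 R) (\<lambda>x. u x + \<epsilon> * (\<eta> x * u x + \<phi> x)) (\<lambda>x. G x + (\<epsilon> *\<^sub>R W x + (\<eta> x * u x + \<phi> x) *\<^sub>R grad (\<lambda>_. \<epsilon>) x))"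
        by (intro H1_grad_add H1_grad_mult G WH smooth_const open_ball)
      then show ?thesis by (simp add: algebra_simps)
    qed
    ultimately have "(LINT x|?B. (norm (G x))\<^sup>2) \<le> (LINT x|?B. (norm (G x + \<epsilon> *\<^sub>R W x))\<^sup>2)"
      using G by (simp add: dirichlet_energy_eq[OF open_ball])
    also have "\<dots> = (LINT x|?B. (norm (G x))\<^sup>2 + \<epsilon> * (2 * (G x \<bullet> W x)) + \<epsilon>\<^sup>2 * (norm (W x))\<^sup>2)"
      by (intro Bochner_Integration.integral_cong refl)
        (simp only: power2_norm_eq_inner, simp add: inner_add_left inner_add_right inner_commute power2_eq_square algebra_simps)
    also have "\<dots> = (LINT x|?B. (norm (G x))\<^sup>2) + \<epsilon> * (2 * I1) + \<epsilon>\<^sup>2 * I2"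
      using L2 integrable_inner_L2[OF L2] by (simp add: I1_def I2_def L2_def)
    finally have "0 \<le> \<epsilon> * (2 * I1 + \<epsilon> * I2)" by (simp add: power2_eq_square algebra_simps)
    then show ?thesis using \<epsilon> by (simp add: zero_le_mult_iff)
  qed
  have "I1 \<ge> 0"
  proof (rule ccontr)
    assume "\<not> I1 \<ge> 0"
    then have n: "I1 < 0" by simp
    have I2: "I2 \<ge> 0" by (simp add: I2_def)
    \<comment> \<open>The first bound keeps the factor \<open>1 + \<epsilon> * \<eta> x\<close>
      nonnegative; the second makes the quadratic term at most \<open>- I1\<close>, which cannot
      outweigh \<open>2 * I1 < 0\<close>.\<close>
    define \<epsilon> where "\<epsilon> = min (1 / (C + 1)) (- I1 / (I2 + 1))"
    have \<epsilon>0: "\<epsilon> > 0" unfolding \<epsilon>_def using C n I2 by (auto simp: divide_neg_pos)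
    have "\<epsilon> * C \<le> 1 / (C + 1) * C" unfolding \<epsilon>_def using C by (intro mult_right_mono) auto
    also have "\<dots> \<le> 1" using C by (simp add: field_simps)
    finally have "0 \<le> 2 * I1 + \<epsilon> * I2" using key \<epsilon>0 by blast
    also have "\<epsilon> * I2 \<le> - I1 / (I2 + 1) * I2" unfolding \<epsilon>_def using I2 by (intro mult_right_mono) auto
    also have "\<dots> \<le> - I1" using n I2 by (simp add: field_simps)
    finally show False using n by simp
  qed
  then show ?thesis by (simp add: I1_def W_def)
qed

section \<open>Global weak gradients\<close>

text \<open>The whole-space counterpart of \<open>H1_grad\<close>, with Borel representatives on
  \<open>lborel\<close>: changes of variables and the Gaussian density are handled there, not on the
  completion.\<close>

definition loc_H1_grad :: "('a::euclidean_space \<Rightarrow> real) \<Rightarrow> ('a \<Rightarrow> 'a) \<Rightarrow> bool" where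
  "loc_H1_grad u G \<longleftrightarrow> u \<in> borel_measurable borel \<and> G \<in> borel_measurable borel \<and>
    (\<forall>R. set_integrable lborel (ball 0 R) (\<lambda>x. (u x)\<^sup>2) \<and> set_integrable lborel (ball 0 R) (\<lambda>x. (norm (G x))\<^sup>2)) \<and>
    (\<forall>\<phi>. test_function UNIV \<phi> \<longrightarrow> (\<forall>b\<in>Basis.
       (LINT x|lborel. u x * (grad \<phi> x \<bullet> b)) = - (LINT x|lborel. (G x \<bullet> b) * \<phi> x)))"

lemma completion_ex_borel_measurable_euclidean:
  fixes f :: "'a \<Rightarrow> 'b::euclidean_space"
  assumes "f \<in> borel_measurable (completion M)"
  shows "\<exists>g\<in>borel_measurable M. AE x in M. f x = g x"
proof -
  have "\<exists>g. g \<in> borel_measurable M \<and> (AE x in M. f x \<bullet> b = g x)" for b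
    using completion_ex_borel_measurable_real[of "\<lambda>x. f x \<bullet> b" M] assms by (auto intro: borel_measurable_inner)
  then obtain g where g: "\<And>b. g b \<in> borel_measurable M" "\<And>b. AE x in M. f x \<bullet> b = g b x" by metis
  have "AE x in M. \<forall>b\<in>Basis. f x \<bullet> b = g b x" using g(2) by (subst AE_finite_all) auto
  then have "AE x in M. f x = (\<Sum>b\<in>Basis. g b x *\<^sub>R b)"
    by eventually_elim (simp add: euclidean_eq_iff[where 'a = 'b])
  then show ?thesis using g(1) by (intro bexI[of _ "\<lambda>x. \<Sum>b\<in>Basis. g b x *\<^sub>R b"]) auto
qed

lemma AE_lborel_iff_lebesgue: "(AE x in lebesgue. P x) \<longleftrightarrow> (AE x in lborel. P x)"
  by (rule AE_completion_iff)

lemma set_integrable_lborel_lebesgue_on: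
  fixes f f' :: "'a::euclidean_space \<Rightarrow> real"
  assumes "integrable (lebesgue_on \<Omega>) f" "\<Omega> \<in> sets borel" "AE x in lborel. x \<in> \<Omega> \<longrightarrow> f x = f' x"
    "f' \<in> borel_measurable borel"
  shows "set_integrable lborel \<Omega> f'"
proof -
  have "integrable lebesgue (\<lambda>x. indicator \<Omega> x *\<^sub>R f x)"
    using assms by (simp add: integrable_restrict_space)
  moreover have "AE x in lebesgue. indicator \<Omega> x *\<^sub>R f x = indicator \<Omega> x *\<^sub>R f' x"
    using assms(3) unfolding AE_lborel_iff_lebesgue by eventually_elim (auto simp: indicator_def)
  moreover have m: "(\<lambda>x. indicator \<Omega> x *\<^sub>R f' x) \<in> borel_measurable lborel" using assms by simp
  ultimately have "integrable lebesgue (\<lambda>x. indicator \<Omega> x *\<^sub>R f' x)"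
    by (subst integrable_cong_AE[of _ _ "\<lambda>x. indicator \<Omega> x *\<^sub>R f x"])
      (auto intro: measurable_completion elim!: eventually_mono)
  then show ?thesis using integrable_completion[OF m] by (simp only: set_integrable_def)
qed

lemma integral_lebesgue_eq_lborel:
  fixes f f' :: "'a::euclidean_space \<Rightarrow> real"
  assumes "f \<in> borel_measurable lebesgue" "f' \<in> borel_measurable borel" "AE x in lborel. f x = f' x"
  shows "(LINT x|lebesgue. f x) = (LINT x|lborel. f' x)"
proof -
  have "(LINT x|lebesgue. f x) = (LINT x|lebesgue. f' x)"
  proof (rule integral_cong_AE)
    show "f' \<in> borel_measurable lebesgue" using assms(2) by (intro measurable_completion) simp
    show "AE x in lebesgue. f x = f' x" using assms(3) by (rule AE_completion)
  qed (rule assms(1))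
  also have "\<dots> = (LINT x|lborel. f' x)" using assms by (intro integral_completion) auto
  finally show ?thesis .
qed

text \<open>Gradients on different balls agree on overlaps by uniqueness, so Borel versions for
  integer radii glue to one field. The last conclusion keeps the link to each ball, where the
  variational inequality is available.\<close>

lemma H1_loc_obtain_gradient:
  fixes z :: "'a::euclidean_space \<Rightarrow> real"
  assumes "H1_loc z"
  obtains u G where "loc_H1_grad u G" "AE x in lebesgue. z x = u x"
    "\<And>R. \<exists>H. H1_grad (ball 0 R) z H \<and> (AE x in lborel. x \<in> ball 0 R \<longrightarrow> H x = G x)"
proof -
  have "\<exists>H. H1_grad (ball 0 R) z H" for R
    using assms unfolding H1_loc_def H1_iff_H1_grad by (metis bounded_ball open_ball)
  then obtain H where H: "\<And>R. H1_grad (ball 0 R) z (H R)" by metis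
  have mz: "(\<lambda>x. indicator (ball 0 R) x *\<^sub>R z x) \<in> borel_measurable lebesgue"
    and mH: "(\<lambda>x. indicator (ball 0 R) x *\<^sub>R H R x) \<in> borel_measurable lebesgue" for R
    using H[of R] by (auto simp: H1_grad_def L2_def borel_measurable_restrict_space_iff)
  have "z \<in> borel_measurable lebesgue"
  proof (rule borel_measurable_LIMSEQ_metric[OF mz])
    fix x :: 'a
    obtain k :: nat where k: "norm x < real k" using reals_Archimedean2 by blast
    have "\<forall>\<^sub>F n in sequentially. indicator (ball 0 (real n)) x *\<^sub>R z x = z x"
      using eventually_ge_at_top[of k] by eventually_elim (use k in \<open>auto simp: indicator_def\<close>)
    then show "(\<lambda>n. indicator (ball 0 (real n)) x *\<^sub>R z x) \<longlonglongrightarrow> z x" by (rule tendsto_eventually)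
  qed
  then obtain u where u[measurable]: "u \<in> borel_measurable borel" and zu: "AE x in lborel. z x = u x"
    using completion_ex_borel_measurable_real[of z lborel] by auto
  have "\<forall>R. \<exists>g. g \<in> borel_measurable borel \<and> (AE x in lborel. indicator (ball 0 R) x *\<^sub>R H R x = g x)"
    using completion_ex_borel_measurable_euclidean[OF mH] by (simp only: Bex_def measurable_lborel2 simp_thms)
  from choice[OF this] obtain K where K[measurable]: "\<And>R. K R \<in> borel_measurable borel"
    and HK: "\<And>R. AE x in lborel. indicator (ball 0 R) x *\<^sub>R H R x = K R x" by blast
  \<comment> \<open>An integer radius whose open ball contains \<open>x\<close>. It takes countably
    many values on measurable sets, so the glued field is Borel.\<close>
  define k where "k x = nat \<lfloor>norm x\<rfloor> + 1" for x :: 'a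
  have k: "norm x < real (k x)" for x unfolding k_def by linarith
  define G where "G x = K (real (k x)) x" for x
  have Gm[measurable]: "G \<in> borel_measurable borel"
    unfolding G_def k_def by (rule measurable_compose_countable) auto
  have HG: "AE x in lborel. x \<in> ball 0 R \<longrightarrow> H R x = G x" for R
  proof -
    \<comment> \<open>On the smaller of the two balls both fields are weak gradients of
      \<open>z\<close>.\<close>
    have "AE x in lborel. x \<in> ball 0 (min R (real n)) \<longrightarrow> H R x = H (real n) x" for n :: nat
    proof -
      let ?U = "ball (0::'a) (min R (real n))"
      have r: "has_weak_gradient ?U z (H S)" if "?U \<subseteq> ball 0 S" for S
        using H[of S] that test_function_mono[of ?U _ "ball 0 S"]
        by (auto simp: H1_grad_def has_weak_gradient_iff locally_integrable_def)
      show ?thesis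
        using has_weak_gradient_unique[OF open_ball r[of R] r[of "real n"]]
        by (simp add: AE_lborel_iff_lebesgue subset_ball)
    qed
    then have "AE x in lborel. \<forall>n::nat. x \<in> ball 0 (min R (real n)) \<longrightarrow> H R x = H (real n) x"
      by (subst AE_all_countable) auto
    moreover have "AE x in lborel. \<forall>n::nat. indicator (ball 0 (real n)) x *\<^sub>R H (real n) x = K (real n) x"
      using HK by (subst AE_all_countable) auto
    ultimately show ?thesis
    proof eventually_elim
      case (elim x)
      show ?case using elim(1)[rule_format, of "k x"] elim(2)[rule_format, of "k x"] k[of x]
        by (auto simp: G_def)
    qed
  qed
  show ?thesis
  proof (rule that[of u G])
    show "AE x in lebesgue. z x = u x" using zu by (simp add: AE_lborel_iff_lebesgue)
    show "\<exists>H. H1_grad (ball 0 R) z H \<and> (AE x in lborel. x \<in> ball 0 R \<longrightarrow> H x = G x)" for R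
      using H HG by blast
    show "loc_H1_grad u G" unfolding loc_H1_grad_def
    proof (intro conjI allI impI ballI)
      fix R
      show "set_integrable lborel (ball 0 R) (\<lambda>x. (u x)\<^sup>2)"
        by (rule set_integrable_lborel_lebesgue_on[of _ "\<lambda>x. (z x)\<^sup>2"])
          (use H[of R] zu in \<open>auto simp: H1_grad_def L2_def\<close>)
      show "set_integrable lborel (ball 0 R) (\<lambda>x. (norm (G x))\<^sup>2)"
        by (rule set_integrable_lborel_lebesgue_on[of _ "\<lambda>x. (norm (H R x))\<^sup>2"])
          (use H[of R] HG[of R] in \<open>auto simp: H1_grad_def L2_def\<close>)
    next
      fix \<phi> :: "'a \<Rightarrow> real" and b :: 'a assume \<phi>: "test_function UNIV \<phi>" and b: "b \<in> Basis"
      obtain S where S: "compact S" "\<And>x. x \<notin> S \<Longrightarrow> \<phi> x = 0" using test_function_supportE[OF \<phi>] by metis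
      obtain R where R: "S \<subseteq> ball 0 R" using bounded_subset_ballD[OF compact_imp_bounded[OF S(1)], of 0] by blast
      have \<phi>R: "test_function (ball 0 R) \<phi>" by (rule test_functionI[OF test_function_smooth[OF \<phi>] S(1) R S(2)])
      note [measurable] = borel_measurable_smooth[OF test_function_smooth[OF \<phi>] refl]
        borel_measurable_smooth[OF smooth_grad_inner[OF test_function_smooth[OF \<phi>]] refl]
      note D = has_weak_gradientD[OF _ open_ball \<phi>R b, of z "H R"]
      have hw: "has_weak_gradient (ball 0 R) z (H R)" using H[of R] by (simp add: H1_grad_def)
      have "(LINT x|lebesgue. z x * (grad \<phi> x \<bullet> b)) = (LINT x|lborel. u x * (grad \<phi> x \<bullet> b))"
        by (rule integral_lebesgue_eq_lborel) (use D(2)[OF hw] zu in auto)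
      moreover have "(LINT x|lebesgue. (H R x \<bullet> b) * \<phi> x) = (LINT x|lborel. (G x \<bullet> b) * \<phi> x)"
      proof (rule integral_lebesgue_eq_lborel)
        show "AE x in lborel. (H R x \<bullet> b) * \<phi> x = (G x \<bullet> b) * \<phi> x"
          using HG[of R]
        proof eventually_elim
          case (elim x)
          then show ?case using S(2)[of x] R by (cases "x \<in> S") auto
        qed
      qed (use D(4)[OF hw] in auto)
      ultimately show "(LINT x|lborel. u x * (grad \<phi> x \<bullet> b)) = - (LINT x|lborel. (G x \<bullet> b) * \<phi> x)"
        using D(1)[OF hw] by simp
    qed (use u Gm in auto)
  qed
qed

section \<open>The Gaussian weight\<close>

lemma power_le_fact_exp:
  fixes t :: real
  assumes "t \<ge> 0"
  shows "t ^ m \<le> fact m * exp t"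
proof -
  have s: "(\<lambda>n. t ^ n /\<^sub>R fact n) sums exp t" by (rule exp_converges)
  have "t ^ m /\<^sub>R fact m \<le> exp t"
    using sum_le_suminf[OF sums_summable[OF s], of "{m}"] assms sums_unique[OF s]
    by (auto simp: divide_inverse)
  then show ?thesis by (simp add: field_simps)
qed

text \<open>k^2 dominates k, and half of the resulting exponent absorbs the power; the other half
  leaves a geometric series of ratio exp(-a/2).\<close>

lemma summable_gaussian_power:
  assumes "a > 0"
  shows "summable (\<lambda>k. exp (- a * (real k)\<^sup>2) * (real k + 1) ^ m)"
proof (rule summable_comparison_test'[of _ 0])
  define q where "q = exp (- a / 2)"
  have "0 \<le> q" "q < 1" using assms by (auto simp: q_def)
  then show "summable (\<lambda>k. fact m * exp (a / 2) / (a / 2) ^ m * q ^ k)"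
    by (intro summable_mult summable_geometric) auto
  fix k :: nat
  define c where "c = a / 2"
  have c: "c > 0" using assms by (simp add: c_def)
  have "(c * (real k + 1)) ^ m \<le> fact m * exp (c * (real k + 1))"
    using c by (intro power_le_fact_exp) auto
  also have "exp (c * (real k + 1)) = exp c * exp (c * real k)"
    by (simp add: mult_exp_exp distrib_left add.commute)
  finally have "(real k + 1) ^ m * c ^ m \<le> fact m * (exp c * exp (c * real k))"
    by (simp only: power_mult_distrib mult.commute)
  then have "(real k + 1) ^ m \<le> fact m * (exp c * exp (c * real k)) / c ^ m"
    using c by (subst pos_le_divide_eq) auto
  then have 1: "(real k + 1) ^ m \<le> fact m * exp (a / 2) / (a / 2) ^ m * exp (a / 2 * real k)"
    by (simp add: c_def)
  have "real k \<le> (real k)\<^sup>2" by (cases k) (auto simp: power2_eq_square)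
  then have 2: "exp (- a * (real k)\<^sup>2) \<le> exp (- a * real k)" using assms by simp
  have "exp (- a * (real k)\<^sup>2) * (real k + 1) ^ m \<le>
      exp (- a * real k) * (fact m * exp (a / 2) / (a / 2) ^ m * exp (a / 2 * real k))"
    by (intro mult_mono 1 2) auto
  also have "\<dots> = fact m * exp (a / 2) / (a / 2) ^ m * (exp (- a * real k) * exp (a / 2 * real k))"
    by simp
  also have "exp (- a * real k) * exp (a / 2 * real k) = q ^ k"
    unfolding q_def exp_of_nat_mult[symmetric] exp_add[symmetric] by (simp add: field_simps)
  finally show "norm (exp (- a * (real k)\<^sup>2) * (real k + 1) ^ m) \<le> fact m * exp (a / 2) / (a / 2) ^ m * q ^ k"
    by simp
qed

text \<open>On the shell between radii k and k + 1 the weight is at most exp(-a k^2), while the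
  integral of \<open>u\<close> over the ball of radius k + 1 is polynomial in k. A homogeneous
  function has such growth by scaling alone.\<close>

lemma integrable_gaussian_of_ball_growth:
  fixes u :: "'a::euclidean_space \<Rightarrow> real"
  assumes a: "a > 0" and u[measurable]: "u \<in> borel_measurable borel" and nn: "\<And>x. u x \<ge> 0"
    and int: "\<And>n::nat. set_integrable lborel (ball 0 (real n)) u"
    and le: "\<And>n::nat. n \<ge> 1 \<Longrightarrow> (LINT x:ball 0 (real n)|lborel. u x) \<le> A * real n ^ m"
  shows "integrable lborel (\<lambda>x. exp (- a * (norm x)\<^sup>2) * u x)"
proof (rule integrableI_bounded)
  have [measurable]: "ball (0::'a) r \<in> sets borel" for r by simp
  define c where "c k = exp (- a * (real k)\<^sup>2)" for k :: nat
  have "(\<integral>\<^sup>+ x. ennreal (norm (exp (- a * (norm x)\<^sup>2) * u x)) \<partial>lborel)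
      \<le> (\<integral>\<^sup>+ x. (\<Sum>k. ennreal (c k) * ennreal (indicator (ball 0 (real (k + 1))) x *\<^sub>R u x)) \<partial>lborel)"
  proof (rule nn_integral_mono)
    fix x :: 'a
    define k where "k = nat \<lfloor>norm x\<rfloor>"
    have k: "real k \<le> norm x" "norm x < real (k + 1)" unfolding k_def by (auto; linarith)+
    have "exp (- a * (norm x)\<^sup>2) \<le> c k" unfolding c_def using a k by (simp add: power_mono)
    then have "ennreal (norm (exp (- a * (norm x)\<^sup>2) * u x)) \<le> ennreal (c k) * ennreal (indicator (ball 0 (real (k + 1))) x *\<^sub>R u x)"
      using k nn[of x] by (auto simp: ennreal_mult[symmetric] c_def indicator_def intro!: ennreal_leI mult_right_mono)
    also have "\<dots> \<le> (\<Sum>k. ennreal (c k) * ennreal (indicator (ball 0 (real (k + 1))) x *\<^sub>R u x))"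
      using sum_le_suminf[OF summableI, of "{k}" "\<lambda>k. ennreal (c k) * ennreal (indicator (ball 0 (real (k + 1))) x *\<^sub>R u x)"]
      by simp
    finally show "ennreal (norm (exp (- a * (norm x)\<^sup>2) * u x))
        \<le> (\<Sum>k. ennreal (c k) * ennreal (indicator (ball 0 (real (k + 1))) x *\<^sub>R u x))" .
  qed
  also have "\<dots> = (\<Sum>k. ennreal (c k) * (\<integral>\<^sup>+ x. ennreal (indicator (ball 0 (real (k + 1))) x *\<^sub>R u x) \<partial>lborel))"
    by (subst nn_integral_suminf) (auto simp: nn_integral_cmult)
  also have "\<dots> \<le> (\<Sum>k. ennreal (c k * (\<bar>A\<bar> * real (k + 1) ^ m)))"
  proof (intro suminf_le summableI)
    fix k
    have "(\<integral>\<^sup>+ x. ennreal (indicator (ball 0 (real (k + 1))) x *\<^sub>R u x) \<partial>lborel)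
        = ennreal (LINT x:ball 0 (real (k + 1))|lborel. u x)"
      unfolding set_lebesgue_integral_def
      using int[of "k + 1"] nn by (subst nn_integral_eq_integral) (auto simp: set_integrable_def indicator_def)
    also have "\<dots> \<le> ennreal (\<bar>A\<bar> * real (k + 1) ^ m)"
    proof (rule ennreal_leI)
      have "A * real (k + 1) ^ m \<le> \<bar>A\<bar> * real (k + 1) ^ m" by (intro mult_right_mono) auto
      then show "(LINT x:ball 0 (real (k + 1))|lborel. u x) \<le> \<bar>A\<bar> * real (k + 1) ^ m"
        using le[of "k + 1"] by linarith
    qed
    finally show "ennreal (c k) * (\<integral>\<^sup>+ x. ennreal (indicator (ball 0 (real (k + 1))) x *\<^sub>R u x) \<partial>lborel)
        \<le> ennreal (c k * (\<bar>A\<bar> * real (k + 1) ^ m))"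
      by (subst ennreal_mult) (auto simp: c_def intro: mult_left_mono)
  qed
  also have "\<dots> < \<infinity>"
  proof -
    have "summable (\<lambda>k. c k * (\<bar>A\<bar> * real (k + 1) ^ m))"
      using summable_mult[OF summable_gaussian_power[OF a, of m], of "\<bar>A\<bar>"]
      by (simp add: c_def mult_ac add.commute)
    then show ?thesis
      by (subst suminf_ennreal2) (auto simp: c_def)
  qed
  finally show "(\<integral>\<^sup>+ x. ennreal (norm (exp (- a * (norm x)\<^sup>2) * u x)) \<partial>lborel) < \<infinity>" .
qed simp

text \<open>Borel measurability is included, so membership alone yields integrability against every
  weight exp(-a |x|^2) with a > 0.\<close>

definition poly_growth :: "('a::euclidean_space \<Rightarrow> real) \<Rightarrow> bool" where
  "poly_growth f \<longleftrightarrow> f \<in> borel_measurable borel \<and> (\<exists>C k. \<forall>x. \<bar>f x\<bar> \<le> C * (1 + norm x) ^ k)"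

lemma poly_growthI: "f \<in> borel_measurable borel \<Longrightarrow> (\<And>x. \<bar>f x\<bar> \<le> C * (1 + norm x) ^ k) \<Longrightarrow> poly_growth f"
  by (auto simp: poly_growth_def)

lemma poly_growthE:
  assumes "poly_growth f"
  obtains C k where "C \<ge> 0" "\<And>x. \<bar>f x\<bar> \<le> C * (1 + norm x) ^ k"
proof -
  obtain C k where C: "\<And>x. \<bar>f x\<bar> \<le> C * (1 + norm x) ^ k" using assms by (auto simp: poly_growth_def)
  have "C \<ge> 0" using C[of 0] abs_ge_zero[of "f 0"] by (simp del: abs_ge_zero)
  then show ?thesis using C that by blast
qed

lemma poly_growth_measurable: "poly_growth f \<Longrightarrow> f \<in> borel_measurable borel"
  by (simp add: poly_growth_def)

lemma poly_growth_const: "poly_growth (\<lambda>_. c)"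
  by (rule poly_growthI[of _ "\<bar>c\<bar>" 0]) auto

lemma poly_growth_norm: "poly_growth norm"
  by (rule poly_growthI[of _ 1 1]) auto

lemma poly_growth_inner: "poly_growth (\<lambda>x. x \<bullet> v)"
proof (rule poly_growthI[of _ "norm v" 1])
  fix x
  have "\<bar>x \<bullet> v\<bar> \<le> norm x * norm v" by (rule Cauchy_Schwarz_ineq2)
  also have "\<dots> \<le> norm v * (1 + norm x) ^ 1" by (simp add: algebra_simps)
  finally show "\<bar>x \<bullet> v\<bar> \<le> norm v * (1 + norm x) ^ 1" .
qed simp

lemma poly_growth_bound:
  assumes "poly_growth g" "f \<in> borel_measurable borel" "\<And>x. \<bar>f x\<bar> \<le> \<bar>g x\<bar>"
  shows "poly_growth f"
  using assms unfolding poly_growth_def by (meson order_trans)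

lemma poly_growth_mult:
  assumes "poly_growth f" "poly_growth g"
  shows "poly_growth (\<lambda>x. f x * g x)"
proof -
  obtain C k where C: "C \<ge> 0" "\<And>x. \<bar>f x\<bar> \<le> C * (1 + norm x) ^ k" using poly_growthE[OF assms(1)] by metis
  obtain D l where D: "D \<ge> 0" "\<And>x. \<bar>g x\<bar> \<le> D * (1 + norm x) ^ l" using poly_growthE[OF assms(2)] by metis
  show ?thesis
  proof (rule poly_growthI[of _ "C * D" "k + l"])
    fix x
    have "\<bar>f x\<bar> * \<bar>g x\<bar> \<le> (C * (1 + norm x) ^ k) * (D * (1 + norm x) ^ l)"
      using C D by (intro mult_mono) auto
    then show "\<bar>f x * g x\<bar> \<le> C * D * (1 + norm x) ^ (k + l)" by (simp add: abs_mult power_add mult_ac)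
  qed (use assms in \<open>auto simp: poly_growth_def\<close>)
qed

lemma poly_growth_add:
  assumes "poly_growth f" "poly_growth g"
  shows "poly_growth (\<lambda>x. f x + g x)"
proof -
  obtain C k where C: "C \<ge> 0" "\<And>x. \<bar>f x\<bar> \<le> C * (1 + norm x) ^ k" using poly_growthE[OF assms(1)] by metis
  obtain D l where D: "D \<ge> 0" "\<And>x. \<bar>g x\<bar> \<le> D * (1 + norm x) ^ l" using poly_growthE[OF assms(2)] by metis
  show ?thesis
  proof (rule poly_growthI[of _ "C + D" "k + l"])
    fix x :: 'a
    have "C * (1 + norm x) ^ k \<le> C * (1 + norm x) ^ (k + l)" "D * (1 + norm x) ^ l \<le> D * (1 + norm x) ^ (k + l)"
      using C(1) D(1) by (intro mult_left_mono power_increasing; simp)+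
    then show "\<bar>f x + g x\<bar> \<le> (C + D) * (1 + norm x) ^ (k + l)"
      using C(2)[of x] D(2)[of x] by (simp add: distrib_right)
  qed (use assms in \<open>auto simp: poly_growth_def\<close>)
qed

lemma poly_growth_power: "poly_growth f \<Longrightarrow> poly_growth (\<lambda>x. f x ^ n)"
  by (induction n) (auto intro: poly_growth_const poly_growth_mult)

lemma poly_growth_cmult: "poly_growth f \<Longrightarrow> poly_growth (\<lambda>x. c * f x)"
  by (intro poly_growth_mult poly_growth_const)

lemma poly_growth_diff: "poly_growth f \<Longrightarrow> poly_growth g \<Longrightarrow> poly_growth (\<lambda>x. f x - g x)"
  using poly_growth_add[of f "\<lambda>x. - 1 * g x"] poly_growth_cmult[of g "-1"] by simp

lemma poly_growth_sum: "(\<And>i. i \<in> I \<Longrightarrow> poly_growth (f i)) \<Longrightarrow> poly_growth (\<lambda>x. \<Sum>i\<in>I. f i x)"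
  by (induction I rule: infinite_finite_induct) (auto intro: poly_growth_const poly_growth_add)

lemmas poly_growth_intros = poly_growth_const poly_growth_norm poly_growth_inner poly_growth_mult
  poly_growth_add poly_growth_power poly_growth_diff poly_growth_sum

text \<open>The ball of radius n lies in a cube of side 2 n, so integrals of powers of 1 + |x| over
  balls grow polynomially.\<close>

lemma integrable_gaussian_poly_growth:
  fixes f :: "'a::euclidean_space \<Rightarrow> real"
  assumes "a > 0" "poly_growth f"
  shows "integrable lborel (\<lambda>x. exp (- a * (norm x)\<^sup>2) * f x)"
proof -
  have [measurable]: "f \<in> borel_measurable borel" using assms by (simp add: poly_growth_def)
  have [measurable]: "ball (0::'a) r \<in> sets borel" for r by simp
  obtain C k where C: "C \<ge> 0" "\<And>x. \<bar>f x\<bar> \<le> C * (1 + norm x) ^ k" using poly_growthE[OF assms(2)] by metis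
  have "integrable lborel (\<lambda>x::'a. exp (- a * (norm x)\<^sup>2) * (1 + norm x) ^ k)"
  proof (rule integrable_gaussian_of_ball_growth[OF assms(1), where A = "2 ^ k * (2 * real DIM('a)) ^ DIM('a)" and m = "k + DIM('a)"])
    fix n :: nat
    have bi: "integrable lborel (indicator (ball (0::'a) (real n)) :: 'a \<Rightarrow> real)"
      by (intro integrable_real_indicator emeasure_lborel_ball_finite) auto
    show si: "set_integrable lborel (ball (0::'a) (real n)) (\<lambda>x. (1 + norm x) ^ k)"
      unfolding set_integrable_def
    proof (rule Bochner_Integration.integrable_bound[OF integrable_mult_right[OF bi, of "(1 + real n) ^ k"]])
      show "AE x in lborel. norm (indicator (ball 0 (real n)) x *\<^sub>R (1 + norm x) ^ k) \<le> norm ((1 + real n) ^ k * indicator (ball (0::'a) (real n)) x)"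
        by (rule AE_I2) (auto simp: indicator_def intro!: power_mono)
    qed simp
    assume "n \<ge> 1"
    have "(LINT x:ball (0::'a) (real n)|lborel. (1 + norm x) ^ k) \<le> (LINT x|lborel. (1 + real n) ^ k * indicator (ball (0::'a) (real n)) x)"
      unfolding set_lebesgue_integral_def
      by (intro integral_mono si[unfolded set_integrable_def] integrable_mult_right bi)
        (auto simp: indicator_def intro!: power_mono)
    also have "\<dots> = (1 + real n) ^ k * measure lborel (ball (0::'a) (real n))" by simp
    also have "measure lborel (ball (0::'a) (real n)) \<le> (2 * real n) ^ DIM('a)"
    proof -
      have sub: "ball (0::'a) (real n) \<subseteq> cbox (- real n *\<^sub>R One) (real n *\<^sub>R One)"
      proof
        fix x :: 'a assume "x \<in> ball 0 (real n)"
        then have "\<bar>x \<bullet> i\<bar> \<le> real n" if "i \<in> Basis" for i using Basis_le_norm[OF that, of x] by simp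
        then show "x \<in> cbox (- real n *\<^sub>R One) (real n *\<^sub>R One)"
          by (auto simp: mem_box abs_le_iff) (metis minus_le_iff)
      qed
      have "measure lborel (ball (0::'a) (real n)) \<le> measure lborel (cbox (- real n *\<^sub>R One) (real n *\<^sub>R One) :: 'a set)"
        using sub by (intro measure_mono_fmeasurable) (auto simp: fmeasurable_cbox)
      also have "\<dots> = (\<Prod>i\<in>(Basis::'a set). (real n *\<^sub>R One - (- real n *\<^sub>R One)) \<bullet> i)"
        by (subst measure_lborel_cbox_eq) auto
      also have "\<dots> = (\<Prod>i\<in>(Basis::'a set). 2 * real n)"
        by (rule prod.cong) (auto simp: inner_diff_left inner_add_left)
      also have "\<dots> = (2 * real n) ^ DIM('a)" by simp
      finally show ?thesis .
    qed
    also have "(1 + real n) ^ k * (2 * real n) ^ DIM('a) \<le> (2 * real n) ^ k * (2 * real DIM('a) * real n) ^ DIM('a)"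
      using \<open>n \<ge> 1\<close> by (intro mult_mono power_mono) (auto simp: mult_le_cancel_right1)
    also have "\<dots> = 2 ^ k * (2 * real DIM('a)) ^ DIM('a) * real n ^ (k + DIM('a))"
      by (simp add: power_mult_distrib power_add)
    finally show "(LINT x:ball (0::'a) (real n)|lborel. (1 + norm x) ^ k) \<le> 2 ^ k * (2 * real DIM('a)) ^ DIM('a) * real n ^ (k + DIM('a))"
      by (simp add: mult_left_mono)
  qed auto
  from integrable_mult_right[OF this, of C]
  show ?thesis
  proof (rule Bochner_Integration.integrable_bound)
    show "AE x in lborel. norm (exp (- a * (norm x)\<^sup>2) * f x) \<le> norm (C * (exp (- a * (norm x)\<^sup>2) * (1 + norm x) ^ k))"
      using C by (auto simp: abs_mult mult.left_commute)
  qed simp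
qed

text \<open>Not normalised: the total mass stays in the formulas as the integral of 1.\<close>

definition gauss :: "'a::euclidean_space measure" where
  "gauss = density lborel (\<lambda>x. ennreal (exp (- (norm x)\<^sup>2 / 2)))"

lemma sets_gauss[simp, measurable_cong]: "sets gauss = sets borel" and space_gauss[simp]: "space gauss = UNIV"
  by (simp_all add: gauss_def)

lemma borel_measurable_gauss_iff[simp]: "f \<in> borel_measurable gauss \<longleftrightarrow> f \<in> borel_measurable borel"
  by (simp cong: measurable_cong_sets)

lemma AE_gauss: "(AE x in gauss. P x) \<longleftrightarrow> (AE x in lborel. P x)"
  unfolding gauss_def by (subst AE_density) auto

lemma integrable_gauss_iff:
  fixes f :: "'a::euclidean_space \<Rightarrow> real"
  assumes "f \<in> borel_measurable borel"
  shows "integrable gauss f \<longleftrightarrow> integrable lborel (\<lambda>x. exp (- (norm x)\<^sup>2 / 2) * f x)"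
  unfolding gauss_def using assms by (subst integrable_density) auto

lemma integral_gauss:
  fixes f :: "'a::euclidean_space \<Rightarrow> real"
  assumes "f \<in> borel_measurable borel"
  shows "(LINT x|gauss. f x) = (LINT x|lborel. exp (- (norm x)\<^sup>2 / 2) * f x)"
  unfolding gauss_def using assms by (subst integral_density) auto

lemma poly_growth_integrable: "poly_growth f \<Longrightarrow> integrable gauss f"
  using integrable_gaussian_poly_growth[of "1/2" f]
  by (simp add: integrable_gauss_iff poly_growth_measurable)

lemma poly_growth_L2: "poly_growth f \<Longrightarrow> L2 gauss f"
  using poly_growth_integrable[OF poly_growth_power[of f 2]] poly_growth_measurable[of f] by (simp add: L2_def)

lemma integral_gauss_pos: "(LINT x|gauss. (1::real)) > 0"
proof -
  have 1: "integrable gauss (\<lambda>x::'a. 1 :: real)" by (intro poly_growth_integrable poly_growth_const)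
  have "(LINT x|(gauss::'a measure). (1::real)) \<ge> 0" by simp
  moreover have "(LINT x|(gauss::'a measure). (1::real)) \<noteq> 0"
  proof
    assume "(LINT x|(gauss::'a measure). (1::real)) = 0"
    then have "AE x in (gauss::'a measure). (1::real) = 0"
      using integral_nonneg_eq_0_iff_AE[OF 1] by simp
    then have "AE x in (lborel::'a measure). False" by (simp add: AE_gauss)
    then show False by (simp add: AE_iff_null_sets trivial_limit_def[symmetric] ae_filter_eq_bot_iff)
  qed
  ultimately show ?thesis by linarith
qed

subsection \<open>Cutoff functions\<close>

text \<open>The factor \<open>exp 1\<close> gives value 1 at the origin. The cutoff is radial so
  that its gradient, like that of the weight, is a multiple of \<open>x\<close>, and pairing with it
  sees only the radial derivative of \<open>u\<close>.\<close>

definition cutoff :: "nat \<Rightarrow> 'a::euclidean_space \<Rightarrow> real" where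
  "cutoff j x = exp 1 * bump (1 - (norm x)\<^sup>2 / (real (Suc j))\<^sup>2)"

text \<open>The scalar factor in \<open>grad_cutoff\<close>, with the minus sign taken out.\<close>

definition cutoff' :: "nat \<Rightarrow> 'a::euclidean_space \<Rightarrow> real" where
  "cutoff' j x = exp 1 * (2 / (real (Suc j))\<^sup>2) * bump_tower 1 (1 - (norm x)\<^sup>2 / (real (Suc j))\<^sup>2)"

lemma smooth_cutoff: "smooth (cutoff j)"
proof -
  have "smooth (\<lambda>x::'a. exp 1 * bump (1 - (1 / (real (Suc j))\<^sup>2) * (norm x)\<^sup>2))"
    by (intro smooth_cmult smooth_bump smooth_diff smooth_const smooth_norm_square)
  then show ?thesis by (simp add: cutoff_def[abs_def])
qed

lemma cutoff_test_function: "test_function UNIV (cutoff j)"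
proof (rule test_functionI[OF smooth_cutoff])
  show "compact (cball (0::'a) (real (Suc j)))" by simp
  fix x :: 'a assume "x \<notin> cball 0 (real (Suc j))"
  then have "(real (Suc j))\<^sup>2 \<le> (norm x)\<^sup>2" by (intro power_mono) auto
  then show "cutoff j x = 0" by (simp add: cutoff_def bump_eq_0_iff)
qed simp

lemma cutoff_bounds: "0 \<le> cutoff j x" "cutoff j x \<le> 1" "cutoff' j x \<ge> 0"
proof -
  show "0 \<le> cutoff j x" "cutoff' j x \<ge> 0"
    by (simp_all add: cutoff_def cutoff'_def bump_ge_0 bump_tower_1_ge_0[unfolded One_nat_def])
  show "cutoff j x \<le> 1"
  proof (cases "1 - (norm x)\<^sup>2 / (real (Suc j))\<^sup>2 > 0")
    case True
    define t where "t = 1 - (norm x)\<^sup>2 / (real (Suc j))\<^sup>2"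
    have "t > 0" "t \<le> 1" using True by (auto simp: t_def)
    then have "1 + - 1 / t \<le> 0" by (simp add: field_simps)
    then have "exp 1 * exp (- 1 / t) \<le> 1" by (simp add: mult_exp_exp)
    then show ?thesis using \<open>t > 0\<close> unfolding cutoff_def t_def[symmetric] bump_def by simp
  qed (simp add: cutoff_def bump_def)
qed

lemma grad_cutoff: "grad (cutoff j) x = - cutoff' j x *\<^sub>R x"
proof (rule grad_eqI)
  have "((\<lambda>x::'a. (norm x)\<^sup>2) has_derivative (\<lambda>v. 2 * (x \<bullet> v))) (at x)"
    unfolding power2_norm_eq_inner by (auto intro!: derivative_eq_intros simp: inner_commute)
  from has_derivative_diff[OF has_derivative_const has_derivative_mult_right[OF this, of "1 / (real (Suc j))\<^sup>2"], of 1]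
  have "((\<lambda>x::'a. 1 - (norm x)\<^sup>2 / (real (Suc j))\<^sup>2) has_derivative (\<lambda>v. - (2 * (x \<bullet> v)) / (real (Suc j))\<^sup>2)) (at x)"
    by simp
  from has_derivative_mult_right[OF DERIV_compose_FDERIV[OF bump_has_derivative this], of "exp 1"]
  show "(cutoff j has_derivative (\<lambda>v. - cutoff' j x *\<^sub>R x \<bullet> v)) (at x)"
    unfolding cutoff_def[abs_def] by (rule has_derivative_eq_rhs) (auto simp: cutoff'_def)
qed

lemma cutoff'_bound:
  obtains C where "C \<ge> 0" "\<And>j (x::'a::euclidean_space). cutoff' j x \<le> C / (real (Suc j))\<^sup>2"
proof -
  have "compact (bump_tower 1 ` {0..1})"
    by (intro compact_continuous_image continuous_bump_tower) simp
  then obtain C where C: "\<And>t. 0 \<le> t \<Longrightarrow> t \<le> 1 \<Longrightarrow> \<bar>bump_tower 1 t\<bar> \<le> C"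
    using compact_imp_bounded by (fastforce simp: bounded_iff)
  have C': "bump_tower 1 t \<le> \<bar>C\<bar>" if "t \<le> 1" for t
    using C[of t] that by (cases "t \<ge> 0") (auto simp: bump_tower_def)
  show ?thesis
  proof (rule that[of "exp 1 * 2 * \<bar>C\<bar>"])
    fix j and x :: 'a
    have "bump_tower 1 (1 - (norm x)\<^sup>2 / (real (Suc j))\<^sup>2) \<le> \<bar>C\<bar>" by (rule C') simp
    then have "exp 1 * (2 / (real (Suc j))\<^sup>2) * bump_tower 1 (1 - (norm x)\<^sup>2 / (real (Suc j))\<^sup>2) \<le> exp 1 * (2 / (real (Suc j))\<^sup>2) * \<bar>C\<bar>"
      by (intro mult_left_mono) auto
    then show "cutoff' j x \<le> exp 1 * 2 * \<bar>C\<bar> / (real (Suc j))\<^sup>2" by (simp add: cutoff'_def)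
  qed simp
qed

lemma cutoff_tendsto: "(\<lambda>j. cutoff j x) \<longlonglongrightarrow> 1"
proof -
  have "(\<lambda>j. 1 - (norm x)\<^sup>2 / (real (Suc j))\<^sup>2) \<longlonglongrightarrow> 1" by real_asymp
  from isCont_tendsto_compose[OF DERIV_isCont[OF bump_has_derivative] this]
  have "(\<lambda>j. exp 1 * bump (1 - (norm x)\<^sup>2 / (real (Suc j))\<^sup>2)) \<longlonglongrightarrow> exp 1 * bump 1"
    by (intro tendsto_intros)
  then show ?thesis by (simp add: cutoff_def bump_def exp_minus)
qed

lemma cutoff'_tendsto: "(\<lambda>j. cutoff' j (x::'a::euclidean_space)) \<longlonglongrightarrow> 0"
proof -
  obtain C where C: "C \<ge> 0" "\<And>j (x::'a). cutoff' j x \<le> C / (real (Suc j))\<^sup>2" using cutoff'_bound by metis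
  show ?thesis
  proof (rule tendsto_sandwich[OF _ _ tendsto_const])
    show "(\<lambda>j. C / (real (Suc j))\<^sup>2) \<longlonglongrightarrow> 0" by real_asymp
    show "\<forall>\<^sub>F j in sequentially. cutoff' j x \<le> C / (real (Suc j))\<^sup>2" using C(2) by (intro always_eventually allI)
  qed (auto simp: cutoff_bounds)
qed

lemma borel_measurable_cutoff[measurable]: "cutoff j \<in> borel_measurable borel"
  "cutoff' j \<in> borel_measurable borel"
proof -
  show "cutoff j \<in> borel_measurable borel" by (rule borel_measurable_smooth[OF smooth_cutoff refl])
  have [measurable]: "bump_tower 1 \<in> borel_measurable borel"
    by (intro borel_measurable_continuous_onI continuous_bump_tower)
  show "cutoff' j \<in> borel_measurable borel" unfolding cutoff'_def[abs_def] by measurable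
qed

lemma smooth_gaussian: "smooth (\<lambda>x. exp (- (norm x)\<^sup>2 / 2))"
  using smooth_exp[OF smooth_cmult[OF smooth_norm_square, of "- 1 / 2"]] by simp

lemma grad_gaussian: "grad (\<lambda>x. exp (- (norm x)\<^sup>2 / 2)) x = - exp (- (norm x)\<^sup>2 / 2) *\<^sub>R x"
proof (rule grad_eqI)
  have "((\<lambda>x::'a. - (norm x)\<^sup>2 / 2) has_derivative (\<lambda>v. - (x \<bullet> v))) (at x)"
    unfolding power2_norm_eq_inner by (auto intro!: derivative_eq_intros simp: inner_commute)
  then show "((\<lambda>x. exp (- (norm x)\<^sup>2 / 2)) has_derivative (\<lambda>v. - exp (- (norm x)\<^sup>2 / 2) *\<^sub>R x \<bullet> v)) (at x)"
    by (auto intro!: derivative_eq_intros)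
qed

text \<open>The Gaussian weight made admissible as a test function.\<close>

definition gcut :: "nat \<Rightarrow> 'a::euclidean_space \<Rightarrow> real" where
  "gcut j x = cutoff j x * exp (- (norm x)\<^sup>2 / 2)"

lemma gcut_test_function: "test_function UNIV (gcut j)"
  unfolding gcut_def[abs_def] by (rule test_function_mult[OF cutoff_test_function smooth_gaussian])

lemma grad_gcut: "grad (gcut j) x = - ((cutoff j x + cutoff' j x) * exp (- (norm x)\<^sup>2 / 2)) *\<^sub>R x"
  unfolding gcut_def[abs_def] grad_mult[OF smooth_cutoff smooth_gaussian] grad_cutoff grad_gaussian
  by (simp add: scaleR_left_distrib[symmetric] algebra_simps)

text \<open>The passage from truncated to full Gaussian identities: \<open>g\<close> collects the
  terms in which the cutoff was differentiated, and \<open>cutoff'\<close> tends to 0 under a bound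
  independent of \<open>j\<close>.\<close>

lemma cutoff_dominated:
  fixes f g :: "'a::euclidean_space \<Rightarrow> real"
  assumes f: "integrable gauss f" and g: "integrable gauss g"
  shows "(\<lambda>j. LINT x|gauss. cutoff j x * f x + cutoff' j x * g x) \<longlonglongrightarrow> (LINT x|gauss. f x)"
proof -
  have [measurable]: "f \<in> borel_measurable borel" "g \<in> borel_measurable borel"
    using borel_measurable_integrable[OF f] borel_measurable_integrable[OF g] by simp_all
  obtain C where C: "C \<ge> 0" "\<And>j (x::'a). cutoff' j x \<le> C / (real (Suc j))\<^sup>2" using cutoff'_bound by metis
  show ?thesis
  proof (rule integral_dominated_convergence[where w = "\<lambda>x. \<bar>f x\<bar> + C * \<bar>g x\<bar>"])
    show "AE x in gauss. (\<lambda>j. cutoff j x * f x + cutoff' j x * g x) \<longlonglongrightarrow> f x"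
    proof (rule AE_I2)
      fix x
      have "(\<lambda>j. cutoff j x * f x + cutoff' j x * g x) \<longlonglongrightarrow> 1 * f x + 0 * g x"
        by (intro tendsto_intros cutoff_tendsto cutoff'_tendsto)
      then show "(\<lambda>j. cutoff j x * f x + cutoff' j x * g x) \<longlonglongrightarrow> f x" by simp
    qed
    fix j
    show "AE x in gauss. norm (cutoff j x * f x + cutoff' j x * g x) \<le> \<bar>f x\<bar> + C * \<bar>g x\<bar>"
    proof (rule AE_I2)
      fix x :: 'a
      have "C / (real (Suc j))\<^sup>2 \<le> C / 1" using C(1) one_le_power[of "real (Suc j)" 2] by (intro divide_left_mono) auto
      then have "cutoff' j x \<le> C" using C(2)[of j x] by simp
      then have "cutoff j x * \<bar>f x\<bar> \<le> 1 * \<bar>f x\<bar>" "cutoff' j x * \<bar>g x\<bar> \<le> C * \<bar>g x\<bar>"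
        using cutoff_bounds(2)[of j x] by (intro mult_right_mono; simp)+
      moreover have "norm (cutoff j x * f x + cutoff' j x * g x) \<le> cutoff j x * \<bar>f x\<bar> + cutoff' j x * \<bar>g x\<bar>"
        using cutoff_bounds[of j x] abs_triangle_ineq[of "cutoff j x * f x" "cutoff' j x * g x"]
        by (simp add: abs_mult)
      ultimately show "norm (cutoff j x * f x + cutoff' j x * g x) \<le> \<bar>f x\<bar> + C * \<bar>g x\<bar>" by linarith
    qed
  qed (use f g in auto)
qed

text \<open>Test with \<open>gcut j x * p x\<close> and remove the cutoff. The term
  \<open>p x * (x \<bullet> b)\<close> is the derivative of the weight: in Gaussian space the
  adjoint of a partial derivative is multiplication by the coordinate minus that derivative.\<close>

lemma gauss_integration_by_parts:
  fixes u :: "'a::euclidean_space \<Rightarrow> real"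
  assumes u: "loc_H1_grad u G" and L2: "L2 gauss u" "L2 gauss G"
    and p: "smooth p" "poly_growth p" and b: "b \<in> Basis" and p': "poly_growth (\<lambda>x. grad p x \<bullet> b)"
  shows "(LINT x|gauss. (G x \<bullet> b) * p x) = (LINT x|gauss. u x * (p x * (x \<bullet> b) - grad p x \<bullet> b))"
proof -
  have [measurable]: "u \<in> borel_measurable borel" "G \<in> borel_measurable borel" using u by (auto simp: loc_H1_grad_def)
  note [measurable] = poly_growth_measurable[OF p(2)] poly_growth_measurable[OF p']
  have Gb: "L2 gauss (\<lambda>x. G x \<bullet> b)"
    by (rule L2_bounded[OF L2(2), of _ 1]) (auto simp: b Basis_le_norm)
  define f where "f x = u x * (grad p x \<bullet> b - p x * (x \<bullet> b))" for x
  define g where "g x = u x * (- (p x * (x \<bullet> b)))" for x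
  define h where "h x = (G x \<bullet> b) * p x" for x
  have int: "integrable gauss f" "integrable gauss g" "integrable gauss h"
    unfolding f_def g_def h_def
    by (rule integrable_mult_L2[OF L2(1)] integrable_mult_L2[OF Gb], rule poly_growth_L2,
      (intro poly_growth_intros p' p poly_growth_cmult[of _ "-1", simplified])?)+
  have [measurable]: "f \<in> borel_measurable borel" "g \<in> borel_measurable borel" "h \<in> borel_measurable borel"
    unfolding f_def g_def h_def by measurable
  have "(LINT x|gauss. cutoff j x * f x + cutoff' j x * g x) = - (LINT x|gauss. cutoff j x * h x + cutoff' j x * 0)" for j
  proof -
    have t: "test_function UNIV (\<lambda>x. gcut j x * p x)" by (rule test_function_mult[OF gcut_test_function p(1)])
    have "(LINT x|lborel. u x * (grad (\<lambda>x. gcut j x * p x) x \<bullet> b)) = - (LINT x|lborel. (G x \<bullet> b) * (gcut j x * p x))"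
      using u t b by (simp add: loc_H1_grad_def)
    moreover have "u x * (grad (\<lambda>x. gcut j x * p x) x \<bullet> b) = exp (- (norm x)\<^sup>2 / 2) * (cutoff j x * f x + cutoff' j x * g x)" for x
      unfolding grad_mult[OF test_function_smooth[OF gcut_test_function] p(1)] grad_gcut f_def g_def
      by (simp add: gcut_def inner_add_left algebra_simps)
    moreover have "(G x \<bullet> b) * (gcut j x * p x) = exp (- (norm x)\<^sup>2 / 2) * (cutoff j x * h x + cutoff' j x * 0)" for x
      by (simp add: gcut_def h_def)
    ultimately show ?thesis by (simp add: integral_gauss)
  qed
  then have "(\<lambda>j. - (LINT x|gauss. cutoff j x * h x + cutoff' j x * 0)) \<longlonglongrightarrow> (LINT x|gauss. f x)"
    using cutoff_dominated[OF int(1,2)] by simp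
  moreover have "(\<lambda>j. - (LINT x|gauss. cutoff j x * h x + cutoff' j x * 0)) \<longlonglongrightarrow> - (LINT x|gauss. h x)"
    using cutoff_dominated[OF int(3), of "\<lambda>_. 0"] by (intro tendsto_minus) simp
  ultimately have "(LINT x|gauss. f x) = - (LINT x|gauss. h x)" by (rule LIMSEQ_unique)
  then have "(LINT x|gauss. h x) = (LINT x|gauss. - f x)" by simp
  then show ?thesis by (simp add: f_def h_def algebra_simps)
qed

section \<open>Polynomials in Gaussian space\<close>

text \<open>The index bounds the degree from above. Building polynomials by multiplication with
  coordinates turns arguments on the degree into rule inductions.\<close>

inductive poly_le :: "nat \<Rightarrow> ('a::euclidean_space \<Rightarrow> real) \<Rightarrow> bool" where
  const: "poly_le d (\<lambda>_. c)"
| add: "poly_le d p \<Longrightarrow> poly_le d q \<Longrightarrow> poly_le d (\<lambda>x. p x + q x)"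
| mult: "poly_le d p \<Longrightarrow> b \<in> Basis \<Longrightarrow> poly_le (Suc d) (\<lambda>x. (x \<bullet> b) * p x)"

lemma poly_le_smooth: "poly_le d p \<Longrightarrow> smooth p"
  by (induction rule: poly_le.induct) (auto intro: smooth_const smooth_add smooth_mult smooth_inner)

lemma poly_le_growth: "poly_le d p \<Longrightarrow> poly_growth p"
  by (induction rule: poly_le.induct) (auto intro: poly_growth_intros)

lemma poly_le_Suc: "poly_le d p \<Longrightarrow> poly_le (Suc d) p"
  by (induction rule: poly_le.induct) (auto intro: poly_le.intros)

lemma poly_le_mono: "poly_le d p \<Longrightarrow> d \<le> e \<Longrightarrow> poly_le e p"
  by (induction e) (auto simp: le_Suc_eq intro: poly_le_Suc)

lemma poly_le_cmult: "poly_le d p \<Longrightarrow> poly_le d (\<lambda>x. c * p x)"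
proof (induction rule: poly_le.induct)
  case (mult d p b)
  from poly_le.mult[OF mult.IH mult.hyps(2)] show ?case by (simp add: mult.left_commute)
qed (auto simp: distrib_left intro: poly_le.intros)

lemma poly_le_diff: "poly_le d p \<Longrightarrow> poly_le d q \<Longrightarrow> poly_le d (\<lambda>x. p x - q x)"
  using poly_le.add[of d p "\<lambda>x. -1 * q x"] poly_le_cmult[of d q "-1"] by simp

lemma poly_le_sum: "(\<And>i. i \<in> I \<Longrightarrow> poly_le d (f i)) \<Longrightarrow> poly_le d (\<lambda>x. \<Sum>i\<in>I. f i x)"
  by (induction I rule: infinite_finite_induct) (auto intro: poly_le.intros)

lemma poly_le_mult: "poly_le d p \<Longrightarrow> poly_le e q \<Longrightarrow> poly_le (d + e) (\<lambda>x. p x * q x)"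
proof (induction rule: poly_le.induct)
  case (const d c)
  then show ?case using poly_le_mono[OF poly_le_cmult[of e q c], of "d + e"] by simp
next
  case (mult d p b)
  then show ?case using poly_le.mult[of "d + e" "\<lambda>x. p x * q x" b] by (simp add: mult.assoc)
qed (auto simp: distrib_right intro: poly_le.intros)

lemma poly_le_inner: "b \<in> Basis \<Longrightarrow> poly_le (Suc 0) (\<lambda>x. x \<bullet> b)"
  using poly_le.mult[OF poly_le.const[of 0 1], of b] by simp

lemma poly_le_norm_square: "poly_le 2 (\<lambda>x. (norm x)\<^sup>2)"
proof -
  have "(norm x)\<^sup>2 = (\<Sum>b\<in>Basis. (x \<bullet> b) * (x \<bullet> b))" for x :: 'a
    by (simp add: power2_norm_eq_inner euclidean_inner[of x x])
  moreover have "poly_le 2 (\<lambda>x::'a. \<Sum>b\<in>Basis. (x \<bullet> b) * (x \<bullet> b))"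
    using poly_le.mult[OF poly_le_inner] by (intro poly_le_sum) (simp add: numeral_2_eq_2)
  ultimately show ?thesis by simp
qed

lemma poly_le_power: "poly_le d p \<Longrightarrow> poly_le (n * d) (\<lambda>x. p x ^ n)"
  by (induction n) (auto intro: poly_le.const poly_le_mult)

lemma poly_le_0: "poly_le d p \<Longrightarrow> d = 0 \<Longrightarrow> \<exists>c. p = (\<lambda>_. c)"
  by (induction rule: poly_le.induct) auto

lemma poly_le_0_grad: "poly_le 0 p \<Longrightarrow> grad p x = 0"
  using poly_le_0[of 0 p] by auto

lemma poly_le_grad: "poly_le d p \<Longrightarrow> b \<in> Basis \<Longrightarrow> poly_le (d - 1) (\<lambda>x. grad p x \<bullet> b)"
proof (induction rule: poly_le.induct)
  case (add d p q)
  then show ?case by (simp add: grad_add[OF poly_le_smooth poly_le_smooth] inner_add_left poly_le.add)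
next
  case (mult d p b')
  have e: "grad (\<lambda>x. x \<bullet> b' * p x) x \<bullet> b = (x \<bullet> b') * (grad p x \<bullet> b) + (b' \<bullet> b) * p x" for x
    by (simp add: grad_mult[OF smooth_inner poly_le_smooth[OF mult.hyps(1)]] inner_add_left)
  \<comment> \<open>For \<open>d = 0\<close> truncated subtraction only bounds the degree of the
    derivative by 0, and the factor \<open>x \<bullet> b'\<close> would raise it to 1; but then the
    derivative is zero.\<close>
  have "poly_le d (\<lambda>x. (x \<bullet> b') * (grad p x \<bullet> b))"
  proof (cases d)
    case 0
    then have "grad p x = 0" for x using poly_le_0_grad[of p x] mult.hyps(1) by simp
    then show ?thesis by (simp add: poly_le.const)
  next
    case (Suc e)
    then show ?thesis using mult poly_le.mult by auto
  qed
  then show ?case unfolding e using mult.hyps(1) by (auto intro: poly_le.add poly_le_cmult)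
qed (auto intro: poly_le.const)

text \<open>By Euler's relation the radial derivative acts as \<open>d\<close> on the part of degree
  exactly \<open>d\<close>, so the difference loses that part. The case \<open>d = 0\<close> is
  separate because no bound below 0 can be expressed.\<close>

lemma poly_le_euler:
  "poly_le d p \<Longrightarrow> (case d of 0 \<Rightarrow> \<forall>x. grad p x = 0 |
     Suc e \<Rightarrow> poly_le e (\<lambda>x. grad p x \<bullet> x - real d * p x))"
proof (induction rule: poly_le.induct)
  case (const d c)
  then show ?case by (cases d) (auto intro: poly_le.const)
next
  case (add d p q)
  note sm = poly_le_smooth[OF add.hyps(1)] poly_le_smooth[OF add.hyps(2)]
  show ?case
  proof (cases d)
    case 0
    then show ?thesis using add.IH by (simp add: grad_add[OF sm])
  next
    case (Suc e)
    have "(grad (\<lambda>x. p x + q x) x \<bullet> x - real d * (p x + q x)) =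
        (grad p x \<bullet> x - real d * p x) + (grad q x \<bullet> x - real d * q x)" for x
      by (simp add: grad_add[OF sm] inner_add_left algebra_simps)
    then show ?thesis using add.IH Suc by (auto intro: poly_le.add)
  qed
next
  case (mult d p b)
  have e: "grad (\<lambda>x. x \<bullet> b * p x) x \<bullet> x - real (Suc d) * (x \<bullet> b * p x) =
      (x \<bullet> b) * (grad p x \<bullet> x - real d * p x)" for x
    unfolding grad_mult[OF smooth_inner poly_le_smooth[OF mult.hyps(1)]]
    by (simp add: inner_add_left inner_commute[of b] algebra_simps)
  show ?case
  proof (cases d)
    case 0
    then show ?thesis using mult e by (auto intro: poly_le.const)
  next
    case (Suc f)
    then show ?thesis using mult unfolding nat.case e by (auto intro: poly_le.mult)
  qed
qed

lemma loc_H1_grad_smooth: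
  assumes "smooth f"
  shows "loc_H1_grad f (grad f)"
  unfolding loc_H1_grad_def
proof (intro conjI allI impI ballI)
  note c = smooth_continuous[OF assms, of UNIV] continuous_grad[OF assms, of UNIV]
  show "f \<in> borel_measurable borel" "grad f \<in> borel_measurable borel"
    using c by (auto intro: borel_measurable_continuous_onI)
  fix R
  have s: "set_integrable lborel (ball (0::'a) R) g" if g: "continuous_on UNIV g" for g :: "'a \<Rightarrow> real"
  proof (rule set_integrable_subset[of _ "cball 0 R"])
    show "set_integrable lborel (cball (0::'a) R) g" unfolding set_integrable_def
      by (rule borel_integrable_compact[OF compact_cball continuous_on_subset[OF g]]) simp
  qed auto
  show "set_integrable lborel (ball 0 R) (\<lambda>x. (f x)\<^sup>2)" "set_integrable lborel (ball 0 R) (\<lambda>x. (norm (grad f x))\<^sup>2)"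
    by (rule s, intro continuous_intros c)+
qed (rule smooth_integration_by_parts[OF assms])

lemma poly_integration_by_parts:
  assumes "poly_le d p" "poly_le e q" "b \<in> Basis"
  shows "(LINT x|gauss. (grad p x \<bullet> b) * q x) = (LINT x|gauss. p x * (q x * (x \<bullet> b) - grad q x \<bullet> b))"
proof -
  have g: "poly_growth (\<lambda>x. grad p x \<bullet> b)" if "b \<in> Basis" for b
    using poly_le_growth[OF poly_le_grad[OF assms(1) that]] .
  have "poly_growth (\<lambda>x. norm (grad p x))"
  proof (rule poly_growth_bound)
    have "poly_growth (\<lambda>x. (grad p x \<bullet> b)\<^sup>2)" if "b \<in> Basis" for b using poly_growth_power[OF g[OF that], of 2] .
    then show "poly_growth (\<lambda>x. 1 + (\<Sum>b\<in>Basis. (grad p x \<bullet> b)\<^sup>2))"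
      by (intro poly_growth_add[OF poly_growth_const poly_growth_sum])
    show "(\<lambda>x. norm (grad p x)) \<in> borel_measurable borel"
      using continuous_grad[OF poly_le_smooth[OF assms(1)], of UNIV] by (auto intro!: borel_measurable_continuous_onI continuous_on_norm)
    fix x
    have "(\<Sum>b\<in>Basis. (grad p x \<bullet> b)\<^sup>2) = (norm (grad p x))\<^sup>2"
      unfolding power2_norm_eq_inner euclidean_inner[of "grad p x" "grad p x"] by (simp add: power2_eq_square)
    then show "\<bar>norm (grad p x)\<bar> \<le> \<bar>1 + (\<Sum>b\<in>Basis. (grad p x \<bullet> b)\<^sup>2)\<bar>"
      using sum_squares_bound[of 1 "norm (grad p x)"] by simp (use norm_ge_zero[of "grad p x"] in linarith)
  qed
  from poly_growth_power[OF this, of 2] have "L2 gauss (grad p)"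
    using poly_growth_integrable continuous_grad[OF poly_le_smooth[OF assms(1)], of UNIV]
    by (auto simp: L2_def intro!: borel_measurable_continuous_onI)
  then show ?thesis
    by (intro gauss_integration_by_parts loc_H1_grad_smooth poly_le_smooth[OF assms(1)] poly_growth_L2
      poly_le_growth[OF assms(1)] poly_le_smooth[OF assms(2)] poly_le_growth[OF assms(2)] assms(3)
      poly_le_growth[OF poly_le_grad[OF assms(2,3)]])
qed

subsection \<open>Orthogonal projection onto polynomials\<close>

abbreviation gip :: "('a::euclidean_space \<Rightarrow> real) \<Rightarrow> ('a \<Rightarrow> real) \<Rightarrow> real" where
  "gip f g \<equiv> (LINT x|gauss. f x * g x)"

lemma gip_add_left: "L2 gauss f \<Longrightarrow> L2 gauss g \<Longrightarrow> L2 gauss k \<Longrightarrow> gip (\<lambda>x. f x + g x) k = gip f k + gip g k"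
  by (simp add: distrib_right integrable_mult_L2)

lemma gip_diff_left: "L2 gauss f \<Longrightarrow> L2 gauss g \<Longrightarrow> L2 gauss k \<Longrightarrow> gip (\<lambda>x. f x - g x) k = gip f k - gip g k"
  by (simp add: left_diff_distrib integrable_mult_L2)

lemma gip_add_right: "L2 gauss f \<Longrightarrow> L2 gauss g \<Longrightarrow> L2 gauss k \<Longrightarrow> gip k (\<lambda>x. f x + g x) = gip k f + gip k g"
  by (simp add: distrib_left integrable_mult_L2)

lemma gip_diff_right: "L2 gauss f \<Longrightarrow> L2 gauss g \<Longrightarrow> L2 gauss k \<Longrightarrow> gip k (\<lambda>x. f x - g x) = gip k f - gip k g"
  by (simp add: right_diff_distrib integrable_mult_L2)

lemma gip_cmult_left: "gip (\<lambda>x. c * f x) k = c * gip f k"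
  and gip_cmult_right: "gip k (\<lambda>x. c * f x) = c * gip k f"
  by (simp_all add: mult.assoc mult.left_commute)

lemma gip_commute: "gip f g = gip g f"
  by (simp add: mult.commute)

lemma gip_self_nonneg: "gip f f \<ge> 0"
  by simp

lemma L2_diff: "L2 M f \<Longrightarrow> L2 M g \<Longrightarrow> L2 M (\<lambda>x. f x - g x)" for f :: "_ \<Rightarrow> real"
  using L2_add[of M f "\<lambda>x. -1 * g x"] L2_cmult[of M g "-1"] by simp

lemma gip_pythagoras:
  assumes f: "L2 gauss f" and g: "L2 gauss g" and "gip f g = 0"
  shows "gip (\<lambda>x. f x + g x) (\<lambda>x. f x + g x) = gip f f + gip g g"
  using assms by (simp add: gip_add_left gip_add_right L2_add gip_commute[of g f])

text \<open>Linear combinations grown one term at a time, which provides the induction for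
  orthogonality and transfer to images.\<close>

inductive spanned :: "('a \<Rightarrow> real) set \<Rightarrow> ('a \<Rightarrow> real) \<Rightarrow> bool" for M where
  zero: "spanned M (\<lambda>_. 0)"
| add: "m \<in> M \<Longrightarrow> spanned M f \<Longrightarrow> spanned M (\<lambda>x. f x + c * m x)"

lemma spanned_add: "spanned M g \<Longrightarrow> spanned M f \<Longrightarrow> spanned M (\<lambda>x. f x + g x)"
proof (induction rule: spanned.induct)
  case (add m g c)
  from spanned.add[OF add.hyps(1) add.IH[OF add.prems], of c] show ?case by (simp add: add.assoc)
qed simp

lemma spanned_cmult: "spanned M f \<Longrightarrow> spanned M (\<lambda>x. c * f x)"
proof (induction rule: spanned.induct)
  case (add m g d)
  from spanned.add[OF add.hyps(1) add.IH, of "c * d"] show ?case by (simp add: algebra_simps)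
qed (auto intro: spanned.zero)

lemma spanned_mono: "spanned M f \<Longrightarrow> M \<subseteq> M' \<Longrightarrow> spanned M' f"
  by (induction rule: spanned.induct) (auto intro: spanned.intros)

lemma spanned_base: "m \<in> M \<Longrightarrow> spanned M m"
  using spanned.add[OF _ spanned.zero, of m M 1] by simp

lemma spanned_mult_image: "spanned M f \<Longrightarrow> spanned ((\<lambda>m x. k x * m x) ` M) (\<lambda>x. k x * f x)"
proof (induction rule: spanned.induct)
  case (add m g c)
  have "spanned ((\<lambda>m x. k x * m x) ` M) (\<lambda>x. k x * g x + c * (k x * m x))"
    by (rule spanned.add[of "\<lambda>x. k x * m x"]) (use add in auto)
  then show ?case by (simp add: algebra_simps)
qed (auto intro: spanned.zero)

text \<open>Degree \<open>Suc d\<close> is spanned by 1 together with the coordinates times a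
  spanning set for degree \<open>d\<close>. Finiteness is what makes the orthogonal projection
  elementary.\<close>

lemma poly_le_finitely_spanned:
  "\<exists>M :: ('a::euclidean_space \<Rightarrow> real) set. finite M \<and> (\<forall>m\<in>M. poly_le d m) \<and> (\<forall>p. poly_le d p \<longrightarrow> spanned M p)"
proof (induction d)
  case 0
  have "spanned {\<lambda>_. 1} p" if "poly_le 0 p" for p :: "'a \<Rightarrow> real"
    using poly_le_0[OF that] spanned_cmult[OF spanned_base[of "\<lambda>_. 1" "{\<lambda>_. 1}"]] by force
  then show ?case by (intro exI[of _ "{\<lambda>_. 1}"]) (auto intro: poly_le.const)
next
  case (Suc d)
  then obtain M :: "('a \<Rightarrow> real) set" where M: "finite M" "\<And>m. m \<in> M \<Longrightarrow> poly_le d m"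
    "\<And>p. poly_le d p \<Longrightarrow> spanned M p" by blast
  define M' where "M' = insert (\<lambda>_. 1) (\<Union>b\<in>Basis. (\<lambda>m x. (x \<bullet> b) * m x) ` M)"
  have "spanned M' p" if "poly_le e p" "e = Suc d" for p e
    using that
  proof (induction rule: poly_le.induct)
    case (const e c)
    then show ?case using spanned_cmult[OF spanned_base[of "\<lambda>_. 1" M'], of c] by (simp add: M'_def)
  next
    case (mult e p b)
    then show ?case by (intro spanned_mono[OF spanned_mult_image[OF M(3)]]) (auto simp: M'_def)
  qed (auto intro: spanned_add)
  moreover have "\<forall>m\<in>M'. poly_le (Suc d) m"
    using M(2) by (auto simp: M'_def intro: poly_le.intros)
  moreover have "finite M'" using M(1) by (simp add: M'_def)
  ultimately show ?case by blast
qed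

lemma spanned_L2: "spanned M p \<Longrightarrow> (\<And>m. m \<in> M \<Longrightarrow> L2 gauss m) \<Longrightarrow> L2 gauss p"
proof (induction rule: spanned.induct)
  case zero
  show ?case by (intro poly_growth_L2 poly_growth_const)
next
  case (add m f c)
  then show ?case by (intro L2_add[of gauss f] L2_cmult) auto
qed

lemma spanned_orthogonal:
  "spanned M p \<Longrightarrow> (\<And>m. m \<in> M \<Longrightarrow> L2 gauss m) \<Longrightarrow> L2 gauss f \<Longrightarrow> (\<And>m. m \<in> M \<Longrightarrow> gip f m = 0) \<Longrightarrow> gip f p = 0"
  by (induction rule: spanned.induct) (auto simp: gip_add_right[OF spanned_L2] L2_cmult gip_cmult_right)

text \<open>Gram-Schmidt: the new vector \<open>u\<close> is first made orthogonal to
  \<open>M\<close>, and its remainder \<open>v\<close> then corrects the projection of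
  \<open>f\<close> onto \<open>M\<close>.\<close>

lemma projection_exists:
  "finite M \<Longrightarrow> (\<And>m. m \<in> M \<Longrightarrow> L2 gauss m) \<Longrightarrow> L2 gauss f \<Longrightarrow>
    \<exists>p. spanned M p \<and> (\<forall>m\<in>M. gip (\<lambda>x. f x - p x) m = 0)"
proof (induction M arbitrary: f rule: finite_induct)
  case empty
  then show ?case by (auto intro: spanned.zero)
next
  case (insert u M)
  have u: "L2 gauss u" and f: "L2 gauss f" and LM: "\<And>m. m \<in> M \<Longrightarrow> L2 gauss m" using insert.prems by auto
  obtain f' where Pf: "spanned M f'" "\<And>m. m \<in> M \<Longrightarrow> gip (\<lambda>x. f x - f' x) m = 0"
    using insert.IH[OF LM f] by blast
  obtain u' where Pu: "spanned M u'" "\<And>m. m \<in> M \<Longrightarrow> gip (\<lambda>x. u x - u' x) m = 0"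
    using insert.IH[OF LM u] by blast
  define v where "v x = u x - u' x" for x
  note L = spanned_L2[OF Pf(1) LM] spanned_L2[OF Pu(1) LM]
  have v: "L2 gauss v" unfolding v_def by (intro L2_diff u L)
  have fP: "L2 gauss (\<lambda>x. f x - f' x)" by (intro L2_diff f L)
  define c where "c = gip (\<lambda>x. f x - f' x) v / gip v v"
  define p where "p x = f' x + c * v x" for x
  have sp: "spanned (insert u M) p"
  proof -
    have "spanned (insert u M) (\<lambda>x. f' x + c * u x)"
      by (rule spanned.add) (auto intro: spanned_mono[OF Pf(1)])
    moreover have "spanned (insert u M) (\<lambda>x. (- c) * u' x)"
      by (intro spanned_cmult spanned_mono[OF Pu(1)]) auto
    ultimately have "spanned (insert u M) (\<lambda>x. (f' x + c * u x) + (- c) * u' x)" by (rule spanned_add[rotated])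
    moreover have "(\<lambda>x. (f' x + c * u x) + (- c) * u' x) = p" by (auto simp: p_def v_def algebra_simps)
    ultimately show ?thesis by simp
  qed
  have fp: "gip (\<lambda>x. f x - p x) g = gip (\<lambda>x. f x - f' x) g - c * gip v g" if "L2 gauss g" for g
    using gip_diff_left[OF fP L2_cmult[OF v, of c] that] by (simp add: p_def algebra_simps gip_cmult_left)
  have om: "gip (\<lambda>x. f x - p x) m = 0" if "m \<in> M" for m
    using fp[OF LM[OF that]] Pf(2)[OF that] Pu(2)[OF that] by (simp add: v_def)
  have ov: "gip (\<lambda>x. f x - p x) v = 0"
  proof (cases "gip v v = 0")
    \<comment> \<open>If \<open>v\<close> vanishes almost everywhere, the quotient \<open>c\<close>
      is 0 by the convention for division, and orthogonality to \<open>v\<close> is trivial.\<close>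
    case True
    then have "AE x in gauss. v x * v x = 0"
      using integral_nonneg_eq_0_iff_AE[OF integrable_mult_L2[OF v v]] by simp
    then have ae: "AE x in gauss. v x = 0" by eventually_elim simp
    have "gip (\<lambda>x. f x - f' x) v = (LINT x|(gauss :: 'a measure). (0::real))"
      by (rule integral_cong_AE) (use ae v fP in \<open>auto simp: L2_def\<close>)
    then show ?thesis using True by (simp add: fp[OF v])
  next
    case False
    then show ?thesis by (simp add: fp[OF v] c_def)
  qed
  have pL: "L2 gauss (\<lambda>x. f x - p x)"
    unfolding p_def using L2_diff[OF f L2_add[OF L(1) L2_cmult[OF v]]] .
  have "gip (\<lambda>x. f x - p x) u' = 0" by (rule spanned_orthogonal[OF Pu(1) LM pL om])
  then have "gip (\<lambda>x. f x - p x) u = 0"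
    using ov gip_add_right[OF v L(2) pL] by (simp add: v_def)
  with om sp show ?case by blast
qed

lemma poly_projection:
  fixes f :: "'a::euclidean_space \<Rightarrow> real"
  assumes "L2 gauss f"
  obtains p where "poly_le d p" "\<And>q. poly_le d q \<Longrightarrow> gip (\<lambda>x. f x - p x) q = 0"
proof -
  obtain M :: "('a \<Rightarrow> real) set" where M: "finite M" "\<And>m. m \<in> M \<Longrightarrow> poly_le d m"
    "\<And>p. poly_le d p \<Longrightarrow> spanned M p" using poly_le_finitely_spanned[of d] by blast
  have LM: "L2 gauss m" if "m \<in> M" for m using M(2)[OF that] by (intro poly_growth_L2 poly_le_growth)
  obtain p where p: "spanned M p" "\<And>m. m \<in> M \<Longrightarrow> gip (\<lambda>x. f x - p x) m = 0"
    using projection_exists[OF M(1) LM assms] by blast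
  have "poly_le d p" using p(1)
  proof (induction rule: spanned.induct)
    case (add m f c)
    show ?case by (rule poly_le.add[OF add.IH poly_le_cmult[OF M(2)[OF add.hyps(1)]]])
  qed (rule poly_le.const)
  moreover have "gip (\<lambda>x. f x - p x) q = 0" if "poly_le d q" for q
    by (rule spanned_orthogonal[OF M(3)[OF that] LM L2_diff[OF assms spanned_L2[OF p(1) LM]] p(2)])
  ultimately show ?thesis by (rule that)
qed

subsection \<open>Density of polynomials\<close>

definition poly_approximable :: "('a::euclidean_space \<Rightarrow> real) \<Rightarrow> bool" where
  "poly_approximable f \<longleftrightarrow> L2 gauss f \<and> (\<forall>\<epsilon>>0. \<exists>d p. poly_le d p \<and> gip (\<lambda>x. f x - p x) (\<lambda>x. f x - p x) < \<epsilon>)"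

lemma gip_add_self_le:
  assumes "L2 gauss f" "L2 gauss g"
  shows "gip (\<lambda>x. f x + g x) (\<lambda>x. f x + g x) \<le> 2 * gip f f + 2 * gip g g"
proof -
  have "gip (\<lambda>x. f x + g x) (\<lambda>x. f x + g x) \<le> (LINT x|gauss. 2 * (f x * f x) + 2 * (g x * g x))"
  proof (rule integral_mono)
    show "(f x + g x) * (f x + g x) \<le> 2 * (f x * f x) + 2 * (g x * g x)" for x
      using sum_squares_bound[of "f x" "g x"] by (simp add: power2_eq_square algebra_simps)
  qed (intro integrable_mult_L2 L2_add Bochner_Integration.integrable_add integrable_mult_right assms)+
  then show ?thesis using integrable_mult_L2[OF assms(1,1)] integrable_mult_L2[OF assms(2,2)] by simp
qed

lemma poly_approximable_limit:
  assumes f: "L2 gauss f"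
    and "\<And>\<epsilon>. \<epsilon> > 0 \<Longrightarrow> \<exists>g. poly_approximable g \<and> gip (\<lambda>x. f x - g x) (\<lambda>x. f x - g x) < \<epsilon>"
  shows "poly_approximable f"
  unfolding poly_approximable_def
proof (intro conjI f allI impI)
  fix \<epsilon> :: real assume "\<epsilon> > 0"
  \<comment> \<open>A quarter each, because \<open>gip_add_self_le\<close> doubles both
    contributions.\<close>
  obtain g where g: "poly_approximable g" "gip (\<lambda>x. f x - g x) (\<lambda>x. f x - g x) < \<epsilon> / 4"
    using assms(2)[of "\<epsilon> / 4"] \<open>\<epsilon> > 0\<close> by auto
  then have gL: "L2 gauss g" by (simp add: poly_approximable_def)
  obtain d p where p: "poly_le d p" "gip (\<lambda>x. g x - p x) (\<lambda>x. g x - p x) < \<epsilon> / 4"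
    using g(1) \<open>\<epsilon> > 0\<close> unfolding poly_approximable_def by (meson zero_less_divide_iff zero_less_numeral)
  have "gip (\<lambda>x. (f x - g x) + (g x - p x)) (\<lambda>x. (f x - g x) + (g x - p x)) < \<epsilon>"
    using gip_add_self_le[OF L2_diff[OF f gL] L2_diff[OF gL poly_growth_L2[OF poly_le_growth[OF p(1)]]]] g(2) p(2)
    by linarith
  then show "\<exists>d p. poly_le d p \<and> gip (\<lambda>x. f x - p x) (\<lambda>x. f x - p x) < \<epsilon>"
    using p(1) by auto
qed

text \<open>Closure under dominated pointwise limits; every enlargement of the class, from Gaussian
  factors up to all of L^2, goes through this lemma.\<close>

lemma poly_approximable_dominated:
  fixes s :: "nat \<Rightarrow> 'a::euclidean_space \<Rightarrow> real"
  assumes s: "\<And>n. poly_approximable (s n)" and lim: "\<And>x. (\<lambda>n. s n x) \<longlonglongrightarrow> f x"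
    and dom: "\<And>n x. \<bar>s n x\<bar> \<le> g x" and g: "L2 gauss g"
  shows "poly_approximable f"
proof (rule poly_approximable_limit)
  have sL: "L2 gauss (s n)" for n using s by (simp add: poly_approximable_def)
  then have [measurable]: "s n \<in> borel_measurable borel" for n by (simp add: L2_def)
  have [measurable]: "f \<in> borel_measurable borel"
    by (rule borel_measurable_LIMSEQ_metric[OF _ lim]) simp
  have fg: "\<bar>f x\<bar> \<le> g x" for x
    by (rule LIMSEQ_le_const2[OF tendsto_rabs[OF lim]]) (use dom in auto)
  show fL: "L2 gauss f"
    by (rule L2_bounded[OF g, of _ 1]) (auto intro: order_trans[OF fg abs_ge_self])
  have "(\<lambda>n. gip (\<lambda>x. f x - s n x) (\<lambda>x. f x - s n x)) \<longlonglongrightarrow> (LINT x|(gauss::'a measure). (0::real))"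
  proof (rule integral_dominated_convergence)
    show "integrable gauss (\<lambda>x. (2 * g x) * (2 * g x))" by (intro integrable_mult_L2 L2_cmult g)
    show "AE x in gauss. (\<lambda>n. (f x - s n x) * (f x - s n x)) \<longlonglongrightarrow> 0"
    proof (rule AE_I2)
      fix x
      have "(\<lambda>n. (f x - s n x) * (f x - s n x)) \<longlonglongrightarrow> (f x - f x) * (f x - f x)"
        by (intro tendsto_intros lim)
      then show "(\<lambda>n. (f x - s n x) * (f x - s n x)) \<longlonglongrightarrow> 0" by simp
    qed
    show "AE x in gauss. norm ((f x - s n x) * (f x - s n x)) \<le> (2 * g x) * (2 * g x)" for n
    proof (rule AE_I2)
      fix x
      have "\<bar>f x - s n x\<bar> \<le> 2 * g x" using fg[of x] dom[of n x] by linarith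
      then have "\<bar>f x - s n x\<bar> * \<bar>f x - s n x\<bar> \<le> (2 * g x) * (2 * g x)" by (intro mult_mono) auto
      then show "norm ((f x - s n x) * (f x - s n x)) \<le> (2 * g x) * (2 * g x)" by (simp add: abs_mult)
    qed
  qed auto
  then have l: "(\<lambda>n. gip (\<lambda>x. f x - s n x) (\<lambda>x. f x - s n x)) \<longlonglongrightarrow> 0" by simp
  fix \<epsilon> :: real assume "\<epsilon> > 0"
  from order_tendstoD(2)[OF l this] obtain n where "gip (\<lambda>x. f x - s n x) (\<lambda>x. f x - s n x) < \<epsilon>"
    by (auto simp: eventually_sequentially)
  then show "\<exists>g. poly_approximable g \<and> gip (\<lambda>x. f x - g x) (\<lambda>x. f x - g x) < \<epsilon>" using s by blast
qed

lemma poly_approximable_poly: "poly_le d p \<Longrightarrow> poly_approximable p"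
  unfolding poly_approximable_def
  by (auto intro!: exI[of _ d] exI[of _ p] poly_growth_L2 poly_le_growth)

lemma poly_approximable_add:
  assumes f: "poly_approximable f" and g: "poly_approximable g"
  shows "poly_approximable (\<lambda>x. f x + g x)"
  unfolding poly_approximable_def
proof (intro conjI allI impI)
  have L: "L2 gauss f" "L2 gauss g" using f g by (auto simp: poly_approximable_def)
  show "L2 gauss (\<lambda>x. f x + g x)" by (intro L2_add L)
  fix \<epsilon> :: real assume "\<epsilon> > 0"
  then have e4: "\<epsilon> / 4 > 0" by simp
  obtain d p where p: "poly_le d p" "gip (\<lambda>x. f x - p x) (\<lambda>x. f x - p x) < \<epsilon> / 4"
    using f e4 unfolding poly_approximable_def by blast
  obtain e q where q: "poly_le e q" "gip (\<lambda>x. g x - q x) (\<lambda>x. g x - q x) < \<epsilon> / 4"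
    using g e4 unfolding poly_approximable_def by blast
  have "poly_le (max d e) (\<lambda>x. p x + q x)"
    using p(1) q(1) by (intro poly_le.add; elim poly_le_mono) auto
  moreover have "gip (\<lambda>x. (f x - p x) + (g x - q x)) (\<lambda>x. (f x - p x) + (g x - q x)) < \<epsilon>"
    using gip_add_self_le[OF L2_diff[OF L(1) poly_growth_L2[OF poly_le_growth[OF p(1)]]]
        L2_diff[OF L(2) poly_growth_L2[OF poly_le_growth[OF q(1)]]]] p(2) q(2) by linarith
  moreover have "(\<lambda>x. (f x - p x) + (g x - q x)) = (\<lambda>x. f x + g x - (p x + q x))" by (auto simp: algebra_simps)
  ultimately show "\<exists>d p. poly_le d p \<and> gip (\<lambda>x. f x + g x - p x) (\<lambda>x. f x + g x - p x) < \<epsilon>" by metis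
qed

lemma poly_approximable_cmult:
  assumes f: "poly_approximable f"
  shows "poly_approximable (\<lambda>x. c * f x)"
  unfolding poly_approximable_def
proof (intro conjI allI impI)
  have L: "L2 gauss f" using f by (auto simp: poly_approximable_def)
  show "L2 gauss (\<lambda>x. c * f x)" by (intro L2_cmult L)
  fix \<epsilon> :: real assume "\<epsilon> > 0"
  then have e: "\<epsilon> / (c\<^sup>2 + 1) > 0" by (simp add: add_nonneg_pos)
  obtain d p where p: "poly_le d p" "gip (\<lambda>x. f x - p x) (\<lambda>x. f x - p x) < \<epsilon> / (c\<^sup>2 + 1)"
    using f e unfolding poly_approximable_def by blast
  have c1: "c\<^sup>2 + 1 > 0" by (simp add: add_nonneg_pos)
  have "gip (\<lambda>x. c * f x - c * p x) (\<lambda>x. c * f x - c * p x) = (LINT x|gauss. c\<^sup>2 * ((f x - p x) * (f x - p x)))"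
    by (intro Bochner_Integration.integral_cong refl) (simp add: power2_eq_square algebra_simps)
  also have "\<dots> = c\<^sup>2 * gip (\<lambda>x. f x - p x) (\<lambda>x. f x - p x)" by simp
  also have "\<dots> \<le> (c\<^sup>2 + 1) * gip (\<lambda>x. f x - p x) (\<lambda>x. f x - p x)" by (intro mult_right_mono) auto
  also have "\<dots> < \<epsilon>" using p(2) c1 by (simp add: pos_less_divide_eq mult.commute)
  finally show "\<exists>d p. poly_le d p \<and> gip (\<lambda>x. c * f x - p x) (\<lambda>x. c * f x - p x) < \<epsilon>"
    using poly_le_cmult[OF p(1)] by blast
qed

text \<open>The exponent \<open>1/8\<close> leaves room for \<open>exp (|x|\<^sup>2/8)\<close>, which dominates the Taylor polynomials of
  \<open>exp (-|x|\<^sup>2/8)\<close>, to be square integrable.\<close>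

definition small_gauss :: "'a::euclidean_space \<Rightarrow> real" where
  "small_gauss x = exp (- (norm x)\<^sup>2 / 8)"

lemma small_gauss_pos: "small_gauss x > 0" and small_gauss_le_1: "small_gauss x \<le> 1"
  by (simp_all add: small_gauss_def)

text \<open>Induction on \<open>k\<close>: one factor is the limit of its Taylor polynomials
  \<open>T m\<close>, which merely enlarge the polynomial in front. The other factors are at most 1,
  so \<open>\<bar>q x\<bar> * E x\<close> is a common majorant.\<close>

lemma poly_approximable_small_gauss: "poly_le d q \<Longrightarrow> poly_approximable (\<lambda>x. q x * small_gauss x ^ k)"
proof (induction k arbitrary: d q)
  case 0
  then show ?case using poly_approximable_poly by auto
next
  case (Suc k)
  define T :: "nat \<Rightarrow> 'a \<Rightarrow> real" where "T m x = (\<Sum>i<m. ((- 1 / 8) * (norm x)\<^sup>2) ^ i /\<^sub>R fact i)" for m x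
  define E where "E x = exp ((norm x)\<^sup>2 / 8)" for x :: 'a
  have T: "\<exists>e. poly_le e (T m)" for m
  proof -
    have "poly_le (i * 2) (\<lambda>x::'a. (1 / fact i) * ((- 1 / 8) * (norm x)\<^sup>2) ^ i)" for i
      by (intro poly_le_cmult poly_le_power poly_le_norm_square)
    then have "poly_le (m * 2) (\<lambda>x::'a. (1 / fact i) * ((- 1 / 8) * (norm x)\<^sup>2) ^ i)" if "i < m" for i
      by (rule poly_le_mono) (use that in auto)
    then have "poly_le (m * 2) (\<lambda>x::'a. \<Sum>i<m. (1 / fact i) * ((- 1 / 8) * (norm x)\<^sup>2) ^ i)"
      by (intro poly_le_sum) auto
    moreover have "(1 / fact i) * a ^ i = a ^ i /\<^sub>R fact i" for a :: real and i by (simp add: divide_inverse)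
    then have "(\<lambda>x. \<Sum>i<m. (1 / fact i) * ((- 1 / 8) * (norm x)\<^sup>2) ^ i) = T m"
      unfolding T_def by presburger
    ultimately show ?thesis by auto
  qed
  have TE: "\<bar>T m x\<bar> \<le> E x" for m x
  proof -
    have "\<bar>T m x\<bar> \<le> (\<Sum>i<m. ((norm x)\<^sup>2 / 8) ^ i /\<^sub>R fact i)"
      unfolding T_def by (rule order_trans[OF sum_abs]) (simp add: abs_mult power_abs)
    also have "\<dots> \<le> E x"
      unfolding E_def exp_def by (rule sum_le_suminf[OF summable_exp_generic]) auto
    finally show ?thesis .
  qed
  have Tlim: "(\<lambda>m. T m x) \<longlonglongrightarrow> small_gauss x" for x
    using exp_converges[of "(- 1 / 8) * (norm x)\<^sup>2"] unfolding sums_def T_def small_gauss_def by simp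
  show ?case
  proof (rule poly_approximable_dominated[where s = "\<lambda>m x. (q x * T m x) * small_gauss x ^ k" and g = "\<lambda>x. \<bar>q x\<bar> * E x"])
    show "poly_approximable (\<lambda>x. (q x * T m x) * small_gauss x ^ k)" for m
      using T[of m] Suc.IH poly_le_mult[OF Suc.prems] by blast
    show "(\<lambda>m. (q x * T m x) * small_gauss x ^ k) \<longlonglongrightarrow> q x * small_gauss x ^ Suc k" for x
      by (rule tendsto_eq_rhs[OF tendsto_mult[OF tendsto_mult[OF tendsto_const Tlim] tendsto_const]]) simp
    show "\<bar>(q x * T m x) * small_gauss x ^ k\<bar> \<le> \<bar>q x\<bar> * E x" for m x
    proof -
      have "\<bar>q x\<bar> * \<bar>T m x\<bar> * small_gauss x ^ k \<le> \<bar>q x\<bar> * E x * 1"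
        using TE[of m x] small_gauss_pos[of x] small_gauss_le_1[of x]
        by (intro mult_mono mult_left_mono power_le_one) (auto simp: E_def)
      then show ?thesis using small_gauss_pos[of x] by (simp add: abs_mult)
    qed
    have [measurable]: "q \<in> borel_measurable borel" "E \<in> borel_measurable borel"
      using poly_le_growth[OF Suc.prems] by (auto simp: E_def[abs_def] intro: poly_growth_measurable)
    have "integrable lborel (\<lambda>x. exp (- (1 / 4) * (norm x)\<^sup>2) * (q x)\<^sup>2)"
      by (intro integrable_gaussian_poly_growth poly_growth_power poly_le_growth[OF Suc.prems]) simp
    moreover have "exp (- (1 / 4) * (norm x)\<^sup>2) * (q x)\<^sup>2 = exp (- (norm x)\<^sup>2 / 2) * (norm (\<bar>q x\<bar> * E x))\<^sup>2" for x
    proof -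
      have "(E x)\<^sup>2 = exp ((norm x)\<^sup>2 / 4)" by (simp add: E_def power2_eq_square mult_exp_exp)
      moreover have "exp (- (1 / 4) * (norm x)\<^sup>2) = exp (- (norm x)\<^sup>2 / 2) * exp ((norm x)\<^sup>2 / 4)"
        by (simp add: mult_exp_exp)
      ultimately show ?thesis by (simp add: power_mult_distrib)
    qed
    ultimately show "L2 gauss (\<lambda>x. \<bar>q x\<bar> * E x)" by (simp add: L2_def integrable_gauss_iff)
  qed
qed

text \<open>The algebra generated by the coordinates and \<open>small_gauss\<close>; it contains the
  pull-backs of polynomial functions under \<open>compactify\<close>.\<close>

inductive gauss_poly :: "('a::euclidean_space \<Rightarrow> real) \<Rightarrow> bool" where
  base: "poly_le d q \<Longrightarrow> gauss_poly (\<lambda>x. q x * small_gauss x ^ k)"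
| add: "gauss_poly f \<Longrightarrow> gauss_poly g \<Longrightarrow> gauss_poly (\<lambda>x. f x + g x)"

lemma gauss_poly_approximable: "gauss_poly f \<Longrightarrow> poly_approximable f"
  by (induction rule: gauss_poly.induct) (auto intro: poly_approximable_small_gauss poly_approximable_add)

lemma gauss_poly_mult: "gauss_poly f \<Longrightarrow> gauss_poly g \<Longrightarrow> gauss_poly (\<lambda>x. f x * g x)"
proof (induction rule: gauss_poly.induct)
  case (base d q k)
  from base(2) show ?case
  proof (induction rule: gauss_poly.induct)
    case (base e r l)
    have "gauss_poly (\<lambda>x. (q x * r x) * small_gauss x ^ (k + l))"
      by (rule gauss_poly.base[OF poly_le_mult[OF \<open>poly_le d q\<close> base]])
    then show ?case by (simp add: power_add mult_ac)
  qed (auto simp: distrib_left intro: gauss_poly.add)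
qed (auto simp: distrib_right intro: gauss_poly.add)

text \<open>An embedding of the whole space into a bounded set, with \<open>x\<close> recoverable as
  the quotient of the components; it makes Stone-Weierstrass applicable although the domain is not
  compact.\<close>

definition compactify :: "'a::euclidean_space \<Rightarrow> 'a \<times> real" where
  "compactify x = (small_gauss x *\<^sub>R x, small_gauss x)"

lemma gauss_poly_compactify: "real_polynomial_function P \<Longrightarrow> gauss_poly (\<lambda>x. P (compactify x))"
proof (induction rule: real_polynomial_function.induct)
  case (linear f)
  interpret f: bounded_linear f by fact
  have "f (compactify x) = (f (0, 1) + (\<Sum>b\<in>Basis. f (b, 0) * (x \<bullet> b))) * small_gauss x ^ 1" for x :: 'a
  proof -
    have "compactify x = small_gauss x *\<^sub>R ((0, 1) + (\<Sum>b\<in>Basis. (x \<bullet> b) *\<^sub>R (b, 0)))"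
      by (auto simp: compactify_def prod_eq_iff fst_sum snd_sum euclidean_representation)
    then show ?thesis
      by (simp only: f.scaleR f.add f.sum) (simp add: mult_ac)
  qed
  moreover have "poly_le 1 (\<lambda>x::'a. f (0, 1) + (\<Sum>b\<in>Basis. f (b, 0) * (x \<bullet> b)))"
    by (intro poly_le.add poly_le.const poly_le_sum poly_le_cmult) (auto intro: poly_le_inner)
  ultimately show ?case using gauss_poly.base[of 1 _ 1] by simp
next
  case (const c)
  from gauss_poly.base[OF poly_le.const, of c 0] show ?case by simp
qed (auto intro: gauss_poly.add gauss_poly_mult)

lemma bounded_range_compactify: "bounded (range compactify)"
proof -
  have "norm (compactify x) \<le> 8 + 1" for x :: 'a
  proof -
    have "norm x \<le> 8 * (1 + (norm x)\<^sup>2 / 8)"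
      using sum_squares_bound[of 1 "norm x"] by simp (use norm_ge_zero[of x] in linarith)
    also have "\<dots> \<le> 8 * exp ((norm x)\<^sup>2 / 8)" by (intro mult_left_mono exp_ge_add_one_self) auto
    finally have "small_gauss x * norm x \<le> small_gauss x * (8 * exp ((norm x)\<^sup>2 / 8))"
      using small_gauss_pos[of x] by (intro mult_left_mono) auto
    also have "\<dots> = 8" by (simp add: small_gauss_def mult_exp_exp mult.left_commute)
    finally have "norm (small_gauss x *\<^sub>R x) \<le> 8" using small_gauss_pos[of x] by simp
    moreover have "norm (small_gauss x) \<le> 1" using small_gauss_pos[of x] small_gauss_le_1[of x] by simp
    ultimately show ?thesis unfolding compactify_def
      using norm_Pair_le[of "small_gauss x *\<^sub>R x" "small_gauss x"] by linarith
  qed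
  then show ?thesis by (auto simp: bounded_iff)
qed

text \<open>A continuous \<open>F\<close> with \<open>F (compactify x) = \<psi> x\<close> is
  uniformly approximated by polynomials on the closure of the image, and their pull-backs are
  approximable by polynomials in \<open>x\<close>.\<close>

lemma poly_approximable_compact_support:
  fixes \<psi> :: "'a::euclidean_space \<Rightarrow> real"
  assumes \<psi>: "continuous_on UNIV \<psi>" and sup: "\<And>x. norm x > R \<Longrightarrow> \<psi> x = 0"
  shows "poly_approximable \<psi>"
proof -
  \<comment> \<open>The value of \<open>small_gauss\<close> at radius \<open>R\<close>. The factor
    \<open>\<theta>\<close> is 1 from \<open>t0\<close> upwards and 0 below \<open>t0 / 2\<close>,
    so \<open>F\<close> is continuous at vanishing second component while \<open>max\<close> keeps
    the quotient defined; in the gap between both values \<open>\<psi>\<close> already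
    vanishes.\<close>
  define t0 where "t0 = exp (- R\<^sup>2 / 8)"
  define \<theta> where "\<theta> t = max 0 (min 1 (2 * t / t0 - 1))" for t :: real
  define F where "F y = \<psi> (fst y /\<^sub>R max (snd y) (t0 / 2)) * \<theta> (snd y)" for y :: "'a \<times> real"
  have t0: "t0 > 0" by (simp add: t0_def)
  have FC: "F (compactify x) = \<psi> x" for x
  proof (cases "norm x \<le> \<bar>R\<bar>")
    case True
    then have "(norm x)\<^sup>2 \<le> R\<^sup>2" by (metis abs_le_square_iff abs_norm_cancel)
    then have "small_gauss x \<ge> t0" by (simp add: small_gauss_def t0_def)
    then show ?thesis using t0 by (auto simp: F_def compactify_def \<theta>_def max_def min_def field_simps)
  next
    case False
    then have z: "\<psi> x = 0" using sup by auto
    show ?thesis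
    proof (cases "small_gauss x \<ge> t0 / 2")
      case True
      then show ?thesis using t0 z small_gauss_pos[of x] by (auto simp: F_def compactify_def max_def)
    next
      case False
      then show ?thesis using t0 z by (auto simp: F_def compactify_def \<theta>_def max_def min_def field_simps)
    qed
  qed
  have "continuous_on UNIV F"
    unfolding F_def \<theta>_def
    by (intro continuous_intros continuous_on_compose2[OF \<psi>]) (use t0 in auto)
  then have cF: "continuous_on (closure (range compactify)) F" by (rule continuous_on_subset) simp
  have K: "compact (closure (range (compactify :: 'a \<Rightarrow> _)))" using bounded_range_compactify by (simp add: compact_closure)
  have "\<exists>P. real_polynomial_function P \<and> (\<forall>x\<in>closure (range compactify). \<bar>F x - P x\<bar> < 1 / real (Suc n))" for n
    using Stone_Weierstrass_real_polynomial_function[OF K cF, of "1 / real (Suc n)"] by (metis of_nat_0_less_iff zero_less_Suc zero_less_divide_1_iff)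
  then obtain P where P: "\<And>n. real_polynomial_function (P n)"
    "\<And>n x. x \<in> closure (range compactify) \<Longrightarrow> \<bar>F x - P n x\<bar> < 1 / real (Suc n)" by metis
  have app: "\<bar>\<psi> x - P n (compactify x)\<bar> < 1 / real (Suc n)" for n x
    using P(2)[of "compactify x" n] closure_subset[of "range compactify"] by (auto simp: FC)
  obtain C where C: "C \<ge> 0" "\<And>x. norm x \<le> R \<Longrightarrow> norm (\<psi> x) \<le> C" using bounded_on_ball[OF \<psi>] by metis
  have C': "\<bar>\<psi> x\<bar> \<le> C" for x using C(1) C(2)[of x] sup[of x] by (cases "norm x \<le> R") auto
  show ?thesis
  proof (rule poly_approximable_dominated[where s = "\<lambda>n x. P n (compactify x)" and g = "\<lambda>_. C + 1"])
    show "poly_approximable (\<lambda>x. P n (compactify x))" for n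
      by (intro gauss_poly_approximable gauss_poly_compactify P)
    show "(\<lambda>n. P n (compactify x)) \<longlonglongrightarrow> \<psi> x" for x
    proof (rule LIM_zero_cancel, rule tendsto_rabs_zero_cancel, rule tendsto_sandwich[OF _ _ tendsto_const])
      show "\<forall>\<^sub>F n in sequentially. \<bar>P n (compactify x) - \<psi> x\<bar> \<le> 1 / real (Suc n)"
        using app[of x] by (intro always_eventually allI) (simp add: abs_minus_commute less_imp_le)
      show "(\<lambda>n. 1 / real (Suc n)) \<longlonglongrightarrow> 0" by real_asymp
    qed simp
    show "\<bar>P n (compactify x)\<bar> \<le> C + 1" for n x
    proof -
      have "1 / real (Suc n) \<le> 1" by simp
      then show ?thesis using app[of x n] C'[of x] by linarith
    qed
  qed (intro poly_growth_L2 poly_growth_const)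
qed

text \<open>The same Dynkin system as for the fundamental lemma: boxes are limits of continuous
  functions of compact support, complements and disjoint unions follow from linearity and dominated
  limits.\<close>

lemma poly_approximable_indicator:
  fixes A :: "'a::euclidean_space set"
  assumes "A \<in> sets borel"
  shows "poly_approximable (indicator A :: 'a \<Rightarrow> real)"
proof -
  have 1: "L2 gauss (\<lambda>_::'a. 1::real)" by (intro poly_growth_L2 poly_growth_const)
  have "Int_stable (range (\<lambda>(a, b). box a b :: 'a set))"
    "range (\<lambda>(a, b). box a b :: 'a set) \<subseteq> Pow UNIV"
    "A \<in> sigma_sets UNIV (range (\<lambda>(a, b). box a b))"
    using assms by (auto simp: borel_eq_box Int_stable_def box_Int_box)
  then show ?thesis
  proof (induction rule: sigma_sets_induct_disjoint)
    case (basic X)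
    then obtain a b where X: "X = box a b" by auto
    obtain \<phi> :: "nat \<Rightarrow> 'a \<Rightarrow> real" where \<phi>: "\<And>j. test_function UNIV (\<phi> j)"
      "\<And>j x. 0 \<le> \<phi> j x \<and> \<phi> j x \<le> indicator (cbox a b) x" "\<And>x. (\<lambda>j. \<phi> j x) \<longlonglongrightarrow> indicator (box a b) x"
      using box_test_functions[of a b UNIV] by auto
    obtain R where R: "\<And>x. x \<in> cbox a b \<Longrightarrow> norm x \<le> R"
      using bounded_cbox[of a b] by (auto simp: bounded_iff)
    show ?case unfolding X
    proof (rule poly_approximable_dominated[OF _ \<phi>(3) _ 1])
      show "poly_approximable (\<phi> j)" for j
      proof (rule poly_approximable_compact_support[of _ R])
        show "\<phi> j x = 0" if "norm x > R" for x
          using \<phi>(2)[of j x] R[of x] that by (cases "x \<in> cbox a b") auto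
      qed (rule smooth_continuous[OF test_function_smooth[OF \<phi>(1)]])
      show "\<bar>\<phi> j x\<bar> \<le> 1" for j x using \<phi>(2)[of j x] by (cases "x \<in> cbox a b") auto
    qed
  next
    case empty
    from poly_approximable_poly[OF poly_le.const[of 0 0]] show ?case by simp
  next
    case (compl B)
    have "poly_approximable (\<lambda>x. 1 + (-1) * indicator B x)"
      by (intro poly_approximable_add poly_approximable_cmult compl poly_approximable_poly[OF poly_le.const])
    moreover have "(\<lambda>x. 1 + (-1) * indicator B x) = (indicator (UNIV - B) :: 'a \<Rightarrow> real)"
      by (auto simp: indicator_def)
    ultimately show ?case by simp
  next
    case (union B)
    show ?case
    proof (rule poly_approximable_dominated[OF _ _ _ 1, where s = "\<lambda>n x. \<Sum>i<n. indicator (B i) x"])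
      show "poly_approximable (\<lambda>x. \<Sum>i<n. indicator (B i) x :: real)" for n
      proof (induction n)
        case 0
        then show ?case using poly_approximable_poly[OF poly_le.const[of 0 0]] by simp
      next
        case (Suc n)
        then show ?case using poly_approximable_add[OF Suc union(3)[of n]] by simp
      qed
      show "(\<lambda>n. \<Sum>i<n. indicator (B i) x) \<longlonglongrightarrow> (indicator (\<Union> (range B)) x :: real)" for x
      proof (cases "\<exists>k. x \<in> B k")
        case True
        then obtain k where k: "x \<in> B k" by blast
        have "(\<Sum>i<n. indicator (B i) x) = (1::real)" if "n > k" for n
        proof -
          have "i \<noteq> k \<Longrightarrow> x \<notin> B i" for i using union(1) k by (auto simp: disjoint_family_on_def)
          then have "(\<Sum>i<n. indicator (B i) x) = (\<Sum>i<n. if i = k then 1 else (0::real))"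
            using k by (intro sum.cong) (auto simp: indicator_def)
          then show ?thesis using that by simp
        qed
        then have "\<forall>\<^sub>F n in sequentially. (\<Sum>i<n. indicator (B i) x) = (1::real)"
          by (intro eventually_mono[OF eventually_gt_at_top[of k]])
        then have "(\<lambda>n. \<Sum>i<n. indicator (B i) x) \<longlonglongrightarrow> (1::real)" by (rule tendsto_eventually)
        then show ?thesis using k by (auto simp: indicator_def)
      next
        case False
        then show ?thesis by auto
      qed
      show "\<bar>\<Sum>i<n. indicator (B i) x\<bar> \<le> (1::real)" for n x
      proof -
        have "(\<Sum>i<n. indicator (B i) x) = (indicator (\<Union>i<n. B i) x :: real)"
          using union(1) by (intro indicator_UN_disjoint[symmetric]) (auto simp: disjoint_family_on_def)
        then show ?thesis by (simp add: indicator_def)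
      qed
    qed
  qed
qed

text \<open>Square integrable functions are dominated limits of simple functions, which are
  combinations of indicators.\<close>

lemma poly_dense:
  fixes u :: "'a::euclidean_space \<Rightarrow> real"
  assumes u: "L2 gauss u"
  shows "poly_approximable u"
proof -
  have [measurable]: "u \<in> borel_measurable borel" using u by (simp add: L2_def)
  obtain s where s: "\<And>i. simple_function borel (s i)" "\<And>x. (\<lambda>i. s i x) \<longlonglongrightarrow> u x"
    "\<And>i x. norm (s i x) \<le> 2 * norm (u x)"
    using borel_measurable_implies_sequence_metric[of u borel 0] by auto
  show ?thesis
  proof (rule poly_approximable_dominated[OF _ s(2)])
    show "\<bar>s i x\<bar> \<le> 2 * \<bar>u x\<bar>" for i x using s(3)[of i x] by simp
    show "L2 gauss (\<lambda>x. 2 * \<bar>u x\<bar>)" by (rule L2_bounded[OF u, of _ 2]) auto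
    fix i
    have fin: "finite (range (s i))" using simple_functionD(1)[OF s(1)[of i]] by simp
    have "poly_approximable (\<lambda>x. \<Sum>y\<in>I. y * indicator (s i -` {y}) x)" if "finite I" for I
      using that
    proof (induction I rule: finite_induct)
      case empty
      then show ?case using poly_approximable_poly[OF poly_le.const[of 0 0]] by simp
    next
      case (insert y I)
      have "s i -` {y} \<in> sets borel" using simple_functionD(2)[OF s(1)[of i], of "{y}"] by simp
      from poly_approximable_add[OF poly_approximable_cmult[OF poly_approximable_indicator[OF this]] insert.IH]
      show ?case by (simp only: sum.insert[OF insert.hyps])
    qed
    from this[OF fin] have "poly_approximable (\<lambda>x. \<Sum>y\<in>range (s i). y * indicator (s i -` {y}) x)" .
    moreover have "(\<Sum>y\<in>range (s i). y * indicator (s i -` {y}) x) = s i x" for x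
    proof -
      have "(\<Sum>y\<in>range (s i). y * indicator (s i -` {y}) x) = (\<Sum>y\<in>range (s i). if y = s i x then y else 0)"
        by (intro sum.cong) (auto simp: indicator_def)
      then show ?thesis using fin by simp
    qed
    ultimately show "poly_approximable (s i)" by simp
  qed
qed

subsection \<open>The spectral gap inequality\<close>

lemma gip_norm_square:
  assumes "L2 gauss G"
  shows "(LINT x|gauss. (norm (G x))\<^sup>2) = (\<Sum>b\<in>Basis. gip (\<lambda>x. G x \<bullet> b) (\<lambda>x. G x \<bullet> b))"
proof -
  have "L2 gauss (\<lambda>x. G x \<bullet> b)" if "b \<in> Basis" for b
    by (rule L2_bounded[OF assms, of _ 1]) (use assms that in \<open>auto simp: L2_def Basis_le_norm\<close>)
  then have "integrable gauss (\<lambda>x. (G x \<bullet> b) * (G x \<bullet> b))" if "b \<in> Basis" for b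
    using that by (intro integrable_mult_L2)
  moreover have "(norm (G x))\<^sup>2 = (\<Sum>b\<in>Basis. (G x \<bullet> b) * (G x \<bullet> b))" for x
    unfolding power2_norm_eq_inner by (rule euclidean_inner)
  ultimately show ?thesis by (simp add: Bochner_Integration.integral_sum)
qed

text \<open>The Ornstein-Uhlenbeck operator acts as \<open>d\<close> on the orthogonal complement of the polynomials of
  degree \<open>d - 1\<close> in those of degree \<open>d\<close>.\<close>

lemma gauss_spectral_gap:
  fixes u :: "'a::euclidean_space \<Rightarrow> real"
  assumes L2: "L2 gauss u" "L2 gauss G"
    and ibp: "\<And>d p b. poly_le d p \<Longrightarrow> b \<in> Basis \<Longrightarrow>
      (LINT x|gauss. (G x \<bullet> b) * p x) = (LINT x|gauss. u x * (p x * (x \<bullet> b) - grad p x \<bullet> b))"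
    and mean: "gip (\<lambda>x. u x - a) (\<lambda>_. 1) = 0" and lin: "\<And>b. b \<in> Basis \<Longrightarrow> gip (\<lambda>x. u x - a) (\<lambda>x. x \<bullet> b) = 0"
  shows "2 * gip (\<lambda>x. u x - a) (\<lambda>x. u x - a) \<le> (LINT x|gauss. (norm (G x))\<^sup>2)"
proof -
  have "\<forall>d. \<exists>p. poly_le d p \<and> (\<forall>q. poly_le d q \<longrightarrow> gip (\<lambda>x. u x - p x) q = 0)"
  proof
    fix d
    obtain p where p: "poly_le d p" "\<And>q. poly_le d q \<Longrightarrow> gip (\<lambda>x. u x - p x) q = 0"
      using poly_projection[OF L2(1), of d] by blast
    show "\<exists>p. poly_le d p \<and> (\<forall>q. poly_le d q \<longrightarrow> gip (\<lambda>x. u x - p x) q = 0)"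
      by (intro exI[of _ p] conjI allI impI p)
  qed
  \<comment> \<open>\<open>w d\<close> is the orthogonal projection of \<open>u\<close> onto
    polynomials of degree at most \<open>d\<close>.\<close>
  from choice[OF this] obtain w where w: "\<And>d. poly_le d (w d)"
    "\<And>d q. poly_le d q \<Longrightarrow> gip (\<lambda>x. u x - w d x) q = 0" by blast
  have PL: "L2 gauss p" if "poly_le d p" for d and p :: "'a \<Rightarrow> real"
    using that by (intro poly_growth_L2 poly_le_growth)
  have GL: "L2 gauss (\<lambda>x. G x \<bullet> b)" if "b \<in> Basis" for b
    by (rule L2_bounded[OF L2(2), of _ 1]) (use L2 that in \<open>auto simp: L2_def Basis_le_norm\<close>)
  define D where "D d = (\<Sum>b\<in>Basis. gip (\<lambda>x. grad (w d) x \<bullet> b) (\<lambda>x. grad (w d) x \<bullet> b))" for d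
  have gradPL: "L2 gauss (\<lambda>x. grad p x \<bullet> b)" if "poly_le d p" "b \<in> Basis" for d b and p :: "'a \<Rightarrow> real"
    using PL[OF poly_le_grad[OF that]] .
  \<comment> \<open>Bessel's inequality for the gradient. Integration by parts moves
    \<open>G x \<bullet> b\<close> paired with \<open>r\<close> to \<open>u\<close> paired with a
    polynomial of degree at most \<open>d\<close>, where \<open>u\<close> may be replaced by
    \<open>w d\<close>; hence \<open>r\<close> is orthogonal to the remainder
    \<open>G x \<bullet> b - r x\<close>.\<close>
  have DG: "D d \<le> (LINT x|gauss. (norm (G x))\<^sup>2)" for d
    unfolding D_def gip_norm_square[OF L2(2)]
  proof (rule sum_mono)
    fix b :: 'a assume b: "b \<in> Basis"
    define r where "r x = grad (w d) x \<bullet> b" for x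
    have r: "poly_le (d - 1) r" unfolding r_def[abs_def] by (rule poly_le_grad[OF w(1) b])
    have rL: "L2 gauss r" by (rule PL[OF r])
    have "gip (\<lambda>x. G x \<bullet> b) r = gip r r"
    proof (cases d)
      case 0
      then have "r = (\<lambda>_. 0)" using poly_le_0_grad[OF w(1)[of 0]] by (auto simp: r_def)
      then show ?thesis by simp
    next
      case (Suc e)
      have q: "poly_le d (\<lambda>x. r x * (x \<bullet> b) - grad r x \<bullet> b)"
      proof (rule poly_le_diff)
        show "poly_le d (\<lambda>x. r x * (x \<bullet> b))" using poly_le.mult[OF r b] Suc by (simp add: mult.commute)
        show "poly_le d (\<lambda>x. grad r x \<bullet> b)" by (rule poly_le_mono[OF poly_le_grad[OF r b]]) simp
      qed
      have "gip (\<lambda>x. G x \<bullet> b) r = gip u (\<lambda>x. r x * (x \<bullet> b) - grad r x \<bullet> b)"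
        by (rule ibp[OF r b])
      also have "\<dots> = gip (w d) (\<lambda>x. r x * (x \<bullet> b) - grad r x \<bullet> b)"
        using w(2)[OF q] gip_diff_left[OF L2(1) PL[OF w(1)] PL[OF q]] by simp
      also have "\<dots> = gip r r"
        using poly_integration_by_parts[OF w(1) r b] by (simp add: r_def)
      finally show ?thesis .
    qed
    then have "gip (\<lambda>x. G x \<bullet> b - r x) r = 0" using gip_diff_left[OF GL[OF b] rL rL] by simp
    from gip_pythagoras[OF L2_diff[OF GL[OF b] rL] rL this]
    have "gip r r \<le> gip (\<lambda>x. G x \<bullet> b) (\<lambda>x. G x \<bullet> b)"
      using gip_self_nonneg[of "\<lambda>x. G x \<bullet> b - r x"] by simp
    then show "gip (\<lambda>x. grad (w d) x \<bullet> b) (\<lambda>x. grad (w d) x \<bullet> b) \<le> gip (\<lambda>x. G x \<bullet> b) (\<lambda>x. G x \<bullet> b)"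
      by (simp add: r_def)
  qed
  \<comment> \<open>The Ornstein-Uhlenbeck operator with positive sign; \<open>green\<close> says
    that it represents the Dirichlet form of the weight.\<close>
  define OU where "OU p x = grad p x \<bullet> x - (\<Sum>b\<in>Basis. grad (\<lambda>x. grad p x \<bullet> b) x \<bullet> b)" for p and x :: 'a
  have green: "(\<Sum>b\<in>Basis. gip (\<lambda>x. grad p x \<bullet> b) (\<lambda>x. grad q x \<bullet> b)) = gip p (OU q)"
    if p: "poly_le d p" and q: "poly_le e q" for p q :: "'a \<Rightarrow> real" and d e
  proof -
    have h: "L2 gauss (\<lambda>x. (grad q x \<bullet> b) * (x \<bullet> b) - grad (\<lambda>x. grad q x \<bullet> b) x \<bullet> b)" if b: "b \<in> Basis" for b
      by (intro L2_diff PL[OF poly_le_mult[OF poly_le_grad[OF q b] poly_le_inner[OF b]]]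
        PL[OF poly_le_grad[OF poly_le_grad[OF q b] b]])
    have "(\<Sum>b\<in>Basis. gip (\<lambda>x. grad p x \<bullet> b) (\<lambda>x. grad q x \<bullet> b))
        = (\<Sum>b\<in>Basis. gip p (\<lambda>x. (grad q x \<bullet> b) * (x \<bullet> b) - grad (\<lambda>x. grad q x \<bullet> b) x \<bullet> b))"
      by (rule sum.cong[OF refl], rule poly_integration_by_parts[OF p poly_le_grad[OF q]])
    also have "\<dots> = (LINT x|gauss. (\<Sum>b\<in>Basis. p x * ((grad q x \<bullet> b) * (x \<bullet> b) - grad (\<lambda>x. grad q x \<bullet> b) x \<bullet> b)))"
      by (rule Bochner_Integration.integral_sum[symmetric]) (intro integrable_mult_L2 PL[OF p] h)
    also have "\<dots> = gip p (OU q)"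
      by (simp add: OU_def sum_distrib_left[symmetric] sum_subtractf euclidean_inner[of "grad q _", symmetric])
    finally show ?thesis .
  qed
  have laplace: "poly_le (d - 1) (\<lambda>x. \<Sum>b\<in>Basis. grad (\<lambda>x. grad p x \<bullet> b) x \<bullet> b)" if "poly_le d p" for d and p :: "'a \<Rightarrow> real"
    by (intro poly_le_sum poly_le_mono[OF poly_le_grad[OF poly_le_grad[OF that]]]) auto
  have OU_le: "poly_le d (OU p)" if p: "poly_le d p" for d and p :: "'a \<Rightarrow> real"
    unfolding OU_def[abs_def]
  proof (rule poly_le_diff)
    show "poly_le d (\<lambda>x. grad p x \<bullet> x)"
    proof (cases d)
      case 0
      then have "grad p x = 0" for x using poly_le_0_grad[of p x] p by simp
      then show ?thesis by (simp add: poly_le.const)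
    next
      case (Suc e)
      then have "poly_le e (\<lambda>x. grad p x \<bullet> x - real d * p x)" using poly_le_euler[OF p] by simp
      then have "poly_le d (\<lambda>x. (grad p x \<bullet> x - real d * p x) + real d * p x)"
        using Suc p by (intro poly_le.add poly_le_cmult) (auto intro: poly_le_Suc)
      then show ?thesis by simp
    qed
    show "poly_le d (\<lambda>x. \<Sum>b\<in>Basis. grad (\<lambda>x. grad p x \<bullet> b) x \<bullet> b)"
      by (rule poly_le_mono[OF laplace[OF p]]) simp
  qed
  \<comment> \<open>The component of \<open>u\<close> in degree exactly \<open>Suc d\<close>:
    orthogonal to all polynomials of degree at most \<open>d\<close>.\<close>
  define s where "s d x = w (Suc d) x - w d x" for d x
  have sP: "poly_le (Suc d) (s d)" for d
    unfolding s_def[abs_def] by (intro poly_le_diff w poly_le_Suc)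
  have s_orth: "gip (s d) q = 0" if q: "poly_le d q" for d q
  proof -
    have "gip (s d) q = gip (\<lambda>x. (u x - w d x) - (u x - w (Suc d) x)) q" by (simp add: s_def)
    also have "\<dots> = gip (\<lambda>x. u x - w d x) q - gip (\<lambda>x. u x - w (Suc d) x) q"
      by (rule gip_diff_left) (intro L2_diff L2 PL[OF w(1)] PL[OF q])+
    finally show ?thesis using w(2)[OF q] w(2)[OF poly_le_Suc[OF q]] by simp
  qed
  \<comment> \<open>The cross term vanishes because \<open>OU\<close> preserves the degree bound of
    \<open>w d\<close>, to which \<open>s d\<close> is orthogonal; the square term yields the
    eigenvalue \<open>Suc d\<close>.\<close>
  have step: "D (Suc d) = D d + real (Suc d) * gip (s d) (s d)" for d
  proof -
    have e: "grad (w (Suc d)) x = grad (w d) x + grad (s d) x" for x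
      using grad_add[OF poly_le_smooth[OF w(1)] poly_le_smooth[OF sP], of d d x] by (simp add: s_def)
    have "D (Suc d) = (\<Sum>b\<in>Basis. gip (\<lambda>x. grad (w d) x \<bullet> b) (\<lambda>x. grad (w d) x \<bullet> b)
        + 2 * gip (\<lambda>x. grad (s d) x \<bullet> b) (\<lambda>x. grad (w d) x \<bullet> b) + gip (\<lambda>x. grad (s d) x \<bullet> b) (\<lambda>x. grad (s d) x \<bullet> b))"
      unfolding D_def e inner_add_left
      by (intro sum.cong refl)
        (simp add: gip_add_left gip_add_right L2_add gradPL[OF w(1)] gradPL[OF sP]
          gip_commute[of "\<lambda>x. grad (w d) x \<bullet> _" "\<lambda>x. grad (s d) x \<bullet> _"])
    also have "\<dots> = D d + 2 * gip (s d) (OU (w d)) + gip (s d) (OU (s d))"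
      by (simp add: sum.distrib D_def sum_distrib_left[symmetric] green[OF sP w(1)] green[OF sP sP])
    also have "gip (s d) (OU (w d)) = 0" by (rule s_orth[OF OU_le[OF w(1)]])
    also have "gip (s d) (OU (s d)) = real (Suc d) * gip (s d) (s d)"
    proof -
      \<comment> \<open>The failure of \<open>s d\<close> to be an exact eigenfunction. Euler's
        relation and the Laplacian both lower the degree, so this remainder is orthogonal to
        \<open>s d\<close> and does not show in the pairing.\<close>
      define r where "r x = (grad (s d) x \<bullet> x - real (Suc d) * s d x) - (\<Sum>b\<in>Basis. grad (\<lambda>x. grad (s d) x \<bullet> b) x \<bullet> b)" for x
      have r: "poly_le d r"
        unfolding r_def[abs_def]
        using poly_le_diff[OF poly_le_euler[OF sP[of d], unfolded nat.case] laplace[OF sP[of d], unfolded diff_Suc_1]] .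
      have "OU (s d) = (\<lambda>x. real (Suc d) * s d x + r x)" by (auto simp: OU_def r_def)
      then have "gip (s d) (OU (s d)) = gip (s d) (\<lambda>x. real (Suc d) * s d x) + gip (s d) r"
        by (simp only:) (rule gip_add_right[OF L2_cmult[OF PL[OF sP]] PL[OF r] PL[OF sP]])
      then show ?thesis using s_orth[OF r] gip_cmult_right[of "s d" "real (Suc d)" "s d"] by linarith
    qed
    finally show ?thesis by simp
  qed
  define N where "N d = gip (\<lambda>x. w d x - a) (\<lambda>x. w d x - a)" for d
  have waP: "poly_le d (\<lambda>x. w d x - a)" for d by (intro poly_le_diff w poly_le.const)
  have Nstep: "N (Suc d) = N d + gip (s d) (s d)" for d
  proof -
    have "gip (\<lambda>x. w d x - a) (s d) = 0"
      using s_orth[OF waP, of d] gip_commute[of "\<lambda>x. w d x - a" "s d"] by linarith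
    from gip_pythagoras[OF PL[OF waP] PL[OF sP] this]
    have "gip (\<lambda>x. (w d x - a) + s d x) (\<lambda>x. (w d x - a) + s d x) = N d + gip (s d) (s d)"
      by (simp only: N_def)
    moreover have "(w d x - a) + s d x = w (Suc d) x - a" for x by (simp add: s_def)
    ultimately show ?thesis by (simp only: N_def)
  qed
  \<comment> \<open>The hypotheses on mean and linear moments say that the projection of
    \<open>u - a\<close> onto degree at most 1 is zero.\<close>
  have N1: "N 1 = 0"
  proof -
    have ua: "L2 gauss (\<lambda>x. u x - a)" by (intro L2_diff L2 poly_growth_L2 poly_growth_const)
    have "gip (\<lambda>x. u x - a) q = 0" if "poly_le d q" "d = 1" for q d
      using that
    proof (induction rule: poly_le.induct)
      case (const d c)
      then show ?case using mean gip_cmult_right[of "\<lambda>x. u x - a" c "\<lambda>_. 1"] by simp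
    next
      case (add d p q)
      then show ?case using gip_add_right[OF PL[OF add.hyps(1)] PL[OF add.hyps(2)] ua] by simp
    next
      case (mult d p b)
      then obtain c where "p = (\<lambda>_. c)" using poly_le_0 by auto
      then show ?case using lin[OF mult.hyps(2)] gip_cmult_right[of "\<lambda>x. u x - a" c "\<lambda>x. x \<bullet> b"] by (simp add: mult.commute)
    qed
    from this[OF waP] have "gip (\<lambda>x. u x - a) (\<lambda>x. w 1 x - a) = 0" by simp
    moreover have "N 1 = gip (\<lambda>x. (u x - a) - (u x - w 1 x)) (\<lambda>x. w 1 x - a)" by (simp add: N_def)
    moreover have "\<dots> = gip (\<lambda>x. u x - a) (\<lambda>x. w 1 x - a) - gip (\<lambda>x. u x - w 1 x) (\<lambda>x. w 1 x - a)"
      by (rule gip_diff_left) (intro ua L2_diff L2 PL[OF w(1)] PL[OF waP])+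
    ultimately show ?thesis using w(2)[OF waP, of 1] by simp
  qed
  \<comment> \<open>The induction starts in degree 1, where \<open>N 1 = 0\<close>; each later
    increment carries an eigenvalue of at least 2.\<close>
  have DN: "2 * N (Suc d) \<le> D (Suc d)" for d
  proof (induction d)
    case 0
    have "D 1 \<ge> 0" unfolding D_def by (intro sum_nonneg) auto
    then show ?case using N1 by simp
  next
    case (Suc d)
    have "2 * gip (s (Suc d)) (s (Suc d)) \<le> real (Suc (Suc d)) * gip (s (Suc d)) (s (Suc d))"
      by (intro mult_right_mono gip_self_nonneg) simp
    then show ?case using Suc step[of "Suc d"] Nstep[of "Suc d"] by linarith
  qed
  show ?thesis
  proof (rule field_le_epsilon)
    fix \<epsilon> :: real assume "\<epsilon> > 0"
    then have "\<epsilon> / 2 > 0" by simp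
    then obtain d p where p: "poly_le d p" "gip (\<lambda>x. u x - p x) (\<lambda>x. u x - p x) < \<epsilon> / 2"
      using poly_dense[OF L2(1)] unfolding poly_approximable_def by blast
    \<comment> \<open>The projection is the best approximation, so it is at least as close to
      \<open>u\<close> as \<open>p\<close>. The successor ensures degree at least 1, where
      \<open>DN\<close> holds.\<close>
    let ?e = "Suc d"
    have pe: "poly_le ?e (\<lambda>x. w ?e x - p x)" by (intro poly_le_diff w poly_le_Suc p(1))
    have uw: "L2 gauss (\<lambda>x. u x - w ?e x)" by (intro L2_diff L2 PL[OF w(1)])
    have "gip (\<lambda>x. u x - w ?e x) (\<lambda>x. u x - w ?e x) \<le> gip (\<lambda>x. u x - p x) (\<lambda>x. u x - p x)"
      using gip_pythagoras[OF uw PL[OF pe] w(2)[OF pe]] gip_self_nonneg[of "\<lambda>x. w ?e x - p x"] by simp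
    moreover have "gip (\<lambda>x. u x - a) (\<lambda>x. u x - a) = gip (\<lambda>x. u x - w ?e x) (\<lambda>x. u x - w ?e x) + N ?e"
      using gip_pythagoras[OF uw PL[OF waP] w(2)[OF waP]] by (simp add: N_def)
    ultimately show "2 * gip (\<lambda>x. u x - a) (\<lambda>x. u x - a) \<le> (LINT x|gauss. (norm (G x))\<^sup>2) + \<epsilon>"
      using p(2) DN[of d] DG[of ?e] by linarith
  qed
qed

section \<open>The homogeneous solutions \<open>h e\<close>\<close>

text \<open>Linearity in the direction: \<open>tdir\<close> below is in general not a basis
  vector.\<close>

lemma gauss_integration_by_parts_dir:
  fixes u :: "'a::euclidean_space \<Rightarrow> real"
  assumes u: "loc_H1_grad u G" and L2: "L2 gauss u" "L2 gauss G" and p: "poly_le d p"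
  shows "(LINT x|gauss. (G x \<bullet> v) * p x) = (LINT x|gauss. u x * (p x * (x \<bullet> v) - grad p x \<bullet> v))"
proof -
  have PL: "L2 gauss q" if "poly_le e q" for e and q :: "'a \<Rightarrow> real"
    using that by (intro poly_growth_L2 poly_le_growth)
  have GL: "L2 gauss (\<lambda>x. G x \<bullet> b)" if "b \<in> Basis" for b
    by (rule L2_bounded[OF L2(2), of _ 1]) (use L2 that in \<open>auto simp: L2_def Basis_le_norm\<close>)
  have i1: "integrable gauss (\<lambda>x. (v \<bullet> b) * ((G x \<bullet> b) * p x))" if "b \<in> Basis" for b
    by (intro integrable_mult_right integrable_mult_L2 GL PL[OF p] that)
  have i2: "integrable gauss (\<lambda>x. (v \<bullet> b) * (u x * (p x * (x \<bullet> b) - grad p x \<bullet> b)))" if "b \<in> Basis" for b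
    by (intro integrable_mult_right integrable_mult_L2 L2 L2_diff PL[OF poly_le_mult[OF p poly_le_inner]]
      PL[OF poly_le_grad[OF p]] that)
  have "(LINT x|gauss. (G x \<bullet> v) * p x) = (LINT x|gauss. (\<Sum>b\<in>Basis. (v \<bullet> b) * ((G x \<bullet> b) * p x)))"
    unfolding euclidean_inner[of "G _" v] sum_distrib_right
    by (intro Bochner_Integration.integral_cong sum.cong refl) simp
  also have "\<dots> = (\<Sum>b\<in>Basis. (v \<bullet> b) * (LINT x|gauss. (G x \<bullet> b) * p x))"
    using i1 by (subst Bochner_Integration.integral_sum) auto
  also have "\<dots> = (\<Sum>b\<in>Basis. (v \<bullet> b) * (LINT x|gauss. u x * (p x * (x \<bullet> b) - grad p x \<bullet> b)))"
    by (intro sum.cong refl arg_cong2[where f = "(*)"]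
      gauss_integration_by_parts[OF u L2 poly_le_smooth[OF p] poly_le_growth[OF p] _ poly_le_growth[OF poly_le_grad[OF p]]])
  also have "\<dots> = (LINT x|gauss. (\<Sum>b\<in>Basis. (v \<bullet> b) * (u x * (p x * (x \<bullet> b) - grad p x \<bullet> b))))"
    using i2 by (subst Bochner_Integration.integral_sum) auto
  also have "\<dots> = (LINT x|gauss. u x * (p x * (x \<bullet> v) - grad p x \<bullet> v))"
  proof (rule Bochner_Integration.integral_cong[OF refl])
    fix x
    have "(\<Sum>b\<in>Basis. (v \<bullet> b) * (u x * (p x * (x \<bullet> b) - grad p x \<bullet> b)))
        = u x * (p x * (\<Sum>b\<in>Basis. (x \<bullet> b) * (v \<bullet> b)) - (\<Sum>b\<in>Basis. (grad p x \<bullet> b) * (v \<bullet> b)))"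
      by (simp add: sum_distrib_left sum_subtractf[symmetric] algebra_simps)
    also have "\<dots> = u x * (p x * (x \<bullet> v) - grad p x \<bullet> v)" by (simp only: euclidean_inner[symmetric])
    finally show "(\<Sum>b\<in>Basis. (v \<bullet> b) * (u x * (p x * (x \<bullet> b) - grad p x \<bullet> b))) = u x * (p x * (x \<bullet> v) - grad p x \<bullet> v)" .
  qed
  finally show ?thesis .
qed

section \<open>Limits of smooth functions under a common polynomial bound\<close>

definition smooth_approx :: "(nat \<Rightarrow> 'a::euclidean_space \<Rightarrow> real) \<Rightarrow> ('a \<Rightarrow> real) \<Rightarrow> ('a \<Rightarrow> 'a) \<Rightarrow> bool" where
  "smooth_approx \<psi> f F \<longleftrightarrow> (\<forall>j. smooth (\<psi> j)) \<and> (\<forall>x. (\<lambda>j. \<psi> j x) \<longlonglongrightarrow> f x) \<and>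
    (\<forall>x. (\<lambda>j. grad (\<psi> j) x) \<longlonglongrightarrow> F x) \<and>
    (\<exists>C k. \<forall>j x. \<bar>\<psi> j x\<bar> \<le> C * (1 + norm x) ^ k \<and> norm (grad (\<psi> j) x) \<le> C * (1 + norm x) ^ k)"

text \<open>The common polynomial bound passes to the limits and gives the growth claims. Times a
  compactly supported test function it is an integrable majorant, so classical integration by parts
  survives the limit and \<open>F\<close> is the weak gradient of \<open>f\<close>.\<close>

lemma smooth_approx_properties:
  fixes f :: "'a::euclidean_space \<Rightarrow> real"
  assumes "smooth_approx \<psi> f F"
  shows "loc_H1_grad f F" "poly_growth f" "poly_growth (\<lambda>x. norm (F x))" "L2 gauss f" "L2 gauss F"
    "\<And>j. poly_growth (\<psi> j)" "\<And>j. poly_growth (\<lambda>x. norm (grad (\<psi> j) x))"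
    "F \<in> borel_measurable borel"
proof -
  have sm: "smooth (\<psi> j)" and lim: "(\<lambda>j. \<psi> j x) \<longlonglongrightarrow> f x" "(\<lambda>j. grad (\<psi> j) x) \<longlonglongrightarrow> F x" for j x
    using assms by (auto simp: smooth_approx_def)
  obtain C k where C: "\<And>j x. \<bar>\<psi> j x\<bar> \<le> C * (1 + norm x) ^ k" "\<And>j x. norm (grad (\<psi> j) x) \<le> C * (1 + norm x) ^ k"
    using assms unfolding smooth_approx_def by blast
  have m\<psi>[measurable]: "\<psi> j \<in> borel_measurable borel" "grad (\<psi> j) \<in> borel_measurable borel" for j
    using smooth_continuous[OF sm, of UNIV j] continuous_grad[OF sm, of UNIV j]
    by (auto intro: borel_measurable_continuous_onI)
  have mf[measurable]: "f \<in> borel_measurable borel"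
    by (rule borel_measurable_LIMSEQ_metric[OF _ lim(1)]) simp
  show mF[measurable]: "F \<in> borel_measurable borel"
    by (rule borel_measurable_LIMSEQ_metric[OF _ lim(2)]) simp
  have Cf: "\<bar>f x\<bar> \<le> C * (1 + norm x) ^ k" for x
    by (rule LIMSEQ_le_const2[OF tendsto_rabs[OF lim(1)]]) (use C in auto)
  have CF: "norm (F x) \<le> C * (1 + norm x) ^ k" for x
    by (rule LIMSEQ_le_const2[OF tendsto_norm[OF lim(2)]]) (use C in auto)
  show pf: "poly_growth f" using Cf by (intro poly_growthI) auto
  show pF: "poly_growth (\<lambda>x. norm (F x))" using CF by (intro poly_growthI) auto
  show "poly_growth (\<psi> j)" "poly_growth (\<lambda>x. norm (grad (\<psi> j) x))" for j
    using C by (intro poly_growthI; auto)+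
  show "L2 gauss f" by (rule poly_growth_L2[OF pf])
  show "L2 gauss F" using poly_growth_L2[OF pF] by (simp add: L2_def)
  have ball: "set_integrable lborel (ball (0::'a) R) g" if g: "poly_growth g" for g :: "'a \<Rightarrow> real" and R
  proof -
    note [measurable] = poly_growth_measurable[OF g]
    have [measurable]: "ball (0::'a) r \<in> sets borel" for r by simp
    obtain D l where D: "D \<ge> 0" "\<And>x. \<bar>g x\<bar> \<le> D * (1 + norm x) ^ l" using poly_growthE[OF g] by metis
    show ?thesis unfolding set_integrable_def
    proof (rule Bochner_Integration.integrable_bound)
      show "integrable lborel (\<lambda>x. (D * (1 + \<bar>R\<bar>) ^ l) * indicator (ball (0::'a) R) x :: real)"
        by (intro integrable_mult_right integrable_real_indicator emeasure_lborel_ball_finite) simp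
      show "AE x in lborel. norm (indicator (ball 0 R) x *\<^sub>R g x) \<le> norm ((D * (1 + \<bar>R\<bar>) ^ l) * indicator (ball (0::'a) R) x :: real)"
      proof (rule AE_I2)
        fix x :: 'a
        show "norm (indicator (ball 0 R) x *\<^sub>R g x) \<le> norm ((D * (1 + \<bar>R\<bar>) ^ l) * indicator (ball (0::'a) R) x :: real)"
        proof (cases "norm x < R")
          case True
          have "D * (1 + norm x) ^ l \<le> D * (1 + \<bar>R\<bar>) ^ l" using True D by (intro mult_left_mono power_mono) auto
          then show ?thesis using True D(2)[of x] D(1) by (simp add: abs_mult)
        qed simp
      qed
    qed simp
  qed
  show "loc_H1_grad f F" unfolding loc_H1_grad_def
  proof (intro conjI mf mF allI impI ballI)
    fix R
    show "set_integrable lborel (ball 0 R) (\<lambda>x. (f x)\<^sup>2)" "set_integrable lborel (ball 0 R) (\<lambda>x. (norm (F x))\<^sup>2)"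
      by (intro ball poly_growth_power pf pF)+
  next
    fix \<phi> :: "'a \<Rightarrow> real" and b :: 'a assume \<phi>: "test_function UNIV \<phi>" and b: "b \<in> Basis"
    note s\<phi> = test_function_smooth[OF \<phi>]
    obtain K where K: "compact K" "\<And>x. x \<notin> K \<Longrightarrow> \<phi> x = 0" "\<And>x. x \<notin> K \<Longrightarrow> grad \<phi> x = 0"
      using test_function_support[OF \<phi>] by metis
    note [measurable] = borel_measurable_smooth[OF s\<phi> refl] borel_measurable_smooth[OF smooth_grad_inner[OF s\<phi>] refl]
    have dom: "integrable lborel (\<lambda>x. (C * (1 + norm x) ^ k) * \<bar>q x\<bar>)"
      if "continuous_on UNIV q" "\<And>x. x \<notin> K \<Longrightarrow> q x = 0" for q :: "'a \<Rightarrow> real"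
      by (rule integrable_continuous_compact_support[OF _ K(1)]) (use that in \<open>auto intro!: continuous_intros\<close>)
    have "(\<lambda>j. LINT x|lborel. \<psi> j x * (grad \<phi> x \<bullet> b)) \<longlonglongrightarrow> (LINT x|lborel. f x * (grad \<phi> x \<bullet> b))"
    proof (rule integral_dominated_convergence[OF _ _ dom[of "\<lambda>x. grad \<phi> x \<bullet> b"]])
      show "AE x in lborel. (\<lambda>j. \<psi> j x * (grad \<phi> x \<bullet> b)) \<longlonglongrightarrow> f x * (grad \<phi> x \<bullet> b)"
        by (intro AE_I2 tendsto_intros lim)
      show "AE x in lborel. norm (\<psi> j x * (grad \<phi> x \<bullet> b)) \<le> (C * (1 + norm x) ^ k) * \<bar>grad \<phi> x \<bullet> b\<bar>" for j
        by (intro AE_I2) (simp add: abs_mult mult_right_mono[OF C(1)])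
    qed (use K in \<open>auto intro: smooth_continuous[OF smooth_grad_inner[OF s\<phi>]]\<close>)
    moreover have "(\<lambda>j. - (LINT x|lborel. (grad (\<psi> j) x \<bullet> b) * \<phi> x)) \<longlonglongrightarrow> - (LINT x|lborel. (F x \<bullet> b) * \<phi> x)"
    proof (rule tendsto_minus, rule integral_dominated_convergence[OF _ _ dom[of \<phi>]])
      show "AE x in lborel. (\<lambda>j. (grad (\<psi> j) x \<bullet> b) * \<phi> x) \<longlonglongrightarrow> (F x \<bullet> b) * \<phi> x"
        by (intro AE_I2 tendsto_intros lim)
      show "AE x in lborel. norm ((grad (\<psi> j) x \<bullet> b) * \<phi> x) \<le> (C * (1 + norm x) ^ k) * \<bar>\<phi> x\<bar>" for j
      proof (rule AE_I2)
        fix x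
        have "\<bar>grad (\<psi> j) x \<bullet> b\<bar> \<le> C * (1 + norm x) ^ k"
          using Basis_le_norm[OF b, of "grad (\<psi> j) x"] C(2)[of j x] by linarith
        then show "norm ((grad (\<psi> j) x \<bullet> b) * \<phi> x) \<le> (C * (1 + norm x) ^ k) * \<bar>\<phi> x\<bar>"
          by (simp add: abs_mult mult_right_mono)
      qed
    qed (use K in \<open>auto intro: smooth_continuous[OF s\<phi>]\<close>)
    moreover have "(LINT x|lborel. \<psi> j x * (grad \<phi> x \<bullet> b)) = - (LINT x|lborel. (grad (\<psi> j) x \<bullet> b) * \<phi> x)" for j
      by (rule smooth_integration_by_parts[OF sm \<phi>])
    ultimately show "(LINT x|lborel. f x * (grad \<phi> x \<bullet> b)) = - (LINT x|lborel. (F x \<bullet> b) * \<phi> x)"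
      using LIMSEQ_unique by simp
  qed
qed

lemma grad_sqrt:
  fixes f :: "'a::euclidean_space \<Rightarrow> real"
  assumes "smooth f" "f x > 0"
  shows "grad (\<lambda>x. sqrt (f x)) x = (1 / (2 * sqrt (f x))) *\<^sub>R grad f x"
proof (rule grad_eqI)
  have "(f has_derivative (\<lambda>v. grad f x \<bullet> v)) (at x)"
    by (rule has_derivative_grad[OF smooth_differentiable[OF assms(1)]])
  from DERIV_compose_FDERIV[OF DERIV_real_sqrt[OF assms(2)] this]
  show "((\<lambda>x. sqrt (f x)) has_derivative (\<lambda>v. ((1 / (2 * sqrt (f x))) *\<^sub>R grad f x) \<bullet> v)) (at x)"
    by (rule has_derivative_eq_rhs) (auto simp: field_simps)
qed

definition ydir :: "'a::euclidean_space \<times> real" where "ydir = (0, 1)"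
text \<open>The last coordinate, written as an inner product so that the general results for
  \<open>x \<bullet> v\<close> apply.\<close>

definition yc :: "'a::euclidean_space \<times> real \<Rightarrow> real" where "yc x = x \<bullet> ydir"

lemma yc_eq: "yc x = snd x"
  by (simp add: yc_def ydir_def inner_prod_def)

lemma smooth_yc: "smooth yc"
  unfolding yc_def[abs_def] by (rule smooth_inner)

lemma grad_yc: "grad yc x = ydir"
  unfolding yc_def[abs_def] by (rule grad_inner)

lemma grad_square: "smooth f \<Longrightarrow> grad (\<lambda>x. f x * f x) x = (2 * f x) *\<^sub>R grad f x"
  by (simp only: grad_mult mult_2 scaleR_left_distrib)

lemma poly_le_inner_dir:
  fixes v :: "'b::euclidean_space"
  shows "poly_le (Suc 0) (\<lambda>x. x \<bullet> v)"
  unfolding euclidean_inner[of _ v]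
proof (rule poly_le_sum)
  fix b :: 'b assume "b \<in> Basis"
  from poly_le_cmult[OF poly_le_inner[OF this], of "v \<bullet> b"]
  show "poly_le (Suc 0) (\<lambda>x. (x \<bullet> b) * (v \<bullet> b))" by (simp only: mult.commute)
qed

text \<open>Integration by parts for the constant function 1, whose gradient is 0.\<close>

lemma gauss_divergence:
  fixes p :: "'b::euclidean_space \<Rightarrow> real"
  assumes "poly_le d p"
  shows "(LINT x|gauss. p x * (x \<bullet> v)) = (LINT x|gauss. grad p x \<bullet> v)"
proof -
  have "grad (\<lambda>_. 1) = (\<lambda>_. 0 :: 'b)" by (rule ext) simp
  moreover have "loc_H1_grad (\<lambda>_::'b. 1) (grad (\<lambda>_. 1))" by (rule loc_H1_grad_smooth[OF smooth_const])
  ultimately have 1: "loc_H1_grad (\<lambda>_. 1) (\<lambda>_. 0 :: 'b)" by simp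
  have L: "L2 gauss (\<lambda>_::'b. 1 :: real)" "L2 gauss (\<lambda>_::'b. 0 :: 'b)"
    by (intro poly_growth_L2 poly_growth_const) (simp add: L2_def)
  have g: "poly_growth (\<lambda>x. grad p x \<bullet> v)"
  proof -
    have "(\<lambda>x. grad p x \<bullet> v) = (\<lambda>x. \<Sum>b\<in>Basis. (grad p x \<bullet> b) * (v \<bullet> b))"
      by (subst euclidean_inner) simp
    then show ?thesis
      using poly_growth_sum[of Basis "\<lambda>b x. (grad p x \<bullet> b) * (v \<bullet> b)"]
        poly_growth_mult[OF poly_le_growth[OF poly_le_grad[OF assms]] poly_growth_const] by simp
  qed
  have "0 = (LINT x|gauss. p x * (x \<bullet> v) - grad p x \<bullet> v)"
    using gauss_integration_by_parts_dir[OF 1 L assms, of v] by simp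
  also have "\<dots> = (LINT x|gauss. p x * (x \<bullet> v)) - (LINT x|gauss. grad p x \<bullet> v)"
    by (intro Bochner_Integration.integral_diff poly_growth_integrable poly_growth_mult g
      poly_le_growth[OF assms] poly_growth_inner)
  finally show ?thesis by simp
qed

lemma poly_le_yc: "poly_le (Suc 0) yc"
  unfolding yc_def[abs_def] by (rule poly_le_inner_dir)

lemmas pg_yc = poly_le_growth[OF poly_le_yc]

definition dseq :: "nat \<Rightarrow> real" where "dseq j = 1 / real (Suc j)"

lemma dseq: "dseq j > 0" "dseq j \<le> 1"
  unfolding dseq_def by auto

lemma dseq_tendsto: "dseq \<longlonglongrightarrow> 0"
  unfolding dseq_def by real_asymp

section \<open>Regularised square roots and the model function\<close>

context
  fixes e :: "real ^ 'n"
  assumes e: "norm e = 1"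
begin

definition tdir :: "(real ^ 'n) \<times> real" where "tdir = (e, 0)"
definition tc :: "(real ^ 'n) \<times> real \<Rightarrow> real" where "tc x = x \<bullet> tdir"

text \<open>With \<open>w = tc x + i |yc x|\<close> one has \<open>rad 0 x = |w|\<close>, \<open>rt 0 x = Re (sqrt w)\<close> and
  \<open>Re (w powr (3/2)) = rt 0 x * (2 * tc x - rad 0 x)\<close>; a positive \<open>\<delta>\<close> removes the singularity on
  the slit \<open>w \<le> 0\<close>.\<close>

definition rad :: "real \<Rightarrow> (real ^ 'n) \<times> real \<Rightarrow> real" where
  "rad \<delta> x = sqrt (tc x * tc x + yc x * yc x + \<delta>\<^sup>2)"

definition rt :: "real \<Rightarrow> (real ^ 'n) \<times> real \<Rightarrow> real" where
  "rt \<delta> x = sqrt ((rad \<delta> x + tc x) * (1 / 2))"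

lemma tc_eq: "tc x = fst x \<bullet> e"
  by (simp add: tc_def tdir_def inner_prod_def)

lemma smooth_tc: "smooth tc"
  unfolding tc_def[abs_def] by (rule smooth_inner)

lemma grad_tc: "grad tc x = tdir"
  unfolding tc_def[abs_def] by (rule grad_inner)

lemma tc_yc_le: "tc x * tc x + yc x * yc x \<le> (norm x)\<^sup>2"
proof -
  have "(fst x \<bullet> e)\<^sup>2 \<le> (norm (fst x) * norm e)\<^sup>2"
    using Cauchy_Schwarz_ineq2[of "fst x" e] by (metis abs_le_square_iff abs_mult abs_norm_cancel)
  then show ?thesis by (simp add: tc_eq yc_eq e norm_prod_def power2_eq_square[symmetric])
qed

lemma rad_sq: "(rad \<delta> x)\<^sup>2 = tc x * tc x + yc x * yc x + \<delta>\<^sup>2"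
  by (simp add: rad_def)

lemma rad_nonneg: "rad \<delta> x \<ge> 0"
  by (simp add: rad_def)

lemma rad_ge_abs_tc: "rad \<delta> x \<ge> \<bar>tc x\<bar>"
  unfolding rad_def by (rule real_le_rsqrt) (simp add: power2_eq_square)

lemma rad_gt_abs_tc: "\<delta> > 0 \<or> yc x \<noteq> 0 \<Longrightarrow> rad \<delta> x > \<bar>tc x\<bar>"
  unfolding rad_def
  by (rule real_less_rsqrt) (auto simp: power2_eq_square[symmetric] sum_power2_gt_zero_iff)

lemma rad_le: "0 \<le> \<delta> \<Longrightarrow> \<delta> \<le> 1 \<Longrightarrow> rad \<delta> x \<le> 1 + norm x"
proof -
  assume d: "0 \<le> \<delta>" "\<delta> \<le> 1"
  have "tc x * tc x + yc x * yc x + \<delta>\<^sup>2 \<le> (1 + norm x)\<^sup>2"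
    using tc_yc_le[of x] power_mono[OF d(2,1), of 2] norm_ge_zero[of x] unfolding power2_sum by linarith
  then show ?thesis unfolding rad_def by (rule real_le_lsqrt[rotated 1]) auto
qed

lemma rt_nonneg: "rt \<delta> x \<ge> 0" and rt_sq: "(rt \<delta> x)\<^sup>2 = (rad \<delta> x + tc x) / 2"
  using rad_ge_abs_tc[of x \<delta>] by (auto simp: rt_def)

lemma rt_pos: "\<delta> > 0 \<or> yc x \<noteq> 0 \<Longrightarrow> rt \<delta> x > 0"
  unfolding rt_def using rad_gt_abs_tc[of \<delta> x] by simp

lemma rt_le: "0 \<le> \<delta> \<Longrightarrow> \<delta> \<le> 1 \<Longrightarrow> rt \<delta> x \<le> 1 + norm x"
proof (rule power2_le_imp_le)
  assume d: "0 \<le> \<delta>" "\<delta> \<le> 1"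
  have "(rt \<delta> x)\<^sup>2 \<le> rad \<delta> x" unfolding rt_sq using rad_ge_abs_tc[of x \<delta>] by simp
  also have "\<dots> \<le> 1 + norm x" by (rule rad_le[OF d])
  also have "\<dots> \<le> (1 + norm x)\<^sup>2" by (rule self_le_power) auto
  finally show "(rt \<delta> x)\<^sup>2 \<le> (1 + norm x)\<^sup>2" .
qed simp

text \<open>y^2 is at most rad^2 - tc^2 = (rad - tc) (rad + tc), and rad + tc = 2 rt^2. Thus the
  quotient stays bounded near the slit although \<open>rt\<close> tends to 0 there.\<close>

lemma yc_div_rt_sq: "(yc x / rt \<delta> x)\<^sup>2 \<le> 2 * (rad \<delta> x - tc x)"
proof (cases "rt \<delta> x = 0")
  case True
  then show ?thesis using rad_ge_abs_tc[of x \<delta>] by simp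
next
  case False
  have "(yc x)\<^sup>2 \<le> (rad \<delta> x)\<^sup>2 - (tc x)\<^sup>2" unfolding rad_sq by (simp add: power2_eq_square)
  also have "\<dots> = 2 * (rad \<delta> x - tc x) * (rt \<delta> x)\<^sup>2"
    unfolding rt_sq by (simp add: power2_eq_square algebra_simps)
  finally show ?thesis using False by (simp add: power_divide pos_divide_le_eq)
qed

lemma yc_div_rt_le: "0 \<le> \<delta> \<Longrightarrow> \<delta> \<le> 1 \<Longrightarrow> \<bar>yc x / rt \<delta> x\<bar> \<le> 2 * (1 + norm x)"
proof (rule power2_le_imp_le)
  assume d: "0 \<le> \<delta>" "\<delta> \<le> 1"
  have "\<bar>yc x / rt \<delta> x\<bar>\<^sup>2 \<le> 2 * (rad \<delta> x - tc x)" using yc_div_rt_sq[of x \<delta>] by (simp only: power2_abs)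
  also have "\<dots> \<le> 4 * rad \<delta> x" using rad_ge_abs_tc[of x \<delta>] by simp
  also have "\<dots> \<le> 4 * (1 + norm x)" using rad_le[OF d, of x] by simp
  also have "\<dots> \<le> (2 * (1 + norm x))\<^sup>2" by (simp add: power2_eq_square algebra_simps)
  finally show "\<bar>yc x / rt \<delta> x\<bar>\<^sup>2 \<le> (2 * (1 + norm x))\<^sup>2" .
qed simp

lemma smooth_rad: "\<delta> > 0 \<Longrightarrow> smooth (rad \<delta>)"
  unfolding rad_def[abs_def]
  by (intro smooth_sqrt smooth_add smooth_mult smooth_tc smooth_yc smooth_const) (auto simp: add_nonneg_pos)

lemma smooth_rt: "\<delta> > 0 \<Longrightarrow> smooth (rt \<delta>)"
  unfolding rt_def[abs_def]
proof (intro smooth_sqrt smooth_add smooth_mult smooth_rad smooth_tc smooth_const)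
  show "\<delta> > 0 \<Longrightarrow> (rad \<delta> x + tc x) * (1 / 2) > 0" for x using rad_gt_abs_tc[of \<delta> x] by simp
qed

lemma grad_rad:
  assumes "\<delta> > 0"
  shows "grad (rad \<delta>) x = (tc x / rad \<delta> x) *\<^sub>R tdir + (yc x / rad \<delta> x) *\<^sub>R ydir"
proof -
  let ?q = "\<lambda>x. tc x * tc x + yc x * yc x + \<delta>\<^sup>2"
  have sm: "smooth ?q" by (intro smooth_add smooth_mult smooth_tc smooth_yc smooth_const)
  have "grad ?q x = (2 * tc x) *\<^sub>R tdir + (2 * yc x) *\<^sub>R ydir"
    by (simp add: grad_add grad_square smooth_add smooth_mult smooth_tc smooth_yc smooth_const grad_tc grad_yc)
  moreover have "?q x > 0" using assms by (simp add: add_nonneg_pos)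
  ultimately show ?thesis
    using grad_sqrt[OF sm, of x] by (simp add: rad_def[abs_def] scaleR_add_right)
qed

lemma grad_rt:
  assumes "\<delta> > 0"
  shows "grad (rt \<delta>) x = (rt \<delta> x / (2 * rad \<delta> x)) *\<^sub>R tdir + (yc x / (4 * rad \<delta> x * rt \<delta> x)) *\<^sub>R ydir"
proof -
  let ?q = "\<lambda>x. (rad \<delta> x + tc x) * (1 / 2)"
  have sm: "smooth ?q" by (intro smooth_add smooth_mult smooth_tc smooth_rad smooth_const assms)
  have pos: "?q x > 0" using rad_gt_abs_tc[of \<delta> x] assms by simp
  have r: "rad \<delta> x > 0" "rt \<delta> x > 0" using rad_gt_abs_tc[of \<delta> x] rt_pos[of \<delta> x] assms by auto
  have "grad ?q x = (1 / 2) *\<^sub>R ((tc x / rad \<delta> x + 1) *\<^sub>R tdir + (yc x / rad \<delta> x) *\<^sub>R ydir)"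
    using grad_mult[OF smooth_add[OF smooth_rad[OF assms] smooth_tc] smooth_const, of "1 / 2" x]
    unfolding grad_add[OF smooth_rad[OF assms] smooth_tc] grad_rad[OF assms] grad_tc grad_const
    by (simp add: scaleR_left_distrib add.commute)
  moreover have "tc x / rad \<delta> x + 1 = 2 * (rt \<delta> x)\<^sup>2 / rad \<delta> x"
    using r by (simp add: rt_sq field_simps)
  ultimately have "grad (rt \<delta>) x = (1 / (2 * rt \<delta> x)) *\<^sub>R ((1 / 2) *\<^sub>R ((2 * (rt \<delta> x)\<^sup>2 / rad \<delta> x) *\<^sub>R tdir + (yc x / rad \<delta> x) *\<^sub>R ydir))"
    using grad_sqrt[OF sm pos] by (simp add: rt_def[abs_def])
  then show ?thesis using r by (simp add: power2_eq_square scaleR_add_right)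
qed

definition hreg :: "real \<Rightarrow> (real ^ 'n) \<times> real \<Rightarrow> real" where
  "hreg \<delta> x = rt \<delta> x * (2 * tc x - rad \<delta> x)"

text \<open>On the slit the second component of \<open>Hreg 0\<close> is \<open>0\<close>, by division by \<open>rt 0 x = 0\<close>.\<close>

definition Hreg :: "real \<Rightarrow> (real ^ 'n) \<times> real \<Rightarrow> (real ^ 'n) \<times> real" where
  "Hreg \<delta> x = ((3 / 2) * rt \<delta> x) *\<^sub>R tdir + (- (3 / 4) * (yc x / rt \<delta> x)) *\<^sub>R ydir"

lemma smooth_hreg: "\<delta> > 0 \<Longrightarrow> smooth (hreg \<delta>)"
  unfolding hreg_def[abs_def] by (intro smooth_mult smooth_diff smooth_rt smooth_rad smooth_tc smooth_const)

text \<open>The regularisation preserves the relation 2 rt^2 = rad + tc, which simplifies the second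
  component; no error term in \<open>\<delta>\<close> remains, and the limit of the gradients can be
  read off.\<close>

lemma grad_hreg:
  assumes "\<delta> > 0"
  shows "grad (hreg \<delta>) x = Hreg \<delta> x"
proof -
  have r: "rad \<delta> x > 0" "rt \<delta> x > 0" using rad_gt_abs_tc[of \<delta> x] rt_pos[of \<delta> x] assms by auto
  have sm: "smooth (\<lambda>x. 2 * tc x + (-1) * rad \<delta> x)"
    by (intro smooth_add smooth_cmult smooth_tc smooth_rad assms)
  have g: "grad (\<lambda>x. 2 * tc x + (-1) * rad \<delta> x) x = 2 *\<^sub>R grad tc x + (-1) *\<^sub>R grad (rad \<delta>) x"
    by (subst grad_add) (intro smooth_cmult smooth_tc smooth_rad assms | simp only: grad_cmult smooth_tc smooth_rad assms)+
  have "grad (hreg \<delta>) x = rt \<delta> x *\<^sub>R (2 *\<^sub>R grad tc x + (-1) *\<^sub>R grad (rad \<delta>) x) + (2 * tc x - rad \<delta> x) *\<^sub>R grad (rt \<delta>) x"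
    using grad_mult[OF smooth_rt[OF assms] sm, of x] unfolding g by (simp add: hreg_def[abs_def])
  also have "\<dots> = (rt \<delta> x * (2 - tc x / rad \<delta> x) + (2 * tc x - rad \<delta> x) * (rt \<delta> x / (2 * rad \<delta> x))) *\<^sub>R tdir
      + (- rt \<delta> x * (yc x / rad \<delta> x) + (2 * tc x - rad \<delta> x) * (yc x / (4 * rad \<delta> x * rt \<delta> x))) *\<^sub>R ydir"
    by (simp add: grad_tc grad_rad[OF assms] grad_rt[OF assms] algebra_simps)
  also have "rt \<delta> x * (2 - tc x / rad \<delta> x) + (2 * tc x - rad \<delta> x) * (rt \<delta> x / (2 * rad \<delta> x)) = (3 / 2) * rt \<delta> x"
    using r by (simp add: field_simps)
  also have "- rt \<delta> x * (yc x / rad \<delta> x) + (2 * tc x - rad \<delta> x) * (yc x / (4 * rad \<delta> x * rt \<delta> x))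
      = (yc x / (4 * rad \<delta> x * rt \<delta> x)) * (2 * tc x - rad \<delta> x - 4 * (rt \<delta> x)\<^sup>2)"
    using r by (simp add: field_simps power2_eq_square)
  also have "\<dots> = - (3 / 4) * (yc x / rt \<delta> x)"
    using r by (simp add: rt_sq field_simps)
  finally show ?thesis by (simp add: Hreg_def)
qed

text \<open>w powr (3/2) is the cube of the principal root, and the real part of (p + i k)^3 is p
  (p^2 - 3 k^2) with p^2 = (rad + tc)/2 and k^2 = (rad - tc)/2.\<close>

lemma h_eq: "h e x = hreg 0 x"
proof -
  define w where "w = Complex (fst x \<bullet> e) \<bar>snd x\<bar>"
  have cm: "cmod w = rad 0 x"
    by (simp add: w_def cmod_def rad_def tc_eq yc_eq power2_eq_square)
  define k where "k = sqrt ((rad 0 x - tc x) / 2)"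
  have cs: "csqrt w = Complex (rt 0 x) k"
    \<comment> \<open>The sign in the imaginary part of \<open>csqrt\<close> is positive because the
      imaginary part of \<open>w\<close> is an absolute value.\<close>
    unfolding complex_eq_iff csqrt.sel cm by (simp add: rt_def k_def w_def tc_eq sgn_if)
  have k2: "k\<^sup>2 = (rad 0 x - tc x) / 2" using rad_ge_abs_tc[of x 0] by (simp add: k_def)
  have "w powr (3 / 2) = csqrt w ^ 3"
  proof (cases "w = 0")
    case False
    have "w powr (3 / 2) = exp (3 / 2 * Ln w)" using False by (simp add: powr_def)
    also have "\<dots> = exp (of_nat 3 * (Ln w / 2))" by simp
    also have "\<dots> = exp (Ln w / 2) ^ 3" by (rule exp_of_nat_mult)
    finally show ?thesis using False by (simp add: csqrt_exp_Ln)
  qed simp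
  then have "h e x = Re (csqrt w ^ 3)" by (simp add: h_def w_def)
  also have "\<dots> = rt 0 x * ((rt 0 x)\<^sup>2 - 3 * k\<^sup>2)"
    unfolding cs by (simp add: power3_eq_cube power2_eq_square algebra_simps)
  also have "\<dots> = hreg 0 x" by (simp add: rt_sq k2 hreg_def field_simps)
  finally show ?thesis .
qed

lemma rad_tendsto: "(\<lambda>j. rad (dseq j) x) \<longlonglongrightarrow> rad 0 x"
  unfolding rad_def by (intro tendsto_intros dseq_tendsto)

lemma rt_tendsto: "(\<lambda>j. rt (dseq j) x) \<longlonglongrightarrow> rt 0 x"
  unfolding rt_def by (intro tendsto_intros rad_tendsto)

text \<open>Where \<open>rt 0 x = 0\<close> the numerator is 0 as well, so the convention for
  division agrees with the limit.\<close>

lemma yc_div_rt_tendsto: "(\<lambda>j. yc x / rt (dseq j) x) \<longlonglongrightarrow> yc x / rt 0 x"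
proof (cases "yc x = 0")
  case False
  then show ?thesis using rt_pos[of 0 x] by (intro tendsto_intros rt_tendsto) auto
qed simp

lemma hreg_tendsto: "(\<lambda>j. hreg (dseq j) x) \<longlonglongrightarrow> hreg 0 x"
  unfolding hreg_def by (intro tendsto_intros rad_tendsto rt_tendsto)

lemma Hreg_tendsto: "(\<lambda>j. Hreg (dseq j) x) \<longlonglongrightarrow> Hreg 0 x"
  unfolding Hreg_def by (intro tendsto_intros rt_tendsto yc_div_rt_tendsto)

lemma norm_dir: "norm (a *\<^sub>R tdir + b *\<^sub>R ydir) \<le> \<bar>a\<bar> + \<bar>b\<bar>"
  by (rule norm_triangle_le) (simp add: tdir_def ydir_def norm_Pair e)

lemma hreg_bounds:
  assumes "0 \<le> \<delta>" "\<delta> \<le> 1"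
  shows "\<bar>hreg \<delta> x\<bar> \<le> 3 * (1 + norm x)\<^sup>2" "norm (Hreg \<delta> x) \<le> 3 * (1 + norm x)"
proof -
  have "- rad \<delta> x \<le> tc x" "tc x \<le> rad \<delta> x" using rad_ge_abs_tc[of x \<delta>] by auto
  then have "\<bar>2 * tc x - rad \<delta> x\<bar> \<le> 3 * (1 + norm x)"
    unfolding abs_le_iff using rad_le[OF assms, of x] by (simp add: algebra_simps)
  then have "rt \<delta> x * \<bar>2 * tc x - rad \<delta> x\<bar> \<le> (1 + norm x) * (3 * (1 + norm x))"
    using rt_le[OF assms, of x] by (intro mult_mono) auto
  moreover have "\<bar>hreg \<delta> x\<bar> = rt \<delta> x * \<bar>2 * tc x - rad \<delta> x\<bar>"
    using rt_nonneg[of \<delta> x] by (simp add: hreg_def abs_mult)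
  moreover have "3 * (1 + norm x)\<^sup>2 = (1 + norm x) * (3 * (1 + norm x))" by (simp add: power2_eq_square)
  ultimately show "\<bar>hreg \<delta> x\<bar> \<le> 3 * (1 + norm x)\<^sup>2" by presburger
  have "norm (Hreg \<delta> x) \<le> \<bar>(3 / 2) * rt \<delta> x\<bar> + \<bar>- (3 / 4) * (yc x / rt \<delta> x)\<bar>"
    unfolding Hreg_def by (rule norm_dir)
  also have "\<dots> = (3 / 2) * rt \<delta> x + (3 / 4) * \<bar>yc x / rt \<delta> x\<bar>"
    using rt_nonneg[of \<delta> x] by (simp add: abs_mult)
  also have "\<dots> \<le> 3 * (1 + norm x)"
    using rt_le[OF assms, of x] yc_div_rt_le[OF assms, of x] by argo
  finally show "norm (Hreg \<delta> x) \<le> 3 * (1 + norm x)" .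
qed

text \<open>The constant 2 makes \<open>1 + (rad \<delta> x)\<^sup>2\<close> at most
  \<open>pen x\<close> on the thin space for \<delta> between 0 and 1.\<close>

definition pen :: "(real ^ 'n) \<times> real \<Rightarrow> real" where
  "pen x = 2 + tc x * tc x + yc x * yc x"

lemma smooth_pen: "smooth pen"
  unfolding pen_def[abs_def] by (intro smooth_add smooth_mult smooth_tc smooth_yc smooth_const)

lemma grad_pen: "grad pen x = (2 * tc x) *\<^sub>R tdir + (2 * yc x) *\<^sub>R ydir"
  unfolding pen_def[abs_def]
  by (simp add: grad_add grad_square smooth_add smooth_mult smooth_tc smooth_yc smooth_const grad_tc grad_yc)

text \<open>The regularised functions \<open>hreg \<delta>\<close> are slightly negative on the thin space; \<open>pen\<close> compensates.\<close>

definition happ :: "nat \<Rightarrow> (real ^ 'n) \<times> real \<Rightarrow> real" where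
  "happ j x = hreg (dseq j) x + (3 * dseq j) * pen x"

text \<open>\<open>hreg\<close> is negative only where 2 tc < rad. There its size is at most 3
  \<delta> times the square root of rad, and that root is absorbed by 1 + rad^2.\<close>

lemma hreg_thin_lower:
  assumes d: "\<delta> > 0" "\<delta> \<le> 1" and y: "yc x = 0"
  shows "hreg \<delta> x \<ge> - (3 * \<delta>) * pen x"
proof (cases "2 * tc x \<ge> rad \<delta> x")
  case True
  then have "hreg \<delta> x \<ge> 0" using rt_nonneg[of \<delta> x] by (simp add: hreg_def)
  moreover have "pen x \<ge> 0" by (simp add: pen_def add_nonneg_nonneg)
  ultimately show ?thesis using d by (smt (verit) mult_nonneg_nonneg mult_minus_left)
next
  case False
  define \<rho> t g where "\<rho> = rad \<delta> x" and "t = tc x" and "g = rt \<delta> x"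
  have \<rho>2: "\<rho>\<^sup>2 = t\<^sup>2 + \<delta>\<^sup>2" using rad_sq[of \<delta> x] y by (simp add: \<rho>_def t_def power2_eq_square)
  have \<rho>t: "\<rho> > \<bar>t\<bar>" using rad_gt_abs_tc[of \<delta> x] d by (simp add: \<rho>_def t_def)
  have g0: "g > 0" using rt_pos[of \<delta> x] d by (simp add: g_def)
  have g2: "g\<^sup>2 = (\<rho> + t) / 2" by (simp add: g_def \<rho>_def t_def rt_sq)
  have lt: "2 * t < \<rho>" using False by (simp add: \<rho>_def t_def)
  have key: "(g * (\<rho> - 2 * t))\<^sup>2 \<le> 9 * \<delta>\<^sup>2 * \<rho>"
  proof (cases "t \<le> 0")
    case True
    \<comment> \<open>For \<open>t \<le> 0\<close> the small factor \<open>\<rho> + t\<close> is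
      measured through its conjugate \<open>\<rho> - t\<close>, which is at least
      \<open>\<rho>\<close>.\<close>
    have "(\<rho> + t) * (\<rho> - t) = \<delta>\<^sup>2" using \<rho>2 by (simp add: power2_eq_square algebra_simps)
    then have "(\<rho> + t) * \<rho> \<le> \<delta>\<^sup>2" using True \<rho>t by (smt (verit) mult_left_mono)
    moreover have "(\<rho> - 2 * t)\<^sup>2 \<le> (3 * \<rho>)\<^sup>2" using True \<rho>t by (intro power_mono) auto
    ultimately have "(\<rho> + t) * \<rho> * ((\<rho> - 2 * t)\<^sup>2 / \<rho>) \<le> \<delta>\<^sup>2 * ((3 * \<rho>)\<^sup>2 / \<rho>)"
      using \<rho>t by (intro mult_mono divide_right_mono) auto
    moreover have "\<rho> \<noteq> 0" using \<rho>t by auto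
    ultimately have "(\<rho> + t) * (\<rho> - 2 * t)\<^sup>2 \<le> 9 * \<delta>\<^sup>2 * \<rho>" by (simp add: power2_eq_square mult_ac)
    moreover have "0 \<le> (\<rho> + t) * (\<rho> - 2 * t)\<^sup>2" using \<rho>t by simp
    ultimately show ?thesis by (simp add: power_mult_distrib g2)
  next
    case t0: False
    \<comment> \<open>For positive \<open>t\<close> the condition 2 t < \<rho> confines the point to
      distance of order \<delta> from the edge, so \<rho> itself is small.\<close>
    have "4 * \<rho>\<^sup>2 \<le> \<rho>\<^sup>2 + 4 * \<delta>\<^sup>2" using power_mono[of "2 * t" \<rho> 2] lt t0 \<rho>2 by simp
    then have r2: "\<rho>\<^sup>2 \<le> 2 * \<delta>\<^sup>2" using zero_le_power2[of \<delta>] by linarith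
    have "(\<rho> - 2 * t)\<^sup>2 \<le> \<rho>\<^sup>2" using lt t0 by (intro power_mono) auto
    then have "(\<rho> + t) / 2 * (\<rho> - 2 * t)\<^sup>2 \<le> \<rho> * (2 * \<delta>\<^sup>2)"
      using \<rho>t t0 r2 by (intro mult_mono) auto
    also have "\<dots> \<le> 9 * \<delta>\<^sup>2 * \<rho>" using \<rho>t by (simp add: mult_right_mono)
    finally show ?thesis by (simp add: power_mult_distrib g2)
  qed
  have "9 * \<delta>\<^sup>2 * \<rho> \<le> 9 * \<delta>\<^sup>2 * (1 + \<rho>\<^sup>2)\<^sup>2"
  proof (intro mult_left_mono)
    have "\<rho> \<le> 1 + \<rho>\<^sup>2" using sum_squares_bound[of 1 \<rho>] \<rho>t by simp
    also have "\<dots> \<le> (1 + \<rho>\<^sup>2)\<^sup>2" by (rule self_le_power) auto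
    finally show "\<rho> \<le> (1 + \<rho>\<^sup>2)\<^sup>2" .
  qed simp
  also have "\<dots> = (3 * \<delta> * (1 + \<rho>\<^sup>2))\<^sup>2" by (simp add: power_mult_distrib)
  finally have "(g * (\<rho> - 2 * t))\<^sup>2 \<le> (3 * \<delta> * (1 + \<rho>\<^sup>2))\<^sup>2" using key by linarith
  then have "g * (\<rho> - 2 * t) \<le> 3 * \<delta> * (1 + \<rho>\<^sup>2)"
    by (rule power2_le_imp_le) (use d in simp)
  also have "\<dots> \<le> 3 * \<delta> * pen x"
  proof (rule mult_left_mono)
    have "\<delta>\<^sup>2 \<le> 1" using d by (simp add: power_le_one)
    then show "1 + \<rho>\<^sup>2 \<le> pen x" using y \<rho>2 by (simp add: pen_def t_def power2_eq_square)
  qed (use d in simp)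
  finally show ?thesis by (simp add: hreg_def g_def \<rho>_def t_def algebra_simps)
qed

lemma happ_thin: "happ j (x', 0) \<ge> 0"
  using hreg_thin_lower[of "dseq j" "(x', 0)"] dseq[of j] by (simp add: happ_def yc_eq)

lemma even_coords: "tc (fst x, - snd x) = tc x" "yc (fst x, - snd x) = - yc x"
  by (simp_all add: tc_eq yc_eq)

lemma hreg_even: "hreg \<delta> (fst x, - snd x) = hreg \<delta> x"
  by (simp add: hreg_def rt_def rad_def even_coords)

lemma happ_even: "happ j (fst x, - snd x) = happ j x"
  by (simp add: happ_def hreg_even pen_def even_coords)

lemma happ_approx: "smooth_approx happ (h e) (Hreg 0)"
proof -
  have g: "grad (happ j) x = Hreg (dseq j) x + (3 * dseq j) *\<^sub>R grad pen x" for j x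
    unfolding happ_def[abs_def]
    by (simp add: grad_add grad_cmult smooth_hreg smooth_cmult smooth_pen dseq grad_hreg)
  have p: "0 \<le> pen x" "pen x \<le> 2 * (1 + norm x)\<^sup>2" for x
  proof -
    show "0 \<le> pen x" by (simp add: pen_def)
    show "pen x \<le> 2 * (1 + norm x)\<^sup>2"
      using tc_yc_le[of x] norm_ge_zero[of x] zero_le_power2[of "norm x"] 
      unfolding pen_def power2_sum power_one mult_1_right ring_distribs by linarith
  qed
  have gp: "norm (grad pen x) \<le> 4 * (1 + norm x)" for x
  proof -
    have "norm (grad pen x) \<le> \<bar>2 * tc x\<bar> + \<bar>2 * yc x\<bar>" unfolding grad_pen by (rule norm_dir)
    moreover have "\<bar>tc x\<bar> \<le> norm x" "\<bar>yc x\<bar> \<le> norm x"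
      using tc_yc_le[of x] abs_le_square_iff[of "tc x" "norm x"] abs_le_square_iff[of "yc x" "norm x"]
        zero_le_square[of "tc x"] zero_le_square[of "yc x"] by (simp_all add: power2_eq_square)
    ultimately show ?thesis by (simp add: abs_mult)
  qed
  show ?thesis unfolding smooth_approx_def
  proof (intro conjI allI exI)
    show "smooth (happ j)" for j unfolding happ_def[abs_def]
      by (intro smooth_add smooth_hreg smooth_cmult smooth_pen dseq)
    show "(\<lambda>j. happ j x) \<longlonglongrightarrow> h e x" for x
      unfolding happ_def h_eq by (rule tendsto_eq_intros hreg_tendsto dseq_tendsto refl | simp)+
    show "(\<lambda>j. grad (happ j) x) \<longlonglongrightarrow> Hreg 0 x" for x
      unfolding g by (rule tendsto_eq_intros Hreg_tendsto dseq_tendsto refl | simp)+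
    fix j x
    have d: "0 \<le> dseq j" "dseq j \<le> 1" using dseq[of j] by auto
    have "\<bar>happ j x\<bar> \<le> \<bar>hreg (dseq j) x\<bar> + 3 * (dseq j * pen x)"
      using p(1)[of x] d unfolding happ_def by (intro order_trans[OF abs_triangle_ineq]) (simp add: abs_mult)
    also have "dseq j * pen x \<le> 1 * pen x" using d p(1)[of x] by (intro mult_right_mono) auto
    finally have "\<bar>happ j x\<bar> \<le> 9 * (1 + norm x)\<^sup>2"
      using hreg_bounds(1)[OF d, of x] p(2)[of x] by linarith
    \<comment> \<open>The constant 15 comes from the gradient bound below: 3 for \<open>Hreg\<close>
      plus 3 times 4 for the gradient of \<open>pen\<close>.\<close>
    also have "\<dots> \<le> 15 * (1 + norm x)\<^sup>2" by (intro mult_right_mono) auto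
    finally show "\<bar>happ j x\<bar> \<le> 15 * (1 + norm x) ^ 2" .
    have "norm (grad (happ j) x) \<le> norm (Hreg (dseq j) x) + 3 * (dseq j * norm (grad pen x))"
      unfolding g by (rule norm_triangle_le) (use d in simp)
    also have "dseq j * norm (grad pen x) \<le> 1 * norm (grad pen x)" using d by (intro mult_right_mono) auto
    finally have "norm (grad (happ j) x) \<le> 15 * (1 + norm x)"
      using hreg_bounds(2)[OF d, of x] gp[of x] by linarith
    also have "\<dots> \<le> 15 * (1 + norm x) ^ 2" by (intro mult_left_mono self_le_power) auto
    finally show "norm (grad (happ j) x) \<le> 15 * (1 + norm x) ^ 2" .
  qed
qed

text \<open>Makes the modulus accessible to Gaussian integration by parts despite its kink. Where
  \<open>rad 0 x = 0\<close>, all approximating gradients and the claimed limit are 0.\<close>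

lemma rad_approx: "smooth_approx (\<lambda>j. rad (dseq j)) (rad 0)
    (\<lambda>x. (tc x / rad 0 x) *\<^sub>R tdir + (yc x / rad 0 x) *\<^sub>R ydir)"
  unfolding smooth_approx_def
proof (intro conjI allI exI)
  show "smooth (rad (dseq j))" for j by (intro smooth_rad dseq)
  show "(\<lambda>j. rad (dseq j) x) \<longlonglongrightarrow> rad 0 x" for x by (rule rad_tendsto)
  show "(\<lambda>j. grad (rad (dseq j)) x) \<longlonglongrightarrow> (tc x / rad 0 x) *\<^sub>R tdir + (yc x / rad 0 x) *\<^sub>R ydir" for x
  proof (cases "rad 0 x = 0")
    case True
    then have "tc x = 0 \<and> yc x = 0" using rad_sq[of 0 x] by (simp add: sum_squares_eq_zero_iff)
    then show ?thesis by (simp add: grad_rad dseq)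
  next
    case False
    then show ?thesis unfolding grad_rad[OF dseq(1)] by (intro tendsto_intros rad_tendsto)
  qed
  fix j x
  have d: "0 \<le> dseq j" "dseq j \<le> 1" using dseq[of j] by auto
  have "rad (dseq j) x \<le> 2 * (1 + norm x)" using rad_le[OF d, of x] norm_ge_zero[of x] by argo
  then show "\<bar>rad (dseq j) x\<bar> \<le> 2 * (1 + norm x) ^ 1" using rad_nonneg[of "dseq j" x] by simp
  have r: "rad (dseq j) x > 0" using rad_gt_abs_tc[of "dseq j" x] dseq by auto
  have "\<bar>yc x\<bar> \<le> rad (dseq j) x" unfolding rad_def by (rule real_le_rsqrt) (simp add: power2_eq_square)
  then have "\<bar>tc x / rad (dseq j) x\<bar> \<le> 1" "\<bar>yc x / rad (dseq j) x\<bar> \<le> 1"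
    using r rad_ge_abs_tc[of x "dseq j"] by (auto simp: abs_divide)
  then have "norm (grad (rad (dseq j)) x) \<le> 2"
    unfolding grad_rad[OF dseq(1)] using norm_dir[of "tc x / rad (dseq j) x" "yc x / rad (dseq j) x"] by linarith
  then show "norm (grad (rad (dseq j)) x) \<le> 2 * (1 + norm x) ^ 1" by (rule order_trans) simp
qed

text \<open>The function y Re(sqrt w) is the one to which \<open>gauss_rt_balance\<close> applies
  integration by parts; the factor y tames the gradient of the root at the slit.\<close>

lemma yrt_approx: "smooth_approx (\<lambda>j x. yc x * rt (dseq j) x) (\<lambda>x. yc x * rt 0 x)
    (\<lambda>x. (yc x * rt 0 x / (2 * rad 0 x)) *\<^sub>R tdir + (rt 0 x + yc x * (yc x / (4 * rad 0 x * rt 0 x))) *\<^sub>R ydir)"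
proof -
  have g: "grad (\<lambda>x. yc x * rt (dseq j) x) x = (yc x * rt (dseq j) x / (2 * rad (dseq j) x)) *\<^sub>R tdir
      + (rt (dseq j) x + yc x * (yc x / (4 * rad (dseq j) x * rt (dseq j) x))) *\<^sub>R ydir" for j x
    by (simp add: grad_mult[OF smooth_yc smooth_rt[OF dseq(1)]] grad_rt[OF dseq(1)] grad_yc algebra_simps)
  show ?thesis unfolding smooth_approx_def g
  proof (intro conjI allI exI)
    show "smooth (\<lambda>x. yc x * rt (dseq j) x)" for j by (intro smooth_mult smooth_yc smooth_rt dseq)
    show "(\<lambda>j. yc x * rt (dseq j) x) \<longlonglongrightarrow> yc x * rt 0 x" for x by (intro tendsto_intros rt_tendsto)
    show "(\<lambda>j. (yc x * rt (dseq j) x / (2 * rad (dseq j) x)) *\<^sub>R tdir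
          + (rt (dseq j) x + yc x * (yc x / (4 * rad (dseq j) x * rt (dseq j) x))) *\<^sub>R ydir)
        \<longlonglongrightarrow> (yc x * rt 0 x / (2 * rad 0 x)) *\<^sub>R tdir + (rt 0 x + yc x * (yc x / (4 * rad 0 x * rt 0 x))) *\<^sub>R ydir" for x
    proof (cases "yc x = 0")
      case True
      then show ?thesis by (auto intro!: tendsto_intros rt_tendsto)
    next
      case False
      then have "rad 0 x \<noteq> 0" "rt 0 x \<noteq> 0" using rad_gt_abs_tc[of 0 x] rt_pos[of 0 x] by auto
      then show ?thesis by (intro tendsto_intros rt_tendsto rad_tendsto) auto
    qed
    fix j x
    have d: "0 \<le> dseq j" "dseq j \<le> 1" using dseq[of j] by auto
    have r: "rad (dseq j) x > 0" "rt (dseq j) x > 0" using rad_gt_abs_tc[of "dseq j" x] rt_pos[of "dseq j" x] dseq(1)[of j] by auto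
    have yr: "\<bar>yc x\<bar> \<le> rad (dseq j) x" unfolding rad_def by (rule real_le_rsqrt) (simp add: power2_eq_square)
    have "\<bar>yc x * rt (dseq j) x\<bar> \<le> (1 + norm x) * (1 + norm x)"
      unfolding abs_mult using yr rad_le[OF d, of x] rt_le[OF d, of x] r by (intro mult_mono) auto
    also have "\<dots> \<le> 4 * (1 + norm x) ^ 2" by (simp add: power2_eq_square)
    finally show "\<bar>yc x * rt (dseq j) x\<bar> \<le> 4 * (1 + norm x) ^ 2" .
    have yr1: "\<bar>yc x / rad (dseq j) x\<bar> \<le> 1" using yr r by (simp add: abs_divide)
    have "\<bar>yc x * rt (dseq j) x / (2 * rad (dseq j) x)\<bar> = \<bar>yc x / rad (dseq j) x\<bar> * rt (dseq j) x / 2"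
      using r by (simp add: abs_mult)
    also have "\<dots> \<le> 1 * rt (dseq j) x / 2" using yr1 r by (intro divide_right_mono mult_right_mono) auto
    finally have 1: "\<bar>yc x * rt (dseq j) x / (2 * rad (dseq j) x)\<bar> \<le> 1 + norm x" using rt_le[OF d, of x] r by linarith
    have "\<bar>yc x * (yc x / (4 * rad (dseq j) x * rt (dseq j) x))\<bar> = \<bar>yc x / rad (dseq j) x\<bar> * \<bar>yc x / rt (dseq j) x\<bar> / 4"
      using r by (simp add: abs_mult)
    also have "\<dots> \<le> 1 * (2 * (1 + norm x)) / 4"
      using yr1 yc_div_rt_le[OF d, of x] by (intro divide_right_mono mult_mono) auto
    finally have 2: "\<bar>yc x * (yc x / (4 * rad (dseq j) x * rt (dseq j) x))\<bar> \<le> 1 + norm x"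
      by (rule order_trans) simp
    have "\<bar>rt (dseq j) x + yc x * (yc x / (4 * rad (dseq j) x * rt (dseq j) x))\<bar> \<le> 2 * (1 + norm x)"
      using 2 rt_le[OF d, of x] r unfolding mult_2 by linarith
    then have "norm ((yc x * rt (dseq j) x / (2 * rad (dseq j) x)) *\<^sub>R tdir
          + (rt (dseq j) x + yc x * (yc x / (4 * rad (dseq j) x * rt (dseq j) x))) *\<^sub>R ydir) \<le> 4 * (1 + norm x)"
      using 1 by (intro order_trans[OF norm_dir]) argo
    also have "\<dots> \<le> 4 * (1 + norm x) ^ 2" by (intro mult_left_mono self_le_power) auto
    finally show "norm ((yc x * rt (dseq j) x / (2 * rad (dseq j) x)) *\<^sub>R tdir
          + (rt (dseq j) x + yc x * (yc x / (4 * rad (dseq j) x * rt (dseq j) x))) *\<^sub>R ydir) \<le> 4 * (1 + norm x) ^ 2" .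
  qed
qed

lemma dir_inner: "tdir \<bullet> tdir = 1" "tdir \<bullet> ydir = 0" "ydir \<bullet> tdir = 0" "ydir \<bullet> ydir = 1"
  using e by (simp_all add: tdir_def ydir_def inner_prod_def norm_eq_1)

lemma poly_le_tc: "poly_le (Suc 0) tc"
  unfolding tc_def[abs_def] by (rule poly_le_inner_dir)

lemmas pg_tc = poly_le_growth[OF poly_le_tc]

lemmas rad_props = smooth_approx_properties[OF rad_approx]
  and h_props = smooth_approx_properties[OF happ_approx]
  and yrt_props = smooth_approx_properties[OF yrt_approx]

lemma pg_rad: "poly_growth (rad 0)"
  by (rule rad_props(2))

lemma pg_rt: "poly_growth (rt 0)"
proof (rule poly_growth_bound)
  show "poly_growth (\<lambda>x. 1 + norm x :: real)" by (intro poly_growth_intros)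
  show "rt 0 \<in> borel_measurable borel"
    unfolding rt_def[abs_def] using poly_growth_measurable[OF pg_rad] poly_growth_measurable[OF pg_tc] by simp
  show "\<bar>rt 0 x\<bar> \<le> \<bar>1 + norm x\<bar>" for x using rt_le[of 0 x] rt_nonneg[of 0 x] by simp
qed

lemmas pg_intros = pg_tc pg_yc pg_rad pg_rt poly_growth_const poly_growth_mult
  poly_growth_add poly_growth_power poly_growth_diff

section \<open>Gaussian integrals of the model function\<close>

lemma gauss_odd_moments: "(LINT x|gauss. tc x) = 0" "(LINT x|gauss. tc x ^ 3) = 0"
  "(LINT x|gauss. tc x * (yc x * yc x)) = 0" "(LINT x|gauss. tc x * tc x) = (LINT x|(gauss :: ((real ^ 'n) \<times> real) measure). 1)"
proof -
  show "(LINT x|gauss. tc x) = 0"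
    using gauss_divergence[OF poly_le.const[of 0 1], of tdir] by (simp add: tc_def)
  then have "(LINT x|gauss. (2 * tc x) * 1) = 0" by simp
  moreover have "(LINT x|gauss. (tc x * tc x) * (x \<bullet> tdir)) = (LINT x|gauss. (2 * tc x) * 1)"
    using gauss_divergence[OF poly_le_mult[OF poly_le_tc poly_le_tc], of tdir]
    by (simp add: grad_square[OF smooth_tc] grad_tc dir_inner)
  ultimately show "(LINT x|gauss. tc x ^ 3) = 0" by (simp add: tc_def power3_eq_cube)
  have "(LINT x|gauss. (yc x * yc x) * (x \<bullet> tdir)) = 0"
    using gauss_divergence[OF poly_le_mult[OF poly_le_yc poly_le_yc], of tdir]
    by (simp add: grad_square[OF smooth_yc] grad_yc dir_inner)
  then show "(LINT x|gauss. tc x * (yc x * yc x)) = 0" by (simp add: tc_def mult.commute)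
  show "(LINT x|gauss. tc x * tc x) = (LINT x|(gauss :: ((real ^ 'n) \<times> real) measure). 1)"
    using gauss_divergence[OF poly_le_tc, of tdir] by (simp add: grad_tc dir_inner tc_def)
qed

text \<open>\<open>rad 0\<close> is homogeneous of degree 1 in the plane of \<open>tdir\<close> and
  \<open>ydir\<close>, so its radial derivative there is itself. Integrating by parts in both
  directions gives E rad = E rad (tc^2 + yc^2 - 2) = E rad^3 - 2 E rad.\<close>

lemma gauss_rad_cubed: "(LINT x|gauss. rad 0 x ^ 3) = 3 * (LINT x|gauss. rad 0 x)"
proof -
  have eq: "(LINT x|gauss. (tc x / rad 0 x) * tc x) = (LINT x|gauss. rad 0 x * (tc x * tc x - 1))"
    "(LINT x|gauss. (yc x / rad 0 x) * yc x) = (LINT x|gauss. rad 0 x * (yc x * yc x - 1))"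
    using gauss_integration_by_parts_dir[OF rad_props(1,4,5) poly_le_tc, of tdir]
      gauss_integration_by_parts_dir[OF rad_props(1,4,5) poly_le_yc, of ydir]
    by (simp_all add: inner_add_left dir_inner grad_tc grad_yc tc_def yc_def)
  have sq: "rad 0 x * rad 0 x = tc x * tc x + yc x * yc x" for x
    using rad_sq[of 0 x] by (simp add: power2_eq_square)
  note m[measurable] = poly_growth_measurable[OF pg_rad] poly_growth_measurable[OF pg_tc] poly_growth_measurable[OF pg_yc]
  have le: "\<bar>s / rad 0 x * s\<bar> \<le> \<bar>rad 0 x\<bar>" if "s * s \<le> rad 0 x * rad 0 x" for s x
  proof (cases "rad 0 x = 0")
    case False
    then have "rad 0 x > 0" using rad_nonneg[of 0 x] by simp
    then show ?thesis using that by (simp add: abs_mult abs_divide pos_divide_le_eq)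
  qed simp
  have i: "integrable gauss (\<lambda>x. (tc x / rad 0 x) * tc x)" "integrable gauss (\<lambda>x. (yc x / rad 0 x) * yc x)"
    by (rule poly_growth_integrable, rule poly_growth_bound[OF pg_rad]; (intro le)?; simp add: sq)+
  have "(LINT x|gauss. rad 0 x) = (LINT x|gauss. (tc x / rad 0 x) * tc x + (yc x / rad 0 x) * yc x)"
  proof (rule Bochner_Integration.integral_cong[OF refl])
    fix x
    have "(tc x / rad 0 x) * tc x + (yc x / rad 0 x) * yc x = (rad 0 x * rad 0 x) / rad 0 x"
      unfolding sq by (simp add: add_divide_distrib)
    then show "rad 0 x = (tc x / rad 0 x) * tc x + (yc x / rad 0 x) * yc x" by simp
  qed
  also have "\<dots> = (LINT x|gauss. rad 0 x * (tc x * tc x - 1)) + (LINT x|gauss. rad 0 x * (yc x * yc x - 1))"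
    using i eq by simp
  also have "\<dots> = (LINT x|gauss. rad 0 x * (tc x * tc x - 1) + rad 0 x * (yc x * yc x - 1))"
    by (intro Bochner_Integration.integral_add[symmetric] poly_growth_integrable pg_intros)
  also have "\<dots> = (LINT x|gauss. rad 0 x ^ 3 - 2 * rad 0 x)"
  proof (rule Bochner_Integration.integral_cong[OF refl])
    fix x
    have "rad 0 x ^ 3 = rad 0 x * (tc x * tc x + yc x * yc x)"
      unfolding sq[symmetric] by (simp add: power3_eq_cube)
    then show "rad 0 x * (tc x * tc x - 1) + rad 0 x * (yc x * yc x - 1) = rad 0 x ^ 3 - 2 * rad 0 x"
      by (simp add: algebra_simps)
  qed
  also have "\<dots> = (LINT x|gauss. rad 0 x ^ 3) - 2 * (LINT x|gauss. rad 0 x)"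
    by (subst Bochner_Integration.integral_diff) (auto intro!: poly_growth_integrable pg_intros)
  finally show ?thesis by simp
qed

text \<open>The squared gradient is at most 9/4 rad. Squaring the real part gives h^2 = (rad^3 + Re
  w^3)/2, and Re w^3 is odd in \<open>tc\<close>, hence of mean 0. With E rad^3 = 3 E rad the two
  sides match.\<close>

lemma gauss_h_energy: "(LINT x|gauss. (norm (Hreg 0 x))\<^sup>2) \<le> 3 / 2 * (LINT x|gauss. (h e x)\<^sup>2)"
proof -
  have "(LINT x|gauss. (norm (Hreg 0 x))\<^sup>2) \<le> (LINT x|gauss. 9 / 4 * rad 0 x)"
  proof (rule integral_mono)
    show "integrable gauss (\<lambda>x. (norm (Hreg 0 x))\<^sup>2)" using h_props(5) by (simp add: L2_def)
    show "integrable gauss (\<lambda>x. 9 / 4 * rad 0 x)" by (intro poly_growth_integrable pg_intros)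
    fix x
    have "(norm (Hreg 0 x))\<^sup>2 = 9 / 4 * (rt 0 x)\<^sup>2 + 9 / 16 * (yc x / rt 0 x)\<^sup>2"
      unfolding Hreg_def power2_norm_eq_inner
      by (simp add: inner_add_left inner_add_right inner_diff_left inner_diff_right dir_inner power2_eq_square)
    also have "\<dots> \<le> 9 / 4 * ((rad 0 x + tc x) / 2) + 9 / 16 * (2 * (rad 0 x - tc x))"
      using yc_div_rt_sq[of x 0] by (simp add: rt_sq)
    finally show "(norm (Hreg 0 x))\<^sup>2 \<le> 9 / 4 * rad 0 x" by (simp add: field_simps)
  qed
  also have "\<dots> = 3 / 4 * (LINT x|gauss. rad 0 x ^ 3)" by (simp add: gauss_rad_cubed)
  also have "\<dots> = 3 / 2 * (LINT x|gauss. (h e x)\<^sup>2)"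
  proof -
    have "(h e x)\<^sup>2 = 1 / 2 * rad 0 x ^ 3 + (1 / 2 * tc x ^ 3 - 3 / 2 * (tc x * (yc x * yc x)))" for x
    proof -
      have y: "yc x * yc x = rad 0 x * rad 0 x - tc x * tc x" using rad_sq[of 0 x] by (simp add: power2_eq_square)
      have "(h e x)\<^sup>2 = ((rad 0 x + tc x) / 2) * (2 * tc x - rad 0 x)\<^sup>2"
        by (simp add: h_eq hreg_def power_mult_distrib rt_sq)
      then show ?thesis unfolding y by (simp add: power2_eq_square power3_eq_cube field_simps)
    qed
    then have "(LINT x|gauss. (h e x)\<^sup>2) = (LINT x|gauss. 1 / 2 * rad 0 x ^ 3 + (1 / 2 * tc x ^ 3 - 3 / 2 * (tc x * (yc x * yc x))))"
      by simp
    also have "\<dots> = (LINT x|gauss. 1 / 2 * rad 0 x ^ 3) + ((LINT x|gauss. 1 / 2 * tc x ^ 3) - (LINT x|gauss. 3 / 2 * (tc x * (yc x * yc x))))"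
      by (subst Bochner_Integration.integral_add, (intro poly_growth_integrable pg_intros)+,
          subst Bochner_Integration.integral_diff, (intro poly_growth_integrable pg_intros)+) simp
    also have "\<dots> = 1 / 2 * (LINT x|gauss. rad 0 x ^ 3)" by (simp add: gauss_odd_moments)
    finally show ?thesis by simp
  qed
  finally show ?thesis .
qed

text \<open>The rotation field tc d/dy - yc d/dt preserves the Gaussian, so the mean of its action
  on y Re(sqrt w) is 0. In the proof both halves are integrated by parts into the same integral, and
  their pointwise difference is half of the integrand.\<close>

lemma gauss_rt_balance: "(LINT x|gauss. rt 0 x * (3 * tc x - rad 0 x)) = 0"
proof -
  let ?A = "\<lambda>x. (rt 0 x + yc x * (yc x / (4 * rad 0 x * rt 0 x))) * tc x"
  let ?B = "\<lambda>x. (yc x * rt 0 x / (2 * rad 0 x)) * yc x"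
  have "(LINT x|gauss. ?A x) = (LINT x|gauss. yc x * rt 0 x * (tc x * yc x))"
    using gauss_integration_by_parts_dir[OF yrt_props(1,4,5) poly_le_tc, of ydir]
    by (simp add: inner_add_left dir_inner grad_tc tc_def yc_def)
  moreover have "(LINT x|gauss. ?B x) = (LINT x|gauss. yc x * rt 0 x * (yc x * tc x))"
    using gauss_integration_by_parts_dir[OF yrt_props(1,4,5) poly_le_yc, of tdir]
    by (simp add: inner_add_left dir_inner grad_yc tc_def yc_def)
  ultimately have AB: "(LINT x|gauss. ?A x) = (LINT x|gauss. ?B x)" by (simp add: mult.commute)
  have y: "yc x * yc x = (rad 0 x - tc x) * (2 * (rt 0 x * rt 0 x))" for x
    using rad_sq[of 0 x] rt_sq[of 0 x] by (simp add: power2_eq_square algebra_simps)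
  have A: "?A x = rt 0 x * tc x + rt 0 x * ((rad 0 x - tc x) / (2 * rad 0 x)) * tc x" for x
  proof (cases "rad 0 x = 0 \<or> rt 0 x = 0")
    case True
    then show ?thesis by auto
  next
    case False
    then show ?thesis by (simp add: y field_simps)
  qed
  have B: "?B x = rt 0 x * ((rad 0 x - tc x) / (2 * rad 0 x)) * (rad 0 x + tc x)" for x
  proof -
    have "yc x * yc x = (rad 0 x - tc x) * (rad 0 x + tc x)"
      using rad_sq[of 0 x] by (simp add: power2_eq_square algebra_simps)
    then have "?B x = rt 0 x * (((rad 0 x - tc x) * (rad 0 x + tc x)) / (2 * rad 0 x))" by (simp add: mult_ac)
    then show ?thesis by (simp add: mult_ac)
  qed
  \<comment> \<open>When \<open>rad 0 x = 0\<close> the quotients in \<open>A\<close> and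
    \<open>B\<close> are meaningless, but \<open>rt 0 x = 0\<close> makes both sides 0.\<close>
  have C: "?A x - ?B x = 1 / 2 * (rt 0 x * (3 * tc x - rad 0 x))" for x
  proof (cases "rad 0 x = 0")
    case True
    then have "tc x = 0" using rad_ge_abs_tc[of x 0] by simp
    then have "rt 0 x = 0" using True by (simp add: rt_def)
    then show ?thesis by simp
  next
    case False
    then show ?thesis unfolding A B by (simp add: field_simps)
  qed
  note [measurable] = poly_growth_measurable[OF pg_rad] poly_growth_measurable[OF pg_tc]
    poly_growth_measurable[OF pg_yc] poly_growth_measurable[OF pg_rt]
  have q: "\<bar>(rad 0 x - tc x) / (2 * rad 0 x)\<bar> \<le> 1" for x
    using rad_ge_abs_tc[of x 0] by (cases "rad 0 x = 0") (auto simp: abs_divide divide_le_eq_1)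
  have i: "integrable gauss ?A" "integrable gauss ?B"
  proof -
    have "poly_growth (\<lambda>x. rt 0 x * ((rad 0 x - tc x) / (2 * rad 0 x)))"
    proof (rule poly_growth_bound[OF pg_rt])
      show "\<bar>rt 0 x * ((rad 0 x - tc x) / (2 * rad 0 x))\<bar> \<le> \<bar>rt 0 x\<bar>" for x
        using mult_left_mono[OF q[of x], of "\<bar>rt 0 x\<bar>"] by (simp add: abs_mult)
    qed simp
    note q' = this
    show "integrable gauss ?A" "integrable gauss ?B"
      unfolding A B
      by (intro poly_growth_integrable poly_growth_add poly_growth_mult[OF q'] poly_growth_mult[OF pg_rt pg_tc]
        pg_tc pg_rad)+
  qed
  have "(LINT x|gauss. 1 / 2 * (rt 0 x * (3 * tc x - rad 0 x))) = (LINT x|gauss. ?A x) - (LINT x|gauss. ?B x)"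
    unfolding C[symmetric] by (rule Bochner_Integration.integral_diff[OF i])
  then show ?thesis using AB by simp
qed

text \<open>Obtained by computation instead of from a variational property of \<open>h e\<close>.
  Integration by parts in y gives E h (y^2 - 1) = E y dh/dy, and 3 h - y dh/dy is 3/2 times the
  integrand of \<open>gauss_rt_balance\<close>.\<close>

lemma gauss_h_yc_square: "(LINT x|gauss. h e x * (yc x * yc x)) = 4 * (LINT x|gauss. h e x)"
proof -
  have pt: "(Hreg 0 x \<bullet> ydir) * yc x = - (3 / 2) * (rt 0 x * (rad 0 x - tc x))" for x
  proof (cases "rt 0 x = 0")
    case True
    then show ?thesis by (simp add: Hreg_def inner_add_left inner_diff_left dir_inner)
  next
    case False
    have "yc x * yc x = (rad 0 x - tc x) * (2 * (rt 0 x * rt 0 x))"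
      using rad_sq[of 0 x] rt_sq[of 0 x] by (simp add: power2_eq_square algebra_simps)
    then have "yc x / rt 0 x * yc x = 2 * (rt 0 x * (rad 0 x - tc x))" using False by (simp add: field_simps)
    then show ?thesis by (simp add: Hreg_def inner_add_left inner_diff_left dir_inner)
  qed
  have hi: "integrable gauss (h e)" "integrable gauss (\<lambda>x. h e x * (yc x * yc x))"
    by (intro poly_growth_integrable pg_intros h_props(2))+
  have "(LINT x|gauss. - (3 / 2) * (rt 0 x * (rad 0 x - tc x))) = (LINT x|gauss. h e x * (yc x * yc x - 1))"
    using gauss_integration_by_parts_dir[OF h_props(1,4,5) poly_le_yc, of ydir]
    unfolding pt by (simp add: grad_yc dir_inner yc_def)
  also have "\<dots> = (LINT x|gauss. h e x * (yc x * yc x)) - (LINT x|gauss. h e x)"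
    using hi by (simp add: right_diff_distrib)
  finally have 1: "(LINT x|gauss. h e x * (yc x * yc x)) - (LINT x|gauss. h e x) = (LINT x|gauss. - (3 / 2) * (rt 0 x * (rad 0 x - tc x)))"
    by simp
  have i3: "integrable gauss (\<lambda>x. - (3 / 2) * (rt 0 x * (rad 0 x - tc x)))"
    by (intro integrable_mult_right poly_growth_integrable pg_intros)
  have "(LINT x|gauss. 3 * h e x - (- (3 / 2) * (rt 0 x * (rad 0 x - tc x)))) = (LINT x|gauss. 3 / 2 * (rt 0 x * (3 * tc x - rad 0 x)))"
    by (intro Bochner_Integration.integral_cong refl) (simp add: h_eq hreg_def algebra_simps)
  also have "\<dots> = 0" using gauss_rt_balance by simp
  finally have "3 * (LINT x|gauss. h e x) - (LINT x|gauss. - (3 / 2) * (rt 0 x * (rad 0 x - tc x))) = 0"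
    by (subst (asm) Bochner_Integration.integral_diff[OF integrable_mult_right[OF hi(1)] i3]) simp
  then show ?thesis using 1 by linarith
qed

lemma gauss_h_linear: "(LINT x|gauss. h e x * (x \<bullet> v)) = (LINT x|gauss. Hreg 0 x \<bullet> v)"
  using gauss_integration_by_parts_dir[OF h_props(1,4,5) poly_le.const[of 0 1], of v] by simp

text \<open>The thin first moments of \<open>h e\<close> form a vector along \<open>e\<close>; with
  \<open>gauss_rt_pos\<close>, nonnegative multiples of the functions \<open>h e\<close> realise
  every prescribed vector.\<close>

lemma gauss_h_linear_thin: "(LINT x|gauss. h e x * (x \<bullet> (b, 0))) = 3 / 2 * (LINT x|gauss. rt 0 x) * (e \<bullet> b)"
proof -
  have "Hreg 0 x \<bullet> (b, 0) = (3 / 2 * (e \<bullet> b)) * rt 0 x" for x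
    by (simp add: Hreg_def tdir_def ydir_def inner_prod_def)
  then show ?thesis unfolding gauss_h_linear by (simp only:) simp
qed

text \<open>If the integral were 0, then rad = - tc almost everywhere. As \<open>tc\<close> has mean
  0, rad and with it \<open>tc\<close> would vanish almost everywhere, contradicting the positive
  second moment.\<close>

lemma gauss_rt_pos: "(LINT x|gauss. rt 0 x) > 0"
proof (rule ccontr)
  assume "\<not> (LINT x|gauss. rt 0 x) > 0"
  moreover have "(LINT x|gauss. rt 0 x) \<ge> 0" using rt_nonneg by simp
  ultimately have "(LINT x|gauss. rt 0 x) = 0" by simp
  then have "AE x in gauss. rt 0 x = 0"
    using integral_nonneg_eq_0_iff_AE[OF poly_growth_integrable[OF pg_rt]] rt_nonneg by simp
  then have "AE x in gauss. rad 0 x + tc x = 0"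
    by eventually_elim (use rt_sq in \<open>metis divide_eq_0_iff power_zero_numeral zero_neq_numeral\<close>)
  then have "(LINT x|gauss. rad 0 x + tc x) = 0" by (rule integral_eq_zero_AE)
  then have "(LINT x|gauss. rad 0 x) = 0"
    using gauss_odd_moments(1) poly_growth_integrable[OF pg_rad] poly_growth_integrable[OF pg_tc] by simp
  then have "AE x in gauss. rad 0 x = 0"
    using integral_nonneg_eq_0_iff_AE[OF poly_growth_integrable[OF pg_rad]] rad_nonneg by simp
  then have "AE x in gauss. tc x * tc x = 0"
    by eventually_elim (use rad_ge_abs_tc in \<open>metis abs_le_zero_iff mult_zero_left\<close>)
  then have "(LINT x|gauss. tc x * tc x) = 0" by (rule integral_eq_zero_AE)
  then show False using gauss_odd_moments(4) integral_gauss_pos by (metis less_irrefl)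
qed

end

section \<open>Homogeneous global solutions\<close>

lemma AE_lborel_affine:
  fixes c :: "'a::euclidean_space \<Rightarrow> real"
  assumes c: "\<And>j. j \<in> Basis \<Longrightarrow> c j \<noteq> 0" and P: "AE x in lborel. P x"
  shows "AE x in lborel. P (\<Sum>j\<in>Basis. (c j * (x \<bullet> j)) *\<^sub>R j)"
proof -
  let ?T = "\<lambda>x::'a. 0 + (\<Sum>j\<in>Basis. (c j * (x \<bullet> j)) *\<^sub>R j)"
  have "AE x in density (distr lborel borel ?T) (\<lambda>_. ennreal (\<Prod>j\<in>Basis. \<bar>c j\<bar>)). P x"
    by (subst lborel_affine_euclidean[where c = c and t = 0, OF c, symmetric]) (use P in auto)
  moreover have "ennreal (\<Prod>j\<in>Basis. \<bar>c j\<bar>) > 0" using c by (simp add: prod_pos)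
  ultimately have "AE x in distr lborel borel ?T. P x"
    by (subst (asm) AE_density) auto
  then have "AE x in lborel. P (?T x)" by (rule AE_distrD[rotated]) simp
  then show ?thesis by simp
qed

text \<open>Diagonal maps cover both symmetries in use: dilations and the reflection in the last
  coordinate.\<close>

lemma integral_lborel_affine:
  fixes c :: "'a::euclidean_space \<Rightarrow> real" and f :: "'a \<Rightarrow> real"
  assumes c: "\<And>j. j \<in> Basis \<Longrightarrow> c j \<noteq> 0" and [measurable]: "f \<in> borel_measurable borel"
  shows "(LINT x|lborel. f x) = (\<Prod>j\<in>Basis. \<bar>c j\<bar>) * (LINT x|lborel. f (\<Sum>j\<in>Basis. (c j * (x \<bullet> j)) *\<^sub>R j))"
proof -
  let ?T = "\<lambda>x::'a. 0 + (\<Sum>j\<in>Basis. (c j * (x \<bullet> j)) *\<^sub>R j)"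
  have "(LINT x|lborel. f x) = (LINT x|density (distr lborel borel ?T) (\<lambda>_. ennreal (\<Prod>j\<in>Basis. \<bar>c j\<bar>)). f x)"
    by (subst lborel_affine_euclidean[where c = c and t = 0, OF c, symmetric]) auto
  also have "\<dots> = (LINT x|distr lborel borel ?T. (\<Prod>j\<in>Basis. \<bar>c j\<bar>) *\<^sub>R f x)"
    by (subst integral_density) (auto simp: prod_nonneg)
  also have "\<dots> = (LINT x|lborel. (\<Prod>j\<in>Basis. \<bar>c j\<bar>) *\<^sub>R f (?T x))"
    by (subst integral_distr) auto
  finally show ?thesis by simp
qed

lemma scaleR_as_sum: "(\<Sum>j\<in>Basis. (c * (x \<bullet> j)) *\<^sub>R j) = c *\<^sub>R x"
  by (simp add: scaleR_scaleR[symmetric] scaleR_sum_right[symmetric] euclidean_representation del: scaleR_scaleR)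

lemma AE_lborel_scaleR: "c \<noteq> 0 \<Longrightarrow> AE x in lborel. P x \<Longrightarrow> AE x in lborel. P (c *\<^sub>R x)"
  using AE_lborel_affine[of "\<lambda>_. c" P] by (simp add: scaleR_as_sum)

lemma integral_lborel_scaleR:
  fixes f :: "'a::euclidean_space \<Rightarrow> real"
  assumes "c > 0" "f \<in> borel_measurable borel"
  shows "(LINT x|lborel. f x) = c ^ DIM('a) * (LINT x|lborel. f (c *\<^sub>R x))"
  using integral_lborel_affine[of "\<lambda>_. c" f] assms by (simp add: scaleR_as_sum)

lemma reflection_as_sum:
  fixes x :: "'b::euclidean_space \<times> real"
  shows "(\<Sum>j\<in>Basis. ((if j = (0, 1) then -1 else 1) * (x \<bullet> j)) *\<^sub>R j) = (fst x, - snd x)"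
proof -
  have "(\<Sum>j\<in>Basis. ((if j = (0, 1) then -1 else 1) * (x \<bullet> j)) *\<^sub>R j)
      = (\<Sum>j\<in>Basis. (x \<bullet> j) *\<^sub>R j) - (\<Sum>j\<in>Basis. if j = (0, 1) then (2 * (x \<bullet> j)) *\<^sub>R j else 0)"
    unfolding sum_subtractf[symmetric] by (intro sum.cong refl) (auto simp: scaleR_left_distrib[symmetric] scaleR_diff_left[symmetric])
  also have "\<dots> = x - (2 * (x \<bullet> (0, 1))) *\<^sub>R (0, 1)"
  proof -
    have "(0, 1) \<in> (Basis :: ('b \<times> real) set)" by (simp add: Basis_prod_def)
    then show ?thesis by (simp add: euclidean_representation)
  qed
  also have "\<dots> = (fst x, - snd x)" by (simp add: prod_eq_iff inner_prod_def)
  finally show ?thesis .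
qed

lemma AE_lborel_reflection:
  fixes P :: "'b::euclidean_space \<times> real \<Rightarrow> bool"
  assumes "AE x in lborel. P x"
  shows "AE x in lborel. P (fst x, - snd x)"
  using AE_lborel_affine[of "\<lambda>j. if j = (0, 1) then -1 else 1" P] assms unfolding reflection_as_sum by auto

lemma integral_gauss_odd:
  fixes f :: "'b::euclidean_space \<times> real \<Rightarrow> real"
  assumes f[measurable]: "f \<in> borel_measurable borel" and odd: "AE x in lborel. f (fst x, - snd x) = - f x"
  shows "(LINT x|gauss. f x) = 0"
proof -
  let ?F = "\<lambda>x. exp (- (norm x)\<^sup>2 / 2) * f x"
  have p: "(\<Prod>j\<in>(Basis :: ('b \<times> real) set). \<bar>if j = (0, 1) then -1 else 1 :: real\<bar>) = 1"
    by (rule prod.neutral) auto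
  have F: "(LINT x|lborel. ?F x) = (LINT x|lborel. ?F (fst x, - snd x))"
    using integral_lborel_affine[of "\<lambda>j. if j = (0, 1) then -1 else 1" ?F]
    unfolding reflection_as_sum p by simp
  have r: "(\<lambda>x::'b \<times> real. (fst x, - snd x)) \<in> borel_measurable borel"
    by (intro borel_measurable_continuous_onI continuous_intros)
  have "(LINT x|lborel. ?F (fst x, - snd x)) = (LINT x|lborel. - ?F x)"
  proof (rule integral_cong_AE)
    have "?F \<in> borel_measurable borel" by simp
    from measurable_compose[OF r this] show "(\<lambda>x. ?F (fst x, - snd x)) \<in> borel_measurable lborel" by simp
    show "AE x in lborel. ?F (fst x, - snd x) = - ?F x"
      using odd by eventually_elim (simp add: norm_prod_def)
  qed simp
  then have "(LINT x|lborel. ?F x) = 0" using F by simp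
  then show ?thesis by (simp add: integral_gauss)
qed

text \<open>On the compact set |f \<phi>| is at most f^2 + \<phi>^2, so local square integrability
  suffices.\<close>

lemma integrable_mult_compact_support:
  assumes "\<And>R. set_integrable lborel (ball 0 R) (\<lambda>x. (norm (f x))\<^sup>2)" "f \<in> borel_measurable borel"
    and \<phi>: "continuous_on UNIV \<phi>" "compact K" "\<And>x. x \<notin> K \<Longrightarrow> \<phi> x = 0"
  shows "integrable lborel (\<lambda>x::'a::euclidean_space. f x * (\<phi> x :: real))"
proof -
  note [measurable] = assms(2) borel_measurable_continuous_onI[OF \<phi>(1)]
  obtain R where R: "K \<subseteq> ball 0 R" using bounded_subset_ballD[OF compact_imp_bounded[OF \<phi>(2)], of 0] by blast
  have i1: "integrable lborel (\<lambda>x. (\<phi> x)\<^sup>2)"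
    by (rule integrable_continuous_compact_support[OF _ \<phi>(2)]) (use \<phi> in \<open>auto intro: continuous_intros\<close>)
  show ?thesis
  proof (rule Bochner_Integration.integrable_bound)
    show "integrable lborel (\<lambda>x. indicator (ball 0 R) x *\<^sub>R (norm (f x))\<^sup>2 + (\<phi> x)\<^sup>2)"
      using assms(1)[of R] i1 by (simp add: set_integrable_def)
    show "AE x in lborel. norm (f x * \<phi> x) \<le> norm (indicator (ball 0 R) x *\<^sub>R (norm (f x))\<^sup>2 + (\<phi> x)\<^sup>2)"
    proof (rule AE_I2)
      fix x
      show "norm (f x * \<phi> x) \<le> norm (indicator (ball 0 R) x *\<^sub>R (norm (f x))\<^sup>2 + (\<phi> x)\<^sup>2)"
      proof (cases "x \<in> K")
        case True
        then have "x \<in> ball 0 R" using R by blast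
        moreover have "\<bar>f x\<bar> * \<bar>\<phi> x\<bar> \<le> (f x)\<^sup>2 + (\<phi> x)\<^sup>2"
          using sum_squares_bound[of "\<bar>f x\<bar>" "\<bar>\<phi> x\<bar>"] mult_nonneg_nonneg[of "\<bar>f x\<bar>" "\<bar>\<phi> x\<bar>"]
          unfolding power2_abs by linarith
        ultimately show ?thesis by (simp add: abs_mult)
      qed (use \<phi>(3) in auto)
    qed
  qed simp
qed

lemma cutoff_even: "cutoff j (fst x, - snd x) = cutoff j x" and gcut_even: "gcut j (fst x, - snd x) = gcut j x"
  for x :: "'b::euclidean_space \<times> real"
  by (simp_all add: gcut_def cutoff_def norm_prod_def)

lemma zero_test_function: "test_function \<Omega> (\<lambda>_. 0)"
  by (rule test_functionI[of _ "{}"]) (auto intro: smooth_const)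

text \<open>The second and fourth moments, in the ratios 1 and 3 to the mass; they give the norm of
  y^2 - 1 in the final step.\<close>

lemma gauss_yc_moments:
  "(LINT x|(gauss :: ('b::euclidean_space \<times> real) measure). yc x * yc x) = (LINT x|(gauss :: ('b \<times> real) measure). 1)"
  "(LINT x|(gauss :: ('b \<times> real) measure). (yc x * yc x) * (yc x * yc x)) = 3 * (LINT x|(gauss :: ('b \<times> real) measure). 1)"
proof -
  have yy: "ydir \<bullet> (ydir :: 'b \<times> real) = 1" by (simp add: ydir_def inner_prod_def)
  have xy: "x \<bullet> ydir = yc x" for x :: "'b \<times> real" by (simp add: yc_def)
  show 2: "(LINT x|(gauss :: ('b \<times> real) measure). yc x * yc x) = (LINT x|(gauss :: ('b \<times> real) measure). 1)"
    using gauss_divergence[OF poly_le_yc, of "ydir :: 'b \<times> real"] unfolding grad_yc yy unfolding xy .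
  have g: "grad (\<lambda>x. yc x * (yc x * yc x)) x \<bullet> ydir = 3 * (yc x * yc x)" for x :: "'b \<times> real"
    unfolding grad_mult[OF smooth_yc smooth_mult[OF smooth_yc smooth_yc]] grad_square[OF smooth_yc] grad_yc
    by (simp add: inner_add_left yy)
  have "(LINT x|(gauss :: ('b \<times> real) measure). (yc x * (yc x * yc x)) * (x \<bullet> ydir)) = (LINT x|(gauss :: ('b \<times> real) measure). 3 * (yc x * yc x))"
    using gauss_divergence[OF poly_le_mult[OF poly_le_yc poly_le_mult[OF poly_le_yc poly_le_yc]], of "ydir :: 'b \<times> real"]
    unfolding g .
  moreover have "(yc x * (yc x * yc x)) * (x \<bullet> ydir) = (yc x * yc x) * (yc x * yc x)" for x :: "'b \<times> real"
    unfolding xy by (simp only: mult_ac)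
  ultimately show "(LINT x|(gauss :: ('b \<times> real) measure). (yc x * yc x) * (yc x * yc x)) = 3 * (LINT x|(gauss :: ('b \<times> real) measure). 1)"
    using 2 by simp
qed

text \<open>All that the classification uses about a solution, freed from balls, traces and the
  completion: a Borel representative with its gradient, the variational inequality, evenness and
  homogeneity.\<close>

context
  fixes u :: "(real ^ 'n) \<times> real \<Rightarrow> real" and G :: "(real ^ 'n) \<times> real \<Rightarrow> (real ^ 'n) \<times> real"
  assumes uG: "loc_H1_grad u G"
    and var: "\<And>\<eta> \<phi>. test_function UNIV \<eta> \<Longrightarrow> (\<And>x. \<eta> (fst x, - snd x) = \<eta> x) \<Longrightarrow>
      test_function UNIV \<phi> \<Longrightarrow> (\<And>x. \<phi> (fst x, - snd x) = \<phi> x) \<Longrightarrow> (\<And>x'. \<phi> (x', 0) \<ge> 0) \<Longrightarrow>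
      0 \<le> (LINT x|lborel. G x \<bullet> (\<eta> x *\<^sub>R G x + u x *\<^sub>R grad \<eta> x + grad \<phi> x))"
    and even: "AE x in lborel. u (fst x, - snd x) = u x"
    and hom: "\<And>t. t > 0 \<Longrightarrow> AE x in lborel. u (t *\<^sub>R x) = t powr (3 / 2) * u x"
begin

lemma sol_measurable: "u \<in> borel_measurable borel" "G \<in> borel_measurable borel"
  using uG by (auto simp: loc_H1_grad_def)

text \<open>By homogeneity the integral of u^2 over the ball of radius n is n^(N + 3) times that
  over the unit ball, N being the dimension; the weight absorbs this growth.\<close>

lemma sol_L2: "L2 gauss u"
proof -
  note [measurable] = sol_measurable
  have [measurable]: "ball (0::(real ^ 'n) \<times> real) r \<in> sets borel" for r by simp
  let ?N = "DIM((real ^ 'n) \<times> real)"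
  have si: "set_integrable lborel (ball 0 R) (\<lambda>x. (u x)\<^sup>2)" for R using uG by (auto simp: loc_H1_grad_def)
  have "(LINT x:ball 0 (real n)|lborel. (u x)\<^sup>2) = (LINT x:ball 0 1|lborel. (u x)\<^sup>2) * real n ^ (?N + 3)" if "n \<ge> 1" for n :: nat
  proof -
    have n: "real n > 0" using that by simp
    have "(LINT x|lborel. indicator (ball 0 (real n)) x * (u x)\<^sup>2) = real n ^ ?N * (LINT x|lborel. indicator (ball 0 (real n)) (real n *\<^sub>R x) * (u (real n *\<^sub>R x))\<^sup>2)"
      by (rule integral_lborel_scaleR[OF n]) simp
    also have "(LINT x|lborel. indicator (ball 0 (real n)) (real n *\<^sub>R x) * (u (real n *\<^sub>R x))\<^sup>2)
        = (LINT x|lborel. real n ^ 3 * (indicator (ball 0 1) x * (u x)\<^sup>2))"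
    proof (rule integral_cong_AE)
      show "AE x in lborel. indicator (ball 0 (real n)) (real n *\<^sub>R x) * (u (real n *\<^sub>R x))\<^sup>2 = real n ^ 3 * (indicator (ball 0 1) x * (u x)\<^sup>2)"
        using hom[OF n]
      proof eventually_elim
        case (elim x)
        have "(real n powr (3 / 2))\<^sup>2 = real n powr (3 / 2 + 3 / 2)" by (simp only: power2_eq_square powr_add)
        also have "\<dots> = real n powr real 3" by simp
        also have "\<dots> = real n ^ 3" by (rule powr_realpow[OF n])
        finally have "(u (real n *\<^sub>R x))\<^sup>2 = real n ^ 3 * (u x)\<^sup>2" by (simp add: elim power_mult_distrib)
        moreover have "indicator (ball 0 (real n)) (real n *\<^sub>R x) = (indicator (ball 0 1) x :: real)"
          using n by (auto simp: indicator_def)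
        ultimately show ?case by simp
      qed
    qed simp_all
    also have "\<dots> = real n ^ 3 * (LINT x|lborel. indicator (ball 0 1) x * (u x)\<^sup>2)"
      by (rule integral_mult_right_zero)
    finally show ?thesis
      unfolding set_lebesgue_integral_def real_scaleR_def power_add by (simp only: mult_ac)
  qed
  then have "integrable lborel (\<lambda>x. exp (- (1 / 2) * (norm x)\<^sup>2) * (u x)\<^sup>2)"
    by (intro integrable_gaussian_of_ball_growth[where A = "LINT x:ball 0 1|lborel. (u x)\<^sup>2" and m = "?N + 3"]) (auto intro: si)
  then show ?thesis by (simp add: L2_def integrable_gauss_iff)
qed

lemma sol_loc_int:
  assumes "continuous_on UNIV \<phi>" "compact K" "\<And>x. x \<notin> K \<Longrightarrow> \<phi> x = 0"
  shows "integrable lborel (\<lambda>x. u x * \<phi> x)" "b \<in> Basis \<Longrightarrow> integrable lborel (\<lambda>x. (G x \<bullet> b) * \<phi> x)"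
proof -
  show "integrable lborel (\<lambda>x. u x * \<phi> x)"
    by (rule integrable_mult_compact_support[OF _ sol_measurable(1) assms]) (use uG in \<open>auto simp: loc_H1_grad_def\<close>)
  assume b: "b \<in> Basis"
  have [measurable]: "ball (0::(real ^ 'n) \<times> real) r \<in> sets borel" for r by simp
  note [measurable] = sol_measurable
  show "integrable lborel (\<lambda>x. (G x \<bullet> b) * \<phi> x)"
  proof (rule integrable_mult_compact_support[OF _ _ assms])
    fix R
    have "set_integrable lborel (ball 0 R) (\<lambda>x. (norm (G x))\<^sup>2)" using uG by (auto simp: loc_H1_grad_def)
    then show "set_integrable lborel (ball 0 R) (\<lambda>x. (norm (G x \<bullet> b))\<^sup>2)"
      unfolding set_integrable_def
      by (rule Bochner_Integration.integrable_bound)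
        (auto simp: indicator_def abs_le_square_iff[symmetric] Basis_le_norm[OF b] power_mono)
  qed simp
qed

text \<open>The scaling law of \<open>J\<close> is differentiated at 1. As \<open>u\<close> need not
  be differentiable, the dilation is put on \<open>\<phi>\<close>.\<close>

lemma weak_homogeneity:
  assumes \<phi>: "test_function UNIV \<phi>"
  shows "(LINT x|lborel. u x * (grad \<phi> x \<bullet> x)) = - (real DIM((real ^ 'n) \<times> real) + 3 / 2) * (LINT x|lborel. u x * \<phi> x)"
proof -
  let ?N = "DIM((real ^ 'n) \<times> real)"
  note sm = test_function_smooth[OF \<phi>]
  note [measurable] = sol_measurable borel_measurable_smooth[OF sm refl]
  obtain K where K: "compact K" "\<And>x. x \<notin> K \<Longrightarrow> \<phi> x = 0" "\<And>x. x \<notin> K \<Longrightarrow> grad \<phi> x = 0"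
    using test_function_support[OF \<phi>] by metis
  obtain B where B: "B \<ge> 0" "\<And>x. norm (grad \<phi> x) \<le> B" using test_function_bounded[OF \<phi>] by metis
  obtain R where R: "\<And>x. x \<in> K \<Longrightarrow> norm x \<le> R"
    using compact_imp_bounded[OF K(1)] by (auto simp: bounded_iff)
  have mg: "(\<lambda>x. grad \<phi> x \<bullet> x) \<in> borel_measurable borel"
    by (intro borel_measurable_continuous_onI continuous_intros continuous_grad[OF sm])
  define J where "J s = (LINT x|lborel. u x * \<phi> (s *\<^sub>R x))" for s
  have J: "J s = s powr (- (real ?N + 3 / 2)) * J 1" if s: "s > 0" for s
  proof -
    have inv_pos: "1 / s > 0" using s by simp
    have "J s = (1 / s) ^ ?N * (LINT x|lborel. u ((1 / s) *\<^sub>R x) * \<phi> (s *\<^sub>R ((1 / s) *\<^sub>R x)))"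
      unfolding J_def by (rule integral_lborel_scaleR[OF inv_pos]) simp
    also have "(LINT x|lborel. u ((1 / s) *\<^sub>R x) * \<phi> (s *\<^sub>R ((1 / s) *\<^sub>R x))) = (LINT x|lborel. (1 / s) powr (3 / 2) * (u x * \<phi> x))"
    proof (rule integral_cong_AE)
      show "AE x in lborel. u ((1 / s) *\<^sub>R x) * \<phi> (s *\<^sub>R ((1 / s) *\<^sub>R x)) = (1 / s) powr (3 / 2) * (u x * \<phi> x)"
        using hom[OF inv_pos] by eventually_elim (use s in simp)
    qed simp_all
    also have "\<dots> = (1 / s) powr (3 / 2) * J 1" by (simp add: J_def)
    also have "(1 / s) ^ ?N * ((1 / s) powr (3 / 2) * J 1) = s powr (- (real ?N + 3 / 2)) * J 1"
    proof -
      have "(1 / s) ^ ?N = s powr (- real ?N)" using s by (simp add: powr_minus powr_realpow power_one_over inverse_eq_divide del: DIM_prod DIM_cart)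
      moreover have "(1 / s) powr (3 / 2) = s powr (- (3 / 2))" using s by (simp add: powr_divide powr_minus_divide)
      moreover have "s powr (- (real ?N + 3 / 2)) = s powr (- real ?N) * s powr (- (3 / 2))"
        unfolding powr_add[symmetric] by simp
      ultimately show ?thesis by (simp only: mult.assoc)
    qed
    finally show ?thesis .
  qed
  define t :: "nat \<Rightarrow> real" where "t n = 1 / real (Suc n)" for n
  \<comment> \<open>Only dilations by factors above 1 occur: they move points outwards, so beyond
    radius \<open>R\<close> a dilated point stays outside \<open>K\<close>.\<close>
  have t: "t n > 0" "t n \<le> 1" for n by (auto simp: t_def)
  have t0: "t \<longlonglongrightarrow> 0" unfolding t_def by real_asymp
  have t0': "filterlim t (at 0) sequentially" using t t0 by (auto simp: filterlim_at less_imp_neq[symmetric])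
  define q where "q n x = u x * ((\<phi> ((1 + t n) *\<^sub>R x) - \<phi> x) / t n)" for n x
  have "(\<lambda>n. LINT x|lborel. q n x) \<longlonglongrightarrow> (LINT x|lborel. u x * (grad \<phi> x \<bullet> x))"
  proof (rule integral_dominated_convergence)
    have "integrable lborel (\<lambda>x. u x * (indicator (ball 0 (R + 1)) x * (B * (R + 1))))"
    proof (rule Bochner_Integration.integrable_bound)
      have "integrable lborel (indicator (ball (0 :: (real ^ 'n) \<times> real) (R + 1)) :: _ \<Rightarrow> real)"
        by (intro integrable_real_indicator emeasure_lborel_ball_finite) simp
      then show "integrable lborel (\<lambda>x. indicator (ball 0 (R + 1)) x *\<^sub>R (u x)\<^sup>2 + (B * (R + 1))\<^sup>2 * indicator (ball 0 (R + 1)) x :: real)"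
        using uG by (auto simp: loc_H1_grad_def set_integrable_def)
      have [measurable]: "ball (0::(real ^ 'n) \<times> real) r \<in> sets borel" for r by simp
      show "(\<lambda>x. u x * (indicator (ball 0 (R + 1)) x * (B * (R + 1)))) \<in> borel_measurable lborel" by simp
      show "AE x in lborel. norm (u x * (indicator (ball 0 (R + 1)) x * (B * (R + 1))))
          \<le> norm (indicator (ball 0 (R + 1)) x *\<^sub>R (u x)\<^sup>2 + (B * (R + 1))\<^sup>2 * indicator (ball 0 (R + 1)) x :: real)"
      proof (rule AE_I2)
        fix x :: "(real ^ 'n) \<times> real"
        have "\<bar>u x\<bar> * \<bar>B * (R + 1)\<bar> \<le> (u x)\<^sup>2 + (B * (R + 1))\<^sup>2"
          using sum_squares_bound[of "\<bar>u x\<bar>" "\<bar>B * (R + 1)\<bar>"] mult_nonneg_nonneg[of "\<bar>u x\<bar>" "\<bar>B * (R + 1)\<bar>"]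
          unfolding power2_abs by linarith
        then show "norm (u x * (indicator (ball 0 (R + 1)) x * (B * (R + 1))))
          \<le> norm (indicator (ball 0 (R + 1)) x *\<^sub>R (u x)\<^sup>2 + (B * (R + 1))\<^sup>2 * indicator (ball 0 (R + 1)) x :: real)"
          by (cases "x \<in> ball 0 (R + 1)") (auto simp: abs_mult)
      qed
    qed
    then show "integrable lborel (\<lambda>x. \<bar>u x * (indicator (ball 0 (R + 1)) x * (B * (R + 1)))\<bar>)" by simp
    show "AE x in lborel. norm (q n x) \<le> \<bar>u x * (indicator (ball 0 (R + 1)) x * (B * (R + 1)))\<bar>" for n
    proof (rule AE_I2)
      fix x
      show "norm (q n x) \<le> \<bar>u x * (indicator (ball 0 (R + 1)) x * (B * (R + 1)))\<bar>"
      proof (cases "norm x < R + 1")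
        case True
        have "\<bar>\<phi> ((1 + t n) *\<^sub>R x) - \<phi> x\<bar> \<le> B * norm ((1 + t n) *\<^sub>R x - x)"
          by (rule lipschitz_of_grad[OF sm B(2)])
        also have "(1 + t n) *\<^sub>R x - x = t n *\<^sub>R x" by (simp add: scaleR_left_distrib)
        also have "B * norm (t n *\<^sub>R x) = t n * (B * norm x)" using t[of n] by simp
        finally have "\<bar>(\<phi> ((1 + t n) *\<^sub>R x) - \<phi> x) / t n\<bar> \<le> B * norm x"
          using t[of n] by (simp add: abs_divide pos_divide_le_eq mult.commute)
        also have "\<dots> \<le> \<bar>B * (R + 1)\<bar>"
          using mult_left_mono[OF less_imp_le[OF True] B(1)] by linarith
        finally have "\<bar>u x\<bar> * \<bar>(\<phi> ((1 + t n) *\<^sub>R x) - \<phi> x) / t n\<bar> \<le> \<bar>u x\<bar> * \<bar>B * (R + 1)\<bar>"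
          by (intro mult_left_mono) auto
        then show ?thesis using True unfolding q_def by (simp add: abs_mult)
      next
        case False
        then have "x \<notin> K" using R[of x] by auto
        moreover have "norm ((1 + t n) *\<^sub>R x) \<ge> norm x" using t[of n] by (simp add: mult_le_cancel_right1)
        then have "(1 + t n) *\<^sub>R x \<notin> K" using R[of "(1 + t n) *\<^sub>R x"] False by fastforce
        ultimately show ?thesis using K(2) by (simp add: q_def)
      qed
    qed
    show "AE x in lborel. (\<lambda>n. q n x) \<longlonglongrightarrow> u x * (grad \<phi> x \<bullet> x)"
    proof (rule AE_I2)
      fix x
      have "((\<lambda>s. \<phi> (x + s *\<^sub>R x)) has_real_derivative grad \<phi> x \<bullet> x) (at 0)"
        unfolding has_field_derivative_def
        by (rule has_derivative_eq_rhs[OF has_derivative_compose[where g = \<phi> and f = "\<lambda>s. x + s *\<^sub>R x"]])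
          (auto intro!: derivative_eq_intros has_derivative_grad smooth_differentiable[OF sm] simp: fun_eq_iff)
      then have "((\<lambda>s. (\<phi> (x + s *\<^sub>R x) - \<phi> x) / s) \<longlongrightarrow> grad \<phi> x \<bullet> x) (at 0)"
        by (simp add: has_field_derivative_iff)
      from filterlim_compose[OF this t0']
      have "(\<lambda>n. (\<phi> (x + t n *\<^sub>R x) - \<phi> x) / t n) \<longlonglongrightarrow> grad \<phi> x \<bullet> x" .
      from tendsto_mult_left[OF this, of "u x"]
      show "(\<lambda>n. q n x) \<longlonglongrightarrow> u x * (grad \<phi> x \<bullet> x)" by (simp add: q_def scaleR_left_distrib)
    qed
    show "(\<lambda>x. u x * (grad \<phi> x \<bullet> x)) \<in> borel_measurable lborel" using mg by simp
    show "q n \<in> borel_measurable lborel" for n unfolding q_def[abs_def] by simp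
  qed
  moreover have "(LINT x|lborel. q n x) = (((1 + t n) powr (- (real ?N + 3 / 2)) - 1) / t n) * J 1" for n
  proof -
    have c: "continuous_on UNIV (\<lambda>x. \<phi> (s *\<^sub>R x))" for s
      by (intro continuous_on_compose2[OF smooth_continuous[OF sm, of UNIV]] continuous_intros) auto
    have i: "integrable lborel (\<lambda>x. u x * \<phi> (s *\<^sub>R x))" if s: "s \<ge> 1" for s
    proof (rule sol_loc_int(1)[OF c, of "cball 0 R"])
      fix x :: "(real ^ 'n) \<times> real" assume "x \<notin> cball 0 R"
      moreover have "norm (s *\<^sub>R x) \<ge> norm x" using s by (simp add: mult_le_cancel_right1)
      ultimately have "s *\<^sub>R x \<notin> K" using R[of "s *\<^sub>R x"] by fastforce
      then show "\<phi> (s *\<^sub>R x) = 0" by (rule K(2))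
    qed simp
    have "q n x = (u x * \<phi> ((1 + t n) *\<^sub>R x) - u x * \<phi> (1 *\<^sub>R x)) / t n" for x
      by (simp add: q_def right_diff_distrib)
    then have "(LINT x|lborel. q n x) = (LINT x|lborel. (u x * \<phi> ((1 + t n) *\<^sub>R x) - u x * \<phi> (1 *\<^sub>R x)) / t n)" by simp
    also have "\<dots> = (J (1 + t n) - J 1) / t n"
      using i[of "1 + t n"] i[of 1] t[of n] by (simp add: J_def)
    also have "J (1 + t n) = (1 + t n) powr (- (real ?N + 3 / 2)) * J 1" using t[of n] by (intro J) simp
    finally show ?thesis by (simp add: field_simps)
  qed
  moreover have "(\<lambda>n. (((1 + t n) powr (- (real ?N + 3 / 2)) - 1) / t n) * J 1) \<longlonglongrightarrow> - (real ?N + 3 / 2) * J 1"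
  proof (rule tendsto_mult_right)
    define \<alpha> where "\<alpha> = - (real ?N + 3 / 2)"
    have "((\<lambda>s. (1 + s) powr \<alpha>) has_real_derivative \<alpha>) (at 0)"
      by (auto intro!: derivative_eq_intros)
    then have "((\<lambda>s. ((1 + s) powr \<alpha> - 1) / s) \<longlongrightarrow> \<alpha>) (at 0)" by (simp add: has_field_derivative_iff)
    from filterlim_compose[OF this t0'] show "(\<lambda>n. ((1 + t n) powr (- (real ?N + 3 / 2)) - 1) / t n) \<longlonglongrightarrow> - (real ?N + 3 / 2)"
      by (simp add: \<alpha>_def)
  qed
  ultimately have "(LINT x|lborel. u x * (grad \<phi> x \<bullet> x)) = - (real ?N + 3 / 2) * J 1"
    using LIMSEQ_unique by simp
  then show ?thesis by (simp add: J_def)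
qed

text \<open>Testing the weak gradient with \<open>(x \<bullet> b) * \<phi> x\<close> and summing
  over \<open>b\<close> produces the dimension times the integral of u \<phi>; it cancels against
  the same term in \<open>weak_homogeneity\<close>. The fundamental lemma removes
  \<open>\<phi>\<close>.\<close>

lemma euler: "AE x in lborel. G x \<bullet> x = 3 / 2 * u x"
proof -
  let ?N = "DIM((real ^ 'n) \<times> real)"
  define f where "f x = G x \<bullet> x - 3 / 2 * u x" for x
  note [measurable] = sol_measurable
  have fm[measurable]: "f \<in> borel_measurable borel" unfolding f_def[abs_def] by simp
  have fint: "integrable lborel (\<lambda>x. f x * \<phi> x)" if "continuous_on UNIV \<phi>" "compact K" "\<And>x. x \<notin> K \<Longrightarrow> \<phi> x = 0" for \<phi> K
  proof -
    have "integrable lborel (\<lambda>x. (G x \<bullet> b) * ((x \<bullet> b) * \<phi> x))" if "b \<in> Basis" for b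
      by (rule sol_loc_int(2)[OF _ \<open>compact K\<close> _ that]) (auto intro!: continuous_intros simp: \<open>continuous_on UNIV \<phi>\<close> \<open>\<And>x. x \<notin> K \<Longrightarrow> \<phi> x = 0\<close>)
    then have "integrable lborel (\<lambda>x. (\<Sum>b\<in>Basis. (G x \<bullet> b) * ((x \<bullet> b) * \<phi> x)) - 3 / 2 * (u x * \<phi> x))"
      using sol_loc_int(1)[OF that] by (intro Bochner_Integration.integrable_diff Bochner_Integration.integrable_sum integrable_mult_right) auto
    moreover have "(\<Sum>b\<in>Basis. (G x \<bullet> b) * ((x \<bullet> b) * \<phi> x)) - 3 / 2 * (u x * \<phi> x) = f x * \<phi> x" for x
      unfolding f_def euclidean_inner[of "G x" x] by (simp add: sum_distrib_right left_diff_distrib mult.assoc)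
    ultimately show ?thesis by simp
  qed
  have "AE x in lebesgue. x \<in> UNIV \<longrightarrow> f x = 0"
  proof (rule fundamental_lemma)
    show "locally_integrable UNIV f" unfolding locally_integrable_def
    proof (intro allI impI)
      fix K :: "((real ^ 'n) \<times> real) set" assume "compact K \<and> K \<subseteq> UNIV"
      then have K: "compact K" "K \<in> sets borel" by (auto intro: borel_compact)
      obtain R where R: "K \<subseteq> ball 0 R" using bounded_subset_ballD[OF compact_imp_bounded[OF K(1)], of 0] by blast
      \<comment> \<open>A continuous cutoff that equals 1 on \<open>K\<close>, so that
        \<open>fint\<close> yields local integrability.\<close>
      define \<psi> where "\<psi> x = max 0 (min 1 (R + 1 - norm x))" for x :: "(real ^ 'n) \<times> real"
      have i: "integrable lborel (\<lambda>x. f x * \<psi> x)"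
        by (rule fint[of _ "cball 0 (R + 1)"]) (auto simp: \<psi>_def[abs_def] intro!: continuous_intros)
      have "integrable lborel (\<lambda>x. indicator K x *\<^sub>R (f x * \<psi> x))"
        by (rule integrable_mult_indicator[OF _ i]) (use K in simp)
      moreover have "(\<lambda>x. indicator K x *\<^sub>R (f x * \<psi> x)) = (\<lambda>x. indicator K x *\<^sub>R f x)"
        by (rule ext) (use R in \<open>auto simp: indicator_def \<psi>_def subset_eq\<close>)
      ultimately have "integrable lborel (\<lambda>x. indicator K x *\<^sub>R f x)" by metis
      then show "set_integrable lebesgue K f"
        unfolding set_integrable_def using K(2) by (subst integrable_completion) auto
    qed
    fix \<phi> :: "(real ^ 'n) \<times> real \<Rightarrow> real" assume \<phi>: "test_function UNIV \<phi>"
    note sm = test_function_smooth[OF \<phi>]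
    note [measurable] = borel_measurable_smooth[OF sm refl]
    obtain K where K: "compact K" "\<And>x. x \<notin> K \<Longrightarrow> \<phi> x = 0" "\<And>x. x \<notin> K \<Longrightarrow> grad \<phi> x = 0"
      using test_function_support[OF \<phi>] by metis
    have eG: "G x \<bullet> x = (\<Sum>b\<in>Basis. (G x \<bullet> b) * (x \<bullet> b))"
      and eg: "grad \<phi> x \<bullet> x = (\<Sum>b\<in>Basis. (grad \<phi> x \<bullet> b) * (x \<bullet> b))" for x
      by (rule euclidean_inner)+
    have iG: "integrable lborel (\<lambda>x. (G x \<bullet> b) * ((x \<bullet> b) * \<phi> x))" if "b \<in> Basis" for b
      by (rule sol_loc_int(2)[OF _ K(1) _ that]) (use K in \<open>auto intro!: continuous_intros smooth_continuous[OF sm]\<close>)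
    have iu: "integrable lborel (\<lambda>x. u x * \<phi> x)"
      by (rule sol_loc_int(1)[OF smooth_continuous[OF sm] K(1,2)])
    have ig: "integrable lborel (\<lambda>x. u x * ((x \<bullet> b) * (grad \<phi> x \<bullet> b)))" for b
      by (rule sol_loc_int(1)[OF _ K(1)]) (use K in \<open>auto intro!: continuous_intros continuous_grad[OF sm]\<close>)
    have "(LINT x|lborel. (G x \<bullet> b) * ((x \<bullet> b) * \<phi> x)) = - (LINT x|lborel. u x * ((x \<bullet> b) * (grad \<phi> x \<bullet> b))) - (LINT x|lborel. u x * \<phi> x)"
      if b: "b \<in> Basis" for b
    proof -
      have t: "test_function UNIV (\<lambda>x. (x \<bullet> b) * \<phi> x)" by (rule test_function_mult(2)[OF \<phi> smooth_inner])
      have "(LINT x|lborel. (G x \<bullet> b) * ((x \<bullet> b) * \<phi> x)) = - (LINT x|lborel. u x * (grad (\<lambda>x. (x \<bullet> b) * \<phi> x) x \<bullet> b))"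
        using uG t b by (simp add: loc_H1_grad_def)
      also have "\<dots> = - (LINT x|lborel. u x * ((x \<bullet> b) * (grad \<phi> x \<bullet> b)) + u x * \<phi> x)"
        unfolding grad_mult[OF smooth_inner sm] using b by (simp add: inner_add_left algebra_simps)
      finally show ?thesis using ig iu by simp
    qed
    then have "(\<Sum>b\<in>Basis. LINT x|lborel. (G x \<bullet> b) * ((x \<bullet> b) * \<phi> x))
       = - (\<Sum>b\<in>Basis. LINT x|lborel. u x * ((x \<bullet> b) * (grad \<phi> x \<bullet> b))) - real ?N * (LINT x|lborel. u x * \<phi> x)"
      by (simp add: sum_subtractf sum_negf)
    also have "(\<Sum>b\<in>Basis. LINT x|lborel. u x * ((x \<bullet> b) * (grad \<phi> x \<bullet> b))) = (LINT x|lborel. u x * (grad \<phi> x \<bullet> x))"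
      unfolding eg sum_distrib_left
      using ig by (subst Bochner_Integration.integral_sum) (auto simp: mult.commute)
    also have "\<dots> = - (real ?N + 3 / 2) * (LINT x|lborel. u x * \<phi> x)" by (rule weak_homogeneity[OF \<phi>])
    also have "(\<Sum>b\<in>Basis. LINT x|lborel. (G x \<bullet> b) * ((x \<bullet> b) * \<phi> x)) = (LINT x|lborel. (G x \<bullet> x) * \<phi> x)"
      unfolding eG sum_distrib_right
      using iG by (subst Bochner_Integration.integral_sum) (auto simp: mult.assoc)
    finally have e: "(LINT x|lborel. (G x \<bullet> x) * \<phi> x) = 3 / 2 * (LINT x|lborel. u x * \<phi> x)" by (simp add: algebra_simps)
    have iGx: "integrable lborel (\<lambda>x. (G x \<bullet> x) * \<phi> x)"
      unfolding eG sum_distrib_right using iG by (auto simp: mult.assoc)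
    have "(LINT x|lebesgue. f x * \<phi> x) = (LINT x|lborel. f x * \<phi> x)"
      by (rule integral_completion) simp
    also have "\<dots> = (LINT x|lborel. (G x \<bullet> x) * \<phi> x - 3 / 2 * (u x * \<phi> x))"
      by (simp add: f_def left_diff_distrib mult.assoc)
    also have "\<dots> = 0" using iGx iu e by simp
    finally show "(LINT x|lebesgue. f x * \<phi> x) = 0" .
  qed simp
  then show ?thesis by (simp add: AE_lborel_iff_lebesgue f_def)
qed

text \<open>The choice \<eta> = - \<open>gcut j\<close> shrinks \<open>u\<close> towards 0; the
  gradient of the weight brings in \<open>G x \<bullet> x\<close>, which \<open>euler\<close>
  replaces by 3/2 u.\<close>

lemma sol_energy: "L2 gauss G" "(LINT x|gauss. (norm (G x))\<^sup>2) \<le> 3 / 2 * (LINT x|gauss. (u x)\<^sup>2)"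
proof -
  note [measurable] = sol_measurable
  have [measurable]: "ball (0::(real ^ 'n) \<times> real) r \<in> sets borel" for r by simp
  have iu: "integrable gauss (\<lambda>x. 3 / 2 * (u x)\<^sup>2)" using sol_L2 by (simp add: L2_def)
  define L where "L = (LINT x|gauss. 3 / 2 * (u x)\<^sup>2)"
  have lim: "(\<lambda>j. LINT x|gauss. cutoff j x * (3 / 2 * (u x)\<^sup>2) + cutoff' j x * (3 / 2 * (u x)\<^sup>2)) \<longlonglongrightarrow> L"
    unfolding L_def by (rule cutoff_dominated[OF iu iu])
  have cG: "integrable gauss (\<lambda>x. cutoff j x * (norm (G x))\<^sup>2)" for j
  proof (subst integrable_gauss_iff)
    have "integrable lborel (\<lambda>x. indicator (ball 0 (real (j + 2))) x *\<^sub>R (norm (G x))\<^sup>2)"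
      using uG by (simp add: loc_H1_grad_def set_integrable_def)
    then show "integrable lborel (\<lambda>x. exp (- (norm x)\<^sup>2 / 2) * (cutoff j x * (norm (G x))\<^sup>2))"
    proof (rule Bochner_Integration.integrable_bound)
      show "AE x in lborel. norm (exp (- (norm x)\<^sup>2 / 2) * (cutoff j x * (norm (G x))\<^sup>2)) \<le> norm (indicator (ball 0 (real (j + 2))) x *\<^sub>R (norm (G x))\<^sup>2)"
      proof (rule AE_I2)
        fix x
        show "norm (exp (- (norm x)\<^sup>2 / 2) * (cutoff j x * (norm (G x))\<^sup>2)) \<le> norm (indicator (ball 0 (real (j + 2))) x *\<^sub>R (norm (G x))\<^sup>2)"
        proof (cases "norm x < real (j + 2)")
          case True
          have "exp (- (norm x)\<^sup>2 / 2) * cutoff j x \<le> 1 * 1"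
            using cutoff_bounds[of j x] by (intro mult_mono) auto
          then have "(exp (- (norm x)\<^sup>2 / 2) * cutoff j x) * (norm (G x))\<^sup>2 \<le> 1 * (norm (G x))\<^sup>2"
            by (intro mult_right_mono) auto
          then show ?thesis using True cutoff_bounds[of j x] by (simp add: abs_mult mult.assoc)
        next
          case False
          then have "(real (Suc j))\<^sup>2 \<le> (norm x)\<^sup>2" by (intro power_mono) auto
          then have "cutoff j x = 0" by (simp add: cutoff_def bump_eq_0_iff)
          then show ?thesis by simp
        qed
      qed
    qed simp
  qed simp
  have le: "(LINT x|gauss. cutoff j x * (norm (G x))\<^sup>2) \<le> (LINT x|gauss. cutoff j x * (3 / 2 * (u x)\<^sup>2) + cutoff' j x * (3 / 2 * (u x)\<^sup>2))" for j
  proof -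
    obtain C where C: "C \<ge> 0" "\<And>j (x::(real ^ 'n) \<times> real). cutoff' j x \<le> C / (real (Suc j))\<^sup>2" using cutoff'_bound by metis
    have i2: "integrable gauss (\<lambda>x. cutoff j x * (3 / 2 * (u x)\<^sup>2) + cutoff' j x * (3 / 2 * (u x)\<^sup>2))"
    proof (rule Bochner_Integration.integrable_add)
      show "integrable gauss (\<lambda>x. cutoff j x * (3 / 2 * (u x)\<^sup>2))"
      proof -
        have "integrable gauss (\<lambda>x. (3 / 2 * (u x)\<^sup>2) * cutoff j x)"
          by (rule integrable_bounded_mult[OF iu, of _ 1]) (auto simp: cutoff_bounds)
        then show ?thesis by (simp only: mult.commute)
      qed
      show "integrable gauss (\<lambda>x. cutoff' j x * (3 / 2 * (u x)\<^sup>2))"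
      proof -
        have "integrable gauss (\<lambda>x. (3 / 2 * (u x)\<^sup>2) * cutoff' j x)"
          by (rule integrable_bounded_mult[OF iu, of _ "C / (real (Suc j))\<^sup>2"])
            (use C(2)[of j] in \<open>auto simp: cutoff_bounds\<close>)
        then show ?thesis by (simp only: mult.commute)
      qed
    qed
    have "test_function UNIV (\<lambda>x. - 1 * gcut j x :: real)"
      by (rule test_function_mult(2)[OF gcut_test_function smooth_const])
    then have "0 \<le> (LINT x|lborel. G x \<bullet> ((- 1 * gcut j x) *\<^sub>R G x + u x *\<^sub>R grad (\<lambda>x. - 1 * gcut j x) x + grad (\<lambda>_. 0) x))"
      by (rule var) (auto simp: gcut_even intro: zero_test_function)
    also have "\<dots> = (LINT x|lborel. exp (- (norm x)\<^sup>2 / 2) * ((cutoff j x * (3 / 2 * (u x)\<^sup>2) + cutoff' j x * (3 / 2 * (u x)\<^sup>2)) - cutoff j x * (norm (G x))\<^sup>2))"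
    proof (rule integral_cong_AE)
      have c: "grad (\<lambda>x. - 1 * gcut j x) x = (- 1) *\<^sub>R grad (gcut j) x" for x :: "(real ^ 'n) \<times> real"
        by (rule grad_cmult[OF test_function_smooth[OF gcut_test_function]])
      have [measurable]: "gcut j \<in> borel_measurable borel" "grad (gcut j) \<in> borel_measurable (borel :: ((real ^ 'n) \<times> real) measure)"
        using test_function_smooth[OF gcut_test_function]
        by (auto intro!: borel_measurable_continuous_onI smooth_continuous continuous_grad)
      show "(\<lambda>x. G x \<bullet> ((- 1 * gcut j x) *\<^sub>R G x + u x *\<^sub>R grad (\<lambda>x. - 1 * gcut j x) x + grad (\<lambda>_. 0) x)) \<in> borel_measurable lborel"
        unfolding c by simp
      show "(\<lambda>x. exp (- (norm x)\<^sup>2 / 2) * ((cutoff j x * (3 / 2 * (u x)\<^sup>2) + cutoff' j x * (3 / 2 * (u x)\<^sup>2)) - cutoff j x * (norm (G x))\<^sup>2)) \<in> borel_measurable lborel"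
        by simp
      show "AE x in lborel. G x \<bullet> ((- 1 * gcut j x) *\<^sub>R G x + u x *\<^sub>R grad (\<lambda>x. - 1 * gcut j x) x + grad (\<lambda>_. 0) x)
          = exp (- (norm x)\<^sup>2 / 2) * ((cutoff j x * (3 / 2 * (u x)\<^sup>2) + cutoff' j x * (3 / 2 * (u x)\<^sup>2)) - cutoff j x * (norm (G x))\<^sup>2)"
        using euler
      proof eventually_elim
        case (elim x)
        have "G x \<bullet> ((- 1 * gcut j x) *\<^sub>R G x + u x *\<^sub>R grad (\<lambda>x. - 1 * gcut j x) x + grad (\<lambda>_. 0) x)
            = - gcut j x * (G x \<bullet> G x) + u x * ((cutoff j x + cutoff' j x) * exp (- (norm x)\<^sup>2 / 2)) * (G x \<bullet> x)"
          unfolding c grad_gcut by (simp add: inner_add_right inner_diff_right mult.assoc)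
        also have "\<dots> = exp (- (norm x)\<^sup>2 / 2) * ((cutoff j x * (3 / 2 * (u x)\<^sup>2) + cutoff' j x * (3 / 2 * (u x)\<^sup>2)) - cutoff j x * (norm (G x))\<^sup>2)"
          unfolding elim gcut_def power2_norm_eq_inner by (simp add: power2_eq_square algebra_simps)
        finally show ?case .
      qed
    qed
    also have "\<dots> = (LINT x|gauss. (cutoff j x * (3 / 2 * (u x)\<^sup>2) + cutoff' j x * (3 / 2 * (u x)\<^sup>2)) - cutoff j x * (norm (G x))\<^sup>2)"
      by (rule integral_gauss[symmetric]) simp
    finally show ?thesis by (subst (asm) Bochner_Integration.integral_diff[OF i2 cG]) simp
  qed
  \<comment> \<open>Global integrability of |G|^2 is not yet known, so the cutoff is removed by
    Fatou in \<open>ennreal\<close>; the bound then proves integrability as well.\<close>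
  have "(\<integral>\<^sup>+ x. ennreal ((norm (G x))\<^sup>2) \<partial>gauss) \<le> (\<integral>\<^sup>+ x. liminf (\<lambda>j. ennreal (cutoff j x * (norm (G x))\<^sup>2)) \<partial>gauss)"
  proof (rule nn_integral_mono)
    fix x
    have "(\<lambda>j. cutoff j x * (norm (G x))\<^sup>2) \<longlonglongrightarrow> 1 * (norm (G x))\<^sup>2" by (intro tendsto_intros cutoff_tendsto)
    then have "(\<lambda>j. ennreal (cutoff j x * (norm (G x))\<^sup>2)) \<longlonglongrightarrow> ennreal ((norm (G x))\<^sup>2)" by (intro tendsto_ennrealI) simp
    then show "ennreal ((norm (G x))\<^sup>2) \<le> liminf (\<lambda>j. ennreal (cutoff j x * (norm (G x))\<^sup>2))"
      by (simp add: lim_imp_Liminf)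
  qed
  also have "\<dots> \<le> liminf (\<lambda>j. \<integral>\<^sup>+ x. ennreal (cutoff j x * (norm (G x))\<^sup>2) \<partial>gauss)"
    by (rule nn_integral_liminf) simp
  also have "\<dots> \<le> liminf (\<lambda>j. ennreal (LINT x|gauss. cutoff j x * (3 / 2 * (u x)\<^sup>2) + cutoff' j x * (3 / 2 * (u x)\<^sup>2)))"
  proof (intro Liminf_mono always_eventually allI)
    fix j
    have "(\<integral>\<^sup>+ x. ennreal (cutoff j x * (norm (G x))\<^sup>2) \<partial>gauss) = ennreal (LINT x|gauss. cutoff j x * (norm (G x))\<^sup>2)"
      by (rule nn_integral_eq_integral[OF cG]) (simp add: cutoff_bounds)
    also have "\<dots> \<le> ennreal (LINT x|gauss. cutoff j x * (3 / 2 * (u x)\<^sup>2) + cutoff' j x * (3 / 2 * (u x)\<^sup>2))"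
      by (rule ennreal_leI[OF le])
    finally show "(\<integral>\<^sup>+ x. ennreal (cutoff j x * (norm (G x))\<^sup>2) \<partial>gauss) \<le> ennreal (LINT x|gauss. cutoff j x * (3 / 2 * (u x)\<^sup>2) + cutoff' j x * (3 / 2 * (u x)\<^sup>2))" .
  qed
  also have "\<dots> = ennreal L" using tendsto_ennrealI[OF lim] by (simp add: lim_imp_Liminf)
  finally have nn: "(\<integral>\<^sup>+ x. ennreal ((norm (G x))\<^sup>2) \<partial>gauss) \<le> ennreal L" .
  have iG: "integrable gauss (\<lambda>x. (norm (G x))\<^sup>2)"
    by (rule integrableI_bounded) (use nn in \<open>auto intro: le_less_trans\<close>)
  then show "L2 gauss G" by (simp add: L2_def)
  have "ennreal (LINT x|gauss. (norm (G x))\<^sup>2) \<le> ennreal L"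
    using nn nn_integral_eq_integral[OF iG] by simp
  moreover have "L \<ge> 0" by (simp add: L_def)
  ultimately show "(LINT x|gauss. (norm (G x))\<^sup>2) \<le> 3 / 2 * (LINT x|gauss. (u x)\<^sup>2)"
    by (simp add: L_def)
qed

text \<open>Take \<eta> = 0 and \<phi> = \<open>gcut j\<close> times \<open>\<psi>\<close>. The
  derivative falling on the weight gives minus \<psi> times the radial derivative of
  \<open>u\<close>, that is, minus 3/2 u \<psi>.\<close>

lemma sol_variation:
  assumes \<psi>: "smooth \<psi>" "poly_growth \<psi>" "poly_growth (\<lambda>x. norm (grad \<psi> x))"
    and even\<psi>: "\<And>x. \<psi> (fst x, - snd x) = \<psi> x" and thin: "\<And>x'. \<psi> (x', 0) \<ge> 0"
  shows "3 / 2 * (LINT x|gauss. u x * \<psi> x) \<le> (LINT x|gauss. G x \<bullet> grad \<psi> x)"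
proof -
  note [measurable] = sol_measurable poly_growth_measurable[OF \<psi>(2)]
  have [measurable]: "grad \<psi> \<in> borel_measurable borel"
    by (intro borel_measurable_continuous_onI continuous_grad \<psi>)
  have g: "L2 gauss (grad \<psi>)" using poly_growth_L2[OF \<psi>(3)] by (simp add: L2_def)
  have i1: "integrable gauss (\<lambda>x. G x \<bullet> grad \<psi> x)" by (rule integrable_inner_L2[OF sol_energy(1) g])
  have i2: "integrable gauss (\<lambda>x. u x * \<psi> x)" by (rule integrable_mult_L2[OF sol_L2 poly_growth_L2[OF \<psi>(2)]])
  let ?f = "\<lambda>x. G x \<bullet> grad \<psi> x - 3 / 2 * (u x * \<psi> x)" and ?g = "\<lambda>x. - (3 / 2) * (u x * \<psi> x)"
  have "0 \<le> (LINT x|gauss. cutoff j x * ?f x + cutoff' j x * ?g x)" for j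
  proof -
    note gs = test_function_smooth[OF gcut_test_function, of j]
    have t: "test_function UNIV (\<lambda>x. gcut j x * \<psi> x)" by (rule test_function_mult[OF gcut_test_function \<psi>(1)])
    have "0 \<le> (LINT x|lborel. G x \<bullet> (0 *\<^sub>R G x + u x *\<^sub>R grad (\<lambda>_. 0) x + grad (\<lambda>x. gcut j x * \<psi> x) x))"
      by (rule var[OF zero_test_function _ t])
        (auto simp: gcut_even even\<psi> intro!: mult_nonneg_nonneg thin, simp add: gcut_def cutoff_bounds)
    also have "\<dots> = (LINT x|lborel. exp (- (norm x)\<^sup>2 / 2) * (cutoff j x * ?f x + cutoff' j x * ?g x))"
    proof (rule integral_cong_AE)
      have [measurable]: "grad (\<lambda>x. gcut j x * \<psi> x) \<in> borel_measurable borel"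
        by (intro borel_measurable_continuous_onI continuous_grad test_function_smooth[OF t])
      show "(\<lambda>x. G x \<bullet> (0 *\<^sub>R G x + u x *\<^sub>R grad (\<lambda>_. 0) x + grad (\<lambda>x. gcut j x * \<psi> x) x)) \<in> borel_measurable lborel" by simp
      show "(\<lambda>x. exp (- (norm x)\<^sup>2 / 2) * (cutoff j x * ?f x + cutoff' j x * ?g x)) \<in> borel_measurable lborel" by simp
      show "AE x in lborel. G x \<bullet> (0 *\<^sub>R G x + u x *\<^sub>R grad (\<lambda>_. 0) x + grad (\<lambda>x. gcut j x * \<psi> x) x)
          = exp (- (norm x)\<^sup>2 / 2) * (cutoff j x * ?f x + cutoff' j x * ?g x)"
        using euler
      proof eventually_elim
        case (elim x)
        have "G x \<bullet> (0 *\<^sub>R G x + u x *\<^sub>R grad (\<lambda>_. 0) x + grad (\<lambda>x. gcut j x * \<psi> x) x)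
            = gcut j x * (G x \<bullet> grad \<psi> x) - \<psi> x * ((cutoff j x + cutoff' j x) * exp (- (norm x)\<^sup>2 / 2)) * (G x \<bullet> x)"
          unfolding grad_mult[OF gs \<psi>(1)] grad_gcut by (simp add: inner_add_right inner_diff_right mult.assoc)
        also have "\<dots> = exp (- (norm x)\<^sup>2 / 2) * (cutoff j x * ?f x + cutoff' j x * ?g x)"
          unfolding elim gcut_def by (simp add: algebra_simps)
        finally show ?case .
      qed
    qed
    also have "\<dots> = (LINT x|gauss. cutoff j x * ?f x + cutoff' j x * ?g x)"
      by (rule integral_gauss[symmetric]) simp
    finally show ?thesis .
  qed
  moreover have "(\<lambda>j. LINT x|gauss. cutoff j x * ?f x + cutoff' j x * ?g x) \<longlonglongrightarrow> (LINT x|gauss. ?f x)"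
    by (rule cutoff_dominated) (intro Bochner_Integration.integrable_diff integrable_mult_right i1 i2)+
  ultimately have "0 \<le> (LINT x|gauss. ?f x)" by (intro LIMSEQ_le_const) auto
  also have "(LINT x|gauss. ?f x) = (LINT x|gauss. G x \<bullet> grad \<psi> x) - 3 / 2 * (LINT x|gauss. u x * \<psi> x)"
    using i1 i2 by simp
  finally show ?thesis by simp
qed

text \<open>Both signs of \<open>c\<close> are admissible, so 3/2 E u y^2 = 2 E y du/dy. Integration
  by parts turns the right side into 2 (E u y^2 - E u), and the factor 4 follows.\<close>

lemma sol_yc_square: "(LINT x|gauss. u x * (yc x * yc x)) = 4 * (LINT x|gauss. u x)"
proof -
  have le: "3 / 2 * (LINT x|gauss. u x * (c * (yc x * yc x))) \<le> (LINT x|gauss. G x \<bullet> grad (\<lambda>x. c * (yc x * yc x)) x)" for c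
  proof (rule sol_variation)
    show "smooth (\<lambda>x. c * (yc x * yc x))" by (intro smooth_cmult smooth_mult smooth_yc)
    show "poly_growth (\<lambda>x. c * (yc x * yc x))" by (intro poly_growth_cmult poly_growth_mult pg_yc)
    have m: "(yc :: (real ^ 'n) \<times> real \<Rightarrow> real) \<in> borel_measurable borel"
      by (rule poly_growth_measurable[OF pg_yc])
    have n: "norm (grad (\<lambda>x. c * (yc x * yc x)) x) = \<bar>(2 * c) * yc x\<bar>" for x :: "(real ^ 'n) \<times> real"
      by (simp add: grad_cmult smooth_mult smooth_yc grad_square grad_yc ydir_def norm_Pair abs_mult)
    show "poly_growth (\<lambda>x :: (real ^ 'n) \<times> real. norm (grad (\<lambda>x. c * (yc x * yc x)) x))"
      unfolding n using m
      by (intro poly_growth_bound[OF poly_growth_cmult[OF pg_yc, of "2 * c"]]) auto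
  qed (auto simp: yc_eq)
  have g: "G x \<bullet> grad (\<lambda>x. c * (yc x * yc x)) x = (2 * c) * ((G x \<bullet> ydir) * yc x)" for c x
    by (simp add: grad_cmult smooth_mult smooth_yc grad_square grad_yc)
  have e: "(LINT x|gauss. (2 * c) * ((G x \<bullet> ydir) * yc x)) = (2 * c) * (LINT x|gauss. (G x \<bullet> ydir) * yc x)"
    "(LINT x|gauss. u x * (c * (yc x * yc x))) = c * (LINT x|gauss. u x * (yc x * yc x))" for c
    by (rule integral_mult_right_zero, rule gip_cmult_right)
  have "3 / 2 * (LINT x|gauss. u x * (yc x * yc x)) = 2 * (LINT x|gauss. (G x \<bullet> ydir) * yc x)"
    using le[of 1] le[of "-1"] unfolding g e by simp
  also have "(LINT x|gauss. (G x \<bullet> ydir) * yc x) = (LINT x|gauss. u x * (yc x * yc x - 1))"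
    using gauss_integration_by_parts_dir[OF uG sol_L2 sol_energy(1) poly_le_yc, of ydir]
    by (simp add: grad_yc yc_def ydir_def inner_prod_def)
  also have "\<dots> = (LINT x|gauss. u x * (yc x * yc x)) - (LINT x|gauss. u x * 1)"
    using gip_diff_right[OF poly_growth_L2[OF poly_growth_mult[OF pg_yc pg_yc]] poly_growth_L2[OF poly_growth_const] sol_L2]
    by simp
  finally show ?thesis by simp
qed

text \<open>\<open>sol_variation\<close> needs a smooth test that is nonnegative on the thin space,
  so it is applied to \<open>happ e j\<close>; both sides converge by domination.\<close>

lemma sol_h_pairing:
  assumes e: "norm e = 1"
  shows "3 / 2 * (LINT x|gauss. u x * h e x) \<le> (LINT x|gauss. G x \<bullet> Hreg e 0 x)"
proof -
  note ap = happ_approx[OF e]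
  note props = smooth_approx_properties[OF ap]
  note [measurable] = sol_measurable poly_growth_measurable[OF props(2)] poly_growth_measurable[OF props(6)] props(8)
  have sm: "smooth (happ e j)" and lim: "(\<lambda>j. happ e j x) \<longlonglongrightarrow> h e x" "(\<lambda>j. grad (happ e j) x) \<longlonglongrightarrow> Hreg e 0 x" for j x
    using ap unfolding smooth_approx_def by blast+
  have [measurable]: "grad (happ e j) \<in> borel_measurable borel" for j
    by (intro borel_measurable_continuous_onI continuous_grad sm)
  obtain C k where C: "\<And>j x. \<bar>happ e j x\<bar> \<le> C * (1 + norm x) ^ k" "\<And>j x. norm (grad (happ e j) x) \<le> C * (1 + norm x) ^ k"
    using ap unfolding smooth_approx_def by blast
  have pC: "poly_growth (\<lambda>x::(real ^ 'n) \<times> real. C * (1 + norm x) ^ k)" by (intro poly_growth_intros)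
  have "3 / 2 * (LINT x|gauss. u x * happ e j x) \<le> (LINT x|gauss. G x \<bullet> grad (happ e j) x)" for j
    by (rule sol_variation[OF sm props(6,7) happ_even[OF e] happ_thin[OF e]])
  moreover have "(\<lambda>j. 3 / 2 * (LINT x|gauss. u x * happ e j x)) \<longlonglongrightarrow> 3 / 2 * (LINT x|gauss. u x * h e x)"
  proof (rule tendsto_mult_left, rule integral_dominated_convergence)
    show "integrable gauss (\<lambda>x. \<bar>u x * (C * (1 + norm x) ^ k)\<bar>)"
      by (intro integrable_abs integrable_mult_L2 sol_L2 poly_growth_L2 pC)
    show "AE x in gauss. (\<lambda>j. u x * happ e j x) \<longlonglongrightarrow> u x * h e x" by (intro AE_I2 tendsto_intros lim)
    show "AE x in gauss. norm (u x * happ e j x) \<le> \<bar>u x * (C * (1 + norm x) ^ k)\<bar>" for j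
    proof (rule AE_I2)
      fix x
      have "\<bar>happ e j x\<bar> \<le> \<bar>C * (1 + norm x) ^ k\<bar>" using C(1)[of j x] by linarith
      then show "norm (u x * happ e j x) \<le> \<bar>u x * (C * (1 + norm x) ^ k)\<bar>"
        by (simp only: real_norm_def abs_mult[of "u x"] mult_left_mono abs_ge_zero)
    qed
  qed simp_all
  moreover have "(\<lambda>j. LINT x|gauss. G x \<bullet> grad (happ e j) x) \<longlonglongrightarrow> (LINT x|gauss. G x \<bullet> Hreg e 0 x)"
  proof (rule integral_dominated_convergence)
    have "L2 gauss (\<lambda>x. norm (G x))" using sol_energy(1) by (simp add: L2_def)
    then show "integrable gauss (\<lambda>x. norm (G x) * (C * (1 + norm x) ^ k))"
      by (rule integrable_mult_L2[OF _ poly_growth_L2[OF pC]])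
    show "AE x in gauss. (\<lambda>j. G x \<bullet> grad (happ e j) x) \<longlonglongrightarrow> G x \<bullet> Hreg e 0 x" by (intro AE_I2 tendsto_intros lim)
    show "AE x in gauss. norm (G x \<bullet> grad (happ e j) x) \<le> norm (G x) * (C * (1 + norm x) ^ k)" for j
    proof (rule AE_I2)
      fix x
      have "norm (G x \<bullet> grad (happ e j) x) \<le> norm (G x) * norm (grad (happ e j) x)"
        by (simp add: Cauchy_Schwarz_ineq2)
      also have "\<dots> \<le> norm (G x) * (C * (1 + norm x) ^ k)" by (intro mult_left_mono C) simp
      finally show "norm (G x \<bullet> grad (happ e j) x) \<le> norm (G x) * (C * (1 + norm x) ^ k)" .
    qed
  qed simp_all
  ultimately show ?thesis by (intro LIMSEQ_le) auto
qed

text \<open>\<open>C\<close> and \<open>e\<close> are fitted to the first moments of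
  \<open>u\<close>; the remainder \<open>w\<close> is then excluded by playing the spectral gap
  against the relation with y^2.\<close>

lemma sol_classification: "\<exists>C e. C \<ge> 0 \<and> norm e = 1 \<and> (AE x in lborel. u x = C * h e x)"
proof -
  note [measurable] = sol_measurable
  \<comment> \<open>The first moments of \<open>u\<close> in the thin directions. Those of
    \<open>C * h e\<close> are \<open>C\<close> times a positive factor times \<open>e\<close>, so
    \<open>e\<close> is the direction of \<open>m\<close>; if \<open>m = 0\<close>, take
    \<open>C = 0\<close> and any unit vector.\<close>
  define m :: "real ^ 'n" where "m = (\<Sum>b\<in>Basis. (LINT x|gauss. u x * (x \<bullet> (b, 0))) *\<^sub>R b)"
  have m: "m \<bullet> b = (LINT x|gauss. u x * (x \<bullet> (b, 0)))" if "b \<in> Basis" for b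
    using that by (simp add: m_def)
  have "\<exists>C e. C \<ge> 0 \<and> norm e = 1 \<and> m = (C * (3 / 2 * (LINT x|gauss. rt e 0 x))) *\<^sub>R e"
  proof (cases "m = 0")
    case True
    obtain e :: "real ^ 'n" where "e \<in> Basis" using nonempty_Basis by blast
    then show ?thesis using True by (intro exI[of _ 0] exI[of _ e]) simp
  next
    case False
    define e where "e = m /\<^sub>R norm m"
    have e: "norm e = 1" using False by (simp add: e_def)
    have "(LINT x|gauss. rt e 0 x) > 0" by (rule gauss_rt_pos[OF e])
    then show ?thesis using e False
      by (intro exI[of _ "norm m / (3 / 2 * (LINT x|gauss. rt e 0 x))"] exI[of _ e]) (auto simp: e_def)
  qed
  then obtain C e where C: "C \<ge> 0" and e: "norm e = 1" and me: "m = (C * (3 / 2 * (LINT x|gauss. rt e 0 x))) *\<^sub>R e"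
    by blast
  note hp = h_props[OF e]
  note [measurable] = poly_growth_measurable[OF hp(2)] hp(8)
  define w where "w x = u x - C * h e x" for x
  define W where "W x = G x - C *\<^sub>R Hreg e 0 x" for x
  have Ch: "L2 gauss (\<lambda>x. C * h e x)" by (rule L2_cmult[OF hp(4)])
  have w: "L2 gauss w" unfolding w_def[abs_def] by (rule L2_diff[OF sol_L2 Ch])
  have W: "L2 gauss W"
    unfolding W_def[abs_def] using L2_add[OF sol_energy(1) L2_scaleR[OF hp(5), of "- C"]] by simp
  have PL: "L2 gauss p" if "poly_le d p" for d and p :: "(real ^ 'n) \<times> real \<Rightarrow> real"
    using that by (intro poly_growth_L2 poly_le_growth)
  have wq: "gip w q = gip u q - C * gip (h e) q" if "L2 gauss q" for q
    unfolding w_def using gip_diff_left[OF sol_L2 Ch that] by (simp add: mult.assoc)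
  have inner_L2: "L2 gauss (\<lambda>x. F x \<bullet> b)" if "L2 gauss F" "b \<in> Basis" for F :: "(real ^ 'n) \<times> real \<Rightarrow> (real ^ 'n) \<times> real" and b
    by (rule L2_bounded[OF that(1), of _ 1]) (use that in \<open>auto simp: L2_def Basis_le_norm\<close>)
  have ibp: "(LINT x|gauss. (W x \<bullet> b) * p x) = (LINT x|gauss. w x * (p x * (x \<bullet> b) - grad p x \<bullet> b))"
    if p: "poly_le d p" and b: "b \<in> Basis" for d p b
  proof -
    have q: "L2 gauss (\<lambda>x. p x * (x \<bullet> b) - grad p x \<bullet> b)"
      by (intro L2_diff PL[OF poly_le_mult[OF p poly_le_inner[OF b]]] PL[OF poly_le_grad[OF p b]])
    have "(LINT x|gauss. (W x \<bullet> b) * p x) = gip (\<lambda>x. G x \<bullet> b - C * (Hreg e 0 x \<bullet> b)) p"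
      by (simp add: W_def inner_diff_left)
    also have "\<dots> = gip (\<lambda>x. G x \<bullet> b) p - C * gip (\<lambda>x. Hreg e 0 x \<bullet> b) p"
      using gip_diff_left[OF inner_L2[OF sol_energy(1) b] L2_cmult[OF inner_L2[OF hp(5) b]] PL[OF p], of C]
      by (simp add: mult.assoc)
    also have "\<dots> = gip w (\<lambda>x. p x * (x \<bullet> b) - grad p x \<bullet> b)"
      unfolding wq[OF q] gauss_integration_by_parts_dir[OF uG sol_L2 sol_energy(1) p]
        gauss_integration_by_parts_dir[OF hp(1,4,5) p] ..
    finally show ?thesis .
  qed
  \<comment> \<open>The mixed term is known only as an inequality, and it enters with the factor
    \<open>- 2 * C\<close>; here the sign of \<open>C\<close> matters.\<close>
  have energy: "(LINT x|gauss. (norm (W x))\<^sup>2) \<le> 3 / 2 * (LINT x|gauss. (w x)\<^sup>2)"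
  proof -
    have i: "integrable gauss (\<lambda>x. (norm (G x))\<^sup>2)" "integrable gauss (\<lambda>x. (norm (Hreg e 0 x))\<^sup>2)"
      "integrable gauss (\<lambda>x. (u x)\<^sup>2)" "integrable gauss (\<lambda>x. (h e x)\<^sup>2)"
      using sol_energy(1) hp(4,5) sol_L2 by (auto simp: L2_def)
    have i2: "integrable gauss (\<lambda>x. G x \<bullet> Hreg e 0 x)" "integrable gauss (\<lambda>x. u x * h e x)"
      by (rule integrable_inner_L2[OF sol_energy(1) hp(5)], rule integrable_mult_L2[OF sol_L2 hp(4)])
    have "(LINT x|gauss. (norm (W x))\<^sup>2) = (LINT x|gauss. (norm (G x))\<^sup>2 - 2 * C * (G x \<bullet> Hreg e 0 x) + C\<^sup>2 * (norm (Hreg e 0 x))\<^sup>2)"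
      unfolding W_def by (intro Bochner_Integration.integral_cong refl, simp only: power2_norm_eq_inner)
        (simp add: inner_diff_left inner_diff_right inner_commute power2_eq_square algebra_simps)
    also have "\<dots> = (LINT x|gauss. (norm (G x))\<^sup>2) - 2 * C * (LINT x|gauss. G x \<bullet> Hreg e 0 x) + C\<^sup>2 * (LINT x|gauss. (norm (Hreg e 0 x))\<^sup>2)"
      using i i2 by simp
    also have "\<dots> \<le> 3 / 2 * (LINT x|gauss. (u x)\<^sup>2) - 2 * C * (3 / 2 * (LINT x|gauss. u x * h e x)) + C\<^sup>2 * (3 / 2 * (LINT x|gauss. (h e x)\<^sup>2))"
      by (intro add_mono diff_mono mult_left_mono sol_energy(2) sol_h_pairing[OF e] gauss_h_energy[OF e]) (use C in auto)
    also have "\<dots> = 3 / 2 * ((LINT x|gauss. (u x)\<^sup>2) - 2 * C * (LINT x|gauss. u x * h e x) + C\<^sup>2 * (LINT x|gauss. (h e x)\<^sup>2))"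
      by (simp add: algebra_simps)
    also have "(LINT x|gauss. (u x)\<^sup>2) - 2 * C * (LINT x|gauss. u x * h e x) + C\<^sup>2 * (LINT x|gauss. (h e x)\<^sup>2)
        = (LINT x|gauss. (u x)\<^sup>2 - 2 * C * (u x * h e x) + C\<^sup>2 * (h e x)\<^sup>2)"
      using i i2 by simp
    also have "\<dots> = (LINT x|gauss. (w x)\<^sup>2)"
      unfolding w_def by (intro Bochner_Integration.integral_cong refl) (simp add: power2_eq_square algebra_simps)
    finally show ?thesis .
  qed
  \<comment> \<open>Thin directions cancel by the choice of \<open>C\<close> and \<open>e\<close>;
    in the last direction \<open>u\<close> and \<open>h e\<close> are even, so both moments
    vanish.\<close>
  have lin: "gip w (\<lambda>x. x \<bullet> b) = 0" if b: "b \<in> Basis" for b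
  proof -
    have L: "L2 gauss (\<lambda>x. x \<bullet> b)" by (intro poly_growth_L2 poly_growth_inner)
    consider b' where "b' \<in> Basis" "b = (b', 0)" | "b = (0, 1)" using b by (auto simp: Basis_prod_def)
    then show ?thesis
    proof cases
      case 1
      have "gip u (\<lambda>x. x \<bullet> b) = C * (3 / 2 * (LINT x|gauss. rt e 0 x) * (e \<bullet> b'))"
        using m[OF 1(1)] 1(2) by (simp add: me)
      moreover have "gip (h e) (\<lambda>x. x \<bullet> b) = 3 / 2 * (LINT x|gauss. rt e 0 x) * (e \<bullet> b')"
        unfolding 1(2) by (rule gauss_h_linear_thin[OF e])
      ultimately show ?thesis unfolding wq[OF L] by (simp only: diff_self)
    next
      case 2
      have "gip u (\<lambda>x. x \<bullet> b) = 0"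
        by (rule integral_gauss_odd, simp, use even in eventually_elim) (simp add: 2 inner_prod_def)
      moreover have "gip (h e) (\<lambda>x. x \<bullet> b) = 0"
        by (rule integral_gauss_odd, simp) (simp add: 2 inner_prod_def h_def)
      ultimately show ?thesis unfolding wq[OF L] by simp
    qed
  qed
  have one: "L2 gauss (\<lambda>_ :: (real ^ 'n) \<times> real. 1 :: real)" by (intro poly_growth_L2 poly_growth_const)
  define y where "y = (yc :: (real ^ 'n) \<times> real \<Rightarrow> real)"
  have y2: "L2 gauss (\<lambda>x. y x * y x)" unfolding y_def by (intro poly_growth_L2 poly_growth_mult pg_yc)
  have wy: "gip w (\<lambda>x. y x * y x) = 4 * gip w (\<lambda>_. 1)"
    unfolding wq[OF y2] wq[OF one] using sol_yc_square gauss_h_yc_square[OF e] by (simp add: y_def)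
  define Z where "Z = (LINT x|(gauss :: ((real ^ 'n) \<times> real) measure). (1::real))"
  have Z: "Z > 0" unfolding Z_def by (rule integral_gauss_pos)
  define a where "a = gip w (\<lambda>_. 1) / Z"
  have aL: "L2 gauss (\<lambda>_ :: (real ^ 'n) \<times> real. a)" by (intro poly_growth_L2 poly_growth_const)
  \<comment> \<open>The part of \<open>w\<close> orthogonal to constants; subtracting
    \<open>a\<close> keeps it orthogonal to linear functions, since these have mean 0.\<close>
  define v where "v x = w x - a" for x
  have v: "L2 gauss v" unfolding v_def[abs_def] by (rule L2_diff[OF w aL])
  have aq: "gip (\<lambda>_. a) q = a * (LINT x|gauss. q x)" for q :: "(real ^ 'n) \<times> real \<Rightarrow> real" by simp
  have v1: "gip v (\<lambda>_. 1) = 0"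
    unfolding v_def gip_diff_left[OF w aL one] aq Z_def[symmetric] using Z by (simp add: a_def)
  have tyL: "L2 gauss (\<lambda>x. x \<bullet> b)" for b :: "(real ^ 'n) \<times> real" by (intro poly_growth_L2 poly_growth_inner)
  have vlin: "gip v (\<lambda>x. x \<bullet> b) = 0" if "b \<in> Basis" for b
    unfolding v_def gip_diff_left[OF w aL tyL] lin[OF that] aq
    using gauss_divergence[OF poly_le.const[of 0 1], of b] by simp
  have gap: "2 * gip v v \<le> (LINT x|gauss. (norm (W x))\<^sup>2)"
    unfolding v_def by (rule gauss_spectral_gap[OF w W ibp v1[unfolded v_def] vlin[unfolded v_def]])
  have ww: "(LINT x|gauss. (w x)\<^sup>2) = gip v v + a\<^sup>2 * Z"
  proof -
    have "gip v (\<lambda>_. a) = 0" using v1 gip_cmult_right[of v a "\<lambda>_. 1"] by simp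
    from gip_pythagoras[OF v aL this] show ?thesis by (simp add: v_def power2_eq_square Z_def)
  qed
  have yyZ: "(LINT x|gauss. y x * y x) = Z" unfolding y_def Z_def by (rule gauss_yc_moments(1))
  \<comment> \<open>E w y^2 is 4 a Z, and subtracting a E y^2 = a Z leaves 3 a Z.\<close>
  have vq: "gip v (\<lambda>x. y x * y x - 1) = 3 * a * Z"
  proof -
    have "gip v (\<lambda>x. y x * y x - 1) = gip v (\<lambda>x. y x * y x)"
      using gip_diff_right[OF y2 one v] v1 by simp
    also have "\<dots> = gip w (\<lambda>x. y x * y x) - a * (LINT x|gauss. y x * y x)"
      unfolding v_def gip_diff_left[OF w aL y2] aq ..
    also have "\<dots> = 3 * a * Z"
      unfolding wy yyZ using Z by (simp add: a_def)
    finally show ?thesis .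
  qed
  have qL: "L2 gauss (\<lambda>x. y x * y x - 1)" by (rule L2_diff[OF y2 one])
  \<comment> \<open>The moments combine to 3 - 2 + 1 = 2 times the mass \<open>Z\<close>.\<close>
  have qq: "gip (\<lambda>x. y x * y x - 1) (\<lambda>x. y x * y x - 1) = 2 * Z"
  proof -
    have "gip (\<lambda>x. y x * y x - 1) (\<lambda>x. y x * y x - 1) = gip (\<lambda>x. y x * y x) (\<lambda>x. y x * y x - 1) - gip (\<lambda>_. 1) (\<lambda>x. y x * y x - 1)"
      by (rule gip_diff_left[OF y2 one qL])
    also have "\<dots> = gip (\<lambda>x. y x * y x) (\<lambda>x. y x * y x) - gip (\<lambda>x. y x * y x) (\<lambda>_. 1) - (gip (\<lambda>_. 1) (\<lambda>x. y x * y x) - gip (\<lambda>_. 1) (\<lambda>_ :: (real ^ 'n) \<times> real. 1))"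
      by (simp only: gip_diff_right[OF y2 one y2] gip_diff_right[OF y2 one one])
    also have "\<dots> = 2 * Z"
    proof -
      have "gip (\<lambda>x. y x * y x) (\<lambda>x. y x * y x) = 3 * Z"
        unfolding y_def Z_def by (rule gauss_yc_moments(2))
      moreover have "gip (\<lambda>x. y x * y x) (\<lambda>_. 1) = Z" "gip (\<lambda>_. 1) (\<lambda>x. y x * y x) = Z"
        using yyZ by simp_all
      moreover have "gip (\<lambda>_. 1) (\<lambda>_ :: (real ^ 'n) \<times> real. 1) = Z" by (simp add: Z_def)
      ultimately show ?thesis by linarith
    qed
    finally show ?thesis .
  qed
  have "gip v v \<ge> 9 / 2 * (a\<^sup>2 * Z)"
  proof -
    \<comment> \<open>The projection coefficient of \<open>v\<close> on y^2 - 1, namely 3 a Z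
      divided by 2 Z; nonnegativity of the remainder is then the sharp Cauchy-Schwarz bound.\<close>
    define c where "c = 3 / 2 * a"
    have lq: "L2 gauss (\<lambda>x. c * (y x * y x - 1))" by (rule L2_cmult[OF qL])
    have "0 \<le> gip (\<lambda>x. v x - c * (y x * y x - 1)) (\<lambda>x. v x - c * (y x * y x - 1))" by simp
    also have "\<dots> = gip v v - gip v (\<lambda>x. c * (y x * y x - 1)) - (gip (\<lambda>x. c * (y x * y x - 1)) v - gip (\<lambda>x. c * (y x * y x - 1)) (\<lambda>x. c * (y x * y x - 1)))"
      by (simp only: gip_diff_left[OF v lq L2_diff[OF v lq]] gip_diff_right[OF v lq v] gip_diff_right[OF v lq lq])
    also have "\<dots> = gip v v - 2 * c * (3 * a * Z) + c * (c * (2 * Z))"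
      unfolding gip_cmult_left gip_cmult_right gip_commute[of "\<lambda>x. y x * y x - 1" v] vq qq by simp
    finally show ?thesis unfolding c_def by (simp add: power2_eq_square algebra_simps)
  qed
  \<comment> \<open>Gap and energy give 2 V \<le> 3/2 (V + a^2 Z) for V = \<open>gip v v\<close>,
    that is, V \<le> 3 a^2 Z. Against the lower bound 9/2 a^2 Z this leaves only a = 0 and V =
    0.\<close>
  moreover have "gip v v \<le> 3 * (a\<^sup>2 * Z)" using gap energy unfolding ww by argo
  ultimately have aZ: "a\<^sup>2 * Z \<le> 0" by argo
  then have "a = 0" using Z by (simp add: mult_le_0_iff)
  moreover have "gip v v \<le> 0" using aZ \<open>gip v v \<le> 3 * (a\<^sup>2 * Z)\<close> by argo
  then have "gip v v = 0" using gip_self_nonneg[of v] by (intro antisym)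
  then have "AE x in gauss. v x * v x = 0"
    using integral_nonneg_eq_0_iff_AE[OF integrable_mult_L2[OF v v]] by simp
  ultimately have "AE x in lborel. u x = C * h e x"
    unfolding AE_gauss by (auto elim!: eventually_mono simp: v_def w_def)
  then show ?thesis using C e by blast
qed

end

theorem proposition1p3:
  fixes z :: "(real ^ 'n) \<times> real \<Rightarrow> real"
  assumes "H1_loc z"
    and "global_solution z"
    and "homogeneous (3/2) z"
  shows "\<exists>C e. C \<ge> 0 \<and> e \<in> sphere 0 1 \<and> (AE x in lebesgue. z x = C * h e x)"
proof -
  obtain u G where uG: "loc_H1_grad u G" and zu: "AE x in lebesgue. z x = u x"
    and H: "\<forall>R. \<exists>H. H1_grad (ball 0 R) z H \<and> (AE x in lborel. x \<in> ball 0 R \<longrightarrow> H x = G x)"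
  proof (rule H1_loc_obtain_gradient[OF assms(1)])
    fix u G
    assume "loc_H1_grad u G" "AE x in lebesgue. z x = u x"
      "\<And>R. \<exists>H. H1_grad (ball 0 R) z H \<and> (AE x in lborel. x \<in> ball 0 R \<longrightarrow> H x = G x)"
    then show thesis by (intro that allI)
  qed
  have sol: "thin_obstacle_solution R z" if "R > 0" for R
    using assms(2) that by (simp add: global_solution_def)
  have zu': "AE x in lborel. z x = u x" using zu by (simp add: AE_lborel_iff_lebesgue)
  have [measurable]: "u \<in> borel_measurable borel" "G \<in> borel_measurable borel"
    using uG by (auto simp: loc_H1_grad_def)
  have "\<exists>C e. C \<ge> 0 \<and> norm e = 1 \<and> (AE x in lborel. u x = C * h e x)"
  proof (rule sol_classification[OF uG])
    fix \<eta> \<phi> :: "(real ^ 'n) \<times> real \<Rightarrow> real"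
    assume \<eta>: "test_function UNIV \<eta>" "\<And>x. \<eta> (fst x, - snd x) = \<eta> x"
      and \<phi>: "test_function UNIV \<phi>" "\<And>x. \<phi> (fst x, - snd x) = \<phi> x" "\<And>x'. \<phi> (x', 0) \<ge> 0"
    obtain K where K: "compact K" "\<And>x. x \<notin> K \<Longrightarrow> \<eta> x = 0" "\<And>x. x \<notin> K \<Longrightarrow> grad \<eta> x = 0"
      using test_function_support[OF \<eta>(1)] by metis
    obtain K' where K': "compact K'" "\<And>x. x \<notin> K' \<Longrightarrow> \<phi> x = 0" "\<And>x. x \<notin> K' \<Longrightarrow> grad \<phi> x = 0"
      using test_function_support[OF \<phi>(1)] by metis
    \<comment> \<open>One ball containing both supports: the inequality on this ball is already the
      one on the whole space.\<close>
    obtain R where R: "R > 0" "K \<union> K' \<subseteq> ball 0 R"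
      using bounded_subset_ballD[of "K \<union> K'" 0] compact_imp_bounded[OF K(1)] compact_imp_bounded[OF K'(1)] by auto
    obtain H where H1: "H1_grad (ball 0 R) z H" and HG: "AE x in lborel. x \<in> ball 0 R \<longrightarrow> H x = G x"
      using H by blast
    note sm = test_function_smooth[OF \<eta>(1)] test_function_smooth[OF \<phi>(1)]
    have \<eta>R: "test_function (ball 0 R) \<eta>" and \<phi>R: "test_function (ball 0 R) \<phi>"
      using R K K' by (auto intro!: test_functionI[OF sm(1) K(1)] test_functionI[OF sm(2) K'(1)])
    let ?f = "\<lambda>x. H x \<bullet> (\<eta> x *\<^sub>R H x + z x *\<^sub>R grad \<eta> x + grad \<phi> x)"
    have z0: "?f x = 0" if "x \<notin> ball 0 R" for x
    proof -
      have "x \<notin> K" "x \<notin> K'" using that R(2) by auto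
      then show ?thesis by (simp add: K K')
    qed
    have "0 \<le> (LINT x|lebesgue_on (ball 0 R). ?f x)"
      by (rule first_variation[where u = z and G = H and \<eta> = \<eta> and \<phi> = \<phi>, OF R(1) sol[OF R(1)] H1 \<eta>R \<eta>(2) \<phi>R \<phi>(2,3)])
    also have "\<dots> = (LINT x|lebesgue. ?f x)" by (rule lebesgue_on_integrable_iff(2)) (simp, rule z0)
    also have "\<dots> = (LINT x|lborel. G x \<bullet> (\<eta> x *\<^sub>R G x + u x *\<^sub>R grad \<eta> x + grad \<phi> x))"
    proof (rule integral_lebesgue_eq_lborel)
      have [measurable]: "H \<in> borel_measurable (lebesgue_on (ball 0 R))" "z \<in> borel_measurable (lebesgue_on (ball 0 R))"
        using H1 by (auto simp: H1_grad_def L2_def)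
      have [measurable]: "\<eta> \<in> borel_measurable (lebesgue_on (ball 0 R))" "grad \<eta> \<in> borel_measurable (lebesgue_on (ball 0 R))"
        "grad \<phi> \<in> borel_measurable (lebesgue_on (ball 0 R))"
        by (intro continuous_measurable_lebesgue_on smooth_continuous continuous_grad sm)+
      have "?f \<in> borel_measurable (lebesgue_on (ball 0 R))" by measurable
      then have "(\<lambda>x. indicator (ball 0 R) x *\<^sub>R ?f x) \<in> borel_measurable lebesgue"
        by (subst (asm) borel_measurable_restrict_space_iff) auto
      moreover have "(\<lambda>x. indicator (ball 0 R) x *\<^sub>R ?f x) = ?f"
      proof
        fix x show "indicator (ball 0 R) x *\<^sub>R ?f x = ?f x" using z0[of x] by (cases "x \<in> ball 0 R") auto
      qed
      ultimately show "?f \<in> borel_measurable lebesgue" by simp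
      have [measurable]: "\<eta> \<in> borel_measurable borel" "grad \<eta> \<in> borel_measurable borel" "grad \<phi> \<in> borel_measurable borel"
        by (intro borel_measurable_continuous_onI smooth_continuous continuous_grad sm)+
      show "(\<lambda>x. G x \<bullet> (\<eta> x *\<^sub>R G x + u x *\<^sub>R grad \<eta> x + grad \<phi> x)) \<in> borel_measurable borel"
        by measurable
      show "AE x in lborel. ?f x = G x \<bullet> (\<eta> x *\<^sub>R G x + u x *\<^sub>R grad \<eta> x + grad \<phi> x)"
        using HG zu'
      proof eventually_elim
        case (elim x)
        show ?case
        proof (cases "x \<in> ball 0 R")
          case True
          then show ?thesis using elim by simp
        next
          case False
          then have "x \<notin> K" "x \<notin> K'" using R by auto
          then show ?thesis using K K' by simp
        qed
      qed
    qed
    finally show "0 \<le> (LINT x|lborel. G x \<bullet> (\<eta> x *\<^sub>R G x + u x *\<^sub>R grad \<eta> x + grad \<phi> x))" .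
  next
    \<comment> \<open>Evenness is part of admissibility on each ball; countably many balls exhaust
      the space.\<close>
    have "AE x in lborel. \<forall>n::nat. x \<in> ball 0 (real (Suc n)) \<longrightarrow> z (fst x, snd x) = z (fst x, - snd x)"
    proof (subst AE_all_countable, rule allI)
      fix n
      have "AE x in lebesgue_on (ball 0 (real (Suc n))). z (fst x, snd x) = z (fst x, - snd x)"
        using sol[of "real (Suc n)"] by (auto simp: thin_obstacle_solution_def admissible_def simp del: of_nat_Suc)
      then show "AE x in lborel. x \<in> ball 0 (real (Suc n)) \<longrightarrow> z (fst x, snd x) = z (fst x, - snd x)"
        by (subst (asm) AE_restrict_space_iff) (auto simp: AE_lborel_iff_lebesgue)
    qed
    then have "AE x in lborel. z (fst x, - snd x) = z x"
    proof eventually_elim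
      case (elim x)
      obtain n :: nat where "norm x < real n" using reals_Archimedean2 by blast
      then have "x \<in> ball 0 (real (Suc n))" by simp
      then show ?case using elim by (metis prod.collapse)
    qed
    then show "AE x in lborel. u (fst x, - snd x) = u x"
      using zu' AE_lborel_reflection[OF zu'] by eventually_elim simp
  next
    fix t :: real assume t: "t > 0"
    have "AE x in lborel. z (t *\<^sub>R x) = t powr (3 / 2) * z x"
      using assms(3) t by (simp add: homogeneous_def AE_lborel_iff_lebesgue)
    moreover have "AE x in lborel. z (t *\<^sub>R x) = u (t *\<^sub>R x)"
      using AE_lborel_scaleR[OF _ zu', of t] t by simp
    ultimately show "AE x in lborel. u (t *\<^sub>R x) = t powr (3 / 2) * u x"
      using zu' by eventually_elim simp
  qed
  then obtain C e where C: "C \<ge> 0" "norm e = 1" "AE x in lborel. u x = C * h e x" by blast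
  have "AE x in lebesgue. z x = C * h e x"
    unfolding AE_lborel_iff_lebesgue using zu' C(3) by eventually_elim simp
  then show ?thesis using C by (intro exI[of _ C] exI[of _ e]) auto
qed

end
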